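(* Let $d\ge 2$, $N_o>0$, $\tau>0$, let $P_{\sup}:=\operatorname{ess\,sup}\mu=\infty$, let the directing random measure $\Lambda$ be stabilizing and let the path-loss function $\ell$ be well-behaved. Then the critical intensity of the SINR graph satisfies $\lambda_c^*<\infty$ if at least one of the following conditions holds: (1) $\ell$ has unbounded support, $\Lambda$ is $b$-dependent for some $b>0$, and for some $\alpha>0$ both $\mathbb E[\exp(\alpha\Lambda(Q_1))]<\infty$ and $\mathbb E[\exp(\alpha P_o)]<\infty$; or (2) $\ell$ has bounded (nonempty) support, $\mathbb E[P_o]<\infty$, and $\Lambda$ is asymptotically essentially connected; or (3) $\ell$ has bounded support, $\mathbb E[P_o]<\infty$, and $\sup\operatorname{supp}(\ell)>c$, where $c\in[0,\infty)$ is a finite constant depending on $\Lambda$, $\tau$ and $N_o$ (i.e. for given $\Lambda,\tau,N_o$ there exists such a finite constant $c=c(\Lambda,\tau,N_o)$ for which this condition suffices).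
   Context: Notation: $Q_n=[-n/2,n/2]^d$ for $n>0$, $Q_n(x)=Q_n+x$, $\operatorname{dist}(x,A)=\inf\{|x-y|:y\in A\}$. For a measurable $A\subseteq\mathbb R^d$, $\Lambda_A$ is the restriction of $\Lambda$ to $A$. Marked Cox point process. $\Lambda$ is a stationary random measure on $\mathbb R^d$ with $\mathbb E[\Lambda(Q_1)]=1$, and $\mu$ is a Borel probability measure on $[0,\infty)$; $P_o$ denotes a random variable with distribution $\mu$. For $\lambda>0$, $\mathbf X^\lambda=\{(X_i,P_i)\}_{i\in I}$ is the i.i.d. marked Cox point process on $\mathbb R^d\times[0,\infty)$ with directing measure $\lambda\Lambda\otimes\mu$ (conditionally on $\Lambda$ it is a Poisson point process with intensity measure $\lambda\Lambda\otimes\mu$), and $X^\lambda=\{X_i\}_{i\in I}$. SINR graph. Given $\tau>0$, $N_o\ge0$, a path-loss function $\ell:[0,\infty)\to[0,\infty)$ and $\gamma\ge0$, the SINR graph $G_\gamma(\mathbf X^\lambda)$ has vertex set $X^\lambda$, and $X_i\ne X_j$ are joined by an edge iff $$P_i\ell(|X_i-X_j|)>\tau\Big(N_o+\gamma\sum_{k\in I\setminus\{i,j\}}P_k\ell(|X_k-X_j|)\Big)\ \text{ and }\ P_j\ell(|X_i-X_j|)>\tau\Big(N_o+\gamma\sum_{k\in I\setminus\{i,j\}}P_k\ell(|X_k-X_i|)\Big).$$ A graph with locally finite vertex set in $\mathbb R^d$ percolates if it has an unbounded connected component. Define $$\gamma(\lambda)=\sup\{\gamma>0:\mathbb P(G_\gamma(\mathbf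 X^\lambda)\text{ percolates})>0\},\qquad \lambda_c^*=\inf\{\lambda>0:\gamma(\lambda')>0\ \forall\lambda'>\lambda\},$$ with $\sup\emptyset=0$ and $\inf\emptyset=\infty$. $\ell$ is well-behaved if it is continuous, constant on $[0,d_o]$ for some $d_o\ge0$, strictly decreasing on $[d_o,\infty)\cap\operatorname{supp}(\ell)$, and $\int_0^\infty r^{d-1}\ell(r)\,dr<\infty$. $\Lambda$ is stabilizing if there is a random field of stabilization radii $R=\{R_x\}_{x\in\mathbb R^d}$ on the same probability space such that, writing $R(Q_n(x))=\sup_{y\in Q_n(x)\cap\mathbb Q^d}R_y$ for $n\ge1$, $x\in\mathbb R^d$: (i) $(\Lambda,R)$ is jointly stationary; (ii) $\lim_{n\to\infty}\mathbb P(R(Q_n)<n)=1$; (iii) for all $n\ge1$, all non-negative bounded measurable functions $f$, and all finite $\varphi\subset\mathbb R^d$ with $\operatorname{dist}(x,\varphi\setminus\{x\})>3n$ for all $x\in\varphi$, the random variables $f(\Lambda_{Q_n(x)})\mathbf 1\{R(Q_n(x))<n\}$, $x\in\varphi$, are independent. $\Lambda$ is $b$-dependent if $\Lambda_A$ and $\Lambda_B$ are independent for all measurable $A,B\subset\mathbb R^d$ with $\operatorname{dist}(A,B)>b$. The stabilizing random measure $\Lambda$ with stabilization radii $R$ is asymptotically essentially connected if for all $n\ge1$, whenever $R(Q_{2n})<n/2$, we have: (i) $\operatorname{supp}(\Lambda_{Q_n})$ contains a connected component of diameter at least $n/3$; and (ii) any two connected components of $\operatorname{supp}(\Lambda_{Q_n})$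 of diameter at least $n/9$ are contained in the same connected component of $\operatorname{supp}(\Lambda_{Q_{2n}})$. *)

theory Defs
  imports "HOL-Probability.Probability"
begin

section \<open>Random measures\<close>

definition cube :: "real \<Rightarrow> real^'d \<Rightarrow> (real^'d) set" where
  "cube n x = cbox (\<chi> i. x $ i - n / 2) (\<chi> i. x $ i + n / 2)"

definition rational_points :: "(real^'d) set" where
  "rational_points = {x. \<forall>i. x $ i \<in> \<rat>}"

text \<open>The space of locally finite Borel measures with the sigma-algebra generated by the
  evaluations, in the style of \<^const>\<open>subprob_algebra\<close>.\<close>

definition locally_finite_algebra :: "(real^'d) measure measure" where
  "locally_finite_algebra =
    (SUP A \<in> sets borel. vimage_algebra
       {m. sets m = sets borel \<and> (\<forall>B\<in>sets borel. bounded B \<longrightarrow> emeasure m B < \<infinity>)}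
       (\<lambda>m. emeasure m A) borel)"

definition random_measure :: "'w measure \<Rightarrow> ('w \<Rightarrow> (real^'d) measure) \<Rightarrow> bool" where
  "random_measure M \<Lambda> \<longleftrightarrow> \<Lambda> \<in> measurable M locally_finite_algebra"

text \<open>The translate \<open>B \<mapsto> m (B + y)\<close>.\<close>

definition translate_measure :: "real^'d \<Rightarrow> (real^'d) measure \<Rightarrow> (real^'d) measure" where
  "translate_measure y m = distr m borel (\<lambda>x. x - y)"

definition stationary_random_measure ::
    "'w measure \<Rightarrow> ('w \<Rightarrow> (real^'d) measure) \<Rightarrow> bool" where
  "stationary_random_measure M \<Lambda> \<longleftrightarrow>
     random_measure M \<Lambda> \<and>
     (\<forall>y. distr M locally_finite_algebra (\<lambda>\<omega>. translate_measure y (\<Lambda> \<omega>)) =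
          distr M locally_finite_algebra \<Lambda>)"

text \<open>Restriction to \<open>A\<close>, kept as a measure on the whole space: \<open>B \<mapsto> m (A \<inter> B)\<close>.\<close>

definition restrict_to :: "(real^'d) set \<Rightarrow> (real^'d) measure \<Rightarrow> (real^'d) measure" where
  "restrict_to A m = density m (indicator A)"

definition measure_support :: "(real^'d) measure \<Rightarrow> (real^'d) set" where
  "measure_support m = {x. \<forall>U. open U \<and> x \<in> U \<longrightarrow> emeasure m U > 0}"

text \<open>\<^const>\<open>setdist\<close> is 0 if one of the sets is empty, which only drops the trivial case of the
  zero measure.\<close>

definition b_dependent ::
    "'w measure \<Rightarrow> ('w \<Rightarrow> (real^'d) measure) \<Rightarrow> real \<Rightarrow> bool" where
  "b_dependent M \<Lambda> b \<longleftrightarrow>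
     (\<forall>A\<in>sets borel. \<forall>B\<in>sets borel. setdist A B > b \<longrightarrow>
        prob_space.indep_var M
          locally_finite_algebra (\<lambda>\<omega>. restrict_to A (\<Lambda> \<omega>))
          locally_finite_algebra (\<lambda>\<omega>. restrict_to B (\<Lambda> \<omega>)))"


section \<open>Stabilization and asymptotic essential connectedness\<close>

definition jointly_stationary ::
    "'w measure \<Rightarrow> ('w \<Rightarrow> (real^'d) measure) \<Rightarrow> (real^'d \<Rightarrow> 'w \<Rightarrow> ennreal) \<Rightarrow> bool" where
  "jointly_stationary M \<Lambda> R \<longleftrightarrow>
     (\<forall>y. distr M (locally_finite_algebra \<Otimes>\<^sub>M PiM UNIV (\<lambda>_. borel))
            (\<lambda>\<omega>. (translate_measure y (\<Lambda> \<omega>), \<lambda>x. R (x + y) \<omega>)) =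
          distr M (locally_finite_algebra \<Otimes>\<^sub>M PiM UNIV (\<lambda>_. borel))
            (\<lambda>\<omega>. (\<Lambda> \<omega>, \<lambda>x. R x \<omega>)))"

definition cube_radius ::
    "(real^'d \<Rightarrow> 'w \<Rightarrow> ennreal) \<Rightarrow> real \<Rightarrow> real^'d \<Rightarrow> 'w \<Rightarrow> ennreal" where
  "cube_radius R n x \<omega> = (SUP y \<in> cube n x \<inter> rational_points. R y \<omega>)"

text \<open>In the separation condition the case \<open>\<phi> = {x}\<close> is listed separately because the distance to
  the empty set is infinite, whereas \<^const>\<open>infdist\<close> gives 0 there.\<close>

definition stabilization_radii ::
    "'w measure \<Rightarrow> ('w \<Rightarrow> (real^'d) measure) \<Rightarrow> (real^'d \<Rightarrow> 'w \<Rightarrow> ennreal) \<Rightarrow> bool" where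
  "stabilization_radii M \<Lambda> R \<longleftrightarrow>
     (\<forall>x. R x \<in> borel_measurable M) \<and>
     jointly_stationary M \<Lambda> R \<and>
     ((\<lambda>n::nat. measure M {\<omega> \<in> space M. cube_radius R (real n) 0 \<omega> < of_nat n})
        \<longlonglongrightarrow> 1) \<and>
     (\<forall>n::nat. \<forall>f :: (real^'d) measure \<Rightarrow> real. \<forall>\<phi>.
        n \<ge> 1 \<and>
        f \<in> borel_measurable locally_finite_algebra \<and>
        (\<forall>m\<in>space locally_finite_algebra. 0 \<le> f m) \<and>
        (\<exists>C. \<forall>m\<in>space locally_finite_algebra. f m \<le> C) \<and>
        finite \<phi> \<and>
        (\<forall>x\<in>\<phi>. \<phi> - {x} = {} \<or> infdist x (\<phi> - {x}) > 3 * real n) \<longrightarrow>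
        prob_space.indep_vars M (\<lambda>_. borel)
          (\<lambda>x \<omega>. f (restrict_to (cube (real n) x) (\<Lambda> \<omega>)) *
                 of_bool (cube_radius R (real n) x \<omega> < of_nat n)) \<phi>)"

definition stabilizing :: "'w measure \<Rightarrow> ('w \<Rightarrow> (real^'d) measure) \<Rightarrow> bool" where
  "stabilizing M \<Lambda> \<longleftrightarrow> (\<exists>R. stabilization_radii M \<Lambda> R)"

definition asymptotically_essentially_connected ::
    "'w measure \<Rightarrow> ('w \<Rightarrow> (real^'d) measure) \<Rightarrow> bool" where
  "asymptotically_essentially_connected M \<Lambda> \<longleftrightarrow>
     (\<exists>R. stabilization_radii M \<Lambda> R \<and>
       (\<forall>n::nat. n \<ge> 1 \<longrightarrow> (\<forall>\<omega>\<in>space M.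
          cube_radius R (2 * real n) 0 \<omega> < ennreal (real n / 2) \<longrightarrow>
          (let S = measure_support (restrict_to (cube (real n) 0) (\<Lambda> \<omega>));
               S' = measure_support (restrict_to (cube (2 * real n) 0) (\<Lambda> \<omega>))
           in (\<exists>C\<in>components S. diameter C \<ge> real n / 3) \<and>
              (\<forall>C1\<in>components S. \<forall>C2\<in>components S.
                 diameter C1 \<ge> real n / 9 \<and> diameter C2 \<ge> real n / 9 \<longrightarrow>
                 (\<exists>D\<in>components S'. C1 \<subseteq> D \<and> C2 \<subseteq> D))))))"


section \<open>Marked Cox point processes\<close>

text \<open>A marked point configuration is enumerated by the set \<open>dom c\<close> of indices; different indices
  may carry the same point, so multiplicities are kept.\<close>

type_synonym 'd config = "nat \<rightharpoonup> (real^'d) \<times> real"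

definition pos :: "('d::finite) config \<Rightarrow> nat \<Rightarrow> real^'d" where
  "pos c i = fst (the (c i))"

definition mark :: "('d::finite) config \<Rightarrow> nat \<Rightarrow> real" where
  "mark c i = snd (the (c i))"

definition points_in :: "('d::finite) config \<Rightarrow> ((real^'d) \<times> real) set \<Rightarrow> nat set" where
  "points_in c B = {i \<in> dom c. (pos c i, mark c i) \<in> B}"

text \<open>Point probabilities of the Poisson distribution; unlike \<^const>\<open>poisson_pmf\<close> this covers
  parameter 0 (where \<open>0 ^ 0 = 1\<close>).\<close>

definition poisson_prob :: "real \<Rightarrow> nat \<Rightarrow> real" where
  "poisson_prob r k = r ^ k / fact k * exp (- r)"

definition mark_distribution :: "real measure \<Rightarrow> bool" where
  "mark_distribution \<mu> \<longleftrightarrow> prob_space \<mu> \<and> sets \<mu> = sets borel \<and> emeasure \<mu> {..<0} = 0"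

text \<open>Conditionally on \<open>\<Lambda>\<close>, the numbers of points in disjoint bounded Borel sets are independent
  and Poisson distributed with the values of the (locally finite) intensity measure as
  parameters.\<close>

definition marked_cox_process ::
    "'w measure \<Rightarrow> ('w \<Rightarrow> (real^'d) measure) \<Rightarrow> real measure \<Rightarrow> real \<Rightarrow>
     ('w \<Rightarrow> ('d::finite) config) \<Rightarrow> bool" where
  "marked_cox_process M \<Lambda> \<mu> lam X \<longleftrightarrow>
     (\<forall>i. \<forall>B\<in>sets borel. {\<omega> \<in> space M. i \<in> points_in (X \<omega>) B} \<in> sets M) \<and>
     (\<forall>(m::nat) (B :: nat \<Rightarrow> ((real^'d) \<times> real) set) (k :: nat \<Rightarrow> nat).
        (\<forall>j<m. B j \<in> sets borel \<and> bounded (B j)) \<and> disjoint_family_on B {..<m} \<longrightarrow>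
        (AE \<omega> in M.
           real_cond_exp M (vimage_algebra (space M) \<Lambda> locally_finite_algebra)
             (indicator {\<omega> \<in> space M. \<forall>j<m.
                finite (points_in (X \<omega>) (B j)) \<and> card (points_in (X \<omega>) (B j)) = k j}) \<omega> =
           (\<Prod>j<m. poisson_prob (lam * measure (\<Lambda> \<omega> \<Otimes>\<^sub>M \<mu>) (B j)) (k j))))"


section \<open>The SINR graph\<close>

definition path_loss :: "(real \<Rightarrow> real) \<Rightarrow> bool" where
  "path_loss l \<longleftrightarrow> (\<forall>r\<ge>0. l r \<ge> 0)"

text \<open>Only the values of \<open>l\<close> on \<open>{0..}\<close> are relevant.\<close>

definition path_loss_support :: "(real \<Rightarrow> real) \<Rightarrow> real set" where
  "path_loss_support l = closure {r. r \<ge> 0 \<and> l r \<noteq> 0}"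

definition well_behaved :: "nat \<Rightarrow> (real \<Rightarrow> real) \<Rightarrow> bool" where
  "well_behaved d l \<longleftrightarrow>
     continuous_on {0..} l \<and>
     (\<exists>d0\<ge>0. l constant_on {0..d0} \<and> strict_antimono_on ({d0..} \<inter> path_loss_support l) l) \<and>
     (\<integral>\<^sup>+ r\<in>{0..}. ennreal (r ^ (d - 1) * l r) \<partial>lborel) < \<infinity>"

text \<open>The interference sum may diverge.\<close>

definition interference :: "(real \<Rightarrow> real) \<Rightarrow> ('d::finite) config \<Rightarrow> nat \<Rightarrow> nat \<Rightarrow> ennreal" where
  "interference l c i j =
     (\<Sum>\<^sub>\<infinity>k \<in> dom c - {i, j}. ennreal (mark c k * l (dist (pos c k) (pos c j))))"

definition sinr_ok ::
    "real \<Rightarrow> real \<Rightarrow> (real \<Rightarrow> real) \<Rightarrow> real \<Rightarrow> ('d::finite) config \<Rightarrow> nat \<Rightarrow> nat \<Rightarrow> bool" where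
  "sinr_ok \<tau> No l \<gamma> c i j \<longleftrightarrow>
     ennreal (mark c i * l (dist (pos c i) (pos c j))) >
       ennreal \<tau> * (ennreal No + ennreal \<gamma> * interference l c i j)"

definition sinr_edges ::
    "real \<Rightarrow> real \<Rightarrow> (real \<Rightarrow> real) \<Rightarrow> real \<Rightarrow> ('d::finite) config \<Rightarrow> ((real^'d) \<times> (real^'d)) set" where
  "sinr_edges \<tau> No l \<gamma> c =
     {(pos c i, pos c j) | i j. i \<in> dom c \<and> j \<in> dom c \<and> pos c i \<noteq> pos c j \<and>
        sinr_ok \<tau> No l \<gamma> c i j \<and> sinr_ok \<tau> No l \<gamma> c j i}"

text \<open>The edge relation is symmetric, so \<open>E\<^sup>* `` {x}\<close> is the connected component of \<open>x\<close>.\<close>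

definition graph_percolates :: "(real^'d) set \<Rightarrow> ((real^'d) \<times> (real^'d)) set \<Rightarrow> bool" where
  "graph_percolates V E \<longleftrightarrow> (\<exists>x\<in>V. \<not> bounded (E\<^sup>* `` {x}))"

definition sinr_percolates ::
    "real \<Rightarrow> real \<Rightarrow> (real \<Rightarrow> real) \<Rightarrow> real \<Rightarrow> ('d::finite) config \<Rightarrow> bool" where
  "sinr_percolates \<tau> No l \<gamma> c \<longleftrightarrow> graph_percolates (pos c ` dom c) (sinr_edges \<tau> No l \<gamma> c)"

text \<open>Suprema and infima are taken in \<^typ>\<open>ennreal\<close>, where the supremum of the empty set is 0 and
  the infimum of the empty set is infinity.\<close>

definition critical_interference ::
    "'w measure \<Rightarrow> real \<Rightarrow> real \<Rightarrow> (real \<Rightarrow> real) \<Rightarrow> ('w \<Rightarrow> ('d::finite) config) \<Rightarrow> ennreal" where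
  "critical_interference M \<tau> No l X =
     (SUP \<gamma> \<in> {\<gamma>. \<gamma> > 0 \<and> measure M {\<omega> \<in> space M. sinr_percolates \<tau> No l \<gamma> (X \<omega>)} > 0}.
        ennreal \<gamma>)"

definition critical_intensity ::
    "'w measure \<Rightarrow> real \<Rightarrow> real \<Rightarrow> (real \<Rightarrow> real) \<Rightarrow> (real \<Rightarrow> 'w \<Rightarrow> ('d::finite) config) \<Rightarrow> ennreal" where
  "critical_intensity M \<tau> No l X =
     (INF lam \<in> {lam. lam > 0 \<and> (\<forall>lam'>lam. critical_interference M \<tau> No l (X lam') > 0)}.
        ennreal lam)"

end

theory Submission
  imports Defs
begin

text \<open>The plane spanned by two coordinate directions is divided into large cubes, indexed by the
  square lattice. A family of events is called rare if any finite set of sites is entirely bad with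
  probability at most \<open>q\<close> to the number of sites; by Peierls' argument, rare bad events leave an
  infinite cluster of good sites with positive probability.

  Stabilization makes the following bad event rare: the support of \<open>\<Lambda>\<close> does not contain, near the site, points that
  link it within range \<open>\<rho>\<close> to all its good neighbours. Large \<open>\<rho>\<close> suffices in general, and any \<open>\<rho> > 0\<close> under
  asymptotic essential connectedness. As the marks are unbounded, there is a threshold \<open>p\<close> with
  \<open>p l(\<rho>) > \<tau> No\<close>, and for large \<open>\<lambda>\<close> all relevant cells contain a point with mark at least \<open>p\<close>, up to
  rare events. Finally the interference near a site is bounded by a constant \<open>K\<close> outside a rare event:
  if \<open>l\<close> has bounded support, it depends only on finitely many points near the site; otherwise
  exponential moments are used, with the \<open>b\<close>-dependence reduced to independence by splitting the cells
  into residue classes. Then every \<open>\<gamma>\<close> with \<open>\<tau> (No + \<gamma> K) < p l(\<rho>)\<close> admits percolation.\<close>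

section \<open>Percolation on the square lattice\<close>

text \<open>The events attached to different sites are dependent: \<open>\<Lambda>\<close> is
  correlated, and the interference at a site may involve points near all other sites. Rareness is
  therefore a bound on joint probabilities, not a statement of independence. It passes to unions of
  families that depend on each other, so that linking, voids and interference can be estimated
  separately. Each union costs a square root, whence constants such as \<open>(1/40)\<^sup>2\<close>
  and \<open>(1/3200)\<^sup>2\<close>. The order of the choices is decisive. Scale, range, mass
  level and window of marks are fixed before the intensity, since one threshold has to serve all
  larger intensities. The interference bound may grow with the intensity, since the interference
  factor is chosen last. A further obstacle for bounded support is that \<open>c\<close> has to be
  fixed before \<open>l\<close>, although both the range of the links and the reach of the
  interference come from \<open>l\<close>. Range and scale are therefore kept within fixed factors
  of each other, so that cubes of side \<open>\<kappa> * s\<close> with a fixed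
  \<open>\<kappa>\<close> contain everything that interferes.\<close>

definition nbr :: "int \<times> int \<Rightarrow> int \<times> int \<Rightarrow> bool" where
  "nbr p q \<longleftrightarrow> \<bar>fst p - fst q\<bar> + \<bar>snd p - snd q\<bar> = 1"

definition star_nbr :: "int \<times> int \<Rightarrow> int \<times> int \<Rightarrow> bool" where
  "star_nbr p q \<longleftrightarrow> \<bar>fst p - fst q\<bar> \<le> 1 \<and> \<bar>snd p - snd q\<bar> \<le> 1"

definition nbr_rel :: "(int \<times> int) set \<Rightarrow> ((int \<times> int) \<times> (int \<times> int)) set" where
  "nbr_rel S = {(p, q). nbr p q \<and> p \<in> S \<and> q \<in> S}"

lemma nbr_sym: "nbr p q \<longleftrightarrow> nbr q p"
  by (auto simp: nbr_def abs_minus_commute)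

lemma sym_nbr_rel: "sym (nbr_rel S)"
  by (auto simp: sym_def nbr_rel_def nbr_sym)

lemma nbr_rel_rtrancl_sym: "(p, q) \<in> (nbr_rel S)\<^sup>* \<Longrightarrow> (q, p) \<in> (nbr_rel S)\<^sup>*"
  using sym_rtrancl[OF sym_nbr_rel[of S]] by (auto dest: symD)

lemma nbr_rel_rtrancl_mem: "(p, q) \<in> (nbr_rel S)\<^sup>* \<Longrightarrow> p \<in> S \<Longrightarrow> q \<in> S"
  by (induction rule: rtrancl_induct) (auto simp: nbr_rel_def)

text \<open>The parity of the number of integers between 0 and \<open>x\<close> at which
  \<open>f\<close> holds changes exactly when a step passes over such an integer.\<close>

lemma xor_antiderivative:
  fixes f :: "int \<Rightarrow> bool"
  shows "\<exists>g. g 0 = c \<and> (\<forall>x. g (x + 1) = (g x \<noteq> f x))"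
proof -
  define g where "g = (\<lambda>x::int. if x \<ge> 0 then c \<noteq> odd (card {i\<in>{0..<x}. f i})
    else c \<noteq> odd (card {i\<in>{x..<0}. f i}))"
  have "g (x + 1) = (g x \<noteq> f x)" for x
  proof (cases "x \<ge> 0")
    case True
    have "{i\<in>{0..<x+1}. f i} = (if f x then insert x {i\<in>{0..<x}. f i} else {i\<in>{0..<x}. f i})"
      using True by (auto simp: order_le_less)
    moreover have "finite {i\<in>{0..<x}. f i}" "x \<notin> {i\<in>{0..<x}. f i}"
      by (rule finite_subset[of _ "{0..<x}"], auto)
    ultimately have "card {i\<in>{0..<x+1}. f i} = (if f x then Suc (card {i\<in>{0..<x}. f i}) else card {i\<in>{0..<x}. f i})"
      by (metis card_insert_disjoint)
    then show ?thesis using True unfolding g_def by (cases "f x") simp_all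
  next
    case False
    have "{i\<in>{x..<0}. f i} = (if f x then insert x {i\<in>{x+1..<0}. f i} else {i\<in>{x+1..<0}. f i})"
      using False by (auto simp: order_le_less)
    moreover have "finite {i\<in>{x+1..<0}. f i}" "x \<notin> {i\<in>{x+1..<0}. f i}"
      by (rule finite_subset[of _ "{x+1..<0}"], auto)
    ultimately have *: "card {i\<in>{x..<0}. f i} = (if f x then Suc (card {i\<in>{x+1..<0}. f i}) else card {i\<in>{x+1..<0}. f i})"
      by (metis card_insert_disjoint)
    \<comment> \<open>At \<open>x = -1\<close> the successor 0 falls under the other branch of
      \<open>g\<close>, where the interval is empty.\<close>
    show ?thesis
    proof (cases "x = -1")
      case True
      then show ?thesis using * unfolding g_def by (cases "f x") simp_all
    next
      case F: False
      then have "\<not> x + 1 \<ge> 0" using False by simp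
      then show ?thesis using * False unfolding g_def by (cases "f x") simp_all
    qed
  qed
  moreover have "g 0 = c" by (simp add: g_def)
  ultimately show ?thesis by blast
qed

text \<open>Discrete Poincare lemma over the field with two elements: \<open>h\<close> and
  \<open>v\<close> are the values of a 1-cochain on horizontal and vertical edges, and the
  hypothesis says that its sum around every unit square vanishes. The potential is integrated along
  the horizontal axis and then along vertical lines; closedness carries the horizontal relation from
  one height to the next, upwards and downwards.\<close>

lemma xor_potential:
  fixes h v :: "int \<Rightarrow> int \<Rightarrow> bool"
  assumes face: "\<And>x y. (h x y \<noteq> v (x + 1) y) = (v x y \<noteq> h x (y + 1))"
  shows "\<exists>\<phi>. (\<forall>x y. \<phi> (x + 1) y = (\<phi> x y \<noteq> h x y)) \<and> (\<forall>x y. \<phi> x (y + 1) = (\<phi> x y \<noteq> v x y))"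
proof -
  obtain g0 where g0: "\<And>x. g0 (x + 1) = (g0 x \<noteq> h x 0)"
    using xor_antiderivative[of False "\<lambda>x. h x 0"] by blast
  have "\<forall>x. \<exists>g. g 0 = g0 x \<and> (\<forall>y. g (y + 1) = (g y \<noteq> v x y))"
    using xor_antiderivative by blast
  then obtain G where G0: "\<And>x. G x 0 = g0 x" and G: "\<And>x y. G x (y + 1) = (G x y \<noteq> v x y)"
    by metis
  have "G (x + 1) y = (G x y \<noteq> h x y)" for x y
  proof (induction y rule: int_induct[where k = 0])
    case base
    show ?case by (simp add: G0 g0)
  next
    case (step1 y)
    then show ?case using face[of x y] by (auto simp: G)
  next
    case (step2 y)
    then show ?case using face[of x "y - 1"] G[of x "y - 1"] G[of "x + 1" "y - 1"] by auto
  qed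
  with G show ?thesis by blast
qed

text \<open>The boundary edges ending in a star-closed part \<open>A\<close> of the boundary form a closed 1-cochain
  modulo 2, hence the coboundary of a potential.  The potential is constant on \<open>C\<close> and
  on \<open>D\<close>, so all or none of the boundary edges end in \<open>A\<close>.\<close>

lemma boundary_star_connected:
  assumes C: "\<And>a b. a \<in> C \<Longrightarrow> b \<in> C \<Longrightarrow> (a, b) \<in> (nbr_rel C)\<^sup>*"
    and D: "\<And>a b. a \<in> D \<Longrightarrow> b \<in> D \<Longrightarrow> (a, b) \<in> (nbr_rel D)\<^sup>*"
    and CD: "C \<inter> D = {}"
    and D_closed: "\<And>p q. p \<in> D \<Longrightarrow> nbr p q \<Longrightarrow> q \<notin> C \<Longrightarrow> q \<in> D"
    and bd: "bd = {v\<in>D. \<exists>c\<in>C. nbr c v}"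
    and A: "A \<subseteq> bd" "a \<in> A" "b \<in> bd - A"
  shows "\<exists>p\<in>A. \<exists>q\<in>bd - A. star_nbr p q"
proof (rule ccontr)
  assume "\<not> ?thesis"
  then have ncl: "\<And>p q. p \<in> A \<Longrightarrow> q \<in> bd \<Longrightarrow> star_nbr p q \<Longrightarrow> q \<in> A" by blast
  define e where "e = (\<lambda>p q. (p \<in> A \<and> q \<in> C) \<or> (q \<in> A \<and> p \<in> C))"
  \<comment> \<open>For an edge close to a point of \<open>A\<close>, being marked by
    \<open>e\<close> is the same as crossing between \<open>D\<close> and its complement. The four
    edges of a unit square cross an even number of times, which gives closedness on squares with a
    corner in \<open>A\<close>; the other squares carry no marked edge.\<close>
  have cut: "e p q \<longleftrightarrow> (p \<in> D) \<noteq> (q \<in> D)"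
    if "nbr p q" "w \<in> A" "star_nbr w p" "star_nbr w q" for p q w
  proof
    assume "e p q"
    then show "(p \<in> D) \<noteq> (q \<in> D)" using A CD bd by (auto simp: e_def)
  next
    assume *: "(p \<in> D) \<noteq> (q \<in> D)"
    show "e p q"
    proof (cases "p \<in> D")
      case True
      then have "q \<in> C" using * D_closed that(1) by blast
      then have "p \<in> bd" unfolding bd using True that(1) nbr_sym[of p q] by auto
      then show ?thesis using ncl that \<open>q \<in> C\<close> by (auto simp: e_def)
    next
      case False
      then have "p \<in> C" using * D_closed[of q p] that(1) nbr_sym[of p q] by blast
      then have "q \<in> bd" unfolding bd using False * that(1) by auto
      then show ?thesis using ncl that \<open>p \<in> C\<close> by (auto simp: e_def)
    qed
  qed
  define h where "h = (\<lambda>x y::int. e (x, y) (x + 1, y))"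
  define v where "v = (\<lambda>x y::int. e (x, y) (x, y + 1))"
  have "(h x y \<noteq> v (x + 1) y) = (v x y \<noteq> h x (y + 1))" for x y
  proof (cases "\<exists>w\<in>A. w \<in> {(x, y), (x + 1, y), (x, y + 1), (x + 1, y + 1)}")
    case True
    then obtain w where w: "w \<in> A" "w \<in> {(x, y), (x + 1, y), (x, y + 1), (x + 1, y + 1)}" by blast
    show ?thesis unfolding h_def v_def
      by (subst (1 2 3 4) cut[OF _ w(1)]) (use w(2) in \<open>auto simp: nbr_def star_nbr_def\<close>)
  next
    case False
    then show ?thesis by (auto simp: h_def v_def e_def)
  qed
  from xor_potential[of h v, OF this] obtain \<phi>
    where \<phi>1: "\<And>x y. \<phi> (x + 1) y = (\<phi> x y \<noteq> h x y)"
      and \<phi>2: "\<And>x y. \<phi> x (y + 1) = (\<phi> x y \<noteq> v x y)" by blast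
  define \<psi> where "\<psi> = (\<lambda>p. \<phi> (fst p) (snd p))"
  have e_sym: "e p q = e q p" for p q by (auto simp: e_def)
  have step: "\<psi> q = (\<psi> p \<noteq> e p q)" if nb: "nbr p q" for p q
  proof -
    obtain x y where p: "p = (x, y)" by (cases p)
    have "q = (x + 1, y) \<or> q = (x - 1, y) \<or> q = (x, y + 1) \<or> q = (x, y - 1)"
      using nb by (cases q) (auto simp: nbr_def p)
    then show ?thesis
    proof (elim disjE)
      assume "q = (x + 1, y)" then show ?thesis using \<phi>1[of x y] by (simp add: \<psi>_def p h_def)
    next
      assume "q = (x - 1, y)" then show ?thesis using \<phi>1[of "x - 1" y] e_sym by (auto simp: \<psi>_def p h_def)
    next
      assume "q = (x, y + 1)" then show ?thesis using \<phi>2[of x y] by (simp add: \<psi>_def p v_def)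
    next
      assume "q = (x, y - 1)" then show ?thesis using \<phi>2[of x "y - 1"] e_sym by (auto simp: \<psi>_def p v_def)
    qed
  qed
  have const: "\<psi> p = \<psi> q" if "(p, q) \<in> (nbr_rel E)\<^sup>*" "E = C \<or> E = D" for p q E
    using that(1)
  proof (induction rule: rtrancl_induct)
    case (step y z)
    then have "nbr y z" "y \<in> E" "z \<in> E" by (auto simp: nbr_rel_def)
    moreover have "\<not> e y z" using \<open>y \<in> E\<close> \<open>z \<in> E\<close> that(2) CD A(1) bd by (auto simp: e_def)
    ultimately show ?case using step.IH \<open>\<And>q p. nbr p q \<Longrightarrow> \<psi> q = (\<psi> p \<noteq> e p q)\<close> by auto
  qed simp
  obtain c c' where c: "c \<in> C" "nbr c a" and c': "c' \<in> C" "nbr c' b" using A bd by blast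
  have "e c a" using c A by (auto simp: e_def)
  moreover have "\<not> e c' b" using c' A CD bd by (auto simp: e_def)
  moreover have "\<psi> c = \<psi> c'" using const C c c' by blast
  moreover have "a \<in> D" "b \<in> D" using A bd by auto
  then have "\<psi> a = \<psi> b" using const D by blast
  ultimately show False using step[OF c(2)] step[OF c'(2)] by auto
qed

text \<open>Loops are cut out as they arise: if the new vertex is already on the list, the list is
  truncated there. Distinctness is what later turns the length of a path into a number of different
  bad sites.\<close>

lemma rtrancl_distinct_list:
  assumes "(a, b) \<in> {(p, q). R p q \<and> p \<in> S \<and> q \<in> S}\<^sup>*" "a \<in> S"
  shows "\<exists>xs. xs \<noteq> [] \<and> hd xs = a \<and> last xs = b \<and> distinct xs \<and> successively R xs \<and> set xs \<subseteq> S"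
  using assms(1)
proof (induction rule: rtrancl_induct)
  case base
  show ?case using assms(2) by (intro exI[of _ "[a]"]) auto
next
  case (step y z)
  then obtain xs where xs: "xs \<noteq> []" "hd xs = a" "last xs = y" "distinct xs" "successively R xs"
    "set xs \<subseteq> S" by blast
  show ?case
  proof (cases "z \<in> set xs")
    case True
    then obtain ys zs where *: "xs = ys @ z # zs" by (meson split_list)
    have "successively R (ys @ [z])"
      using xs(5) unfolding * by (auto simp: successively_append_iff)
    moreover have "hd (ys @ [z]) = a" using xs(2) * by (cases ys) auto
    ultimately show ?thesis using xs * by (intro exI[of _ "ys @ [z]"]) auto
  next
    case False
    then show ?thesis using xs step.hyps
      by (intro exI[of _ "xs @ [z]"]) (auto simp: successively_append_iff)
  qed
qed

text \<open>A star step moves the first coordinate by at most one. Hence a path from the positive to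
  the negative half-axis has more points than the abscissa of its start.\<close>

lemma star_path_displacement:
  "successively star_nbr xs \<Longrightarrow> xs \<noteq> [] \<Longrightarrow> fst (hd xs) - fst (last xs) < int (length xs)"
proof (induction xs)
  case (Cons x xs)
  then show ?case by (cases xs) (auto simp: star_nbr_def)
qed simp

section \<open>Blocking paths around a finite cluster\<close>

lemma horizontal_segment:
  assumes "\<And>x. x1 \<le> x \<Longrightarrow> x \<le> x2 \<Longrightarrow> (x, y) \<in> S" "x1 \<le> x2"
  shows "((x1, y), (x2, y)) \<in> (nbr_rel S)\<^sup>*"
  using assms(2,1)
proof (induction x2 rule: int_ge_induct)
  case (step i)
  have "((i, y), (i + 1, y)) \<in> nbr_rel S" using step by (auto simp: nbr_rel_def nbr_def)
  with step show ?case by (auto intro: rtrancl_into_rtrancl)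
qed simp

lemma vertical_segment:
  assumes "\<And>y. y1 \<le> y \<Longrightarrow> y \<le> y2 \<Longrightarrow> (x, y) \<in> S" "y1 \<le> y2"
  shows "((x, y1), (x, y2)) \<in> (nbr_rel S)\<^sup>*"
  using assms(2,1)
proof (induction y2 rule: int_ge_induct)
  case (step i)
  have "((x, i), (x, i + 1)) \<in> nbr_rel S" using step by (auto simp: nbr_rel_def nbr_def)
  with step show ?case by (auto intro: rtrancl_into_rtrancl)
qed simp

text \<open>The boundary of the cluster \<open>C\<close> towards the unbounded component
  \<open>D\<close> of its complement is star-connected and avoids \<open>G\<close>, because a
  neighbour of \<open>C\<close> in \<open>G\<close> would belong to \<open>C\<close>. It meets the
  axis at some \<open>(m, 0)\<close> on the right and some \<open>(- m', 0)\<close> on the left, so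
  a star path in it between these two points has more than \<open>m\<close> sites. Its first
  \<open>m + 1\<close> sites are all that the union bound needs, and their starting point determines
  their number.\<close>

lemma finite_cluster_blocked:
  assumes z: "(0, 0) \<in> G" and fin: "finite {z. ((0, 0), z) \<in> (nbr_rel G)\<^sup>*}"
  shows "\<exists>m xs. length xs = Suc m \<and> hd xs = (int m, 0) \<and> distinct xs \<and>
    successively star_nbr xs \<and> set xs \<inter> G = {}"
proof -
  define C where "C = {z. ((0, 0), z) \<in> (nbr_rel G)\<^sup>*}"
  have CG: "C \<subseteq> G" using nbr_rel_rtrancl_mem z by (auto simp: C_def)
  have C0: "(0, 0) \<in> C" by (simp add: C_def)
  have path0: "((0, 0), p) \<in> (nbr_rel C)\<^sup>*" if "p \<in> C" for p
    using that unfolding C_def mem_Collect_eq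
  proof (induction rule: rtrancl_induct)
    case (step y z)
    then have "(y, z) \<in> nbr_rel C" by (auto simp: nbr_rel_def C_def intro: rtrancl_into_rtrancl)
    with step show ?case by (auto simp: C_def intro: rtrancl_into_rtrancl)
  qed simp
  have Cc: "(a, b) \<in> (nbr_rel C)\<^sup>*" if "a \<in> C" "b \<in> C" for a b
    using path0[OF that(1)] path0[OF that(2)] nbr_rel_rtrancl_sym rtrancl_trans by metis
  have "finite ((\<lambda>p. max \<bar>fst p\<bar> \<bar>snd p\<bar>) ` C)" using fin by (simp add: C_def)
  then obtain M where M: "\<And>p. p \<in> C \<Longrightarrow> max \<bar>fst p\<bar> \<bar>snd p\<bar> \<le> M"
    by (meson bdd_above_finite bdd_above.unfold imageI)
  define N where "N = M + 1"
  have N: "\<bar>fst p\<bar> < N \<and> \<bar>snd p\<bar> < N" if "p \<in> C" for p using M[OF that] by (auto simp: N_def)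
  have N0: "N > 0" using N[OF C0] by simp
  define D where "D = {p. ((N, 0), p) \<in> (nbr_rel (- C))\<^sup>*}"
  have o: "(N, 0) \<in> - C" using N[of "(N, 0)"] by auto
  have DC: "C \<inter> D = {}" using nbr_rel_rtrancl_mem[OF _ o] by (auto simp: D_def)
  have D_closed: "q \<in> D" if "p \<in> D" "nbr p q" "q \<notin> C" for p q
  proof -
    have "(p, q) \<in> nbr_rel (- C)" using that DC by (auto simp: nbr_rel_def)
    then show ?thesis using that(1) by (auto simp: D_def intro: rtrancl_into_rtrancl)
  qed
  have pathD: "((N, 0), p) \<in> (nbr_rel D)\<^sup>*" if "p \<in> D" for p
    using that unfolding D_def mem_Collect_eq
  proof (induction rule: rtrancl_induct)
    case (step y z)
    then have "(y, z) \<in> nbr_rel D" by (auto simp: nbr_rel_def D_def intro: rtrancl_into_rtrancl)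
    with step show ?case by (auto simp: D_def intro: rtrancl_into_rtrancl)
  qed simp
  have Dc: "(a, b) \<in> (nbr_rel D)\<^sup>*" if "a \<in> D" "b \<in> D" for a b
    using pathD[OF that(1)] pathD[OF that(2)] nbr_rel_rtrancl_sym rtrancl_trans by metis
  have right: "(x, 0) \<in> D" if "x \<ge> N" for x
    using horizontal_segment[of N x 0 "- C"] N that by (force simp: D_def)
  \<comment> \<open>A detour around the square that contains \<open>C\<close> puts the far left of
    the axis into the same component \<open>D\<close> as the far right.\<close>
  have "((N, 0), (N, N)) \<in> (nbr_rel (- C))\<^sup>*"
    using vertical_segment[of 0 N N "- C"] N N0 by force
  moreover have "((- N, N), (N, N)) \<in> (nbr_rel (- C))\<^sup>*"
    using horizontal_segment[of "- N" N N "- C"] N N0 by force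
  moreover have "((- N, 0), (- N, N)) \<in> (nbr_rel (- C))\<^sup>*"
    using vertical_segment[of 0 N "- N" "- C"] N N0 by force
  ultimately have lN: "(- N, 0) \<in> D"
    unfolding D_def mem_Collect_eq using nbr_rel_rtrancl_sym rtrancl_trans by metis
  have left: "(- x, 0) \<in> D" if "x \<ge> N" for x
  proof -
    have "((- x, 0), (- N, 0)) \<in> (nbr_rel (- C))\<^sup>*"
      using horizontal_segment[of "- x" "- N" 0 "- C"] N that by force
    then show ?thesis using lN nbr_rel_rtrancl_sym rtrancl_trans
      unfolding D_def mem_Collect_eq by metis
  qed
  define bd where "bd = {v\<in>D. \<exists>c\<in>C. nbr c v}"
  have cross: "\<exists>m\<ge>1. pt m \<in> bd" if pt0: "pt 0 = (0, 0)" and ptn: "\<And>k::nat. nbr (pt k) (pt (Suc k))"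
    and ptD: "\<And>k. int k \<ge> N \<Longrightarrow> pt k \<in> D" for pt
  proof -
    have ex: "\<exists>m. \<forall>k\<ge>m. pt k \<in> D" using ptD by (intro exI[of _ "nat N"]) auto
    \<comment> \<open>The last entry of the ray into \<open>D\<close>. Its predecessor is adjacent
      to \<open>D\<close> without belonging to it, hence lies in \<open>C\<close>.\<close>
    define m where "m = (LEAST m. \<forall>k\<ge>m. pt k \<in> D)"
    have m: "\<forall>k\<ge>m. pt k \<in> D" unfolding m_def using ex by (rule LeastI_ex)
    have "pt 0 \<notin> D" using pt0 C0 DC by auto
    then have m0: "m \<noteq> 0" using m by (metis le_refl)
    then obtain m' where m': "m = Suc m'" by (cases m) auto
    have "pt m' \<notin> D"
    proof
      assume "pt m' \<in> D"
      then have "\<forall>k\<ge>m'. pt k \<in> D" using m m' by (metis le_antisym not_less_eq_eq)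
      then have "m \<le> m'" unfolding m_def by (rule Least_le)
      then show False using m' by simp
    qed
    then have "pt m' \<in> C" using D_closed[of "pt m" "pt m'"] m m' ptn[of m'] nbr_sym by auto
    then have "pt m \<in> bd" using m ptn[of m'] m' by (auto simp: bd_def)
    then show ?thesis using m0 by (intro exI[of _ m]) auto
  qed
  obtain m where m: "m \<ge> 1" "(int m, 0) \<in> bd"
    using cross[of "\<lambda>k. (int k, 0)", OF _ _ right] by (auto simp: nbr_def)
  obtain m' where m': "m' \<ge> 1" "(- int m', 0) \<in> bd"
    using cross[of "\<lambda>k. (- int k, 0)", OF _ _ left] by (auto simp: nbr_def)
  let ?R = "{(p, q). star_nbr p q \<and> p \<in> bd \<and> q \<in> bd}"
  define A where "A = {p. ((int m, 0), p) \<in> ?R\<^sup>*}"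
  have A_bd: "A \<subseteq> bd"
  proof
    fix p assume "p \<in> A"
    then have "((int m, 0), p) \<in> ?R\<^sup>*" by (simp add: A_def)
    then show "p \<in> bd" using m(2) by (induction rule: rtrancl_induct) auto
  qed
  have "(- int m', 0) \<in> A"
  proof (rule ccontr)
    assume "(- int m', 0) \<notin> A"
    then have "\<exists>p\<in>A. \<exists>q\<in>bd - A. star_nbr p q"
      using m' by (intro boundary_star_connected[OF Cc Dc DC D_closed bd_def A_bd, where a = "(int m, 0)" and b = "(- int m', 0)"])
        (auto simp: A_def)
    then obtain p q where "p \<in> A" "q \<in> bd" "q \<notin> A" "star_nbr p q" by blast
    then show False using A_bd by (auto simp: A_def intro: rtrancl_into_rtrancl)
  qed
  then obtain xs where xs: "xs \<noteq> []" "hd xs = (int m, 0)" "last xs = (- int m', 0)" "distinct xs"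
    "successively star_nbr xs" "set xs \<subseteq> bd"
    using rtrancl_distinct_list[of "(int m, 0)" "(- int m', 0)" star_nbr bd] m(2) by (auto simp: A_def)
  have len: "length xs \<ge> Suc m" using star_path_displacement[OF xs(5,1)] xs(2,3) m' by auto
  define ys where "ys = take (Suc m) xs"
  have "successively star_nbr ys"
    using xs(5) append_take_drop_id[of "Suc m" xs] by (metis successively_append_iff ys_def)
  moreover have "hd ys = (int m, 0)" using xs by (simp add: ys_def)
  moreover have "bd \<inter> G = {}"
  proof (rule ccontr)
    assume "bd \<inter> G \<noteq> {}"
    then obtain v c where v: "v \<in> D" "v \<in> G" "c \<in> C" "nbr c v" by (auto simp: bd_def)
    then have "(c, v) \<in> nbr_rel G" using CG by (auto simp: nbr_rel_def)
    then have "v \<in> C" using v by (auto simp: C_def intro: rtrancl_into_rtrancl)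
    then show False using v DC by blast
  qed
  moreover have "set ys \<subseteq> bd" using xs(6) set_take_subset[of "Suc m" xs] by (auto simp: ys_def)
  ultimately show ?thesis using xs len
    by (intro exI[of _ m] exI[of _ ys]) (auto simp: ys_def)
qed

section \<open>Counting star paths and the Peierls estimate\<close>

primrec walks :: "nat \<Rightarrow> int \<times> int \<Rightarrow> (int \<times> int) list set" where
  "walks 0 p = {[p]}"
| "walks (Suc n) p = (\<Union>e\<in>{-1..1} \<times> {-1..1}. (#) p ` walks n (fst p + fst e, snd p + snd e))"

lemma finite_walks: "finite (walks n p)"
  by (induction n arbitrary: p) auto

text \<open>The nine displacements include the zero step. This overcounts star paths, but the count
  has one and the same factor for each step.\<close>

lemma card_walks: "card (walks n p) \<le> 9 ^ n"
proof (induction n arbitrary: p)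
  case (Suc n)
  have "card (walks (Suc n) p)
      \<le> (\<Sum>e\<in>{-1..1::int} \<times> {-1..1::int}. card ((#) p ` walks n (fst p + fst e, snd p + snd e)))"
    unfolding walks.simps by (rule card_UN_le) simp
  also have "\<dots> \<le> (\<Sum>e\<in>{-1..1::int} \<times> {-1..1::int}. 9 ^ n)"
    by (intro sum_mono order_trans[OF card_image_le Suc.IH]) (rule finite_walks)
  also have "\<dots> = 9 ^ Suc n" by (simp add: card_cartesian_product)
  finally show ?case .
qed simp

lemma mem_walks:
  "length xs = Suc n \<Longrightarrow> hd xs = p \<Longrightarrow> successively star_nbr xs \<Longrightarrow> xs \<in> walks n p"
proof (induction n arbitrary: xs p)
  case 0
  then show ?case by (cases xs) auto
next
  case (Suc n)
  then obtain ys where xs: "xs = p # ys" "length ys = Suc n" by (cases xs) auto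
  then have "successively star_nbr ys" "star_nbr p (hd ys)"
    using Suc.prems by (cases ys; auto)+
  then have "ys \<in> walks n (hd ys)" using Suc.IH[of ys "hd ys"] xs by auto
  moreover have "(fst (hd ys) - fst p, snd (hd ys) - snd p) \<in> {-1..1} \<times> {-1..1}"
    using \<open>star_nbr p (hd ys)\<close> by (auto simp: star_nbr_def)
  ultimately show ?case using xs by (force simp: image_iff)
qed

text \<open>A bound on finite intersections is exactly what a union bound over paths of distinct
  sites consumes. The factor \<open>space M\<close> gives the empty intersection its meaning as the
  sure event.\<close>

definition rare :: "'w measure \<Rightarrow> ('i \<Rightarrow> 'w set) \<Rightarrow> real \<Rightarrow> bool" where
  "rare M B q \<longleftrightarrow> (\<forall>z. B z \<in> sets M) \<and>
     (\<forall>S. finite S \<longrightarrow> measure M (space M \<inter> (\<Inter>z\<in>S. B z)) \<le> q ^ card S)"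

lemma rareD:
  assumes "rare M B q"
  shows "B z \<in> sets M" "finite S \<Longrightarrow> measure M (space M \<inter> (\<Inter>z\<in>S. B z)) \<le> q ^ card S"
  using assms by (auto simp: rare_def)

lemma Int_INT_sets:
  assumes "finite S" "\<And>z. z \<in> S \<Longrightarrow> B z \<in> sets M"
  shows "space M \<inter> (\<Inter>z\<in>S. B z) \<in> sets M"
proof (cases "S = {}")
  case False
  then show ?thesis using assms by (intro sets.Int sets.top sets.finite_INT) auto
qed simp

text \<open>Peierls' argument.\<close>

lemma rare_infinite_cluster:
  fixes B :: "int \<times> int \<Rightarrow> 'w set"
  assumes M: "prob_space M" and B: "rare M B (1/20)"
  shows "\<exists>N\<in>sets M. measure M N < 1 \<and> (\<forall>\<omega>\<in>space M - N.
    \<omega> \<notin> B (0, 0) \<and> infinite {z. ((0, 0), z) \<in> (nbr_rel {z. \<omega> \<notin> B z})\<^sup>*})"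
proof -
  interpret prob_space M by fact
  define E where "E = (\<lambda>xs. space M \<inter> (\<Inter>z\<in>set xs. B z))"
  have E: "E xs \<in> sets M" for xs
    unfolding E_def using rareD[OF B] by (intro Int_INT_sets) auto
  define W where "W = (\<lambda>m. {xs\<in>walks m (int m, 0). distinct xs \<and> length xs = Suc m})"
  have finW: "finite (W m)" for m using finite_walks by (simp add: W_def)
  define F where "F = (\<lambda>m. \<Union>xs\<in>W m. E xs)"
  have F: "F m \<in> sets M" for m unfolding F_def using finW E by auto
  \<comment> \<open>At most \<open>9 ^ m\<close> blocking paths start at \<open>(m, 0)\<close>, each
    with \<open>m + 1\<close> distinct sites. For \<open>m = 0\<close> the only path is the origin
    itself, so \<open>F 0\<close> is the event that the origin is bad.\<close>
  have mF: "measure M (F m) \<le> (9/20) ^ m / 20" for m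
  proof -
    have "measure M (F m) \<le> (\<Sum>xs\<in>W m. measure M (E xs))"
      unfolding F_def using finW E by (intro finite_measure_subadditive_finite) auto
    also have "\<dots> \<le> (\<Sum>xs\<in>W m. (1/20) ^ Suc m)"
    proof (intro sum_mono)
      fix xs assume "xs \<in> W m"
      then show "measure M (E xs) \<le> (1/20) ^ Suc m"
        using rareD(2)[OF B, of "set xs"] by (simp add: E_def W_def distinct_card)
    qed
    also have "\<dots> = real (card (W m)) * (1/20) ^ Suc m" by simp
    also have "\<dots> \<le> 9 ^ m * (1/20) ^ Suc m"
    proof (intro mult_right_mono)
      have "card (W m) \<le> card (walks m (int m, 0))"
        by (rule card_mono[OF finite_walks]) (auto simp: W_def)
      then have "card (W m) \<le> 9 ^ m" using card_walks order_trans by blast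
      then show "real (card (W m)) \<le> 9 ^ m" by (metis of_nat_le_iff of_nat_numeral of_nat_power)
    qed simp
    also have "\<dots> = (9/20) ^ m / 20" by (simp add: power_divide)
    finally show ?thesis .
  qed
  \<comment> \<open>The ratio is below one because \<open>1/20 < 1/9\<close>; the total is
    \<open>1/11\<close>.\<close>
  have sums: "(\<lambda>m. (9/20::real) ^ m / 20) sums (1 / (1 - 9/20) / 20)"
    by (intro sums_divide geometric_sums) simp
  have summ: "summable (\<lambda>m. measure M (F m))"
    by (rule summable_comparison_test[OF _ sums_summable[OF sums]]) (use mF in auto)
  have "measure M (\<Union>m. F m) \<le> (\<Sum>m. measure M (F m))"
    using F by (intro finite_measure_subadditive_countably summ) auto
  also have "\<dots> \<le> (\<Sum>m. (9/20::real) ^ m / 20)"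
    by (rule suminf_le[OF mF summ sums_summable[OF sums]])
  also have "\<dots> = 1 / (1 - 9/20) / 20" using sums by (rule sums_unique[symmetric])
  also have "\<dots> < (1::real)" by simp
  finally have lt: "measure M (\<Union>m. F m) < 1" .
  show ?thesis
  proof (intro bexI[of _ "\<Union>m. F m"] conjI ballI lt)
    show "(\<Union>m. F m) \<in> sets M" using F by auto
    fix \<omega> assume w: "\<omega> \<in> space M - (\<Union>m. F m)"
    show *: "\<omega> \<notin> B (0, 0)"
    proof
      assume "\<omega> \<in> B (0, 0)"
      then have "\<omega> \<in> F 0" using w by (auto simp: F_def W_def E_def)
      then show False using w by auto
    qed
    show "infinite {z. ((0, 0), z) \<in> (nbr_rel {z. \<omega> \<notin> B z})\<^sup>*}"
    proof
      assume "finite {z. ((0, 0), z) \<in> (nbr_rel {z. \<omega> \<notin> B z})\<^sup>*}"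
      from finite_cluster_blocked[OF _ this] * obtain m xs where xs: "length xs = Suc m"
        "hd xs = (int m, 0)" "distinct xs" "successively star_nbr xs" "set xs \<inter> {z. \<omega> \<notin> B z} = {}"
        by auto
      then have "xs \<in> W m" using mem_walks by (auto simp: W_def)
      moreover have "\<omega> \<in> E xs" using xs(5) w by (auto simp: E_def)
      ultimately show False using w by (auto simp: F_def)
    qed
  qed
qed

text \<open>Of the points of \<open>T\<close> and \<open>S - T\<close>, at least half lie on the larger side.\<close>

lemma rare_Un:
  fixes A B :: "'i \<Rightarrow> 'w set"
  assumes M: "prob_space M" and A: "rare M A (q\<^sup>2)" and B: "rare M B (q\<^sup>2)" and q: "0 \<le> q" "q \<le> 1"
  shows "rare M (\<lambda>z. A z \<union> B z) (2 * q)"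
  unfolding rare_def
proof (intro conjI allI impI)
  interpret prob_space M by fact
  fix z show "A z \<union> B z \<in> sets M" using rareD[OF A] rareD[OF B] by auto
next
  interpret prob_space M by fact
  fix S :: "'i set" assume S: "finite S"
  let ?I = "\<lambda>(X :: 'i \<Rightarrow> 'w set) T. space M \<inter> (\<Inter>z\<in>T. X z)"
  have meas: "?I A T \<in> sets M" "?I B T \<in> sets M" if "T \<subseteq> S" for T
    using rareD(1)[OF A] rareD(1)[OF B] that S by (auto intro!: Int_INT_sets dest: finite_subset)
  have bound: "measure M (?I A T \<inter> ?I B (S - T)) \<le> q ^ card S" if T: "T \<subseteq> S" for T
  proof -
    have fin: "finite T" "finite (S - T)" using S T by (auto dest: finite_subset)
    have le: "measure M (?I A T \<inter> ?I B (S - T)) \<le> measure M (?I A T)"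
      "measure M (?I A T \<inter> ?I B (S - T)) \<le> measure M (?I B (S - T))"
      using meas[OF T] meas[of "S - T"] by (auto intro!: finite_measure_mono)
    have c: "card S = card T + card (S - T)" using T S by (metis card_Diff_subset card_mono fin(1) le_add_diff_inverse)
    show ?thesis
    proof (cases "card S \<le> 2 * card T")
      case True
      have "measure M (?I A T) \<le> (q\<^sup>2) ^ card T" using rareD(2)[OF A fin(1)] .
      also have "\<dots> \<le> q ^ card S" unfolding power_mult[symmetric] using True q by (intro power_decreasing) auto
      finally show ?thesis using le by linarith
    next
      case False
      have "measure M (?I B (S - T)) \<le> (q\<^sup>2) ^ card (S - T)" using rareD(2)[OF B fin(2)] .
      also have "\<dots> \<le> q ^ card S" unfolding power_mult[symmetric] using False c q by (intro power_decreasing) auto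
      finally show ?thesis using le by linarith
    qed
  qed
  have "?I (\<lambda>z. A z \<union> B z) S \<subseteq> (\<Union>T\<in>Pow S. ?I A T \<inter> ?I B (S - T))"
  proof
    fix \<omega> assume "\<omega> \<in> ?I (\<lambda>z. A z \<union> B z) S"
    then have "\<omega> \<in> ?I A {z\<in>S. \<omega> \<in> A z} \<inter> ?I B (S - {z\<in>S. \<omega> \<in> A z})" by auto
    moreover have "{z\<in>S. \<omega> \<in> A z} \<in> Pow S" by simp
    ultimately show "\<omega> \<in> (\<Union>T\<in>Pow S. ?I A T \<inter> ?I B (S - T))"
      by (rule_tac UN_I)
  qed
  note sub = this
  have sets: "?I A T \<inter> ?I B (S - T) \<in> sets M" if "T \<in> Pow S" for T
    by (rule sets.Int[OF meas(1) meas(2)]) (use that in auto)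
  have finS: "finite (Pow S)" using S by simp
  have "measure M (?I (\<lambda>z. A z \<union> B z) S) \<le> measure M (\<Union>T\<in>Pow S. ?I A T \<inter> ?I B (S - T))"
    by (rule finite_measure_mono[OF sub sets.finite_UN[OF finS sets]])
  also have "\<dots> \<le> (\<Sum>T\<in>Pow S. measure M (?I A T \<inter> ?I B (S - T)))"
    by (rule finite_measure_subadditive_finite[OF finS image_subsetI[OF sets]])
  \<comment> \<open>The factor 2 in the new parameter counts the \<open>2 ^ card S\<close> ways to
    split \<open>S\<close> between the two families.\<close>
  also have "\<dots> \<le> (\<Sum>T\<in>Pow S. q ^ card S)" using bound by (intro sum_mono) auto
  also have "\<dots> = (2 * q) ^ card S" using S by (simp add: card_Pow power_mult_distrib)
  finally show "measure M (?I (\<lambda>z. A z \<union> B z) S) \<le> (2 * q) ^ card S" .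
qed

section \<open>Thinning to well separated sites\<close>

definition separated :: "nat \<Rightarrow> (int \<times> int) set \<Rightarrow> bool" where
  "separated t S \<longleftrightarrow> (\<forall>p\<in>S. \<forall>q\<in>S. p \<noteq> q \<longrightarrow> \<bar>fst p - fst q\<bar> \<ge> int t \<or> \<bar>snd p - snd q\<bar> \<ge> int t)"

text \<open>A residue class modulo \<open>t\<close> in both coordinates is separated.\<close>

lemma separated_subset:
  assumes "finite S" "t \<ge> 1"
  shows "\<exists>T\<subseteq>S. separated t T \<and> card S \<le> t * t * card T"
proof -
  define f where "f = (\<lambda>p::int\<times>int. (fst p mod int t, snd p mod int t))"
  let ?R = "{0..<int t} \<times> {0..<int t}"
  have fR: "f ` S \<subseteq> ?R" using assms by (auto simp: f_def)
  have "\<exists>r\<in>?R. card S \<le> t * t * card {p\<in>S. f p = r}"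
  proof (rule ccontr)
    assume "\<not> ?thesis"
    then have *: "\<And>r. r \<in> ?R \<Longrightarrow> t * t * card {p\<in>S. f p = r} < card S" by force
    have ne: "?R \<noteq> {}" using assms by auto
    have "t * t * card S = t * t * (\<Sum>r\<in>?R. card {p\<in>S. f p = r})"
    proof -
      have "card S = (\<Sum>r\<in>?R. card {p\<in>S. f p = r})"
        using sum.group[of S ?R f "\<lambda>_. 1::nat"] assms fR by simp
      then show ?thesis by simp
    qed
    also have "\<dots> = (\<Sum>r\<in>?R. t * t * card {p\<in>S. f p = r})" by (simp add: sum_distrib_left)
    also have "\<dots> < (\<Sum>r\<in>?R. card S)" using * ne by (intro sum_strict_mono) auto
    also have "\<dots> = t * t * card S" by (simp add: card_cartesian_product)
    finally show False by simp
  qed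
  then obtain r where r: "card S \<le> t * t * card {p\<in>S. f p = r}" by blast
  have "separated t {p\<in>S. f p = r}"
    unfolding separated_def
  proof (intro ballI impI)
    fix p q assume p: "p \<in> {p\<in>S. f p = r}" and q: "q \<in> {p\<in>S. f p = r}" and ne: "p \<noteq> q"
    have *: "\<bar>x - y\<bar> \<ge> int t" if "x mod int t = y mod int t" "x \<noteq> y" for x y :: int
    proof -
      have "int t dvd (x - y)" using that(1) by (simp add: mod_eq_dvd_iff)
      then show ?thesis using that(2) dvd_imp_le_int[of "x - y" "int t"] by simp
    qed
    have "fst p \<noteq> fst q \<or> snd p \<noteq> snd q" using ne by (auto simp: prod_eq_iff)
    moreover have "fst p mod int t = fst q mod int t" "snd p mod int t = snd q mod int t"
      using p q by (auto simp: f_def)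
    ultimately show "\<bar>fst p - fst q\<bar> \<ge> int t \<or> \<bar>snd p - snd q\<bar> \<ge> int t" using * by blast
  qed
  with r show ?thesis by (intro exI[of _ "{p\<in>S. f p = r}"]) auto
qed

text \<open>The joint estimate is only required for distant sites. It is applied to a separated
  subset containing at least the fraction \<open>1 / (t * t)\<close> of all sites, and the exponent
  \<open>t * t\<close> in the hypothesis makes up for this loss.\<close>

lemma rare_of_separated:
  fixes B :: "int \<times> int \<Rightarrow> 'w set"
  assumes M: "prob_space M" and B: "\<And>z. B z \<in> sets M" and t: "t \<ge> 1" and q: "0 \<le> q" "q \<le> 1"
    and sep: "\<And>S. finite S \<Longrightarrow> separated t S \<Longrightarrow>
      measure M (space M \<inter> (\<Inter>z\<in>S. B z)) \<le> (q ^ (t * t)) ^ card S"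
  shows "rare M B q"
  unfolding rare_def
proof (intro conjI allI impI B)
  interpret prob_space M by fact
  fix S :: "(int \<times> int) set" assume S: "finite S"
  obtain T where T: "T \<subseteq> S" "separated t T" "card S \<le> t * t * card T"
    using separated_subset[OF S t] by blast
  then have fT: "finite T" using S finite_subset by blast
  have "measure M (space M \<inter> (\<Inter>z\<in>S. B z)) \<le> measure M (space M \<inter> (\<Inter>z\<in>T. B z))"
    using T B fT by (intro finite_measure_mono Int_INT_sets) auto
  also have "\<dots> \<le> (q ^ (t * t)) ^ card T" using sep fT T by blast
  also have "\<dots> \<le> q ^ card S" unfolding power_mult[symmetric] using T q by (intro power_decreasing) auto
  finally show "measure M (space M \<inter> (\<Inter>z\<in>S. B z)) \<le> q ^ card S" .
qed

section \<open>Locally finite measures\<close>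

lemma space_locally_finite_algebra:
  "space locally_finite_algebra =
    {m. sets m = sets borel \<and> (\<forall>B\<in>sets borel. bounded B \<longrightarrow> emeasure m B < \<infinity>)}"
  by (auto simp: locally_finite_algebra_def space_Sup_eq_UN)

lemma measurable_emeasure_locally_finite_algebra [measurable]:
  "A \<in> sets borel \<Longrightarrow> (\<lambda>m. emeasure m A) \<in> borel_measurable locally_finite_algebra"
  by (auto intro!: measurable_Sup1 measurable_vimage_algebra1 simp: locally_finite_algebra_def)

lemma measurable_measure_locally_finite_algebra [measurable]:
  "A \<in> sets borel \<Longrightarrow> (\<lambda>m. measure m A) \<in> borel_measurable locally_finite_algebra"
  unfolding measure_def
  by (rule borel_measurable_enn2real[OF measurable_emeasure_locally_finite_algebra])

lemma measurable_locally_finite_algebraI: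
  assumes "\<And>a. a \<in> space M \<Longrightarrow> K a \<in> space locally_finite_algebra"
    and "\<And>A. A \<in> sets borel \<Longrightarrow> (\<lambda>a. emeasure (K a) A) \<in> borel_measurable M"
  shows "K \<in> measurable M locally_finite_algebra"
  using assms unfolding space_locally_finite_algebra
  by (auto intro!: measurable_Sup2 measurable_vimage_algebra2 simp: locally_finite_algebra_def)

lemma lfa_sets: "m \<in> space locally_finite_algebra \<Longrightarrow> sets m = sets borel"
  by (simp add: space_locally_finite_algebra)

lemma lfa_finite: "m \<in> space locally_finite_algebra \<Longrightarrow> A \<in> sets borel \<Longrightarrow> bounded A \<Longrightarrow> emeasure m A < \<infinity>"
  by (simp add: space_locally_finite_algebra)

section \<open>Translation and restriction of measures\<close>

lemma translation_eq_vimage: "(+) y ` A = (\<lambda>x::real^'d. x - y) -` A"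
proof (intro set_eqI iffI)
  fix x assume "x \<in> (\<lambda>x. x - y) -` A"
  then show "x \<in> (+) y ` A" by (intro image_eqI[of _ _ "x - y"]) auto
qed auto

lemma emeasure_translate:
  fixes A :: "(real^'d) set"
  assumes "sets m = sets borel" "A \<in> sets borel"
  shows "emeasure (translate_measure y m) A = emeasure m ((+) y ` A)"
proof -
  have "(\<lambda>x. x - y) \<in> measurable m borel"
    unfolding measurable_cong_sets[OF assms(1) refl] by simp
  then have "emeasure (translate_measure y m) A = emeasure m ((\<lambda>x. x - y) -` A \<inter> space m)"
    unfolding translate_measure_def by (rule emeasure_distr[OF _ assms(2)])
  also have "(\<lambda>x. x - y) -` A \<inter> space m = (+) y ` A"
    using sets_eq_imp_space_eq[OF assms(1)] by (simp add: translation_eq_vimage)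
  finally show ?thesis .
qed

lemma sets_translate [simp]: "sets (translate_measure y m) = sets borel"
  by (simp add: translate_measure_def)

lemma translate_image_borel [measurable]:
  fixes A :: "(real^'d) set"
  assumes "A \<in> sets borel" shows "(+) y ` A \<in> sets borel"
proof -
  have "(+) y ` A = (\<lambda>x. x - y) -` A \<inter> space borel"
    by (simp add: translation_eq_vimage)
  also have "\<dots> \<in> sets borel" using assms by (intro measurable_sets[of _ borel borel]) auto
  finally show ?thesis .
qed

lemma translate_lfa:
  assumes "m \<in> space locally_finite_algebra"
  shows "translate_measure y m \<in> space locally_finite_algebra"
  using assms lfa_finite[OF assms translate_image_borel]
  by (auto simp: space_locally_finite_algebra emeasure_translate bounded_translation)

lemma measurable_translate [measurable]:
  "translate_measure y \<in> measurable locally_finite_algebra locally_finite_algebra"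
proof (rule measurable_locally_finite_algebraI[OF translate_lfa])
  fix A :: "(real^'a) set" assume A: "A \<in> sets borel"
  have "(\<lambda>m. emeasure m ((+) y ` A)) \<in> borel_measurable locally_finite_algebra"
    using A by measurable
  then show "(\<lambda>m. emeasure (translate_measure y m) A) \<in> borel_measurable locally_finite_algebra"
    by (rule measurable_cong[THEN iffD1, rotated]) (simp add: emeasure_translate A lfa_sets)
qed

lemma sets_restrict_to [simp]: "sets (restrict_to A m) = sets m"
  by (simp add: restrict_to_def)

lemma emeasure_restrict_to:
  assumes "sets m = sets borel" "A \<in> sets borel" "B \<in> sets borel"
  shows "emeasure (restrict_to A m) B = emeasure m (A \<inter> B)"
proof -
  have "(indicator A :: _ \<Rightarrow> ennreal) \<in> borel_measurable m"
    unfolding measurable_cong_sets[OF assms(1) refl] using assms(2) by simp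
  then have "emeasure (restrict_to A m) B = (\<integral>\<^sup>+x. indicator A x * indicator B x \<partial>m)"
    unfolding restrict_to_def using assms by (simp add: emeasure_density)
  also have "\<dots> = (\<integral>\<^sup>+x. indicator (A \<inter> B) x \<partial>m)"
    by (intro nn_integral_cong) (simp add: indicator_def)
  also have "\<dots> = emeasure m (A \<inter> B)"
    using assms by (intro nn_integral_indicator) auto
  finally show ?thesis .
qed

lemma restrict_to_lfa:
  assumes "m \<in> space locally_finite_algebra" "A \<in> sets borel"
  shows "restrict_to A m \<in> space locally_finite_algebra"
  using assms lfa_finite[OF assms(1)]
  by (auto simp: space_locally_finite_algebra emeasure_restrict_to bounded_Int)

lemma measurable_restrict_to [measurable]:
  assumes "A \<in> sets borel"
  shows "restrict_to A \<in> measurable locally_finite_algebra locally_finite_algebra"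
proof (rule measurable_locally_finite_algebraI[OF restrict_to_lfa[OF _ assms]])
  fix B :: "(real^'a) set" assume B: "B \<in> sets borel"
  have "(\<lambda>m. emeasure m (A \<inter> B)) \<in> borel_measurable locally_finite_algebra"
    using assms B by measurable
  then show "(\<lambda>m. emeasure (restrict_to A m) B) \<in> borel_measurable locally_finite_algebra"
    by (rule measurable_cong[THEN iffD1, rotated]) (simp add: emeasure_restrict_to assms B lfa_sets)
qed

lemma mem_cube: "y \<in> cube n x \<longleftrightarrow> (\<forall>i. \<bar>y $ i - x $ i\<bar> \<le> n / 2)"
proof -
  have "(x $ i - n / 2 \<le> y $ i \<and> y $ i \<le> x $ i + n / 2) \<longleftrightarrow> \<bar>y $ i - x $ i\<bar> \<le> n / 2" for i
    by linarith
  then show ?thesis unfolding cube_def mem_box_cart by auto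
qed

lemma cube_borel [measurable]: "cube n x \<in> sets borel"
  by (simp add: cube_def)

lemma bounded_cube: "bounded (cube n x)"
  by (simp add: cube_def)

lemma compact_cube: "compact (cube n x)"
  by (simp add: cube_def)

lemma translate_cube: "(+) y ` cube n x = cube n (x + y)"
proof (intro set_eqI iffI)
  fix z assume "z \<in> cube n (x + y)"
  then have "z - y \<in> cube n x" by (auto simp: mem_cube algebra_simps)
  then show "z \<in> (+) y ` cube n x" by (auto simp: image_iff intro!: bexI[of _ "z - y"])
qed (auto simp: mem_cube algebra_simps)

lemma cube_dist:
  fixes x :: "real^'d"
  assumes "x \<in> cube n a" "y \<in> cube m b" "\<And>i. \<bar>a $ i - b $ i\<bar> \<le> r"
  shows "dist x y \<le> real CARD('d) * (n / 2 + m / 2 + r)"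
proof -
  have "dist x y \<le> (\<Sum>i\<in>UNIV. \<bar>(x - y) $ i\<bar>)" unfolding dist_norm by (rule norm_le_l1_cart)
  also have "\<dots> \<le> (\<Sum>i\<in>(UNIV::'d set). n / 2 + m / 2 + r)"
  proof (rule sum_mono)
    fix i
    have "\<bar>x $ i - a $ i\<bar> \<le> n / 2" "\<bar>y $ i - b $ i\<bar> \<le> m / 2" "\<bar>a $ i - b $ i\<bar> \<le> r"
      using assms unfolding mem_cube by blast+
    then show "\<bar>(x - y) $ i\<bar> \<le> n / 2 + m / 2 + r" unfolding vector_minus_component by linarith
  qed
  also have "\<dots> = real CARD('d) * (n / 2 + m / 2 + r)" by simp
  finally show ?thesis .
qed

section \<open>Poisson counts\<close>

lemma poisson_prob_nonneg: "r \<ge> 0 \<Longrightarrow> poisson_prob r k \<ge> 0"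
  by (simp add: poisson_prob_def)

text \<open>The moment generating function of the Poisson distribution, as an extended series so
  that it can replace a factor in \<open>count_formula\<close>.\<close>

lemma poisson_exp_sum:
  assumes "r \<ge> 0"
  shows "(\<Sum>k. ennreal (exp (s * real k)) * ennreal (poisson_prob r k)) = ennreal (exp (r * (exp s - 1)))"
proof -
  have "(\<lambda>k. (r * exp s) ^ k /\<^sub>R fact k) sums exp (r * exp s)" by (rule exp_converges)
  then have "(\<lambda>k. (r * exp s) ^ k /\<^sub>R fact k * exp (- r)) sums (exp (r * exp s) * exp (- r))"
    by (rule sums_mult2)
  moreover have "(r * exp s) ^ k /\<^sub>R fact k * exp (- r) = exp (s * real k) * poisson_prob r k" for k
    by (simp add: poisson_prob_def power_mult_distrib exp_of_nat2_mult divide_inverse mult_ac)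
  moreover have "exp (r * exp s) * exp (- r) = exp (r * (exp s - 1))"
    by (simp add: exp_add[symmetric] algebra_simps)
  ultimately have "(\<lambda>k. exp (s * real k) * poisson_prob r k) sums exp (r * (exp s - 1))" by simp
  then have "(\<Sum>k. ennreal (exp (s * real k) * poisson_prob r k)) = ennreal (exp (r * (exp s - 1)))"
    using poisson_prob_nonneg[OF assms] by (intro suminf_ennreal_eq) auto
  then show ?thesis by (simp add: ennreal_mult' poisson_prob_nonneg[OF assms] mult.commute)
qed

lemma poisson_sum: "r \<ge> 0 \<Longrightarrow> (\<Sum>k. ennreal (poisson_prob r k)) = 1"
  using poisson_exp_sum[of r 0] by simp

section \<open>Joint law of the counts of a Cox process\<close>

locale cox = prob_space M
  for M :: "'w measure" +
  fixes \<Lambda> :: "'w \<Rightarrow> (real^'d) measure" and \<mu> :: "real measure" and lam :: real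
    and X :: "'w \<Rightarrow> 'd config"
  assumes \<Lambda>: "random_measure M \<Lambda>" and \<mu>: "mark_distribution \<mu>" and lam: "lam > 0"
    and X: "marked_cox_process M \<Lambda> \<mu> lam X"
begin

lemma measurable_\<Lambda> [measurable]: "\<Lambda> \<in> measurable M locally_finite_algebra"
  using \<Lambda> by (simp add: random_measure_def)

lemma \<Lambda>_lfa: "\<omega> \<in> space M \<Longrightarrow> \<Lambda> \<omega> \<in> space locally_finite_algebra"
  using measurable_space[OF measurable_\<Lambda>] .

lemma \<mu>_prob: "prob_space \<mu>" and sets_\<mu>: "sets \<mu> = sets borel"
  using \<mu> by (auto simp: mark_distribution_def)

lemma point_event: "B \<in> sets borel \<Longrightarrow> {\<omega>\<in>space M. i \<in> points_in (X \<omega>) B} \<in> sets M"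
  using X by (auto simp: marked_cox_process_def)

lemma count_event:
  assumes "B \<in> sets borel"
  shows "{\<omega>\<in>space M. finite (points_in (X \<omega>) B) \<and> card (points_in (X \<omega>) B) = k} \<in> sets M"
proof -
  have "{\<omega>\<in>space M. finite (points_in (X \<omega>) B) \<and> card (points_in (X \<omega>) B) = k} =
    (\<Union>T\<in>{T. finite T \<and> card T = k}. {\<omega>\<in>space M. \<forall>i. i \<in> points_in (X \<omega>) B \<longleftrightarrow> i \<in> T})"
    unfolding set_eq_iff[symmetric] by auto
  also have "\<dots> \<in> sets M"
  proof (intro sets.countable_UN' image_subsetI)
    show "countable {T::nat set. finite T \<and> card T = k}"
      by (rule countable_subset[OF _ countable_Collect_finite]) auto
    fix T :: "nat set"
    note point_event[OF assms, measurable]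
    show "{\<omega>\<in>space M. \<forall>i. i \<in> points_in (X \<omega>) B \<longleftrightarrow> i \<in> T} \<in> sets M" by measurable
  qed
  finally show ?thesis .
qed

text \<open>Infinite counts get the value 0. They turn out to be null events, and with this
  convention a function of the count is the series over its finite values.\<close>

definition count_fun :: "(nat \<Rightarrow> ennreal) \<Rightarrow> ((real^'d) \<times> real) set \<Rightarrow> 'w \<Rightarrow> ennreal" where
  "count_fun \<phi> B \<omega> = (if finite (points_in (X \<omega>) B) then \<phi> (card (points_in (X \<omega>) B)) else 0)"

lemma count_fun_suminf:
  "count_fun \<phi> B \<omega> = (\<Sum>k. \<phi> k * indicator {\<omega>. finite (points_in (X \<omega>) B) \<and> card (points_in (X \<omega>) B) = k} \<omega>)"
proof (cases "finite (points_in (X \<omega>) B)")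
  case True
  have "(\<Sum>k. \<phi> k * indicator {\<omega>. finite (points_in (X \<omega>) B) \<and> card (points_in (X \<omega>) B) = k} \<omega>)
    = (\<Sum>k\<in>{card (points_in (X \<omega>) B)}. \<phi> k * indicator {\<omega>. finite (points_in (X \<omega>) B) \<and> card (points_in (X \<omega>) B) = k} \<omega>)"
    by (rule suminf_finite) auto
  then show ?thesis using True by (simp add: count_fun_def)
qed (simp add: count_fun_def)

lemma measurable_count_fun:
  assumes "B \<in> sets borel"
  shows "count_fun \<phi> B \<in> borel_measurable M"
proof -
  note count_event[OF assms, measurable]
  have "(\<lambda>\<omega>. \<Sum>k. \<phi> k * indicator {\<omega>\<in>space M. finite (points_in (X \<omega>) B) \<and> card (points_in (X \<omega>) B) = k} \<omega>) \<in> borel_measurable M"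
    by measurable
  then show ?thesis
    by (rule measurable_cong[THEN iffD1, rotated]) (auto simp: count_fun_suminf indicator_def intro!: suminf_cong)
qed

abbreviation rate :: "(real^'d) set \<Rightarrow> real set \<Rightarrow> 'w \<Rightarrow> real" where
  "rate A C \<omega> \<equiv> lam * (measure (\<Lambda> \<omega>) A * measure \<mu> C)"

lemma measurable_rate [measurable]:
  assumes "A \<in> sets borel"
  shows "rate A C \<in> borel_measurable M"
  using measurable_compose[OF measurable_\<Lambda> measurable_measure_locally_finite_algebra[OF assms]]
  by (intro borel_measurable_times borel_measurable_const)

lemma measurable_poisson:
  assumes "A \<in> sets borel"
  shows "(\<lambda>\<omega>. poisson_prob (rate A C \<omega>) k) \<in> borel_measurable M"
proof -
  have "(\<lambda>r. poisson_prob r k) \<in> borel_measurable borel"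
    unfolding poisson_prob_def by measurable
  from measurable_compose[OF measurable_rate[OF assms] this] show ?thesis .
qed

lemma rate_nonneg: "rate A C \<omega> \<ge> 0"
  using lam by simp

lemma measure_rectangle:
  assumes "m \<in> space locally_finite_algebra" "A \<in> sets borel" "C \<in> sets borel"
  shows "measure (m \<Otimes>\<^sub>M \<mu>) (A \<times> C) = measure m A * measure \<mu> C"
proof -
  interpret \<mu>: prob_space \<mu> by (rule \<mu>_prob)
  show ?thesis using assms sets_\<mu> lfa_sets[OF assms(1)]
    by (simp add: measure_def \<mu>.emeasure_pair_measure_Times enn2real_mult)
qed

text \<open>The defining conditional probability, integrated over the event that
  \<open>\<Lambda>\<close> lies in \<open>G\<close>. Keeping \<open>G\<close> allows the masses of
  cells to be restricted before the counts are estimated.\<close>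

lemma count_prob:
  fixes m :: nat
  assumes A: "\<And>j. j < m \<Longrightarrow> A j \<in> sets borel" "\<And>j. j < m \<Longrightarrow> bounded (A j)"
    and C: "\<And>j. j < m \<Longrightarrow> C j \<in> sets borel" "\<And>j. j < m \<Longrightarrow> bounded (C j)"
    and disj: "disjoint_family_on (\<lambda>j. A j \<times> C j) {..<m}"
    and G: "G \<in> sets locally_finite_algebra"
  shows "(\<integral>\<^sup>+\<omega>. indicator G (\<Lambda> \<omega>) * indicator {\<omega>\<in>space M. \<forall>j<m.
        finite (points_in (X \<omega>) (A j \<times> C j)) \<and> card (points_in (X \<omega>) (A j \<times> C j)) = k j} \<omega> \<partial>M)
    = (\<integral>\<^sup>+\<omega>. indicator G (\<Lambda> \<omega>) * (\<Prod>j<m. ennreal (poisson_prob (rate (A j) (C j) \<omega>) (k j))) \<partial>M)"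
proof -
  define F where "F = vimage_algebra (space M) \<Lambda> locally_finite_algebra"
  have sub: "subalgebra M F"
    unfolding subalgebra_def F_def by (auto simp: sets_vimage_algebra2 measurable_space[OF measurable_\<Lambda>] intro: measurable_sets[OF measurable_\<Lambda>])
  interpret finite_measure_subalgebra M F by unfold_locales (rule sub)
  define E where "E = {\<omega>\<in>space M. \<forall>j<m. finite (points_in (X \<omega>) (A j \<times> C j)) \<and> card (points_in (X \<omega>) (A j \<times> C j)) = k j}"
  have rect: "A j \<times> C j \<in> sets borel" if "j < m" for j using A C that by (intro borel_Times) auto
  have E: "E \<in> sets M"
  proof -
    have "E = space M \<inter> (\<Inter>j\<in>{..<m}. {\<omega>\<in>space M. finite (points_in (X \<omega>) (A j \<times> C j)) \<and> card (points_in (X \<omega>) (A j \<times> C j)) = k j})"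
      by (auto simp: E_def)
    also have "\<dots> \<in> sets M" by (intro Int_INT_sets count_event rect) auto
    finally show ?thesis .
  qed
  define V where "V = \<Lambda> -` G \<inter> space M"
  have V: "V \<in> sets F" using G unfolding V_def F_def
    by (auto simp: sets_vimage_algebra2 measurable_space[OF measurable_\<Lambda>])
  have VM: "V \<in> sets M" using V sub by (auto simp: subalgebra_def)
  define g where "g = (\<lambda>\<omega>. \<Prod>j<m. poisson_prob (rate (A j) (C j) \<omega>) (k j))"
  have g_meas: "g \<in> borel_measurable M"
    unfolding g_def using measurable_poisson A by (intro borel_measurable_prod) auto
  have g_nn: "g \<omega> \<ge> 0" for \<omega> unfolding g_def by (intro prod_nonneg) (auto intro: poisson_prob_nonneg rate_nonneg)
  have "AE \<omega> in M. real_cond_exp M F (indicator E) \<omega> =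
      (\<Prod>j<m. poisson_prob (lam * measure (\<Lambda> \<omega> \<Otimes>\<^sub>M \<mu>) (A j \<times> C j)) (k j))"
    using X rect A C disj unfolding marked_cox_process_def F_def[symmetric] E_def
    by (auto simp: bounded_Times)
  then have ae: "AE \<omega> in M. real_cond_exp M F (indicator E) \<omega> = g \<omega>"
  proof (rule AE_mp, intro AE_I2 impI)
    fix \<omega> assume w: "\<omega> \<in> space M" and *: "real_cond_exp M F (indicator E) \<omega> =
      (\<Prod>j<m. poisson_prob (lam * measure (\<Lambda> \<omega> \<Otimes>\<^sub>M \<mu>) (A j \<times> C j)) (k j))"
    show "real_cond_exp M F (indicator E) \<omega> = g \<omega>"
      unfolding * g_def using A C by (intro prod.cong refl) (simp add: measure_rectangle[OF \<Lambda>_lfa[OF w]])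
  qed
  have intE: "integrable M (indicator E :: 'w \<Rightarrow> real)" using E by (simp add: emeasure_eq_measure)
  have "integrable M (real_cond_exp M F (indicator E))" using real_cond_exp_int(1)[OF intE] .
  then have intg: "integrable M g"
    by (rule integrable_cong_AE_imp) (use ae g_meas in auto)
  have "(\<integral>\<omega>\<in>V. indicator E \<omega> \<partial>M) = (\<integral>\<omega>\<in>V. real_cond_exp M F (indicator E) \<omega> \<partial>M)"
    by (rule real_cond_exp_intA[OF intE V])
  also have "\<dots> = (\<integral>\<omega>\<in>V. g \<omega> \<partial>M)"
    unfolding set_lebesgue_integral_def
    by (rule integral_cong_AE) (use ae g_meas VM in \<open>auto simp: set_borel_measurable_def\<close>)
  finally have eq: "(\<integral>\<omega>. indicator V \<omega> * indicator E \<omega> \<partial>M) = (\<integral>\<omega>. indicator V \<omega> * g \<omega> \<partial>M)"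
    by (simp add: set_lebesgue_integral_def)
  have i1: "integrable M (\<lambda>\<omega>. indicator V \<omega> * indicator E \<omega> :: real)"
    using integrable_mult_indicator[OF VM intE] by simp
  have i2: "integrable M (\<lambda>\<omega>. indicator V \<omega> * g \<omega>)"
    using integrable_mult_indicator[OF VM intg] by simp
  have "(\<integral>\<^sup>+\<omega>. indicator G (\<Lambda> \<omega>) * indicator E \<omega> \<partial>M) = (\<integral>\<^sup>+\<omega>. ennreal (indicator V \<omega> * indicator E \<omega>) \<partial>M)"
    by (intro nn_integral_cong) (auto simp: V_def indicator_def)
  also have "\<dots> = ennreal (\<integral>\<omega>. indicator V \<omega> * indicator E \<omega> \<partial>M)"
    by (rule nn_integral_eq_integral[OF i1]) auto
  also have "\<dots> = (\<integral>\<^sup>+\<omega>. ennreal (indicator V \<omega> * g \<omega>) \<partial>M)"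
    unfolding eq by (rule nn_integral_eq_integral[OF i2, symmetric]) (simp add: g_nn)
  also have "\<dots> = (\<integral>\<^sup>+\<omega>. indicator G (\<Lambda> \<omega>) * (\<Prod>j<m. ennreal (poisson_prob (rate (A j) (C j) \<omega>) (k j))) \<partial>M)"
    by (intro nn_integral_cong) (auto simp: V_def g_def indicator_def prod_ennreal poisson_prob_nonneg rate_nonneg)
  finally show ?thesis unfolding E_def .
qed

text \<open>The factors are converted one after the other from indicators of a count to general
  functions of it.\<close>

lemma count_formula_aux:
  fixes m :: nat
  assumes A: "\<And>j. j < m \<Longrightarrow> A j \<in> sets borel" "\<And>j. j < m \<Longrightarrow> bounded (A j)"
    and C: "\<And>j. j < m \<Longrightarrow> C j \<in> sets borel" "\<And>j. j < m \<Longrightarrow> bounded (C j)"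
    and disj: "disjoint_family_on (\<lambda>j. A j \<times> C j) {..<m}"
    and G: "G \<in> sets locally_finite_algebra" and i: "i \<le> m"
  shows "(\<integral>\<^sup>+\<omega>. indicator G (\<Lambda> \<omega>) * (\<Prod>j<i. count_fun (\<phi> j) (A j \<times> C j) \<omega>) *
      indicator {\<omega>\<in>space M. \<forall>j\<in>{i..<m}.
        finite (points_in (X \<omega>) (A j \<times> C j)) \<and> card (points_in (X \<omega>) (A j \<times> C j)) = k j} \<omega> \<partial>M)
    = (\<integral>\<^sup>+\<omega>. indicator G (\<Lambda> \<omega>) * (\<Prod>j<i. \<Sum>n. \<phi> j n * ennreal (poisson_prob (rate (A j) (C j) \<omega>) n)) *
        (\<Prod>j\<in>{i..<m}. ennreal (poisson_prob (rate (A j) (C j) \<omega>) (k j))) \<partial>M)"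
  using i
proof (induction i arbitrary: k)
  case 0
  have "(\<forall>j\<in>{0..<m}. P j) \<longleftrightarrow> (\<forall>j<m. P j)" for P by auto
  then show ?case using count_prob[OF A C disj G, of k] by (simp only: lessThan_0 prod.empty mult_1_right atLeast0LessThan)
next
  case (Suc i)
  then have im: "i < m" by simp
  have rect: "A j \<times> C j \<in> sets borel" if "j < m" for j using A C that by (intro borel_Times) auto
  let ?N = "\<lambda>j n. {\<omega>. finite (points_in (X \<omega>) (A j \<times> C j)) \<and> card (points_in (X \<omega>) (A j \<times> C j)) = n}"
  let ?I = "\<lambda>i k. {\<omega>\<in>space M. \<forall>j\<in>{i..<m}. \<omega> \<in> ?N j (k j)}"
  have I_meas: "?I i k \<in> sets M" if "i \<le> m" for i k
  proof -
    have "?I i k = space M \<inter> (\<Inter>j\<in>{i..<m}. {\<omega>\<in>space M. finite (points_in (X \<omega>) (A j \<times> C j)) \<and> card (points_in (X \<omega>) (A j \<times> C j)) = k j})"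
      by auto
    also have "\<dots> \<in> sets M" by (intro Int_INT_sets count_event rect) auto
    finally show ?thesis .
  qed
  have G_meas: "(\<lambda>\<omega>. indicator G (\<Lambda> \<omega>) :: ennreal) \<in> borel_measurable M"
    using G by measurable
  have cf_meas: "(\<lambda>\<omega>. \<Prod>j<i. count_fun (\<phi> j) (A j \<times> C j) \<omega>) \<in> borel_measurable M"
    using im by (intro borel_measurable_prod_ennreal measurable_count_fun rect) auto
  have p_meas: "(\<lambda>\<omega>. ennreal (poisson_prob (rate (A j) (C j) \<omega>) n)) \<in> borel_measurable M" if "j < m" for j n
    using measurable_poisson[OF A(1)[OF that]] by measurable
  have P_meas: "(\<lambda>\<omega>. \<Prod>j<i. \<Sum>n. \<phi> j n * ennreal (poisson_prob (rate (A j) (C j) \<omega>) n)) \<in> borel_measurable M"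
    using im by (intro borel_measurable_prod_ennreal borel_measurable_suminf_order borel_measurable_times_ennreal borel_measurable_const p_meas) auto
  have Q_meas: "(\<lambda>\<omega>. \<Prod>j\<in>{i..<m}. ennreal (poisson_prob (rate (A j) (C j) \<omega>) (k j))) \<in> borel_measurable M" for k
    using im by (intro borel_measurable_prod_ennreal p_meas) auto
  have ivl: "{i..<m} = insert i {Suc i..<m}" using im by auto
  \<comment> \<open>Factor \<open>i\<close> is expanded over the value \<open>n\<close> of its
    count. The induction hypothesis applies with \<open>n\<close> prescribed at place
    \<open>i\<close>, and the series is then summed again under the integral.\<close>
  have "(\<integral>\<^sup>+\<omega>. indicator G (\<Lambda> \<omega>) * (\<Prod>j<Suc i. count_fun (\<phi> j) (A j \<times> C j) \<omega>) * indicator (?I (Suc i) k) \<omega> \<partial>M)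
    = (\<integral>\<^sup>+\<omega>. (\<Sum>n. \<phi> i n * (indicator G (\<Lambda> \<omega>) * (\<Prod>j<i. count_fun (\<phi> j) (A j \<times> C j) \<omega>) * indicator (?I i (k(i := n))) \<omega>)) \<partial>M)"
  proof (rule nn_integral_cong)
    fix \<omega> assume w: "\<omega> \<in> space M"
    have ind: "indicator (?N i n) \<omega> * indicator (?I (Suc i) k) \<omega> = (indicator (?I i (k(i := n))) \<omega> :: ennreal)" for n
      using w by (auto simp: ivl indicator_def)
    have "indicator G (\<Lambda> \<omega>) * (\<Prod>j<Suc i. count_fun (\<phi> j) (A j \<times> C j) \<omega>) * indicator (?I (Suc i) k) \<omega>
      = (\<Sum>n. \<phi> i n * indicator (?N i n) \<omega>) * (indicator G (\<Lambda> \<omega>) * (\<Prod>j<i. count_fun (\<phi> j) (A j \<times> C j) \<omega>) * indicator (?I (Suc i) k) \<omega>)"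
      by (simp add: count_fun_suminf[of "\<phi> i"] mult_ac)
    also have "\<dots> = (\<Sum>n. (\<phi> i n * indicator (?N i n) \<omega>) * (indicator G (\<Lambda> \<omega>) * (\<Prod>j<i. count_fun (\<phi> j) (A j \<times> C j) \<omega>) * indicator (?I (Suc i) k) \<omega>))"
      by simp
    also have "\<dots> = (\<Sum>n. \<phi> i n * (indicator G (\<Lambda> \<omega>) * (\<Prod>j<i. count_fun (\<phi> j) (A j \<times> C j) \<omega>) * indicator (?I i (k(i := n))) \<omega>))"
      unfolding ind[symmetric] by (intro suminf_cong) (simp add: mult_ac)
    finally show "indicator G (\<Lambda> \<omega>) * (\<Prod>j<Suc i. count_fun (\<phi> j) (A j \<times> C j) \<omega>) * indicator (?I (Suc i) k) \<omega> = \<dots>" .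
  qed
  also have "\<dots> = (\<Sum>n. \<integral>\<^sup>+\<omega>. \<phi> i n * (indicator G (\<Lambda> \<omega>) * (\<Prod>j<i. count_fun (\<phi> j) (A j \<times> C j) \<omega>) * indicator (?I i (k(i := n))) \<omega>) \<partial>M)"
    using I_meas im by (intro nn_integral_suminf borel_measurable_times_ennreal G_meas cf_meas borel_measurable_const borel_measurable_indicator) auto
  also have "\<dots> = (\<Sum>n. \<phi> i n * (\<integral>\<^sup>+\<omega>. indicator G (\<Lambda> \<omega>) * (\<Prod>j<i. count_fun (\<phi> j) (A j \<times> C j) \<omega>) * indicator (?I i (k(i := n))) \<omega> \<partial>M))"
    using I_meas im by (intro suminf_cong nn_integral_cmult borel_measurable_times_ennreal G_meas cf_meas borel_measurable_const borel_measurable_indicator) auto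
  also have "\<dots> = (\<Sum>n. \<phi> i n * (\<integral>\<^sup>+\<omega>. indicator G (\<Lambda> \<omega>) * (\<Prod>j<i. \<Sum>n. \<phi> j n * ennreal (poisson_prob (rate (A j) (C j) \<omega>) n)) *
        (\<Prod>j\<in>{i..<m}. ennreal (poisson_prob (rate (A j) (C j) \<omega>) ((k(i := n)) j))) \<partial>M))"
    using Suc.IH[of "k(i := _)"] im by simp
  also have "\<dots> = (\<Sum>n. \<integral>\<^sup>+\<omega>. \<phi> i n * (indicator G (\<Lambda> \<omega>) * (\<Prod>j<i. \<Sum>n. \<phi> j n * ennreal (poisson_prob (rate (A j) (C j) \<omega>) n)) *
        (\<Prod>j\<in>{i..<m}. ennreal (poisson_prob (rate (A j) (C j) \<omega>) ((k(i := n)) j)))) \<partial>M)"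
    by (intro suminf_cong nn_integral_cmult[symmetric] borel_measurable_times_ennreal G_meas P_meas Q_meas)
  also have "\<dots> = (\<integral>\<^sup>+\<omega>. (\<Sum>n. \<phi> i n * (indicator G (\<Lambda> \<omega>) * (\<Prod>j<i. \<Sum>n. \<phi> j n * ennreal (poisson_prob (rate (A j) (C j) \<omega>) n)) *
        (\<Prod>j\<in>{i..<m}. ennreal (poisson_prob (rate (A j) (C j) \<omega>) ((k(i := n)) j))))) \<partial>M)"
    by (intro nn_integral_suminf[symmetric] borel_measurable_times_ennreal borel_measurable_const G_meas P_meas Q_meas)
  also have "\<dots> = (\<integral>\<^sup>+\<omega>. indicator G (\<Lambda> \<omega>) * (\<Prod>j<Suc i. \<Sum>n. \<phi> j n * ennreal (poisson_prob (rate (A j) (C j) \<omega>) n)) *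
        (\<Prod>j\<in>{Suc i..<m}. ennreal (poisson_prob (rate (A j) (C j) \<omega>) (k j))) \<partial>M)"
  proof (rule nn_integral_cong)
    fix \<omega> assume "\<omega> \<in> space M"
    let ?a = "indicator G (\<Lambda> \<omega>) :: ennreal"
    let ?b = "\<Prod>j<i. \<Sum>n. \<phi> j n * ennreal (poisson_prob (rate (A j) (C j) \<omega>) n)"
    let ?c = "\<Prod>j\<in>{Suc i..<m}. ennreal (poisson_prob (rate (A j) (C j) \<omega>) (k j))"
    have pr: "(\<Prod>j\<in>{i..<m}. ennreal (poisson_prob (rate (A j) (C j) \<omega>) ((k(i := n)) j)))
      = ennreal (poisson_prob (rate (A i) (C i) \<omega>) n) * ?c" for n
    proof -
      have "(\<Prod>j\<in>{Suc i..<m}. ennreal (poisson_prob (rate (A j) (C j) \<omega>) ((k(i := n)) j))) = ?c"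
        by (rule prod.cong) auto
      then show ?thesis unfolding ivl by simp
    qed
    have "(\<Sum>n. \<phi> i n * (?a * ?b * (\<Prod>j\<in>{i..<m}. ennreal (poisson_prob (rate (A j) (C j) \<omega>) ((k(i := n)) j)))))
      = (\<Sum>n. (\<phi> i n * ennreal (poisson_prob (rate (A i) (C i) \<omega>) n)) * (?a * ?b * ?c))"
      unfolding pr by (intro suminf_cong) (simp add: mult_ac)
    also have "\<dots> = (\<Sum>n. \<phi> i n * ennreal (poisson_prob (rate (A i) (C i) \<omega>) n)) * (?a * ?b * ?c)"
      by simp
    finally show "(\<Sum>n. \<phi> i n * (?a * ?b * (\<Prod>j\<in>{i..<m}. ennreal (poisson_prob (rate (A j) (C j) \<omega>) ((k(i := n)) j)))))
      = ?a * (\<Prod>j<Suc i. \<Sum>n. \<phi> j n * ennreal (poisson_prob (rate (A j) (C j) \<omega>) n)) * ?c"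
      by (simp add: mult_ac)
  qed
  finally show ?case by simp
qed

text \<open>Conditional independence of Poisson counts in integrated form. The later estimates, of
  voids as well as of exponential moments, are choices of \<open>\<phi>\<close> here.\<close>

lemma count_formula:
  assumes S: "finite S"
    and A: "\<And>j. j \<in> S \<Longrightarrow> A j \<in> sets borel" "\<And>j. j \<in> S \<Longrightarrow> bounded (A j)"
    and C: "\<And>j. j \<in> S \<Longrightarrow> C j \<in> sets borel" "\<And>j. j \<in> S \<Longrightarrow> bounded (C j)"
    and disj: "disjoint_family_on (\<lambda>j. A j \<times> C j) S"
    and G: "G \<in> sets locally_finite_algebra"
  shows "(\<integral>\<^sup>+\<omega>. indicator G (\<Lambda> \<omega>) * (\<Prod>j\<in>S. count_fun (\<phi> j) (A j \<times> C j) \<omega>) \<partial>M)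
    = (\<integral>\<^sup>+\<omega>. indicator G (\<Lambda> \<omega>) * (\<Prod>j\<in>S. \<Sum>n. \<phi> j n * ennreal (poisson_prob (rate (A j) (C j) \<omega>) n)) \<partial>M)"
proof -
  obtain h where h: "bij_betw h {..<card S} S"
    using ex_bij_betw_nat_finite[OF S] by (auto simp: atLeast0LessThan)
  have hS: "h j \<in> S" if "j < card S" for j using h that by (auto simp: bij_betw_def)
  have inj: "inj_on h {..<card S}" using h by (simp add: bij_betw_def)
  have disj': "disjoint_family_on (\<lambda>j. A (h j) \<times> C (h j)) {..<card S}"
    unfolding disjoint_family_on_def
  proof (intro ballI impI)
    fix i j assume "i \<in> {..<card S}" "j \<in> {..<card S}" "i \<noteq> j"
    then have "h i \<in> S" "h j \<in> S" "h i \<noteq> h j" using hS inj by (auto dest: inj_onD)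
    then show "A (h i) \<times> C (h i) \<inter> A (h j) \<times> C (h j) = {}"
      using disj unfolding disjoint_family_on_def by blast
  qed
  have re: "(\<Prod>j\<in>S. f j) = (\<Prod>j<card S. f (h j))" for f :: "_ \<Rightarrow> ennreal"
    by (rule prod.reindex_bij_betw[OF h, symmetric])
  have "(\<integral>\<^sup>+\<omega>. indicator G (\<Lambda> \<omega>) * (\<Prod>j<card S. count_fun (\<phi> (h j)) (A (h j) \<times> C (h j)) \<omega>) *
      indicator {\<omega>\<in>space M. \<forall>j\<in>{card S..<card S}.
        finite (points_in (X \<omega>) (A (h j) \<times> C (h j))) \<and> card (points_in (X \<omega>) (A (h j) \<times> C (h j))) = 0} \<omega> \<partial>M)
    = (\<integral>\<^sup>+\<omega>. indicator G (\<Lambda> \<omega>) * (\<Prod>j<card S. \<Sum>n. \<phi> (h j) n * ennreal (poisson_prob (rate (A (h j)) (C (h j)) \<omega>) n)) *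
        (\<Prod>j\<in>{card S..<card S}. ennreal (poisson_prob (rate (A (h j)) (C (h j)) \<omega>) 0)) \<partial>M)"
    using A C disj' G hS
    by (intro count_formula_aux[where A = "\<lambda>j. A (h j)" and C = "\<lambda>j. C (h j)" and \<phi> = "\<lambda>j. \<phi> (h j)" and k = "\<lambda>_. 0"]) auto
  moreover have "(\<integral>\<^sup>+\<omega>. indicator G (\<Lambda> \<omega>) * (\<Prod>j<card S. count_fun (\<phi> (h j)) (A (h j) \<times> C (h j)) \<omega>) *
      indicator {\<omega>\<in>space M. \<forall>j\<in>{card S..<card S}.
        finite (points_in (X \<omega>) (A (h j) \<times> C (h j))) \<and> card (points_in (X \<omega>) (A (h j) \<times> C (h j))) = 0} \<omega> \<partial>M)
     = (\<integral>\<^sup>+\<omega>. indicator G (\<Lambda> \<omega>) * (\<Prod>j<card S. count_fun (\<phi> (h j)) (A (h j) \<times> C (h j)) \<omega>) \<partial>M)"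
    by (rule nn_integral_cong) simp
  ultimately show ?thesis unfolding re by simp
qed

text \<open>For the constant function 1 the left side of \<open>count_formula\<close> is the
  probability of a finite count, and the right side is 1 because Poisson probabilities sum to
  one.\<close>

lemma AE_finite_points:
  assumes "A \<in> sets borel" "bounded A" "C \<in> sets borel" "bounded C"
  shows "AE \<omega> in M. finite (points_in (X \<omega>) (A \<times> C))"
proof -
  have "(\<integral>\<^sup>+\<omega>. indicator (space locally_finite_algebra) (\<Lambda> \<omega>) * (\<Prod>j\<in>{()}. count_fun (\<lambda>_. 1) (A \<times> C) \<omega>) \<partial>M)
    = (\<integral>\<^sup>+\<omega>. indicator (space locally_finite_algebra) (\<Lambda> \<omega>) * (\<Prod>j\<in>{()}. \<Sum>n. 1 * ennreal (poisson_prob (rate A C \<omega>) n)) \<partial>M)"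
    using assms by (intro count_formula[where A = "\<lambda>_. A" and C = "\<lambda>_. C" and \<phi> = "\<lambda>_ _. 1"]) (auto simp: disjoint_family_on_def)
  also have "\<dots> = (\<integral>\<^sup>+\<omega>. 1 \<partial>M)"
    using poisson_sum[OF rate_nonneg] by (intro nn_integral_cong) (simp add: \<Lambda>_lfa)
  also have "\<dots> = 1" by (simp add: emeasure_space_1)
  also have "(\<integral>\<^sup>+\<omega>. indicator (space locally_finite_algebra) (\<Lambda> \<omega>) * (\<Prod>j\<in>{()}. count_fun (\<lambda>_. 1) (A \<times> C) \<omega>) \<partial>M)
    = (\<integral>\<^sup>+\<omega>. indicator {\<omega>\<in>space M. count_fun (\<lambda>_. 1) (A \<times> C) \<omega> = 1} \<omega> \<partial>M)"
    by (intro nn_integral_cong) (auto simp: \<Lambda>_lfa count_fun_def)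
  finally have 1: "(\<integral>\<^sup>+\<omega>. indicator {\<omega>\<in>space M. count_fun (\<lambda>_. 1) (A \<times> C) \<omega> = 1} \<omega> \<partial>M) = 1" .
  have "A \<times> C \<in> sets borel" using assms by (intro borel_Times) auto
  note measurable_count_fun[OF this, measurable]
  have "emeasure M {\<omega>\<in>space M. count_fun (\<lambda>_. 1) (A \<times> C) \<omega> = 1} = 1"
    using 1 by (subst (asm) nn_integral_indicator) auto
  then have "AE \<omega> in M. \<omega> \<in> {\<omega>\<in>space M. count_fun (\<lambda>_. 1) (A \<times> C) \<omega> = 1}"
    by (subst prob_eq_1[symmetric]) (auto simp: emeasure_eq_measure)
  then show ?thesis by eventually_elim (auto simp: count_fun_def split: if_splits)
qed

end

section \<open>Stabilization\<close>

definition site :: "'d \<Rightarrow> 'd \<Rightarrow> nat \<Rightarrow> int \<times> int \<Rightarrow> real^'d" where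
  "site i1 i2 s z = (\<chi> i. if i = i1 then real s * of_int (fst z)
    else if i = i2 then real s * of_int (snd z) else 0)"

lemma site_rational: "site i1 i2 s z \<in> rational_points"
  by (simp add: site_def rational_points_def)

lemma site_nbr: "nbr p q \<Longrightarrow> \<bar>site i1 i2 s p $ i - site i1 i2 s q $ i\<bar> \<le> real s"
proof -
  assume "nbr p q"
  then have "\<bar>fst p - fst q\<bar> \<le> 1" "\<bar>snd p - snd q\<bar> \<le> 1" by (auto simp: nbr_def)
  then have "\<bar>real_of_int (fst p) - of_int (fst q)\<bar> \<le> 1" "\<bar>real_of_int (snd p) - of_int (snd q)\<bar> \<le> 1"
    by linarith+
  then have "real s * \<bar>real_of_int (fst p) - of_int (fst q)\<bar> \<le> real s"
    "real s * \<bar>real_of_int (snd p) - of_int (snd q)\<bar> \<le> real s"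
    by (simp_all add: mult_left_le)
  then show ?thesis by (auto simp: site_def right_diff_distrib[symmetric] abs_mult)
qed

lemma site_separated:
  assumes "i1 \<noteq> i2" "separated t S" "p \<in> S" "q \<in> S" "p \<noteq> q"
  shows "\<exists>i. \<bar>site i1 i2 s p $ i - site i1 i2 s q $ i\<bar> \<ge> real (s * t)"
proof -
  have *: "real (s * t) \<le> \<bar>real s * of_int a - real s * of_int b\<bar>" if "int t \<le> \<bar>a - b\<bar>" for a b
  proof -
    have "real t \<le> \<bar>of_int a - of_int b\<bar>" using that by linarith
    then have "real s * real t \<le> real s * \<bar>of_int a - of_int b\<bar>" by (intro mult_left_mono) auto
    then show ?thesis by (simp add: right_diff_distrib[symmetric] abs_mult)
  qed
  from assms have "\<bar>fst p - fst q\<bar> \<ge> int t \<or> \<bar>snd p - snd q\<bar> \<ge> int t" by (auto simp: separated_def)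
  then show ?thesis
  proof
    assume "\<bar>fst p - fst q\<bar> \<ge> int t"
    from *[OF this] show ?thesis by (intro exI[of _ i1]) (simp add: site_def)
  next
    assume "\<bar>snd p - snd q\<bar> \<ge> int t"
    from *[OF this] show ?thesis using assms(1) by (intro exI[of _ i2]) (simp add: site_def)
  qed
qed

lemma cube_disjoint:
  assumes "\<bar>x $ i - y $ i\<bar> > n"
  shows "cube n x \<inter> cube n y = {}"
proof (rule ccontr)
  assume "cube n x \<inter> cube n y \<noteq> {}"
  then obtain w where "\<bar>w $ i - x $ i\<bar> \<le> n / 2" "\<bar>w $ i - y $ i\<bar> \<le> n / 2"
    unfolding mem_cube ex_in_conv[symmetric] Int_iff by blast
  then show False using assms by linarith
qed

section \<open>Stabilization radii and stabilized events\<close>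

lemma countable_rational_points: "countable (rational_points :: (real^'d) set)"
proof -
  have "countable (PiE (UNIV :: 'd set) (\<lambda>_. \<rat> :: real set))"
    by (intro countable_PiE) (auto simp: countable_rat)
  then have "countable (vec_lambda ` PiE (UNIV :: 'd set) (\<lambda>_. \<rat> :: real set))" by (rule countable_image)
  moreover have "rational_points \<subseteq> vec_lambda ` PiE (UNIV :: 'd set) (\<lambda>_. \<rat> :: real set)"
  proof
    fix x :: "real^'d" assume "x \<in> rational_points"
    then show "x \<in> vec_lambda ` PiE (UNIV :: 'd set) (\<lambda>_. \<rat>)"
      by (intro image_eqI[of _ _ "\<lambda>i. x $ i"]) (auto simp: rational_points_def)
  qed
  ultimately show ?thesis by (rule countable_subset[rotated])
qed

lemma rational_points_add:
  "x \<in> rational_points \<Longrightarrow> y + x \<in> rational_points \<longleftrightarrow> y \<in> rational_points"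
proof -
  assume x: "x \<in> rational_points"
  have "y $ i + x $ i \<in> \<rat> \<longleftrightarrow> y $ i \<in> \<rat>" for i
  proof
    assume "y $ i + x $ i \<in> \<rat>"
    then have "y $ i + x $ i - x $ i \<in> \<rat>" using x by (intro Rats_diff) (auto simp: rational_points_def)
    then show "y $ i \<in> \<rat>" by simp
  qed (use x in \<open>auto simp: rational_points_def\<close>)
  then show ?thesis by (simp add: rational_points_def)
qed

text \<open>The supremum samples the radii at rational points, so it follows a shift of the cube
  only if the shift is rational. Sites have this property.\<close>

lemma cube_radius_shift:
  assumes "x \<in> rational_points"
  shows "cube_radius R n x \<omega> = (SUP y\<in>cube n 0 \<inter> rational_points. R (y + x) \<omega>)"
proof -
  have "cube n x \<inter> rational_points = (\<lambda>y. y + x) ` (cube n 0 \<inter> rational_points)"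
  proof (intro set_eqI iffI)
    fix z assume "z \<in> cube n x \<inter> rational_points"
    moreover have "z - x \<in> rational_points \<longleftrightarrow> z \<in> rational_points"
      using rational_points_add[OF assms, of "z - x"] by simp
    ultimately show "z \<in> (\<lambda>y. y + x) ` (cube n 0 \<inter> rational_points)"
      by (intro image_eqI[of _ _ "z - x"]) (auto simp: mem_cube)
  qed (use rational_points_add[OF assms] in \<open>auto simp: mem_cube\<close>)
  then show ?thesis by (simp add: cube_radius_def image_image)
qed

text \<open>The property is tested on the picture centred again at the origin, so that the same
  question is asked around every site and joint stationarity makes the answers equally
  likely.\<close>

definition stab_event ::
    "'w measure \<Rightarrow> ('w \<Rightarrow> (real^'d) measure) \<Rightarrow> (real^'d \<Rightarrow> 'w \<Rightarrow> ennreal) \<Rightarrow> nat \<Rightarrow>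
     ((real^'d) measure \<Rightarrow> bool) \<Rightarrow> real^'d \<Rightarrow> 'w set" where
  "stab_event M \<Lambda> R n F x = {\<omega>\<in>space M. cube_radius R (real n) x \<omega> < of_nat n \<and>
     F (restrict_to (cube (real n) 0) (translate_measure x (\<Lambda> \<omega>)))}"

locale stab = prob_space M
  for M :: "'w measure" +
  fixes \<Lambda> :: "'w \<Rightarrow> (real^'d) measure" and R :: "real^'d \<Rightarrow> 'w \<Rightarrow> ennreal"
  assumes \<Lambda>: "random_measure M \<Lambda>" and R: "stabilization_radii M \<Lambda> R"
begin

lemma measurable_\<Lambda> [measurable]: "\<Lambda> \<in> measurable M locally_finite_algebra"
  using \<Lambda> by (simp add: random_measure_def)

lemma \<Lambda>_lfa: "\<omega> \<in> space M \<Longrightarrow> \<Lambda> \<omega> \<in> space locally_finite_algebra"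
  using measurable_space[OF measurable_\<Lambda>] .

lemma measurable_R [measurable]: "R x \<in> borel_measurable M"
  using R by (simp add: stabilization_radii_def)

lemma measurable_cube_radius [measurable]: "cube_radius R n x \<in> borel_measurable M"
proof -
  have "countable (cube n x \<inter> rational_points)" using countable_rational_points by blast
  then have "(\<lambda>\<omega>. SUP y\<in>cube n x \<inter> rational_points. R y \<omega>) \<in> borel_measurable M"
    by (rule borel_measurable_SUP) (rule measurable_R)
  then show ?thesis by (simp add: cube_radius_def[abs_def])
qed

lemma joint_event:
  assumes P: "P \<in> sets (locally_finite_algebra \<Otimes>\<^sub>M PiM UNIV (\<lambda>_. borel))"
  shows "measure M {\<omega>\<in>space M. (translate_measure y (\<Lambda> \<omega>), \<lambda>x. R (x + y) \<omega>) \<in> P} =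
    measure M {\<omega>\<in>space M. (\<Lambda> \<omega>, \<lambda>x. R x \<omega>) \<in> P}"
proof -
  let ?N = "locally_finite_algebra \<Otimes>\<^sub>M PiM UNIV (\<lambda>_. borel) :: ((real^'d) measure \<times> (real^'d \<Rightarrow> ennreal)) measure"
  let ?T = "\<lambda>\<omega>. (translate_measure y (\<Lambda> \<omega>), \<lambda>x. R (x + y) \<omega>)"
  let ?I = "\<lambda>\<omega>. (\<Lambda> \<omega>, \<lambda>x. R x \<omega>)"
  have T: "?T \<in> measurable M ?N"
    by (intro measurable_Pair measurable_compose[OF measurable_\<Lambda> measurable_translate] measurable_PiM_single') auto
  have I: "?I \<in> measurable M ?N"
    by (intro measurable_Pair measurable_\<Lambda> measurable_PiM_single') auto
  have "distr M ?N ?T = distr M ?N ?I"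
    using R by (auto simp: stabilization_radii_def jointly_stationary_def)
  then have "measure (distr M ?N ?T) P = measure (distr M ?N ?I) P" by simp
  then show ?thesis using P T I
    by (simp add: measure_distr vimage_def Int_def conj_commute)
qed

lemma stab_event_measurable:
  assumes F: "{m\<in>space locally_finite_algebra. F m} \<in> sets locally_finite_algebra"
  shows "stab_event M \<Lambda> R n F x \<in> sets M"
proof -
  have "(\<lambda>\<omega>. restrict_to (cube (real n) 0) (translate_measure x (\<Lambda> \<omega>))) \<in> measurable M locally_finite_algebra"
    by (intro measurable_compose[OF _ measurable_restrict_to] measurable_compose[OF measurable_\<Lambda> measurable_translate]) simp
  from measurable_sets[OF this F]
  have "{\<omega>\<in>space M. F (restrict_to (cube (real n) 0) (translate_measure x (\<Lambda> \<omega>)))} \<in> sets M"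
    by (rule back_subst[of "\<lambda>S. S \<in> sets M"])
      (auto intro: restrict_to_lfa translate_lfa \<Lambda>_lfa cube_borel)
  moreover have "{\<omega>\<in>space M. cube_radius R (real n) x \<omega> < of_nat n} \<in> sets M" by measurable
  ultimately have "{\<omega>\<in>space M. cube_radius R (real n) x \<omega> < of_nat n} \<inter>
    {\<omega>\<in>space M. F (restrict_to (cube (real n) 0) (translate_measure x (\<Lambda> \<omega>)))} \<in> sets M" by (rule sets.Int[rotated])
  then show ?thesis by (rule back_subst[of "\<lambda>S. S \<in> sets M"]) (auto simp: stab_event_def)
qed

lemma stab_event_stationary:
  assumes F: "{m\<in>space locally_finite_algebra. F m} \<in> sets locally_finite_algebra"
    and x: "x \<in> rational_points"
  shows "measure M (stab_event M \<Lambda> R n F x) = measure M (stab_event M \<Lambda> R n F 0)"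
proof -
  define D where "D = cube (real n) 0 \<inter> (rational_points :: (real^'d) set)"
  let ?L = "locally_finite_algebra :: (real^'d) measure measure"
  let ?Q = "PiM UNIV (\<lambda>_. borel) :: (real^'d \<Rightarrow> ennreal) measure"
  \<comment> \<open>Both requirements become one event for the pair of the measure and the field of
    radii, which is the form in which joint stationarity is available.\<close>
  define P where "P = {m\<in>space ?L. F (restrict_to (cube (real n) 0) m)} \<times>
    {\<rho>\<in>space ?Q. (SUP y\<in>D. \<rho> y) < of_nat n}"
  have "countable D" using countable_rational_points by (auto simp: D_def)
  then have "(\<lambda>\<rho>. SUP y\<in>D. \<rho> y) \<in> borel_measurable ?Q"
    by (rule borel_measurable_SUP) (auto intro: measurable_component_singleton)
  then have 1: "{\<rho>\<in>space ?Q. (SUP y\<in>D. \<rho> y) < of_nat n} \<in> sets ?Q" by measurable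
  from measurable_sets[OF measurable_restrict_to[OF cube_borel] F]
  have 2: "{m\<in>space ?L. F (restrict_to (cube (real n) 0) m)} \<in> sets ?L"
    by (rule back_subst[of "\<lambda>S. S \<in> sets ?L"]) (auto intro: restrict_to_lfa cube_borel)
  have P: "P \<in> sets (?L \<Otimes>\<^sub>M ?Q)" unfolding P_def using 1 2 by (intro pair_measureI)
  have t0: "restrict_to (cube (real n) 0) (translate_measure 0 (\<Lambda> \<omega>)) = restrict_to (cube (real n) 0) (\<Lambda> \<omega>)"
    if "\<omega> \<in> space M" for \<omega>
    using lfa_sets[OF \<Lambda>_lfa[OF that]]
    by (intro measure_eqI) (auto simp: emeasure_restrict_to emeasure_translate)
  have e: "stab_event M \<Lambda> R n F x = {\<omega>\<in>space M. (translate_measure x (\<Lambda> \<omega>), \<lambda>y. R (y + x) \<omega>) \<in> P}"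
    using translate_lfa[OF \<Lambda>_lfa]
    by (auto simp: stab_event_def P_def cube_radius_shift[OF x] D_def space_PiM)
  have z: "(0 :: real^'d) \<in> rational_points" by (simp add: rational_points_def)
  have e0: "stab_event M \<Lambda> R n F 0 = {\<omega>\<in>space M. (\<Lambda> \<omega>, \<lambda>y. R y \<omega>) \<in> P}"
    using \<Lambda>_lfa by (auto simp: stab_event_def P_def cube_radius_shift[OF z] D_def space_PiM t0)
  show ?thesis unfolding e e0 by (rule joint_event[OF P])
qed

text \<open>The stabilization axiom uses one function for all cubes of a family; since the cubes are
  disjoint, such a function can read off from the restricted measure in which cube it lives.\<close>

lemma stab_event_independent:
  assumes F: "{m\<in>space locally_finite_algebra. F m} \<in> sets locally_finite_algebra"
    and F0: "\<not> F (null_measure borel)"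
    and n: "n \<ge> 1" and \<phi>: "finite \<phi>" "\<phi> \<subseteq> rational_points"
    and far: "\<And>x y. x \<in> \<phi> \<Longrightarrow> y \<in> \<phi> \<Longrightarrow> x \<noteq> y \<Longrightarrow> \<exists>i. \<bar>x $ i - y $ i\<bar> > 3 * real n"
  shows "measure M (space M \<inter> (\<Inter>x\<in>\<phi>. space M - stab_event M \<Lambda> R n F x)) =
    (1 - measure M (stab_event M \<Lambda> R n F 0)) ^ card \<phi>"
proof (cases "\<phi> = {}")
  case True
  then show ?thesis by (simp add: prob_space)
next
  case False
  let ?L = "locally_finite_algebra :: (real^'d) measure measure"
  let ?c = "cube (real n)"
  \<comment> \<open>The cubes are disjoint, so a restriction to \<open>?c x\<close> can charge no
    other cube of the family: positive mass reveals \<open>x\<close>. A restriction of mass zero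
    reveals nothing, and there \<open>F\<close> fails by hypothesis, in agreement with
    \<open>P\<close>.\<close>
  define P where "P = (\<lambda>m. \<exists>x\<in>\<phi>. emeasure m (?c x) \<noteq> 0 \<and> F (restrict_to (?c 0) (translate_measure x m)))"
  define f where "f = (\<lambda>m. if P m then 1 else 0 :: real)"
  have Pm: "{m\<in>space ?L. P m} \<in> sets ?L"
  proof -
    have "{m\<in>space ?L. F (restrict_to (?c 0) (translate_measure x m))} \<in> sets ?L" for x
    proof -
      have "(\<lambda>m. restrict_to (?c 0) (translate_measure x m)) \<in> measurable ?L ?L"
        by (intro measurable_compose[OF measurable_translate] measurable_restrict_to) simp
      from measurable_sets[OF this F] show ?thesis
        by (rule back_subst[of "\<lambda>S. S \<in> sets ?L"]) (auto intro: restrict_to_lfa translate_lfa cube_borel)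
    qed
    moreover have "{m\<in>space ?L. emeasure m (?c x) \<noteq> 0} \<in> sets ?L" for x
      using measurable_emeasure_locally_finite_algebra[OF cube_borel, of "real n" x] by measurable
    ultimately have "(\<Union>x\<in>\<phi>. {m\<in>space ?L. emeasure m (?c x) \<noteq> 0} \<inter> {m\<in>space ?L. F (restrict_to (?c 0) (translate_measure x m))}) \<in> sets ?L"
      using \<phi> by (intro sets.finite_UN sets.Int) auto
    then show ?thesis by (rule back_subst[of "\<lambda>S. S \<in> sets ?L"]) (auto simp: P_def)
  qed
  then have f_meas: "f \<in> borel_measurable ?L" unfolding f_def by measurable
  have disj: "?c x \<inter> ?c y = {}" if xy: "x \<in> \<phi>" "y \<in> \<phi>" "x \<noteq> y" for x y
  proof -
    obtain i where "\<bar>x $ i - y $ i\<bar> > 3 * real n" using far[OF xy] by blast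
    then have "\<bar>x $ i - y $ i\<bar> > real n" using n by linarith
    then show ?thesis by (rule cube_disjoint)
  qed
  have key: "P (restrict_to (?c x) (\<Lambda> \<omega>)) \<longleftrightarrow> F (restrict_to (?c 0) (translate_measure x (\<Lambda> \<omega>)))"
    if x: "x \<in> \<phi>" and w: "\<omega> \<in> space M" for x \<omega>
  proof -
    note s = lfa_sets[OF \<Lambda>_lfa[OF w]]
    have e1: "emeasure (restrict_to (?c x) (\<Lambda> \<omega>)) (?c y) = (if y = x then emeasure (\<Lambda> \<omega>) (?c x) else 0)" if "y \<in> \<phi>" for y
      using disj[OF x that] by (auto simp: emeasure_restrict_to s)
    have e2: "restrict_to (?c 0) (translate_measure x (restrict_to (?c x) (\<Lambda> \<omega>))) = restrict_to (?c 0) (translate_measure x (\<Lambda> \<omega>))"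
    proof (intro measure_eqI)
      fix A assume "A \<in> sets (restrict_to (?c 0) (translate_measure x (restrict_to (?c x) (\<Lambda> \<omega>))))"
      then have A: "A \<in> sets borel" by simp
      have "(+) x ` (?c 0 \<inter> A) = ?c x \<inter> (+) x ` (?c 0 \<inter> A)"
        using translate_cube[of x "real n" 0] by auto
      then show "emeasure (restrict_to (?c 0) (translate_measure x (restrict_to (?c x) (\<Lambda> \<omega>)))) A = emeasure (restrict_to (?c 0) (translate_measure x (\<Lambda> \<omega>))) A"
        using A s by (simp add: emeasure_restrict_to emeasure_translate)
    qed simp
    have e3: "\<not> F (restrict_to (?c 0) (translate_measure x (\<Lambda> \<omega>)))" if z: "emeasure (\<Lambda> \<omega>) (?c x) = 0"
    proof -
      have "restrict_to (?c 0) (translate_measure x (\<Lambda> \<omega>)) = null_measure borel"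
      proof (intro measure_eqI)
        fix A assume "A \<in> sets (restrict_to (?c 0) (translate_measure x (\<Lambda> \<omega>)))"
        then have A: "A \<in> sets borel" by simp
        have "(+) x ` (?c 0 \<inter> A) \<subseteq> ?c x" using translate_cube[of x "real n" 0] by auto
        then have "emeasure (\<Lambda> \<omega>) ((+) x ` (?c 0 \<inter> A)) \<le> emeasure (\<Lambda> \<omega>) (?c x)"
          using s by (intro emeasure_mono) auto
        then show "emeasure (restrict_to (?c 0) (translate_measure x (\<Lambda> \<omega>))) A = emeasure (null_measure borel) A"
          using A s z by (simp add: emeasure_restrict_to emeasure_translate)
      qed simp
      then show ?thesis using F0 by simp
    qed
    show ?thesis
    proof
      assume "P (restrict_to (?c x) (\<Lambda> \<omega>))"
      then obtain y where y: "y \<in> \<phi>" "emeasure (restrict_to (?c x) (\<Lambda> \<omega>)) (?c y) \<noteq> 0"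
        "F (restrict_to (?c 0) (translate_measure y (restrict_to (?c x) (\<Lambda> \<omega>))))"
        unfolding P_def by blast
      then have "y = x" using e1[OF y(1)] by metis
      then show "F (restrict_to (?c 0) (translate_measure x (\<Lambda> \<omega>)))" using y(3) e2 by simp
    next
      assume *: "F (restrict_to (?c 0) (translate_measure x (\<Lambda> \<omega>)))"
      have ne: "emeasure (restrict_to (?c x) (\<Lambda> \<omega>)) (?c x) \<noteq> 0"
      proof
        assume "emeasure (restrict_to (?c x) (\<Lambda> \<omega>)) (?c x) = 0"
        then have "emeasure (\<Lambda> \<omega>) (?c x) = 0" using e1[OF x] by simp
        from e3[OF this] * show False by contradiction
      qed
      have F': "F (restrict_to (?c 0) (translate_measure x (restrict_to (?c x) (\<Lambda> \<omega>))))"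
        unfolding e2 by (rule *)
      show "P (restrict_to (?c x) (\<Lambda> \<omega>))" unfolding P_def
        by (rule bexI[OF _ x]) (rule conjI[OF ne F'])
    qed
  qed
  have "indep_vars (\<lambda>_. borel) (\<lambda>x \<omega>. f (restrict_to (?c x) (\<Lambda> \<omega>)) * of_bool (cube_radius R (real n) x \<omega> < of_nat n)) \<phi>"
  proof -
    have "\<phi> - {x} = {} \<or> infdist x (\<phi> - {x}) > 3 * real n" if x: "x \<in> \<phi>" for x
    proof (cases "\<phi> - {x} = {}")
      case False
      then obtain y where y: "y \<in> \<phi> - {x}" "infdist x (\<phi> - {x}) = dist x y"
        using infdist_attains_inf[of "\<phi> - {x}" x] \<phi> by (auto simp: finite_imp_closed)
      then obtain i where "\<bar>x $ i - y $ i\<bar> > 3 * real n" using far x by blast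
      also have "\<bar>x $ i - y $ i\<bar> \<le> dist x y"
        using component_le_norm_cart[of "x - y" i] by (simp add: dist_norm)
      finally show ?thesis using y by simp
    qed simp
    moreover have "\<forall>m\<in>space ?L. 0 \<le> f m" "\<exists>C. \<forall>m\<in>space ?L. f m \<le> C" by (auto simp: f_def intro: exI[of _ 1])
    moreover note R[unfolded stabilization_radii_def, THEN conjunct2, THEN conjunct2, THEN conjunct2,
      rule_format, of n f \<phi>]
    ultimately show ?thesis using n f_meas \<phi>(1) by simp
  qed
  \<comment> \<open>Both factors take only the values 0 and 1, so a product different from 1 means
    that the event around \<open>x\<close> fails.\<close>
  then have ind: "indep_events (\<lambda>x. {\<omega>\<in>space M. f (restrict_to (?c x) (\<Lambda> \<omega>)) * of_bool (cube_radius R (real n) x \<omega> < of_nat n) \<noteq> 1}) \<phi>"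
    by (rule indep_eventsI_indep_vars[where P = "\<lambda>_ r. r \<noteq> 1"]) simp
  have eq: "{\<omega>\<in>space M. f (restrict_to (?c x) (\<Lambda> \<omega>)) * of_bool (cube_radius R (real n) x \<omega> < of_nat n) \<noteq> 1}
    = space M - stab_event M \<Lambda> R n F x" if "x \<in> \<phi>" for x
    using key[OF that] by (auto simp: f_def stab_event_def)
  have "measure M (\<Inter>x\<in>\<phi>. {\<omega>\<in>space M. f (restrict_to (?c x) (\<Lambda> \<omega>)) * of_bool (cube_radius R (real n) x \<omega> < of_nat n) \<noteq> 1})
    = (\<Prod>x\<in>\<phi>. measure M {\<omega>\<in>space M. f (restrict_to (?c x) (\<Lambda> \<omega>)) * of_bool (cube_radius R (real n) x \<omega> < of_nat n) \<noteq> 1})"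
    using ind \<phi>(1) False unfolding indep_events_def by blast
  also have "\<dots> = (\<Prod>x\<in>\<phi>. 1 - measure M (stab_event M \<Lambda> R n F 0))"
  proof (rule prod.cong[OF refl])
    fix x assume x: "x \<in> \<phi>"
    show "measure M {\<omega>\<in>space M. f (restrict_to (?c x) (\<Lambda> \<omega>)) * of_bool (cube_radius R (real n) x \<omega> < of_nat n) \<noteq> 1}
      = 1 - measure M (stab_event M \<Lambda> R n F 0)"
      unfolding eq[OF x] using prob_compl[OF stab_event_measurable[OF F]] stab_event_stationary[OF F, of x] x \<phi>(2) by auto
  qed
  finally have "measure M (\<Inter>x\<in>\<phi>. {\<omega>\<in>space M. f (restrict_to (?c x) (\<Lambda> \<omega>)) * of_bool (cube_radius R (real n) x \<omega> < of_nat n) \<noteq> 1})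
    = (1 - measure M (stab_event M \<Lambda> R n F 0)) ^ card \<phi>" by simp
  moreover have "(\<Inter>x\<in>\<phi>. {\<omega>\<in>space M. f (restrict_to (?c x) (\<Lambda> \<omega>)) * of_bool (cube_radius R (real n) x \<omega> < of_nat n) \<noteq> 1})
    = space M \<inter> (\<Inter>x\<in>\<phi>. space M - stab_event M \<Lambda> R n F x)"
    using eq False by auto
  ultimately show ?thesis by simp
qed

lemma site_events:
  assumes F: "{m\<in>space locally_finite_algebra. F m} \<in> sets locally_finite_algebra"
    and F0: "\<not> F (null_measure borel)"
    and n: "n \<ge> 1" and t: "s * t > 3 * n" and i12: "i1 \<noteq> i2"
    and S: "finite S" "separated t S"
  shows "measure M (space M \<inter> (\<Inter>z\<in>S. space M - stab_event M \<Lambda> R n F (site i1 i2 s z))) =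
    (1 - measure M (stab_event M \<Lambda> R n F 0)) ^ card S"
proof -
  have sep: "\<exists>i. \<bar>site i1 i2 s p $ i - site i1 i2 s q $ i\<bar> > 3 * real n" if pq: "p \<in> S" "q \<in> S" "p \<noteq> q" for p q
  proof -
    obtain i where i: "\<bar>site i1 i2 s p $ i - site i1 i2 s q $ i\<bar> \<ge> real (s * t)"
      using site_separated[OF i12 S(2) pq] by blast
    have "real (3 * n) < real (s * t)" using t by (simp only: of_nat_less_iff)
    then show ?thesis using i by (intro exI[of _ i]) simp
  qed
  have inj: "inj_on (site i1 i2 s) S"
  proof (rule inj_onI, rule ccontr)
    fix p q assume "p \<in> S" "q \<in> S" "site i1 i2 s p = site i1 i2 s q" "p \<noteq> q"
    then show False using sep[of p q] by auto
  qed
  have "measure M (space M \<inter> (\<Inter>x\<in>site i1 i2 s ` S. space M - stab_event M \<Lambda> R n F x)) =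
    (1 - measure M (stab_event M \<Lambda> R n F 0)) ^ card (site i1 i2 s ` S)"
  proof (rule stab_event_independent[OF F F0 n])
    show "finite (site i1 i2 s ` S)" "site i1 i2 s ` S \<subseteq> rational_points"
      using S by (auto simp: site_rational)
    fix x y assume "x \<in> site i1 i2 s ` S" "y \<in> site i1 i2 s ` S" "x \<noteq> y"
    then obtain p q where "x = site i1 i2 s p" "y = site i1 i2 s q" "p \<in> S" "q \<in> S" by blast
    then show "\<exists>i. \<bar>x $ i - y $ i\<bar> > 3 * real n" using sep[of p q] \<open>x \<noteq> y\<close> by metis
  qed
  moreover have "(\<Inter>x\<in>site i1 i2 s ` S. space M - stab_event M \<Lambda> R n F x) =
      (\<Inter>z\<in>S. space M - stab_event M \<Lambda> R n F (site i1 i2 s z))" by (rule INF_image[unfolded o_def])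
  ultimately show ?thesis using card_image[OF inj] by simp
qed

text \<open>Independence on separated sets reduces rareness to one estimate at the origin. The
  condition \<open>s * t > 3 * n\<close> is the separation demanded by stabilization, and the
  exponent \<open>t * t\<close> is the price of the thinning.\<close>

lemma stab_rare:
  assumes F: "{m\<in>space locally_finite_algebra. F m} \<in> sets locally_finite_algebra"
    and F0: "\<not> F (null_measure borel)"
    and n: "n \<ge> 1" and t: "s * t > 3 * n" and i12: "i1 \<noteq> i2" and q: "0 \<le> q" "q \<le> 1"
    and p: "measure M (stab_event M \<Lambda> R n F 0) \<ge> 1 - q ^ (t * t)"
  shows "rare M (\<lambda>z. space M - stab_event M \<Lambda> R n F (site i1 i2 s z)) q"
proof (rule rare_of_separated[where t = t, OF prob_space_axioms _ _ q])
  fix z show "space M - stab_event M \<Lambda> R n F (site i1 i2 s z) \<in> sets M"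
    using stab_event_measurable[OF F] by blast
next
  fix S :: "(int \<times> int) set" assume S: "finite S" "separated t S"
  show "measure M (space M \<inter> (\<Inter>z\<in>S. space M - stab_event M \<Lambda> R n F (site i1 i2 s z)))
    \<le> (q ^ (t * t)) ^ card S"
    unfolding site_events[OF F F0 n t i12 S] using p by (intro power_mono) auto
next
  show "t \<ge> 1" using t by (cases t) auto
qed

lemma cube_radius_small:
  assumes "\<epsilon> > 0"
  shows "\<exists>n0. \<forall>n\<ge>n0. measure M {\<omega>\<in>space M. cube_radius R (real n) 0 \<omega> < of_nat n} > 1 - \<epsilon>"
proof -
  have "(\<lambda>n. measure M {\<omega> \<in> space M. cube_radius R (real n) 0 \<omega> < of_nat n}) \<longlonglongrightarrow> 1"
    using R by (simp add: stabilization_radii_def)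
  from order_tendstoD(1)[OF this, of "1 - \<epsilon>"] assms show ?thesis
    by (simp add: eventually_sequentially)
qed

text \<open>A large cube is covered by a number of small cubes that depends only on the ratio of the
  sides.\<close>

lemma cube_radius_scaled_small:
  assumes "\<epsilon> > 0" and c: "c \<ge> 1"
  shows "\<exists>n0. \<forall>n\<ge>n0. measure M {\<omega>\<in>space M. cube_radius R (real (c * n)) 0 \<omega> < of_nat n} > 1 - \<epsilon>"
proof -
  \<comment> \<open>Rounding the coordinates of \<open>y / n\<close>, which are at most
    \<open>c / 2\<close> in absolute value, gives integers up to \<open>(c + 1) / 2\<close>, and
    this is at most \<open>c\<close>.\<close>
  define W where "W = PiE (UNIV :: 'd set) (\<lambda>_. {- int c..int c})"
  have fW: "finite W" unfolding W_def by (intro finite_PiE) auto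
  have "(\<lambda>_. 0) \<in> W" by (auto simp: W_def)
  then have cW: "card W > 0" using fW by (auto simp: card_gt_0_iff)
  obtain n0 where n0: "\<And>n. n \<ge> n0 \<Longrightarrow> measure M {\<omega>\<in>space M. cube_radius R (real n) 0 \<omega> < of_nat n} > 1 - \<epsilon> / card W"
    using cube_radius_small[of "\<epsilon> / card W"] assms cW by auto
  show ?thesis
  proof (intro exI[of _ "max 1 n0"] allI impI)
    fix n assume "n \<ge> max 1 n0"
    then have n: "n \<ge> 1" "n \<ge> n0" by auto
    define pt where "pt = (\<lambda>v :: 'd \<Rightarrow> int. (\<chi> i. real n * of_int (v i)) :: real^'d)"
    have ptr: "pt v \<in> rational_points" for v by (simp add: pt_def rational_points_def)
    define E where "E = (\<lambda>x. {\<omega>\<in>space M. cube_radius R (real n) x \<omega> < of_nat n})"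
    have E: "E x \<in> sets M" for x unfolding E_def by measurable
    have Ee: "E x = stab_event M \<Lambda> R n (\<lambda>_. True) x" for x by (auto simp: E_def stab_event_def)
    have mE: "measure M (E (pt v)) > 1 - \<epsilon> / card W" for v
      using stab_event_stationary[of "\<lambda>_. True" "pt v" n] n0[OF n(2)] ptr unfolding Ee[symmetric] by (simp add: E_def)
    have sub: "space M - {\<omega>\<in>space M. cube_radius R (real (c * n)) 0 \<omega> < of_nat n} \<subseteq> (\<Union>v\<in>W. space M - E (pt v))"
    proof
      fix \<omega> assume w: "\<omega> \<in> space M - {\<omega>\<in>space M. cube_radius R (real (c * n)) 0 \<omega> < of_nat n}"
      show "\<omega> \<in> (\<Union>v\<in>W. space M - E (pt v))"
      proof (rule ccontr)
        assume "\<omega> \<notin> (\<Union>v\<in>W. space M - E (pt v))"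
        then have *: "\<And>v. v \<in> W \<Longrightarrow> cube_radius R (real n) (pt v) \<omega> < of_nat n" using w by (auto simp: E_def)
        have "cube_radius R (real (c * n)) 0 \<omega> \<le> (MAX v\<in>W. cube_radius R (real n) (pt v) \<omega>)"
          unfolding cube_radius_def[of R "real (c * n)"]
        proof (rule SUP_least)
          fix y :: "real^'d" assume y: "y \<in> cube (real (c * n)) 0 \<inter> rational_points"
          define v where "v = (\<lambda>i. round (y $ i / real n))"
          have r: "\<bar>of_int (v i) - y $ i / real n\<bar> \<le> 1 / 2" for i
            unfolding v_def by (rule of_int_round_abs_le)
          have yc: "\<bar>y $ i / real n\<bar> \<le> real c / 2" for i
          proof -
            have "\<bar>y $ i\<bar> \<le> real (c * n) / 2" using y by (auto simp: mem_cube)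
            then show ?thesis using n by (simp add: abs_divide field_simps)
          qed
          have "\<bar>of_int (v i)\<bar> \<le> real c / 2 + 1 / 2" for i using r[of i] yc[of i] by linarith
          moreover have "real c / 2 + 1 / 2 \<le> real c" using c by simp
          ultimately have "\<bar>of_int (v i)\<bar> \<le> real c" for i by (meson order_trans)
          then have "\<bar>v i\<bar> \<le> int c" for i by (metis of_int_abs of_int_le_iff of_int_of_nat_eq)
          then have vW: "v \<in> W" unfolding W_def by (auto simp: abs_le_iff minus_le_iff)
          have "y \<in> cube (real n) (pt v)"
            unfolding mem_cube
          proof
            fix i
            have "y $ i - real n * of_int (v i) = real n * (y $ i / real n - of_int (v i))"
              using n by (simp add: right_diff_distrib)
            then have "\<bar>y $ i - real n * of_int (v i)\<bar> = real n * \<bar>of_int (v i) - y $ i / real n\<bar>"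
              by (simp add: abs_mult abs_minus_commute)
            also have "\<dots> \<le> real n * (1 / 2)" by (intro mult_left_mono r) simp
            finally show "\<bar>y $ i - pt v $ i\<bar> \<le> real n / 2" by (simp add: pt_def)
          qed
          then have "R y \<omega> \<le> cube_radius R (real n) (pt v) \<omega>"
            unfolding cube_radius_def using y by (intro SUP_upper) auto
          also have "\<dots> \<le> (MAX v\<in>W. cube_radius R (real n) (pt v) \<omega>)"
            using fW vW by (intro Max_ge) auto
          finally show "R y \<omega> \<le> (MAX v\<in>W. cube_radius R (real n) (pt v) \<omega>)" .
        qed
        also have "\<dots> < of_nat n" using fW * cW by (subst Max_less_iff) auto
        finally show False using w by auto
      qed
    qed
    have m: "{\<omega>\<in>space M. cube_radius R (real (c * n)) 0 \<omega> < of_nat n} \<in> sets M" by measurable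
    have "1 - measure M {\<omega>\<in>space M. cube_radius R (real (c * n)) 0 \<omega> < of_nat n} = measure M (space M - {\<omega>\<in>space M. cube_radius R (real (c * n)) 0 \<omega> < of_nat n})"
      using prob_compl[OF m] by simp
    also have "\<dots> \<le> measure M (\<Union>v\<in>W. space M - E (pt v))"
      using sub fW E by (intro finite_measure_mono sets.finite_UN) auto
    also have "\<dots> \<le> (\<Sum>v\<in>W. measure M (space M - E (pt v)))"
      using fW E by (intro finite_measure_subadditive_finite) auto
    also have "\<dots> = (\<Sum>v\<in>W. 1 - measure M (E (pt v)))" using prob_compl[OF E] by simp
    also have "\<dots> < (\<Sum>v\<in>W. \<epsilon> / card W)"
      using mE fW cW by (intro sum_strict_mono) (auto simp: algebra_simps)
    also have "\<dots> = \<epsilon>" using cW by simp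
    finally show "1 - \<epsilon> < measure M {\<omega>\<in>space M. cube_radius R (real (c * n)) 0 \<omega> < of_nat n}" by simp
  qed
qed

text \<open>If a cube of side \<open>k\<close> is charged with positive probability, then so is, with probability
  close to 1, one of many independent such cubes.\<close>

lemma cube_charged:
  assumes i12: "(i1 :: 'd) \<noteq> i2"
    and mean: "(\<integral>\<^sup>+\<omega>. emeasure (\<Lambda> \<omega>) (cube 1 0) \<partial>M) = 1" and \<epsilon>: "\<epsilon> > 0"
  shows "\<exists>n0. \<forall>n\<ge>n0. measure M {\<omega>\<in>space M. emeasure (\<Lambda> \<omega>) (cube (real n) 0) > 0} > 1 - \<epsilon>"
proof -
  define A where "A = (\<lambda>n::nat. {\<omega>\<in>space M. emeasure (\<Lambda> \<omega>) (cube (real n) 0) > 0})"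
  have em: "(\<lambda>\<omega>. emeasure (\<Lambda> \<omega>) B) \<in> borel_measurable M" if "B \<in> sets borel" for B
    by (rule measurable_compose[OF measurable_\<Lambda> measurable_emeasure_locally_finite_algebra[OF that]])
  have A: "A n \<in> sets M" for n unfolding A_def using em[OF cube_borel, of "real n" 0] by measurable
  have mono: "emeasure (\<Lambda> \<omega>) C \<le> emeasure (\<Lambda> \<omega>) B" if "C \<subseteq> B" "B \<in> sets borel" "\<omega> \<in> space M" for C B \<omega>
    using that lfa_sets[OF \<Lambda>_lfa] by (intro emeasure_mono) auto
  have sub: "cube (real a) (0::real^'d) \<subseteq> cube (real b) 0" if "a \<le> b" for a b :: nat
  proof
    fix y :: "real^'d" assume "y \<in> cube (real a) 0"
    then have "\<bar>y $ i - 0 $ i\<bar> \<le> real a / 2" for i by (simp add: mem_cube)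
    moreover have "real a / 2 \<le> real b / 2" using that by simp
    ultimately show "y \<in> cube (real b) 0" unfolding mem_cube by (meson order_trans)
  qed
  have p1: "measure M (A 1) > 0"
  proof (rule ccontr)
    assume "\<not> measure M (A 1) > 0"
    then have "measure M (A 1) = 0" using measure_nonneg[of M "A 1"] by linarith
    then have "emeasure M (A 1) = 0" by (simp add: emeasure_eq_measure)
    then have "AE \<omega> in M. \<omega> \<notin> A 1" using A by (intro AE_not_in) (auto simp: null_sets_def)
    then have "AE \<omega> in M. emeasure (\<Lambda> \<omega>) (cube 1 0) = 0" by (auto simp: A_def not_gr_zero elim!: AE_mp)
    then have "(\<integral>\<^sup>+\<omega>. emeasure (\<Lambda> \<omega>) (cube 1 0) \<partial>M) = 0"
      using em[OF cube_borel] by (subst nn_integral_0_iff_AE) auto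
    then show False using mean by simp
  qed
  \<comment> \<open>An exceptional probability below that of \<open>A 1\<close> forces the radius
    event to meet \<open>A 1\<close> with positive probability.\<close>
  obtain k0 where k0: "\<And>n. n \<ge> k0 \<Longrightarrow> measure M {\<omega>\<in>space M. cube_radius R (real n) 0 \<omega> < of_nat n} > 1 - measure M (A 1)"
    using cube_radius_small[OF p1] by blast
  define k where "k = max 1 k0"
  have k: "k \<ge> 1" "k \<ge> k0" by (auto simp: k_def)
  define F where "F = (\<lambda>m :: (real^'d) measure. emeasure m UNIV > 0)"
  have F: "{m\<in>space locally_finite_algebra. F m} \<in> sets locally_finite_algebra"
    unfolding F_def using measurable_emeasure_locally_finite_algebra[of UNIV] by measurable
  have F0: "\<not> F (null_measure borel)" by (simp add: F_def)
  have Feq: "F (restrict_to (cube (real k) 0) (translate_measure x (\<Lambda> \<omega>))) \<longleftrightarrow> emeasure (\<Lambda> \<omega>) (cube (real k) x) > 0"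
    if "\<omega> \<in> space M" for x \<omega>
    using lfa_sets[OF \<Lambda>_lfa[OF that]] translate_cube[of x "real k" 0]
    by (simp add: F_def emeasure_restrict_to emeasure_translate)
  define p where "p = measure M (stab_event M \<Lambda> R k F 0)"
  have "p > 0"
  proof -
    let ?B = "{\<omega>\<in>space M. cube_radius R (real k) 0 \<omega> < of_nat k}"
    have B: "?B \<in> sets M" by measurable
    have "A 1 \<inter> ?B \<subseteq> stab_event M \<Lambda> R k F 0"
    proof
      fix \<omega> assume w: "\<omega> \<in> A 1 \<inter> ?B"
      have "emeasure (\<Lambda> \<omega>) (cube (real 1) 0) \<le> emeasure (\<Lambda> \<omega>) (cube (real k) 0)"
        using w k by (intro mono sub) auto
      then show "\<omega> \<in> stab_event M \<Lambda> R k F 0" using w Feq[of \<omega> 0] by (auto simp: stab_event_def A_def)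
    qed
    then have "measure M (A 1 \<inter> ?B) \<le> p" unfolding p_def
      using stab_event_measurable[OF F] by (intro finite_measure_mono)
    moreover have "measure M (A 1) + measure M ?B \<le> 1 + measure M (A 1 \<inter> ?B)"
      using measure_Un3[of "A 1" M ?B] A B fmeasurable_eq_sets prob_le_1[of "A 1 \<union> ?B"] by auto
    ultimately show ?thesis using k0[OF k(2)] by linarith
  qed
  moreover have "p \<le> 1" unfolding p_def by (rule prob_le_1)
  ultimately have "(\<lambda>j. (1 - p) ^ j) \<longlonglongrightarrow> 0" by (intro LIMSEQ_realpow_zero) auto
  from order_tendstoD(2)[OF this \<epsilon>] obtain J where J: "(1 - p) ^ J < \<epsilon>" by (auto simp: eventually_sequentially)
  \<comment> \<open>On the scale 1 sites at distance \<open>t\<close> are more than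
    \<open>3 * k\<close> apart, as independence requires. The \<open>J\<close> sites lie on one
    axis.\<close>
  define t where "t = 3 * k + 1"
  define S where "S = (\<lambda>j. (int (t * j), 0 :: int)) ` {..<J}"
  have S: "finite S" "card S = J"
  proof -
    have "t \<noteq> 0" by (simp add: t_def)
    then have "inj_on (\<lambda>j. (int (t * j), 0 :: int)) {..<J}" by (intro inj_onI) simp
    then show "card S = J" unfolding S_def by (simp only: card_image card_lessThan)
  qed (simp add: S_def)
  have sepS: "separated t S"
    unfolding separated_def S_def
  proof (intro ballI impI)
    fix p q assume "p \<in> (\<lambda>j. (int (t * j), 0 :: int)) ` {..<J}" "q \<in> (\<lambda>j. (int (t * j), 0 :: int)) ` {..<J}"
      and pq: "p \<noteq> q"
    then obtain a b where ab: "p = (int (t * a), 0)" "q = (int (t * b), 0)" by blast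
    with pq have ne: "a \<noteq> b" by auto
    have "int t * 1 \<le> int t * \<bar>int a - int b\<bar>" using ne by (intro mult_left_mono) auto
    then show "int t \<le> \<bar>fst p - fst q\<bar> \<or> int t \<le> \<bar>snd p - snd q\<bar>"
      by (simp add: ab right_diff_distrib[symmetric] abs_mult)
  qed
  have mS: "measure M (space M \<inter> (\<Inter>z\<in>S. space M - stab_event M \<Lambda> R k F (site i1 i2 1 z))) < \<epsilon>"
    using site_events[OF F F0 k(1) _ i12 S(1), of 1 t] sepS J S(2) by (simp add: t_def p_def)
  \<comment> \<open>The centres have coordinates up to \<open>t * J\<close>, so a cube of side
    \<open>2 * t * J + k\<close> around the origin contains all \<open>J\<close> cubes of side
    \<open>k\<close>.\<close>
  show ?thesis
  proof (intro exI[of _ "2 * t * J + k"] allI impI)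
    fix n assume n: "n \<ge> 2 * t * J + k"
    have "space M - A n \<subseteq> space M \<inter> (\<Inter>z\<in>S. space M - stab_event M \<Lambda> R k F (site i1 i2 1 z))"
    proof
      fix \<omega> assume w: "\<omega> \<in> space M - A n"
      have "\<omega> \<notin> stab_event M \<Lambda> R k F (site i1 i2 1 z)" if z: "z \<in> S" for z
      proof -
        have "cube (real k) (site i1 i2 1 z) \<subseteq> cube (real n) 0"
        proof
          fix y assume y: "y \<in> cube (real k) (site i1 i2 1 z)"
          show "y \<in> cube (real n) 0"
            unfolding mem_cube
          proof
            fix i
            obtain j where j: "j < J" "z = (int (t * j), 0)" using z by (auto simp: S_def)
            have "t * j \<le> t * J" using j by (intro mult_le_mono2) simp
            then have "real (t * j) \<le> real (t * J)" by (simp only: of_nat_le_iff)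
            then have 1: "\<bar>site i1 i2 1 z $ i\<bar> \<le> real (t * J)" using j by (auto simp: site_def)
            have 2: "\<bar>y $ i - site i1 i2 1 z $ i\<bar> \<le> real k / 2" using y by (auto simp: mem_cube)
            have "real (2 * t * J + k) \<le> real n" using n by (simp only: of_nat_le_iff)
            then have "2 * real (t * J) + real k \<le> real n" by simp
            then have "\<bar>y $ i\<bar> \<le> real n / 2" using 1 2 by linarith
            then show "\<bar>y $ i - 0 $ i\<bar> \<le> real n / 2" by simp
          qed
        qed
        then have "emeasure (\<Lambda> \<omega>) (cube (real k) (site i1 i2 1 z)) \<le> emeasure (\<Lambda> \<omega>) (cube (real n) 0)"
          using w by (intro mono) auto
        then show ?thesis using w Feq[of \<omega> "site i1 i2 1 z"] by (auto simp: stab_event_def A_def not_gr_zero)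
      qed
      then show "\<omega> \<in> space M \<inter> (\<Inter>z\<in>S. space M - stab_event M \<Lambda> R k F (site i1 i2 1 z))" using w by auto
    qed
    moreover have "space M \<inter> (\<Inter>z\<in>S. space M - stab_event M \<Lambda> R k F (site i1 i2 1 z)) \<in> sets M"
      using S stab_event_measurable[OF F] by (intro Int_INT_sets) auto
    ultimately have "measure M (space M - A n) < \<epsilon>" using mS finite_measure_mono by (meson le_less_trans)
    then show "measure M {\<omega>\<in>space M. emeasure (\<Lambda> \<omega>) (cube (real n) 0) > 0} > 1 - \<epsilon>"
      using prob_compl[OF A, of n] by (simp add: A_def)
  qed
qed

end

section \<open>Linking schemes\<close>

text \<open>A linking scheme on the scale \<open>s\<close>: if the good events \<open>H z\<close> hold along an infinite cluster of
  sites and a set \<open>V\<close> of points meets all cells that are charged with mass at least \<open>\<delta>\<close>, then the graph on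
  \<open>V\<close> with range \<open>\<rho>\<close> percolates inside the union of the cubes of the cluster.\<close>

definition linking_scheme ::
    "'w measure \<Rightarrow> ('w \<Rightarrow> (real^'d) measure) \<Rightarrow> 'd \<Rightarrow> 'd \<Rightarrow> real \<Rightarrow> real \<Rightarrow> nat \<Rightarrow> nat \<Rightarrow> nat \<Rightarrow> real \<Rightarrow>
     (int \<times> int \<Rightarrow> 'w set) \<Rightarrow> (int \<times> int \<Rightarrow> (real^'d) set set) \<Rightarrow> bool" where
  "linking_scheme M \<Lambda> i1 i2 \<rho> q s N K \<delta> H cells \<longleftrightarrow>
      N \<le> 8 * s \<and> \<delta> > 0 \<and> rare M (\<lambda>z. space M - H z) q \<and>
      (\<forall>z. finite (cells z) \<and> card (cells z) \<le> K \<and>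
        (\<forall>c\<in>cells z. c \<in> sets borel \<and> c \<subseteq> cube (real N) (site i1 i2 s z))) \<and>
      (\<forall>\<omega>\<in>space M. \<forall>Z V. (0, 0) \<in> Z \<and> infinite {z. ((0, 0), z) \<in> (nbr_rel Z)\<^sup>*} \<and>
          (\<forall>z\<in>Z. \<omega> \<in> H z \<and> (\<forall>c\<in>cells z. emeasure (\<Lambda> \<omega>) c \<ge> ennreal \<delta> \<longrightarrow> V \<inter> c \<noteq> {})) \<longrightarrow>
        (\<exists>x\<in>V. \<not> bounded ({(x, y). x \<in> V \<and> y \<in> V \<and> x \<noteq> y \<and> dist x y \<le> \<rho> \<and>
          x \<in> (\<Union>z\<in>Z. cube (real N) (site i1 i2 s z)) \<and>
          y \<in> (\<Union>z\<in>Z. cube (real N) (site i1 i2 s z))}\<^sup>* `` {x})))"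

definition linked ::
    "'w measure \<Rightarrow> ('w \<Rightarrow> (real^'d) measure) \<Rightarrow> 'd \<Rightarrow> 'd \<Rightarrow> real \<Rightarrow> real \<Rightarrow> nat \<Rightarrow> bool" where
  "linked M \<Lambda> i1 i2 \<rho> q s \<longleftrightarrow> (\<exists>N K \<delta> H cells. linking_scheme M \<Lambda> i1 i2 \<rho> q s N K \<delta> H cells)"

text \<open>Each point stays within a fixed distance of its site, and only finitely many sites lie
  in a bounded region.\<close>

lemma sites_unbounded:
  fixes v :: "int \<times> int \<Rightarrow> real^'d"
  assumes i12: "i1 \<noteq> i2" and s: "s \<ge> 1" and inf: "infinite Z"
    and v: "\<And>z. z \<in> Z \<Longrightarrow> v z \<in> cube n (site i1 i2 s z)"
  shows "\<not> bounded (v ` Z)"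
proof
  assume "bounded (v ` Z)"
  then obtain b where b: "\<And>z. z \<in> Z \<Longrightarrow> norm (v z) \<le> b" by (auto simp: bounded_iff)
  define B where "B = \<lceil>b + n / 2\<rceil>"
  have bound: "\<bar>fst z\<bar> \<le> B \<and> \<bar>snd z\<bar> \<le> B" if z: "z \<in> Z" for z
  proof -
    have *: "\<bar>site i1 i2 s z $ i\<bar> \<le> b + n / 2" for i
    proof -
      have "\<bar>v z $ i - site i1 i2 s z $ i\<bar> \<le> n / 2" using v[OF z] by (simp add: mem_cube)
      moreover have "\<bar>v z $ i\<bar> \<le> b" using b[OF z] component_le_norm_cart[of "v z" i] by simp
      ultimately show ?thesis by linarith
    qed
    have **: "\<bar>a\<bar> \<le> B" if "\<bar>real s * of_int a\<bar> \<le> b + n / 2" for a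
    proof -
      have "1 * \<bar>real_of_int a\<bar> \<le> real s * \<bar>of_int a\<bar>" using s by (intro mult_right_mono) auto
      then have "\<bar>real_of_int a\<bar> \<le> b + n / 2" using that by (simp add: abs_mult)
      then show ?thesis unfolding B_def by linarith
    qed
    show ?thesis using *[of i1] *[of i2] i12 by (auto intro!: ** simp: site_def)
  qed
  have "Z \<subseteq> {-B..B} \<times> {-B..B}"
  proof
    fix z assume "z \<in> Z"
    from bound[OF this] show "z \<in> {-B..B} \<times> {-B..B}" by (cases z) auto
  qed
  then show False using inf by (meson finite_SigmaI finite_atLeastAtMost_int finite_subset)
qed

context stab begin

lemma mass_measurable: "B \<in> sets borel \<Longrightarrow> (\<lambda>\<omega>. emeasure (\<Lambda> \<omega>) B) \<in> borel_measurable M"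
  by (rule measurable_compose[OF measurable_\<Lambda> measurable_emeasure_locally_finite_algebra])

lemma prob_Int_gt:
  assumes "A \<in> sets M" "B \<in> sets M" "measure M A > 1 - a" "measure M B > 1 - b"
  shows "measure M (A \<inter> B) > 1 - (a + b)"
proof -
  have "measure M (A \<union> B) = measure M A + measure M B - measure M (A \<inter> B)"
    using assms by (intro measure_Un3) (auto simp: fmeasurable_eq_sets)
  then show ?thesis using assms prob_le_1[of "A \<union> B"] by simp
qed

lemma total_mass_translate:
  assumes "\<omega> \<in> space M"
  shows "emeasure (restrict_to (cube n 0) (translate_measure x (\<Lambda> \<omega>))) UNIV = emeasure (\<Lambda> \<omega>) (cube n x)"
  using lfa_sets[OF \<Lambda>_lfa[OF assms]] translate_cube[of x n 0]
  by (simp add: emeasure_restrict_to emeasure_translate)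

text \<open>The events of mass at least \<open>1 / (k + 1)\<close> increase to the event of positive
  mass, so a fixed level costs arbitrarily little probability. A level fixed beforehand is what
  makes voids unlikely at large intensity, uniformly in \<open>\<Lambda>\<close>.\<close>

lemma cube_mass_bounded_below:
  assumes i12: "(i1 :: 'd) \<noteq> i2"
    and mean: "(\<integral>\<^sup>+\<omega>. emeasure (\<Lambda> \<omega>) (cube 1 0) \<partial>M) = 1" and \<epsilon>: "\<epsilon> > 0"
  shows "\<exists>n0. \<forall>n\<ge>n0. \<exists>\<delta>>0. measure M {\<omega>\<in>space M. emeasure (\<Lambda> \<omega>) (cube (real n) 0) \<ge> ennreal \<delta>} > 1 - \<epsilon>"
proof -
  obtain n0 where n0: "\<And>n. n \<ge> n0 \<Longrightarrow> measure M {\<omega>\<in>space M. emeasure (\<Lambda> \<omega>) (cube (real n) 0) > 0} > 1 - \<epsilon>"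
    using cube_charged[OF i12 mean \<epsilon>] by blast
  show ?thesis
  proof (intro exI[of _ n0] allI impI)
    fix n assume "n \<ge> n0"
    define A where "A = (\<lambda>k. {\<omega>\<in>space M. emeasure (\<Lambda> \<omega>) (cube (real n) 0) \<ge> ennreal (1 / real (Suc k))})"
    have A: "A k \<in> sets M" for k
      unfolding A_def using mass_measurable[OF cube_borel, of "real n" 0] by measurable
    have "incseq A"
    proof (rule incseq_SucI, rule subsetI)
      fix k \<omega> assume w: "\<omega> \<in> A k"
      have "ennreal (1 / real (Suc (Suc k))) \<le> ennreal (1 / real (Suc k))"
        by (intro ennreal_leI) (simp add: frac_le)
      also have "\<dots> \<le> emeasure (\<Lambda> \<omega>) (cube (real n) 0)" using w by (simp add: A_def)
      finally show "\<omega> \<in> A (Suc k)" using w by (simp add: A_def)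
    qed
    then have "(\<lambda>k. measure M (A k)) \<longlonglongrightarrow> measure M (\<Union>k. A k)"
      using A by (intro finite_Lim_measure_incseq) auto
    moreover have "(\<Union>k. A k) = {\<omega>\<in>space M. emeasure (\<Lambda> \<omega>) (cube (real n) 0) > 0}"
    proof (intro set_eqI iffI)
      fix \<omega> assume "\<omega> \<in> (\<Union>k. A k)"
      then show "\<omega> \<in> {\<omega>\<in>space M. emeasure (\<Lambda> \<omega>) (cube (real n) 0) > 0}"
        by (auto simp: A_def intro: less_le_trans[rotated])
    next
      fix \<omega> assume w: "\<omega> \<in> {\<omega>\<in>space M. emeasure (\<Lambda> \<omega>) (cube (real n) 0) > 0}"
      have fin: "emeasure (\<Lambda> \<omega>) (cube (real n) 0) < \<infinity>"
        using w by (intro lfa_finite[OF \<Lambda>_lfa]) (auto simp: bounded_cube cube_borel)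
      define r where "r = enn2real (emeasure (\<Lambda> \<omega>) (cube (real n) 0))"
      have r: "emeasure (\<Lambda> \<omega>) (cube (real n) 0) = ennreal r" "r > 0"
        using fin w by (auto simp: r_def enn2real_positive_iff)
      obtain k where "inverse (real (Suc k)) < r" using reals_Archimedean[OF r(2)] by blast
      then have "\<omega> \<in> A k" using w by (auto simp: A_def r(1) inverse_eq_divide intro!: ennreal_leI)
      then show "\<omega> \<in> (\<Union>k. A k)" by blast
    qed
    ultimately have "(\<lambda>k. measure M (A k)) \<longlonglongrightarrow> measure M {\<omega>\<in>space M. emeasure (\<Lambda> \<omega>) (cube (real n) 0) > 0}" by simp
    from order_tendstoD(1)[OF this n0[OF \<open>n \<ge> n0\<close>]] obtain k where "measure M (A k) > 1 - \<epsilon>"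
      by (auto simp: eventually_sequentially)
    then show "\<exists>\<delta>>0. measure M {\<omega>\<in>space M. emeasure (\<Lambda> \<omega>) (cube (real n) 0) \<ge> ennreal \<delta>} > 1 - \<epsilon>"
      unfolding A_def by (intro exI[of _ "1 / real (Suc k)"]) simp
  qed
qed

text \<open>One cell per site suffices, namely the cube of side \<open>s\<close> around it: points
  of cubes at neighbouring sites differ by at most \<open>2 * s\<close> in each coordinate, so the
  range covers every step between neighbouring good sites.\<close>

lemma linked_large_range:
  assumes i12: "(i1 :: 'd) \<noteq> i2"
    and mean: "(\<integral>\<^sup>+\<omega>. emeasure (\<Lambda> \<omega>) (cube 1 0) \<partial>M) = 1" and q: "0 < q" "q \<le> 1"
  shows "\<exists>s0. \<forall>s\<ge>s0. \<forall>\<rho>\<ge>2 * real CARD('d) * real s. linked M \<Lambda> i1 i2 \<rho> q s"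
proof -
  \<comment> \<open>The cubes have the side \<open>s\<close> of the lattice, so \<open>t = 4\<close>
    satisfies \<open>s * t > 3 * s\<close>; the half is for the intersection of two events.\<close>
  define \<epsilon> where "\<epsilon> = q ^ 16 / 2"
  have \<epsilon>: "\<epsilon> > 0" using q by (simp add: \<epsilon>_def)
  obtain n1 where n1: "\<And>n. n \<ge> n1 \<Longrightarrow> \<exists>\<delta>>0. measure M {\<omega>\<in>space M. emeasure (\<Lambda> \<omega>) (cube (real n) 0) \<ge> ennreal \<delta>} > 1 - \<epsilon>"
    using cube_mass_bounded_below[OF i12 mean \<epsilon>] by blast
  obtain n2 where n2: "\<And>n. n \<ge> n2 \<Longrightarrow> measure M {\<omega>\<in>space M. cube_radius R (real n) 0 \<omega> < of_nat n} > 1 - \<epsilon>"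
    using cube_radius_small[OF \<epsilon>] by blast
  show ?thesis
  proof (intro exI[of _ "max 1 (max n1 n2)"] allI impI)
    fix s \<rho> assume s: "s \<ge> max 1 (max n1 n2)" and \<rho>: "\<rho> \<ge> 2 * real CARD('d) * real s"
    obtain \<delta> where \<delta>: "\<delta> > 0" "measure M {\<omega>\<in>space M. emeasure (\<Lambda> \<omega>) (cube (real s) 0) \<ge> ennreal \<delta>} > 1 - \<epsilon>"
      using n1[of s] s by auto
    define F where "F = (\<lambda>m :: (real^'d) measure. emeasure m UNIV \<ge> ennreal \<delta>)"
    have F: "{m\<in>space locally_finite_algebra. F m} \<in> sets locally_finite_algebra"
      unfolding F_def using measurable_emeasure_locally_finite_algebra[of UNIV] by measurable
    have F0: "\<not> F (null_measure borel)" using \<delta>(1) by (simp add: F_def)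
    define H where "H = (\<lambda>z. stab_event M \<Lambda> R s F (site i1 i2 s z))"
    have Hmass: "emeasure (\<Lambda> \<omega>) (cube (real s) (site i1 i2 s z)) \<ge> ennreal \<delta>" if "\<omega> \<in> H z" for \<omega> z
      using that total_mass_translate[of \<omega> "real s" "site i1 i2 s z"] by (auto simp: H_def stab_event_def F_def)
    have rare: "rare M (\<lambda>z. space M - H z) q"
      unfolding H_def
    proof (rule stab_rare[OF F F0, where t = 4])
      let ?A = "{\<omega>\<in>space M. emeasure (\<Lambda> \<omega>) (cube (real s) 0) \<ge> ennreal \<delta>}"
      let ?B = "{\<omega>\<in>space M. cube_radius R (real s) 0 \<omega> < of_nat s}"
      have AB: "?A \<in> sets M" "?B \<in> sets M"
        using mass_measurable[OF cube_borel, of "real s" 0] by measurable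
      have "measure M (?A \<inter> ?B) > 1 - (\<epsilon> + \<epsilon>)"
        using s by (intro prob_Int_gt AB \<delta>(2) n2) auto
      moreover have "?A \<inter> ?B = stab_event M \<Lambda> R s F 0"
        using total_mass_translate[of _ "real s" 0] by (auto simp: stab_event_def F_def)
      ultimately show "1 - q ^ (4 * 4) \<le> measure M (stab_event M \<Lambda> R s F 0)" by (simp add: \<epsilon>_def)
    qed (use s i12 q in auto)
    let ?c = "\<lambda>z. cube (real s) (site i1 i2 s z)"
    have link: "\<exists>x\<in>V. \<not> bounded ({(x, y). x \<in> V \<and> y \<in> V \<and> x \<noteq> y \<and> dist x y \<le> \<rho> \<and>
          x \<in> (\<Union>z\<in>Z. ?c z) \<and> y \<in> (\<Union>z\<in>Z. ?c z)}\<^sup>* `` {x})"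
      if Z: "(0, 0) \<in> Z" "infinite {z. ((0, 0), z) \<in> (nbr_rel Z)\<^sup>*}"
        and good: "\<And>z. z \<in> Z \<Longrightarrow> \<omega> \<in> H z \<and> (emeasure (\<Lambda> \<omega>) (?c z) \<ge> ennreal \<delta> \<longrightarrow> V \<inter> ?c z \<noteq> {})" for \<omega> Z V
    proof -
      define E where "E = {(x, y). x \<in> V \<and> y \<in> V \<and> x \<noteq> y \<and> dist x y \<le> \<rho> \<and>
          x \<in> (\<Union>z\<in>Z. ?c z) \<and> y \<in> (\<Union>z\<in>Z. ?c z)}"
      have "\<exists>v. v \<in> V \<inter> ?c z" if "z \<in> Z" for z using good[OF that] Hmass by blast
      then obtain v where v: "\<And>z. z \<in> Z \<Longrightarrow> v z \<in> V \<and> v z \<in> ?c z" by (metis IntE)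
      have reach: "(v (0, 0), v z) \<in> E\<^sup>*" if "((0, 0), z) \<in> (nbr_rel Z)\<^sup>*" for z
        using that
      proof (induction rule: rtrancl_induct)
        case (step y z)
        then have yz: "nbr y z" "y \<in> Z" "z \<in> Z" by (auto simp: nbr_rel_def)
        have "dist (v y) (v z) \<le> real CARD('d) * (real s / 2 + real s / 2 + real s)"
          by (rule cube_dist[OF _ _ site_nbr[OF yz(1)]]) (use v yz in blast)+
        then have "dist (v y) (v z) \<le> \<rho>" using \<rho> by (simp add: algebra_simps)
        then have "v y = v z \<or> (v y, v z) \<in> E"
          unfolding E_def using v[OF yz(2)] v[OF yz(3)] yz by blast
        then show ?case using step.IH by (auto intro: rtrancl_into_rtrancl)
      qed simp
      have "\<not> bounded (v ` {z. ((0, 0), z) \<in> (nbr_rel Z)\<^sup>*})"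
        using s Z nbr_rel_rtrancl_mem[OF _ Z(1)] v by (intro sites_unbounded[OF i12, of s]) auto
      moreover have "v ` {z. ((0, 0), z) \<in> (nbr_rel Z)\<^sup>*} \<subseteq> E\<^sup>* `` {v (0, 0)}" using reach by auto
      ultimately have "\<not> bounded (E\<^sup>* `` {v (0, 0)})" using bounded_subset by blast
      then show ?thesis using v[OF Z(1)] unfolding E_def by blast
    qed
    show "linked M \<Lambda> i1 i2 \<rho> q s"
      unfolding linked_def linking_scheme_def
    proof (rule exI[of _ s], rule exI[of _ 1], rule exI[of _ \<delta>], rule exI[of _ H],
        rule exI[of _ "\<lambda>z. {?c z}"], intro conjI allI ballI impI)
      fix \<omega> Z V
      assume "\<omega> \<in> space M" and *: "(0, 0) \<in> Z \<and> infinite {z. ((0, 0), z) \<in> (nbr_rel Z)\<^sup>*} \<and>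
        (\<forall>z\<in>Z. \<omega> \<in> H z \<and> (\<forall>c\<in>{?c z}. emeasure (\<Lambda> \<omega>) c \<ge> ennreal \<delta> \<longrightarrow> V \<inter> c \<noteq> {}))"
      show "\<exists>x\<in>V. \<not> bounded ({(x, y). x \<in> V \<and> y \<in> V \<and> x \<noteq> y \<and> dist x y \<le> \<rho> \<and>
          x \<in> (\<Union>z\<in>Z. ?c z) \<and> y \<in> (\<Union>z\<in>Z. ?c z)}\<^sup>* `` {x})"
        by (rule link) (use * in auto)
    qed (use rare \<delta> in \<open>auto simp: cube_borel\<close>)
  qed
qed

text \<open>The mass is also bounded away from 0 because stabilization provides independence only for
  events that fail for the zero measure.\<close>

lemma mass_bound_rare:
  assumes i12: "(i1 :: 'd) \<noteq> i2" and \<kappa>: "\<kappa> \<ge> 1"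
    and mean: "(\<integral>\<^sup>+\<omega>. emeasure (\<Lambda> \<omega>) (cube 1 0) \<partial>M) = 1" and q: "0 < q" "q \<le> 1"
  shows "\<exists>s0. \<forall>s\<ge>s0. \<exists>C\<ge>0. \<exists>H. rare M (\<lambda>z. space M - H z) q \<and>
    (\<forall>z. \<forall>\<omega>\<in>H z. emeasure (\<Lambda> \<omega>) (cube (real (\<kappa> * s)) (site i1 i2 s z)) \<le> ennreal C)"
proof -
  \<comment> \<open>The least factor with \<open>s * t > 3 * (\<kappa> * s)\<close>. The third in
    \<open>\<epsilon>\<close> shares the error among positive mass, bounded mass and small
    radius.\<close>
  define t where "t = 3 * \<kappa> + 1"
  define \<epsilon> where "\<epsilon> = q ^ (t * t) / 3"
  have \<epsilon>: "\<epsilon> > 0" using q by (simp add: \<epsilon>_def)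
  obtain n1 where n1: "\<And>n. n \<ge> n1 \<Longrightarrow> measure M {\<omega>\<in>space M. emeasure (\<Lambda> \<omega>) (cube (real n) 0) > 0} > 1 - \<epsilon>"
    using cube_charged[OF i12 mean \<epsilon>] by blast
  obtain n2 where n2: "\<And>n. n \<ge> n2 \<Longrightarrow> measure M {\<omega>\<in>space M. cube_radius R (real n) 0 \<omega> < of_nat n} > 1 - \<epsilon>"
    using cube_radius_small[OF \<epsilon>] by blast
  show ?thesis
  proof (intro exI[of _ "max 1 (max n1 n2)"] allI impI)
    fix s assume s: "s \<ge> max 1 (max n1 n2)"
    define n where "n = \<kappa> * s"
    have sn: "s \<le> n" using \<kappa> by (simp add: n_def)
    then have n: "n \<ge> 1" "n \<ge> n1" "n \<ge> n2" using s by auto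
    define A where "A = (\<lambda>k. {\<omega>\<in>space M. emeasure (\<Lambda> \<omega>) (cube (real n) 0) \<le> ennreal (real k)})"
    have A: "A k \<in> sets M" for k
      unfolding A_def using mass_measurable[OF cube_borel, of "real n" 0] by measurable
    have "incseq A"
    proof (rule incseq_SucI, rule subsetI)
      fix k \<omega> assume w: "\<omega> \<in> A k"
      have "ennreal (real k) \<le> ennreal (real (Suc k))" by (intro ennreal_leI) simp
      then show "\<omega> \<in> A (Suc k)" using w unfolding A_def by (auto intro: order_trans)
    qed
    then have "(\<lambda>k. measure M (A k)) \<longlonglongrightarrow> measure M (\<Union>k. A k)"
      using A by (intro finite_Lim_measure_incseq) auto
    moreover have "(\<Union>k. A k) = space M"
    proof (intro set_eqI iffI)
      fix \<omega> assume w: "\<omega> \<in> space M"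
      have "emeasure (\<Lambda> \<omega>) (cube (real n) 0) < \<infinity>"
        using w by (intro lfa_finite[OF \<Lambda>_lfa]) (auto simp: bounded_cube cube_borel)
      then obtain k :: nat where "emeasure (\<Lambda> \<omega>) (cube (real n) 0) < of_nat k"
        using ennreal_Ex_less_of_nat by (auto simp: infinity_ennreal_def)
      then have "\<omega> \<in> A k" using w by (auto simp: A_def ennreal_of_nat_eq_real_of_nat)
      then show "\<omega> \<in> (\<Union>k. A k)" by blast
    qed (auto simp: A_def)
    ultimately have "(\<lambda>k. measure M (A k)) \<longlonglongrightarrow> 1" by (simp add: prob_space)
    from order_tendstoD(1)[OF this, of "1 - \<epsilon>"] \<epsilon> obtain k where k: "measure M (A k) > 1 - \<epsilon>"
      by (auto simp: eventually_sequentially)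
    define F where "F = (\<lambda>m :: (real^'d) measure. emeasure m UNIV > 0 \<and> emeasure m UNIV \<le> ennreal (real k))"
    have F: "{m\<in>space locally_finite_algebra. F m} \<in> sets locally_finite_algebra"
      unfolding F_def using measurable_emeasure_locally_finite_algebra[of UNIV] by measurable
    have F0: "\<not> F (null_measure borel)" by (simp add: F_def)
    define H where "H = (\<lambda>z. stab_event M \<Lambda> R n F (site i1 i2 s z))"
    have rare: "rare M (\<lambda>z. space M - H z) q"
      unfolding H_def
    proof (rule stab_rare[OF F F0, where t = t])
      let ?A = "{\<omega>\<in>space M. emeasure (\<Lambda> \<omega>) (cube (real n) 0) > 0}"
      let ?B = "{\<omega>\<in>space M. cube_radius R (real n) 0 \<omega> < of_nat n}"
      have AB: "?A \<in> sets M" "?B \<in> sets M"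
        using mass_measurable[OF cube_borel, of "real n" 0] by measurable
      have "measure M (?A \<inter> ?B \<inter> A k) > 1 - ((\<epsilon> + \<epsilon>) + \<epsilon>)"
        by (intro prob_Int_gt AB A sets.Int n1 n2 n k)
      moreover have "?A \<inter> ?B \<inter> A k = stab_event M \<Lambda> R n F 0"
        using total_mass_translate[of _ "real n" 0] by (auto simp: stab_event_def F_def A_def)
      ultimately show "1 - q ^ (t * t) \<le> measure M (stab_event M \<Lambda> R n F 0)" by (simp add: \<epsilon>_def)
      show "3 * n < s * t" using s by (simp add: t_def n_def algebra_simps)
    qed (use n i12 q in auto)
    show "\<exists>C\<ge>0. \<exists>H. rare M (\<lambda>z. space M - H z) q \<and>
      (\<forall>z. \<forall>\<omega>\<in>H z. emeasure (\<Lambda> \<omega>) (cube (real (\<kappa> * s)) (site i1 i2 s z)) \<le> ennreal C)"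
    proof (intro exI[of _ "real k"] exI[of _ H] conjI allI ballI rare)
      fix z \<omega> assume "\<omega> \<in> H z"
      then show "emeasure (\<Lambda> \<omega>) (cube (real (\<kappa> * s)) (site i1 i2 s z)) \<le> ennreal (real k)"
        using total_mass_translate[of \<omega> "real n" "site i1 i2 s z"]
        by (auto simp: H_def stab_event_def F_def n_def)
    qed simp
  qed
qed

end

section \<open>Chains in compact sets\<close>

definition chain :: "real \<Rightarrow> 'a::metric_space set \<Rightarrow> ('a \<times> 'a) set" where
  "chain \<epsilon> K = {(x, y). x \<in> K \<and> y \<in> K \<and> dist x y \<le> \<epsilon>}"

lemma chain_mono: "\<epsilon> \<le> \<delta> \<Longrightarrow> K \<subseteq> L \<Longrightarrow> chain \<epsilon> K \<subseteq> chain \<delta> L"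
  by (auto simp: chain_def)

lemma chain_rtrancl_sym: "(x, y) \<in> (chain \<epsilon> K)\<^sup>* \<Longrightarrow> (y, x) \<in> (chain \<epsilon> K)\<^sup>*"
proof -
  have "sym (chain \<epsilon> K)" by (auto simp: sym_def chain_def dist_commute)
  then show "(x, y) \<in> (chain \<epsilon> K)\<^sup>* \<Longrightarrow> (y, x) \<in> (chain \<epsilon> K)\<^sup>*" by (meson sym_rtrancl symD)
qed

text \<open>Being joined by a \<open>\<delta>\<close>-chain is an equivalence relation whose classes
  are relatively open, so a connected set has only one class.\<close>

lemma connected_chain:
  assumes "connected C" "x \<in> C" "y \<in> C" "\<delta> > 0"
  shows "(x, y) \<in> (chain \<delta> C)\<^sup>*"
proof (rule connected_equivalence_relation[OF assms(1-3)])
  fix a assume a: "a \<in> C"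
  show "\<exists>T. openin (top_of_set C) T \<and> a \<in> T \<and> (\<forall>x\<in>T. (a, x) \<in> (chain \<delta> C)\<^sup>*)"
  proof (intro exI[of _ "C \<inter> ball a \<delta>"] conjI ballI)
    show "openin (top_of_set C) (C \<inter> ball a \<delta>)" by (rule openin_open_Int) simp
    fix x assume "x \<in> C \<inter> ball a \<delta>"
    then show "(a, x) \<in> (chain \<delta> C)\<^sup>*" using a by (intro r_into_rtrancl) (auto simp: chain_def)
  qed (use a assms in auto)
qed (auto intro: chain_rtrancl_sym rtrancl_trans)

text \<open>A component of diameter less than \<open>t\<close> has a relatively clopen neighbourhood of diameter less
  than \<open>t\<close>, which short chains cannot leave.\<close>

lemma small_component_chain:
  fixes K :: "'a::euclidean_space set"
  assumes K: "compact K" and a: "a \<in> K" and t: "diameter (connected_component_set K a) < t"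
  shows "\<exists>\<epsilon>>0. \<forall>b v w \<epsilon>'. b \<in> K \<and> dist a b < \<epsilon> \<and> \<epsilon>' \<le> \<epsilon> \<and> (b, v) \<in> (chain \<epsilon>' K)\<^sup>* \<and>
    (b, w) \<in> (chain \<epsilon>' K)\<^sup>* \<longrightarrow> dist v w < t"
proof -
  define C where "C = connected_component_set K a"
  have C: "C \<in> components K" using a by (auto simp: C_def components_def)
  have cC: "compact C" by (rule compact_components[OF K C])
  have aC: "a \<in> C" using a by (simp add: C_def)
  \<comment> \<open>A third of the gap: points of \<open>W\<close> are at distance at most
    \<open>diameter C + 2 * \<eta> < t\<close> from each other.\<close>
  define \<eta> where "\<eta> = (t - diameter C) / 3"
  have \<eta>: "\<eta> > 0" using t by (simp add: \<eta>_def C_def)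
  define W where "W = (\<Union>c\<in>C. ball c \<eta>)"
  have W: "open W" "C \<subseteq> W" using \<eta> by (auto simp: W_def)
  obtain U where U: "openin (top_of_set K) U" "compact U" "C \<subseteq> U" "U \<subseteq> W"
    using Sura_Bura_clopen_subset[OF closed_imp_locally_compact[OF compact_imp_closed[OF K]] C cC W] .
  have dU: "dist v w < t" if vw: "v \<in> U" "w \<in> U" for v w
  proof -
    have "v \<in> W" "w \<in> W" using vw U(4) by auto
    then obtain c c' where c: "c \<in> C" "dist c v < \<eta>" "c' \<in> C" "dist c' w < \<eta>"
      unfolding W_def UN_iff mem_ball by blast
    have "dist c c' \<le> diameter C" using c cC by (intro diameter_bounded_bound compact_imp_bounded) auto
    moreover have "dist v w \<le> dist c v + dist c c' + dist c' w" by (metis dist_commute dist_triangle3 dist_triangle_le add.commute add_left_mono)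
    ultimately show ?thesis using c \<eta> by (simp add: \<eta>_def)
  qed
  have "closed (K - U)"
  proof -
    obtain T where "open T" "U = K \<inter> T" using U(1) by (auto simp: openin_open)
    then have "K - U = K - T" by auto
    then show ?thesis using K \<open>open T\<close> by (auto intro: closed_Diff compact_imp_closed)
  qed
  \<comment> \<open>Since \<open>U\<close> is compact and relatively open in \<open>K\<close>, it is
    at positive distance from the rest of \<open>K\<close>. Steps of length at most
    \<open>d / 2\<close> cannot cross this gap.\<close>
  then obtain d where d: "d > 0" "\<And>x y. x \<in> U \<Longrightarrow> y \<in> K - U \<Longrightarrow> d \<le> dist x y"
    using separate_compact_closed[OF U(2), of "K - U"] by auto
  have stay: "v \<in> U" if "(b, v) \<in> (chain \<epsilon>' K)\<^sup>*" "b \<in> U" "\<epsilon>' \<le> d / 2" for b v \<epsilon>'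
    using that(1)
  proof (induction rule: rtrancl_induct)
    case (step y z)
    then have "dist y z \<le> \<epsilon>'" "z \<in> K" by (auto simp: chain_def)
    then show ?case using d that(3) step.IH by (cases "z \<in> U") force+
  qed (rule that(2))
  show ?thesis
  proof (intro exI[of _ "d / 2"] conjI allI impI)
    fix b v w \<epsilon>' assume *: "b \<in> K \<and> dist a b < d / 2 \<and> \<epsilon>' \<le> d / 2 \<and> (b, v) \<in> (chain \<epsilon>' K)\<^sup>* \<and>
      (b, w) \<in> (chain \<epsilon>' K)\<^sup>*"
    have "b \<in> U"
    proof (rule ccontr)
      assume "b \<notin> U"
      then have "d \<le> dist a b" using d(2)[of a b] aC U(3) * by auto
      then show False using * d(1) by linarith
    qed
    then show "dist v w < t" using * stay dU by meson
  qed (use d in simp)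
qed

text \<open>Fine chains around a point with a short component are short, so a long chain shows that
  a point with a long component is near. Compactness makes "fine" and "near" uniform over
  \<open>K\<close>. The two long components found in this way lie in one component of
  \<open>K'\<close>, where chains of any fineness exist.\<close>

lemma long_chains_linked:
  fixes K K' :: "'a::euclidean_space set"
  assumes K: "compact K" "K \<subseteq> K'" and \<delta>: "\<delta> > 0"
    and comp: "\<And>C1 C2. C1 \<in> components K \<Longrightarrow> C2 \<in> components K \<Longrightarrow> diameter C1 \<ge> t \<Longrightarrow>
      diameter C2 \<ge> t \<Longrightarrow> \<exists>D\<in>components K'. C1 \<subseteq> D \<and> C2 \<subseteq> D"
  shows "\<exists>\<epsilon>>0. \<forall>a\<in>K. \<forall>b\<in>K. (\<exists>v w. (a, v) \<in> (chain \<epsilon> K)\<^sup>* \<and> (a, w) \<in> (chain \<epsilon> K)\<^sup>* \<and> dist v w \<ge> t) \<longrightarrow>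
    (\<exists>v w. (b, v) \<in> (chain \<epsilon> K)\<^sup>* \<and> (b, w) \<in> (chain \<epsilon> K)\<^sup>* \<and> dist v w \<ge> t) \<longrightarrow>
    (a, b) \<in> (chain \<delta> K')\<^sup>*"
proof -
  let ?C = "connected_component_set K"
  have "\<forall>x\<in>K. \<exists>e>0. e \<le> \<delta> \<and> (diameter (?C x) < t \<longrightarrow> (\<forall>b v w \<epsilon>'. b \<in> K \<and> dist x b < e \<and> \<epsilon>' \<le> e \<and>
    (b, v) \<in> (chain \<epsilon>' K)\<^sup>* \<and> (b, w) \<in> (chain \<epsilon>' K)\<^sup>* \<longrightarrow> dist v w < t))"
  proof
    fix x assume x: "x \<in> K"
    show "\<exists>e>0. e \<le> \<delta> \<and> (diameter (?C x) < t \<longrightarrow> (\<forall>b v w \<epsilon>'. b \<in> K \<and> dist x b < e \<and> \<epsilon>' \<le> e \<and>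
      (b, v) \<in> (chain \<epsilon>' K)\<^sup>* \<and> (b, w) \<in> (chain \<epsilon>' K)\<^sup>* \<longrightarrow> dist v w < t))"
    proof (cases "diameter (?C x) < t")
      case True
      from small_component_chain[OF K(1) x this] obtain e where e: "e > 0"
        "\<And>b v w \<epsilon>'. b \<in> K \<and> dist x b < e \<and> \<epsilon>' \<le> e \<and> (b, v) \<in> (chain \<epsilon>' K)\<^sup>* \<and> (b, w) \<in> (chain \<epsilon>' K)\<^sup>* \<Longrightarrow> dist v w < t"
        by blast
      show ?thesis using e \<delta> by (intro exI[of _ "min e \<delta>"]) auto
    next
      case False
      then show ?thesis using \<delta> by (intro exI[of _ \<delta>]) auto
    qed
  qed
  then obtain e where e0: "\<And>x. x \<in> K \<Longrightarrow> e x > 0 \<and> e x \<le> \<delta>"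
    and e: "\<And>x b v w \<epsilon>'. x \<in> K \<Longrightarrow> diameter (?C x) < t \<Longrightarrow> b \<in> K \<Longrightarrow> dist x b < e x \<Longrightarrow> \<epsilon>' \<le> e x \<Longrightarrow>
      (b, v) \<in> (chain \<epsilon>' K)\<^sup>* \<Longrightarrow> (b, w) \<in> (chain \<epsilon>' K)\<^sup>* \<Longrightarrow> dist v w < t"
    by (metis (no_types, lifting))
  have "K \<subseteq> (\<Union>x\<in>K. ball x (e x))" using e0 by force
  then obtain T where T: "T \<subseteq> K" "finite T" "K \<subseteq> (\<Union>x\<in>T. ball x (e x))"
    using compactE_image[OF K(1), of K "\<lambda>x. ball x (e x)"] by auto
  \<comment> \<open>Inserting \<open>\<delta>\<close> keeps the minimum meaningful when
    \<open>K\<close> is empty and no ball is selected.\<close>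
  define \<epsilon> where "\<epsilon> = Min (insert \<delta> (e ` T))"
  have \<epsilon>: "\<epsilon> > 0" "\<And>x. x \<in> T \<Longrightarrow> \<epsilon> \<le> e x" using T e0 \<delta> by (auto simp: \<epsilon>_def)
  have near: "\<exists>x\<in>K. dist x a < \<delta> \<and> diameter (?C x) \<ge> t"
    if a: "a \<in> K" and vw: "(a, v) \<in> (chain \<epsilon> K)\<^sup>*" "(a, w) \<in> (chain \<epsilon> K)\<^sup>*" "dist v w \<ge> t" for a v w
  proof -
    obtain x where x: "x \<in> T" "dist x a < e x" using T(3) a by auto
    then have xK: "x \<in> K" using T by auto
    have "\<not> diameter (?C x) < t" using e[OF xK _ a x(2) \<epsilon>(2)[OF x(1)] vw(1,2)] vw(3) by force
    then show ?thesis using x e0[OF xK] xK by (intro bexI[of _ x]) auto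
  qed
  show ?thesis
  proof (intro exI[of _ \<epsilon>] conjI ballI impI \<epsilon>(1))
    fix a b assume a: "a \<in> K" and b: "b \<in> K"
      and "\<exists>v w. (a, v) \<in> (chain \<epsilon> K)\<^sup>* \<and> (a, w) \<in> (chain \<epsilon> K)\<^sup>* \<and> dist v w \<ge> t"
      and "\<exists>v w. (b, v) \<in> (chain \<epsilon> K)\<^sup>* \<and> (b, w) \<in> (chain \<epsilon> K)\<^sup>* \<and> dist v w \<ge> t"
    then obtain x y where x: "x \<in> K" "dist x a < \<delta>" "diameter (?C x) \<ge> t"
      and y: "y \<in> K" "dist y b < \<delta>" "diameter (?C y) \<ge> t" using near by metis
    have "?C x \<in> components K" "?C y \<in> components K" using x y by (auto simp: components_def)
    then obtain D where D: "D \<in> components K'" "?C x \<subseteq> D" "?C y \<subseteq> D" using comp x y by blast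
    have DK: "D \<subseteq> K'" by (rule in_components_subset[OF D(1)])
    have "x \<in> D" "y \<in> D" using D x y by (auto simp: subset_iff)
    then have "(x, y) \<in> (chain \<delta> D)\<^sup>*"
      using in_components_connected[OF D(1)] \<delta> by (intro connected_chain)
    then have "(x, y) \<in> (chain \<delta> K')\<^sup>*" using rtrancl_mono[OF chain_mono[OF order_refl DK]] by blast
    moreover have "(a, x) \<in> chain \<delta> K'" "(y, b) \<in> chain \<delta> K'"
      using a b x y K by (auto simp: chain_def dist_commute)
    ultimately show "(a, b) \<in> (chain \<delta> K')\<^sup>*"
      by (meson converse_rtrancl_into_rtrancl rtrancl_into_rtrancl)
  qed
qed

section \<open>Supports and occupied cells\<close>

lemma dist_le_components:
  fixes x y :: "real^'d"
  assumes "\<And>i. \<bar>x $ i - y $ i\<bar> \<le> a"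
  shows "dist x y \<le> real CARD('d) * a"
proof -
  have "dist x y \<le> (\<Sum>i\<in>UNIV. \<bar>(x - y) $ i\<bar>)" unfolding dist_norm by (rule norm_le_l1_cart)
  also have "\<dots> \<le> (\<Sum>i\<in>(UNIV::'d set). a)" using assms by (intro sum_mono) simp
  finally show ?thesis by simp
qed

section \<open>Occupied cells of the grid of mesh \<open>1 / k\<close>\<close>

definition idx :: "nat \<Rightarrow> real^'d \<Rightarrow> int^'d" where
  "idx k x = (\<chi> i. \<lfloor>real k * x $ i\<rfloor>)"

definition gcell :: "nat \<Rightarrow> int^'d \<Rightarrow> (real^'d) set" where
  "gcell k u = {x. idx k x = u}"

definition corner :: "nat \<Rightarrow> int^'d \<Rightarrow> real^'d" where
  "corner k u = (\<chi> i. of_int (u $ i) / real k)"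

text \<open>The support cannot be read off from finitely many masses, the set of charged cells
  inside a bounded set can. It approximates the support up to neighbouring cells and so brings
  connectedness within reach of measurable events.\<close>

definition occ :: "nat \<Rightarrow> (real^'d) measure \<Rightarrow> (real^'d) set \<Rightarrow> (int^'d) set" where
  "occ k m Q = {u. emeasure m (gcell k u \<inter> Q) > 0}"

lemma gcell_borel [measurable]: "gcell k u \<in> sets borel"
proof -
  have "gcell k u = (\<Inter>i. {x. of_int (u $ i) \<le> real k * x $ i \<and> real k * x $ i < of_int (u $ i) + 1})"
    by (auto simp: gcell_def idx_def vec_eq_iff floor_eq_iff)
  also have "\<dots> \<in> sets borel"
  proof (intro sets.countable_INT'' ballI)
    fix i :: 'a
    have "(\<lambda>x::real^'a. x $ i) \<in> borel_measurable borel"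
      by (intro borel_measurable_continuous_onI continuous_intros)
    then show "{x. of_int (u $ i) \<le> real k * x $ i \<and> real k * x $ i < of_int (u $ i) + 1} \<in> sets borel"
      by measurable
  qed auto
  finally show ?thesis .
qed

lemma finite_int_box: "finite {u :: int^'d. \<forall>i. \<bar>u $ i - a $ i\<bar> \<le> B}"
proof -
  have "finite (PiE (UNIV :: 'd set) (\<lambda>i. {a $ i - B..a $ i + B}))" by (intro finite_PiE) auto
  then have "finite (vec_lambda ` PiE (UNIV :: 'd set) (\<lambda>i. {a $ i - B..a $ i + B}))" by (rule finite_imageI)
  moreover have "{u. \<forall>i. \<bar>u $ i - a $ i\<bar> \<le> B} \<subseteq> vec_lambda ` PiE (UNIV :: 'd set) (\<lambda>i. {a $ i - B..a $ i + B})"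
  proof
    fix u :: "int^'d" assume u: "u \<in> {u. \<forall>i. \<bar>u $ i - a $ i\<bar> \<le> B}"
    have "a $ i - B \<le> u $ i \<and> u $ i \<le> a $ i + B" for i
      using spec[OF u[unfolded mem_Collect_eq], of i] by linarith
    then show "u \<in> vec_lambda ` PiE (UNIV :: 'd set) (\<lambda>i. {a $ i - B..a $ i + B})"
      by (intro image_eqI[of _ _ "\<lambda>i. u $ i"]) auto
  qed
  ultimately show ?thesis by (rule finite_subset[rotated])
qed

lemma finite_idx_cube: "finite (idx k ` cube n x)"
proof (rule finite_subset[OF _ finite_int_box[of "idx k x" "\<lceil>real k * (n / 2)\<rceil>"]], rule image_subsetI)
  fix y assume y: "y \<in> cube n x"
  show "idx k y \<in> {u. \<forall>i. \<bar>u $ i - idx k x $ i\<bar> \<le> \<lceil>real k * (n / 2)\<rceil>}"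
  proof (rule CollectI, rule allI)
    fix i
    have "\<bar>y $ i - x $ i\<bar> \<le> n / 2" using y by (simp add: mem_cube)
    then have "real k * \<bar>y $ i - x $ i\<bar> \<le> real k * (n / 2)" by (rule mult_left_mono) simp
    then have "\<bar>real k * (y $ i - x $ i)\<bar> \<le> real k * (n / 2)" by (simp add: abs_mult)
    then have "\<bar>real k * y $ i - real k * x $ i\<bar> \<le> real k * (n / 2)" by (simp add: right_diff_distrib)
    then show "\<bar>idx k y $ i - idx k x $ i\<bar> \<le> \<lceil>real k * (n / 2)\<rceil>" unfolding idx_def vec_lambda_beta
      using le_of_int_ceiling[of "real k * (n / 2)"] by linarith
  qed
qed

lemma occ_subset: "occ k m Q \<subseteq> idx k ` Q"
proof
  fix u assume "u \<in> occ k m Q"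
  then have "gcell k u \<inter> Q \<noteq> {}" by (auto simp: occ_def)
  then show "u \<in> idx k ` Q" by (auto simp: gcell_def)
qed

lemma occ_mono:
  assumes "sets m = sets borel" "Q \<subseteq> Q'" "Q' \<in> sets borel"
  shows "occ k m Q \<subseteq> occ k m Q'"
proof
  fix u assume u: "u \<in> occ k m Q"
  have "emeasure m (gcell k u \<inter> Q) \<le> emeasure m (gcell k u \<inter> Q')"
    using assms by (intro emeasure_mono) auto
  then show "u \<in> occ k m Q'" using u by (auto simp: occ_def)
qed

lemma measure_support_mono:
  assumes "sets m = sets borel" "Q \<subseteq> Q'" "Q \<in> sets borel" "Q' \<in> sets borel"
  shows "measure_support (restrict_to Q m) \<subseteq> measure_support (restrict_to Q' m)"
proof
  fix x assume x: "x \<in> measure_support (restrict_to Q m)"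
  have "emeasure (restrict_to Q' m) U > 0" if U: "open U" "x \<in> U" for U
  proof -
    have "0 < emeasure (restrict_to Q m) U" using x U by (auto simp: measure_support_def)
    also have "\<dots> \<le> emeasure (restrict_to Q' m) U"
      using assms U by (simp add: emeasure_restrict_to, intro emeasure_mono) auto
    finally show ?thesis .
  qed
  then show "x \<in> measure_support (restrict_to Q' m)" by (auto simp: measure_support_def)
qed

lemma closed_measure_support: "closed (measure_support m)"
proof -
  have "- measure_support m = \<Union>{U. open U \<and> \<not> emeasure m U > 0}" by (auto simp: measure_support_def)
  moreover have "open (\<Union>{U. open U \<and> \<not> emeasure m U > 0})" by (rule open_Union) auto
  ultimately show ?thesis by (simp add: closed_def)
qed

lemma measure_support_subset:
  assumes "sets m = sets borel" "closed Q"
  shows "measure_support (restrict_to Q m) \<subseteq> Q"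
proof (rule ccontr)
  assume "\<not> ?thesis"
  then obtain x where x: "x \<in> measure_support (restrict_to Q m)" "x \<notin> Q" by blast
  have "open (- Q)" using assms by (simp add: open_Compl)
  then have "emeasure (restrict_to Q m) (- Q) > 0" using x by (auto simp: measure_support_def)
  moreover have "emeasure (restrict_to Q m) (- Q) = 0"
    using assms by (subst emeasure_restrict_to) auto
  ultimately show False by simp
qed

lemma compact_support_cube:
  assumes "sets m = sets borel"
  shows "compact (measure_support (restrict_to (cube n x) m))"
proof -
  have "measure_support (restrict_to (cube n x) m) = cube n x \<inter> measure_support (restrict_to (cube n x) m)"
    using measure_support_subset[OF assms, of "cube n x"] compact_cube[of n x] by (auto simp: compact_imp_closed)
  also have "compact \<dots>" by (rule compact_Int_closed[OF compact_cube closed_measure_support])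
  finally show ?thesis .
qed

text \<open>The complement of the support is a union of open null sets, of which countably many
  suffice by Lindeloef.\<close>

lemma outside_support_null:
  fixes m :: "(real^'d) measure"
  assumes "sets m = sets borel"
  shows "emeasure m (- measure_support m) = 0"
proof -
  obtain \<F> where F: "\<F> \<subseteq> {U. open U \<and> \<not> emeasure m U > 0}" "countable \<F>" "\<Union>\<F> = \<Union>{U. open U \<and> \<not> emeasure m U > 0}"
    using Lindelof[of "{U. open U \<and> \<not> emeasure m U > 0}"] by blast
  have "- measure_support m = (\<Union>U\<in>\<F>. U)" using F(3) by (auto simp: measure_support_def)
  moreover have "(\<Union>U\<in>\<F>. U) \<in> null_sets m"
    using F assms by (intro null_sets_UN') (auto simp: null_sets_def)
  ultimately show ?thesis by auto
qed

lemma occ_support_point: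
  assumes m: "sets m = sets borel" and Q: "Q \<in> sets borel" and u: "u \<in> occ k m Q"
  shows "\<exists>x\<in>gcell k u. x \<in> measure_support (restrict_to Q m)"
proof (rule ccontr)
  assume "\<not> ?thesis"
  then have "gcell k u \<subseteq> - measure_support (restrict_to Q m)" by blast
  then have "emeasure (restrict_to Q m) (gcell k u) \<le> emeasure (restrict_to Q m) (- measure_support (restrict_to Q m))"
    using m closed_measure_support[of "restrict_to Q m"] by (intro emeasure_mono) (auto simp: open_Compl)
  then have "emeasure m (Q \<inter> gcell k u) = 0"
    using outside_support_null[of "restrict_to Q m"] m Q by (simp add: emeasure_restrict_to)
  then show False using u by (simp add: occ_def Int_commute)
qed

text \<open>The open box of half-side \<open>1 / k\<close> around the point is charged and is
  covered by the cells whose indices differ by at most one. The cell of the point itself may carry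
  no mass, hence the tolerance of one index.\<close>

lemma support_occ:
  fixes m :: "(real^'d) measure"
  assumes m: "sets m = sets borel" and Q: "Q \<in> sets borel" and k: "k > 0"
    and x: "x \<in> measure_support (restrict_to Q m)"
  shows "\<exists>u\<in>occ k m Q. \<forall>i. \<bar>u $ i - idx k x $ i\<bar> \<le> 1"
proof (rule ccontr)
  assume neg: "\<not> ?thesis"
  define N where "N = {u. \<forall>i. \<bar>u $ i - idx k x $ i\<bar> \<le> 1}"
  have fN: "finite N" unfolding N_def by (rule finite_int_box)
  define U where "U = box (\<chi> i. x $ i - 1 / real k) (\<chi> i. x $ i + 1 / real k)"
  have oU: "open U" "x \<in> U" using k by (auto simp: U_def mem_box_cart open_box)
  have sub: "Q \<inter> U \<subseteq> (\<Union>u\<in>N. gcell k u \<inter> Q)"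
  proof
    fix y assume y: "y \<in> Q \<inter> U"
    have "idx k y \<in> N"
      unfolding N_def
    proof (rule CollectI, rule allI)
      fix i
      have "x $ i - 1 / real k < y $ i" "y $ i < x $ i + 1 / real k"
        using y by (auto simp: U_def mem_box_cart)
      then have "real k * x $ i - 1 < real k * y $ i" "real k * y $ i < real k * x $ i + 1"
        using k by (auto simp: field_simps)
      then show "\<bar>idx k y $ i - idx k x $ i\<bar> \<le> 1" by (simp add: idx_def) linarith
    qed
    then show "y \<in> (\<Union>u\<in>N. gcell k u \<inter> Q)" using y by (auto simp: gcell_def)
  qed
  have "(\<Union>u\<in>N. gcell k u \<inter> Q) \<in> null_sets m"
  proof (rule null_sets.finite_UN[OF fN])
    fix u assume "u \<in> N"
    then have "\<not> emeasure m (gcell k u \<inter> Q) > 0" using neg by (auto simp: N_def occ_def)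
    then show "gcell k u \<inter> Q \<in> null_sets m" using m Q by (auto simp: null_sets_def)
  qed
  then have "Q \<inter> U \<in> null_sets m"
    using sub m Q oU by (intro null_sets_subset[OF _ _ sub]) auto
  then have "emeasure (restrict_to Q m) U = 0" using m Q oU by (simp add: emeasure_restrict_to null_sets_def)
  then show False using x oU by (auto simp: measure_support_def)
qed

section \<open>Chains of cells\<close>

definition cchain :: "int \<Rightarrow> (int^'d) set \<Rightarrow> ((int^'d) \<times> (int^'d)) set" where
  "cchain r S = {(u, v). u \<in> S \<and> v \<in> S \<and> (\<forall>i. \<bar>u $ i - v $ i\<bar> \<le> r)}"

text \<open>Discrete counterpart of lying in a component of diameter at least \<open>\<tau>\<close>.
  The step 3 is what a chain of support points with steps \<open>1 / k\<close> turns into: one for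
  the step and one for the index error at either end.\<close>

definition big :: "nat \<Rightarrow> real \<Rightarrow> (int^'d) set \<Rightarrow> (int^'d) set" where
  "big k \<tau> S = {u\<in>S. \<exists>v w. (u, v) \<in> (cchain 3 S)\<^sup>* \<and> (u, w) \<in> (cchain 3 S)\<^sup>* \<and> dist (corner k v) (corner k w) \<ge> \<tau>}"

lemma cchain_mono: "S \<subseteq> T \<Longrightarrow> cchain r S \<subseteq> cchain r T"
  by (auto simp: cchain_def)

lemma bigI:
  "u \<in> S \<Longrightarrow> (u, v) \<in> (cchain 3 S)\<^sup>* \<Longrightarrow> (u, w) \<in> (cchain 3 S)\<^sup>* \<Longrightarrow>
    dist (corner k v) (corner k w) \<ge> \<tau> \<Longrightarrow> u \<in> big k \<tau> S"
  unfolding big_def by blast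

lemma bigE:
  assumes "u \<in> big k \<tau> S"
  obtains v w where "u \<in> S" "(u, v) \<in> (cchain 3 S)\<^sup>*" "(u, w) \<in> (cchain 3 S)\<^sup>*"
    "dist (corner k v) (corner k w) \<ge> \<tau>"
  using assms unfolding big_def by blast

lemma big_mono:
  assumes "S \<subseteq> T"
  shows "big k \<tau> S \<subseteq> big k \<tau> T"
proof
  fix u assume "u \<in> big k \<tau> S"
  then obtain v w where *: "u \<in> S" "(u, v) \<in> (cchain 3 S)\<^sup>*" "(u, w) \<in> (cchain 3 S)\<^sup>*"
    "dist (corner k v) (corner k w) \<ge> \<tau>" by (rule bigE)
  note sub = rtrancl_mono[OF cchain_mono[OF assms]]
  show "u \<in> big k \<tau> T"
    by (rule bigI[OF _ subsetD[OF sub *(2)] subsetD[OF sub *(3)] *(4)]) (use * assms in blast)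
qed

lemma cchain_shift:
  assumes "(u, v) \<in> (cchain r S)\<^sup>*"
  shows "(u + a, v + a) \<in> (cchain r ((\<lambda>u. u + a) ` S))\<^sup>*"
  using assms
proof (induction rule: rtrancl_induct)
  case (step y z)
  then have "(y + a, z + a) \<in> cchain r ((\<lambda>u. u + a) ` S)" by (auto simp: cchain_def)
  with step.IH show ?case by (rule rtrancl_into_rtrancl)
qed simp

lemma corner_shift: "dist (corner k (u + a)) (corner k (v + a)) = dist (corner k u) (corner k v)"
proof -
  have "corner k (u + a) - corner k (v + a) = corner k u - corner k v"
    by (simp add: corner_def vec_eq_iff diff_divide_distrib[symmetric])
  then show ?thesis by (simp add: dist_norm)
qed

lemma big_shift:
  assumes "u \<in> big k \<tau> S"
  shows "u + a \<in> big k \<tau> ((\<lambda>u. u + a) ` S)"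
proof -
  from assms obtain v w where *: "u \<in> S" "(u, v) \<in> (cchain 3 S)\<^sup>*" "(u, w) \<in> (cchain 3 S)\<^sup>*"
    "dist (corner k v) (corner k w) \<ge> \<tau>" by (rule bigE)
  show ?thesis
    by (rule bigI[OF _ cchain_shift[OF *(2)] cchain_shift[OF *(3)]]) (use * in \<open>auto simp: corner_shift\<close>)
qed

lemma near_corner:
  assumes "\<And>i. \<bar>u $ i - idx k x $ i\<bar> \<le> 1" "k > 0"
  shows "dist (corner k u) (x :: real^'d) \<le> real CARD('d) * (2 / real k)"
proof (rule dist_le_components)
  fix i
  have "\<bar>of_int (u $ i) - real k * x $ i\<bar> \<le> 2" using assms(1)[of i] by (simp add: idx_def) linarith
  then show "\<bar>corner k u $ i - x $ i\<bar> \<le> 2 / real k"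
    using assms(2) by (simp add: corner_def abs_le_iff field_simps)
qed

lemma gcell_dist:
  fixes x y :: "real^'d"
  assumes "x \<in> gcell k u" "y \<in> gcell k v" "\<And>i. \<bar>u $ i - v $ i\<bar> \<le> r" "k > 0"
  shows "dist x y \<le> real CARD('d) * ((of_int r + 1) / real k)"
proof (rule dist_le_components)
  fix i
  have "u $ i = \<lfloor>real k * x $ i\<rfloor>" "v $ i = \<lfloor>real k * y $ i\<rfloor>" using assms by (auto simp: gcell_def idx_def)
  then have "\<bar>real k * x $ i - real k * y $ i\<bar> \<le> of_int r + 1" using assms(3)[of i] by linarith
  moreover have "\<bar>real k * x $ i - real k * y $ i\<bar> = real k * \<bar>x $ i - y $ i\<bar>"
    unfolding right_diff_distrib[symmetric] abs_mult by simp
  ultimately have "real k * \<bar>x $ i - y $ i\<bar> \<le> of_int r + 1" by simp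
  then show "\<bar>x $ i - y $ i\<bar> \<le> (of_int r + 1) / real k" using assms(4) by (simp add: field_simps)
qed

text \<open>From support points to charged cells. The charged cell near a support point may be off
  by one index, at both ends of a step, hence \<open>r0 + 2\<close>.\<close>

lemma lift_chain:
  fixes m :: "(real^'d) measure"
  assumes m: "sets m = sets borel" and Q: "Q \<in> sets borel" and k: "k > 0"
    and xy: "(x, y) \<in> (chain \<eta> (measure_support (restrict_to Q m)))\<^sup>*" and \<eta>: "real k * \<eta> \<le> of_int r0"
    and u: "u \<in> occ k m Q" "\<And>i. \<bar>u $ i - idx k x $ i\<bar> \<le> 1"
  shows "\<exists>v\<in>occ k m Q. (\<forall>i. \<bar>v $ i - idx k y $ i\<bar> \<le> 1) \<and> (u, v) \<in> (cchain (r0 + 2) (occ k m Q))\<^sup>*"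
  using xy
proof (induction rule: rtrancl_induct)
  case base
  show ?case using u by (intro bexI[of _ u]) auto
next
  case (step y z)
  then obtain v where v: "v \<in> occ k m Q" "\<And>i. \<bar>v $ i - idx k y $ i\<bar> \<le> 1" "(u, v) \<in> (cchain (r0 + 2) (occ k m Q))\<^sup>*"
    by blast
  have yz: "z \<in> measure_support (restrict_to Q m)" "dist y z \<le> \<eta>" using step.hyps by (auto simp: chain_def)
  obtain w where w: "w \<in> occ k m Q" "\<And>i. \<bar>w $ i - idx k z $ i\<bar> \<le> 1" using support_occ[OF m Q k yz(1)] by blast
  have "\<bar>v $ i - w $ i\<bar> \<le> r0 + 2" for i
  proof -
    have "\<bar>y $ i - z $ i\<bar> \<le> \<eta>" using component_le_norm_cart[of "y - z" i] yz(2) by (simp add: dist_norm)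
    then have "real k * \<bar>y $ i - z $ i\<bar> \<le> real k * \<eta>" by (intro mult_left_mono) auto
    then have "real k * \<bar>y $ i - z $ i\<bar> \<le> of_int r0" using \<eta> by linarith
    moreover have "\<bar>real k * y $ i - real k * z $ i\<bar> = real k * \<bar>y $ i - z $ i\<bar>"
      unfolding right_diff_distrib[symmetric] abs_mult by simp
    ultimately have "\<bar>real k * y $ i - real k * z $ i\<bar> \<le> of_int r0" by simp
    then have "\<bar>idx k y $ i - idx k z $ i\<bar> \<le> r0" unfolding idx_def by simp linarith
    then show ?thesis using v(2)[of i] w(2)[of i] by linarith
  qed
  then have "(v, w) \<in> cchain (r0 + 2) (occ k m Q)" using v w by (auto simp: cchain_def)
  then show ?case using v w by (intro bexI[of _ w]) (auto intro: rtrancl_into_rtrancl)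
qed

text \<open>From charged cells back to points chosen in them: an index difference \<open>r\<close>
  allows a distance of \<open>(r + 1) / k\<close> in every coordinate.\<close>

lemma lower_chain:
  fixes m :: "(real^'d) measure"
  assumes k: "k > 0"
    and p: "\<And>u. u \<in> S \<Longrightarrow> p u \<in> gcell k u \<and> p u \<in> T"
    and uv: "(u, v) \<in> (cchain r S)\<^sup>*"
  shows "(p u, p v :: real^'d) \<in> (chain (real CARD('d) * ((of_int r + 1) / real k)) T)\<^sup>*"
  using uv
proof (induction rule: rtrancl_induct)
  case (step y z)
  then have yz: "y \<in> S" "z \<in> S" "\<And>i. \<bar>y $ i - z $ i\<bar> \<le> r" by (auto simp: cchain_def)
  have "dist (p y) (p z) \<le> real CARD('d) * ((of_int r + 1) / real k)"
    by (rule gcell_dist[OF _ _ yz(3) k]) (use p yz in auto)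
  then have "(p y, p z) \<in> chain (real CARD('d) * ((of_int r + 1) / real k)) T" using p yz by (auto simp: chain_def)
  with step.IH show ?case by (rule rtrancl_into_rtrancl)
qed simp

section \<open>Linking through the support\<close>

lemma cchain_mem: "(u, v) \<in> (cchain r S)\<^sup>* \<Longrightarrow> u \<in> S \<Longrightarrow> v \<in> S"
  by (induction rule: rtrancl_induct) (auto simp: cchain_def)

text \<open>The two conditions of asymptotic essential connectedness in discrete form. The first,
  for the side \<open>2 * s\<close>, provides diameter \<open>2 / 3 * s\<close>; the second, for the
  side \<open>4 * s\<close>, accepts diameter \<open>4 / 9 * s\<close> and connects within the side
  \<open>8 * s\<close>. The threshold \<open>5 / 9 * s\<close> lies strictly between, which leaves
  room for discretization errors in both directions.\<close>

definition good_link :: "nat \<Rightarrow> int \<Rightarrow> (real^'d) measure \<Rightarrow> nat \<Rightarrow> real^'d \<Rightarrow> bool" where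
  "good_link k r m s x \<longleftrightarrow> big k (5 * real s / 9) (occ k m (cube (real (2 * s)) x)) \<noteq> {} \<and>
    (\<forall>u\<in>big k (5 * real s / 9) (occ k m (cube (real (4 * s)) x)).
      \<forall>v\<in>big k (5 * real s / 9) (occ k m (cube (real (4 * s)) x)).
        (u, v) \<in> (cchain r (occ k m (cube (real (8 * s)) x)))\<^sup>*)"

lemma dist_perturb:
  assumes "dist a (x::'a::metric_space) \<le> e" "dist b y \<le> e"
  shows "dist a b \<ge> dist x y - 2 * e" "dist x y \<ge> dist a b - 2 * e"
proof -
  have "dist x y \<le> dist a x + dist a b + dist b y" "dist a b \<le> dist a x + dist x y + dist b y"
    by (metis dist_commute dist_triangle_le add.commute add_left_mono dist_triangle2 dist_triangle3)+
  then show "dist a b \<ge> dist x y - 2 * e" "dist x y \<ge> dist a b - 2 * e" using assms by linarith+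
qed

text \<open>Long components yield long chains of cells, and long chains of cells yield long fine
  chains of support points, to which \<open>long_chains_linked\<close> applies. The mesh from which
  this works depends on the measure, so the conclusion is only eventual in \<open>k\<close>.\<close>

lemma good_link_eventually:
  fixes m :: "(real^'d) measure"
  assumes m: "sets m = sets borel" and s: "s \<ge> 1" and \<delta>: "\<delta> > 0"
    and i: "\<exists>C\<in>components (measure_support (restrict_to (cube (real (2 * s)) 0) m)). diameter C \<ge> real (2 * s) / 3"
    and ii: "\<And>C1 C2. C1 \<in> components (measure_support (restrict_to (cube (real (4 * s)) 0) m)) \<Longrightarrow>
      C2 \<in> components (measure_support (restrict_to (cube (real (4 * s)) 0) m)) \<Longrightarrow>
      diameter C1 \<ge> real (4 * s) / 9 \<Longrightarrow> diameter C2 \<ge> real (4 * s) / 9 \<Longrightarrow>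
      \<exists>D\<in>components (measure_support (restrict_to (cube (real (8 * s)) 0) m)). C1 \<subseteq> D \<and> C2 \<subseteq> D"
  shows "\<exists>k0. \<forall>k\<ge>k0. good_link k (\<lceil>real k * \<delta>\<rceil> + 2) m s 0"
proof -
  define D where "D = real CARD('d)"
  have D: "D \<ge> 1" by (simp add: D_def Suc_leI)
  define Q where "Q = (\<lambda>n. cube (real (n * s)) (0::real^'d))"
  define S where "S = (\<lambda>n. measure_support (restrict_to (Q n) m))"
  define O' where "O' = (\<lambda>k n. occ k m (Q n))"
  have Qb: "Q n \<in> sets borel" for n by (simp add: Q_def cube_borel)
  have Q48: "Q 4 \<subseteq> Q 8"
  proof
    fix x assume "x \<in> Q 4"
    then have "\<bar>x $ i - 0 $ i\<bar> \<le> real (4 * s) / 2" for i by (simp add: Q_def mem_cube)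
    then show "x \<in> Q 8" unfolding Q_def mem_cube by (rule allI[OF order_trans]) simp
  qed
  have S48: "S 4 \<subseteq> S 8" unfolding S_def by (rule measure_support_mono[OF m Q48 Qb Qb])
  have "\<exists>\<epsilon>>0. \<forall>a\<in>S 4. \<forall>b\<in>S 4.
    (\<exists>v w. (a, v) \<in> (chain \<epsilon> (S 4))\<^sup>* \<and> (a, w) \<in> (chain \<epsilon> (S 4))\<^sup>* \<and> dist v w \<ge> real s / 2) \<longrightarrow>
    (\<exists>v w. (b, v) \<in> (chain \<epsilon> (S 4))\<^sup>* \<and> (b, w) \<in> (chain \<epsilon> (S 4))\<^sup>* \<and> dist v w \<ge> real s / 2) \<longrightarrow>
    (a, b) \<in> (chain \<delta> (S 8))\<^sup>*"
  proof (rule long_chains_linked[OF _ S48 \<delta>])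
    show "compact (S 4)" unfolding S_def Q_def by (rule compact_support_cube[OF m])
    fix C1 C2 assume *: "C1 \<in> components (S 4)" "C2 \<in> components (S 4)"
      and d: "diameter C1 \<ge> real s / 2" "diameter C2 \<ge> real s / 2"
    \<comment> \<open>The chain threshold \<open>1 / 2\<close> exceeds \<open>4 / 9\<close>, so the
      second connectedness condition applies.\<close>
    have "diameter C1 \<ge> real (4 * s) / 9" "diameter C2 \<ge> real (4 * s) / 9" using d by auto
    then show "\<exists>D\<in>components (S 8). C1 \<subseteq> D \<and> C2 \<subseteq> D" using ii * by (simp add: S_def Q_def)
  qed
  then obtain \<epsilon> where \<epsilon>: "\<epsilon> > 0" and link: "\<And>a b v w v' w'. a \<in> S 4 \<Longrightarrow> b \<in> S 4 \<Longrightarrow>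
    (a, v) \<in> (chain \<epsilon> (S 4))\<^sup>* \<Longrightarrow> (a, w) \<in> (chain \<epsilon> (S 4))\<^sup>* \<Longrightarrow> dist v w \<ge> real s / 2 \<Longrightarrow>
    (b, v') \<in> (chain \<epsilon> (S 4))\<^sup>* \<Longrightarrow> (b, w') \<in> (chain \<epsilon> (S 4))\<^sup>* \<Longrightarrow> dist v' w' \<ge> real s / 2 \<Longrightarrow>
    (a, b) \<in> (chain \<delta> (S 8))\<^sup>*" by blast
  \<comment> \<open>The term \<open>72 * D\<close> keeps the discretization error
    \<open>4 * D / k\<close> below \<open>s / 18\<close>. The term \<open>4 * D / \<epsilon>\<close>
    makes cell steps of 3 into steps of at most \<open>\<epsilon>\<close> between points.\<close>
  show ?thesis
  proof (intro exI[of _ "nat \<lceil>72 * D + 4 * D / \<epsilon>\<rceil> + 1"] allI impI)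
    fix k assume k0: "k \<ge> nat \<lceil>72 * D + 4 * D / \<epsilon>\<rceil> + 1"
    then have kk: "real k \<ge> 72 * D + 4 * D / \<epsilon>" by linarith
    have k: "k > 0" using k0 by simp
    have "4 * D / \<epsilon> \<ge> 0" using D \<epsilon> by simp
    then have k72: "real k \<ge> 72 * D" using kk by simp
    have "real k \<ge> 4 * D / \<epsilon>" using kk D by simp
    then have k\<epsilon>: "D * (4 / real k) \<le> \<epsilon>" using k \<epsilon> by (simp add: field_simps)
    have err: "2 * (D * (2 / real k)) \<le> real s / 18"
    proof -
      have "2 * (D * (2 / real k)) \<le> 1 / 18" using k72 k by (simp add: field_simps)
      also have "\<dots> \<le> real s / 18" using s by simp
      finally show ?thesis .
    qed
    have "big k (5 * real s / 9) (O' k 2) \<noteq> {}"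
    proof -
      obtain C where C: "C \<in> components (S 2)" "diameter C \<ge> real (2 * s) / 3" using i by (auto simp: S_def Q_def)
      have "compact (S 2)" unfolding S_def Q_def by (rule compact_support_cube[OF m])
      then have "bounded C" using C(1) compact_components compact_imp_bounded by blast
      \<comment> \<open>In units of \<open>s / 18\<close>, the component has diameter 12, the two
        points are more than 11 apart, and after an error of 1 their corners are still 10 apart,
        which is the threshold \<open>5 / 9\<close>.\<close>
      moreover have "11 * real s / 18 < diameter C" using C(2) s by simp
      ultimately obtain x y where xy: "x \<in> C" "y \<in> C" "dist x y > 11 * real s / 18"
        using diameter_lower_bounded[of C "11 * real s / 18"] s by auto
      have CS: "C \<subseteq> S 2" by (rule in_components_subset[OF C(1)])
      have "(x, y) \<in> (chain (1 / real k) C)\<^sup>*"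
        using in_components_connected[OF C(1)] xy k by (intro connected_chain) auto
      then have path: "(x, y) \<in> (chain (1 / real k) (measure_support (restrict_to (Q 2) m)))\<^sup>*"
        using rtrancl_mono[OF chain_mono[OF order_refl CS]] unfolding S_def by blast
      have "x \<in> measure_support (restrict_to (Q 2) m)" using xy CS by (auto simp: S_def)
      then obtain u where u: "u \<in> O' k 2" "\<And>i. \<bar>u $ i - idx k x $ i\<bar> \<le> 1"
        using support_occ[OF m Qb k] unfolding O'_def by blast
      obtain v where v: "v \<in> O' k 2" "\<And>i. \<bar>v $ i - idx k y $ i\<bar> \<le> 1" "(u, v) \<in> (cchain (1 + 2) (O' k 2))\<^sup>*"
        using lift_chain[OF m Qb k path, of 1 u] u k unfolding O'_def by auto
      have "dist (corner k u) (corner k v) \<ge> dist x y - 2 * (D * (2 / real k))"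
        using near_corner[OF u(2) k] near_corner[OF v(2) k] by (intro dist_perturb(1)) (auto simp: D_def)
      then have "dist (corner k u) (corner k v) \<ge> 5 * real s / 9" using xy(3) err by linarith
      then have "u \<in> big k (5 * real s / 9) (O' k 2)"
        by (intro bigI[where v = u and w = v]) (use u v in auto)
      then show ?thesis by blast
    qed
    moreover have "(u, v) \<in> (cchain (\<lceil>real k * \<delta>\<rceil> + 2) (O' k 8))\<^sup>*"
      if uv: "u \<in> big k (5 * real s / 9) (O' k 4)" "v \<in> big k (5 * real s / 9) (O' k 4)" for u v
    proof -
      have "\<forall>w\<in>O' k 4. \<exists>x. x \<in> gcell k w \<and> x \<in> S 4"
        using occ_support_point[OF m Qb] unfolding O'_def S_def by blast
      then obtain p where p: "\<And>w. w \<in> O' k 4 \<Longrightarrow> p w \<in> gcell k w \<and> p w \<in> S 4" by metis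
      have near: "dist (corner k w) (p w) \<le> D * (2 / real k)" if "w \<in> O' k 4" for w
        unfolding D_def by (rule near_corner[OF _ k]) (use p[OF that] in \<open>simp add: gcell_def\<close>)
      have low: "\<exists>v w. (p u, v) \<in> (chain \<epsilon> (S 4))\<^sup>* \<and> (p u, w) \<in> (chain \<epsilon> (S 4))\<^sup>* \<and> dist v w \<ge> real s / 2"
        if u: "u \<in> big k (5 * real s / 9) (O' k 4)" for u
      proof -
        from u obtain v w where vw: "u \<in> O' k 4" "(u, v) \<in> (cchain 3 (O' k 4))\<^sup>*" "(u, w) \<in> (cchain 3 (O' k 4))\<^sup>*"
          "dist (corner k v) (corner k w) \<ge> 5 * real s / 9" by (rule bigE)
        have "v \<in> O' k 4" "w \<in> O' k 4" using vw cchain_mem by blast+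
        then have "dist (p v) (p w) \<ge> dist (corner k v) (corner k w) - 2 * (D * (2 / real k))"
          by (intro dist_perturb(2) near)
        \<comment> \<open>Again in units of \<open>s / 18\<close>: 10 between the corners leaves 9
          between the points.\<close>
        then have "dist (p v) (p w) \<ge> real s / 2" using vw(4) err by linarith
        moreover have "chain (D * ((of_int 3 + 1) / real k)) (S 4) \<subseteq> chain \<epsilon> (S 4)"
          using k\<epsilon> by (intro chain_mono) auto
        then have sub: "(chain (D * ((of_int 3 + 1) / real k)) (S 4))\<^sup>* \<subseteq> (chain \<epsilon> (S 4))\<^sup>*" by (rule rtrancl_mono)
        ultimately show ?thesis
          using subsetD[OF sub lower_chain[OF k p vw(2), folded D_def]] subsetD[OF sub lower_chain[OF k p vw(3), folded D_def]]
          by blast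
      qed
      have uvO: "u \<in> O' k 4" "v \<in> O' k 4" using uv by (auto simp: big_def)
      then have pS: "p u \<in> S 4" "p v \<in> S 4" using p by auto
      have "(p u, p v) \<in> (chain \<delta> (S 8))\<^sup>*" using low[OF uv(1)] low[OF uv(2)] link[OF pS] by blast
      then have path: "(p u, p v) \<in> (chain \<delta> (measure_support (restrict_to (Q 8) m)))\<^sup>*" by (simp add: S_def)
      have sub: "O' k 4 \<subseteq> O' k 8" unfolding O'_def by (rule occ_mono[OF m Q48 Qb])
      have idxp: "idx k (p u) = u" "idx k (p v) = v" using p uvO by (auto simp: gcell_def)
      \<comment> \<open>The lifted chain ends in a cell that may differ from \<open>v\<close> by one
        index; one more step leads to \<open>v\<close> itself.\<close>
      obtain v' where v': "v' \<in> O' k 8" "\<And>i. \<bar>v' $ i - v $ i\<bar> \<le> 1" "(u, v') \<in> (cchain (\<lceil>real k * \<delta>\<rceil> + 2) (O' k 8))\<^sup>*"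
        using lift_chain[OF m Qb k path, of "\<lceil>real k * \<delta>\<rceil>" u] uvO sub unfolding O'_def idxp by auto
      have "real k * \<delta> \<ge> 0" using \<delta> by simp
      then have r0: "\<lceil>real k * \<delta>\<rceil> \<ge> 0" by linarith
      have "\<bar>v' $ i - v $ i\<bar> \<le> \<lceil>real k * \<delta>\<rceil> + 2" for i using v'(2)[of i] r0 by linarith
      then have "(v', v) \<in> cchain (\<lceil>real k * \<delta>\<rceil> + 2) (O' k 8)" using v' uvO sub by (auto simp: cchain_def)
      with v'(3) show ?thesis by (rule rtrancl_into_rtrancl)
    qed
    ultimately show "good_link k (\<lceil>real k * \<delta>\<rceil> + 2) m s 0"
      unfolding good_link_def O'_def Q_def by blast
  qed
qed

text \<open>Consecutive cubes of side \<open>2 * s\<close> both lie in the cube of side \<open>4 * s\<close> around either site.\<close>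

lemma good_link_percolates:
  fixes m :: "(real^'d) measure"
  assumes i12: "i1 \<noteq> i2" and s: "s \<ge> 1" and k: "k > 0" and r: "r \<ge> 0"
    and \<rho>: "real CARD('d) * ((of_int r + 1) / real k) \<le> \<rho>" and m: "sets m = sets borel"
    and Z: "(0, 0) \<in> Z" "infinite {z. ((0, 0), z) \<in> (nbr_rel Z)\<^sup>*}"
    and good: "\<And>z. z \<in> Z \<Longrightarrow> good_link k r m s (site i1 i2 s z)"
    and V: "\<And>z u. z \<in> Z \<Longrightarrow> u \<in> occ k m (cube (real (8 * s)) (site i1 i2 s z)) \<Longrightarrow>
      V \<inter> (gcell k u \<inter> cube (real (8 * s)) (site i1 i2 s z)) \<noteq> {}"
  shows "\<exists>x\<in>V. \<not> bounded ({(x, y). x \<in> V \<and> y \<in> V \<and> x \<noteq> y \<and> dist x y \<le> \<rho> \<and>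
          x \<in> (\<Union>z\<in>Z. cube (real (8 * s)) (site i1 i2 s z)) \<and>
          y \<in> (\<Union>z\<in>Z. cube (real (8 * s)) (site i1 i2 s z))}\<^sup>* `` {x})"
proof -
  define W where "W = (\<Union>z\<in>Z. cube (real (8 * s)) (site i1 i2 s z))"
  define E where "E = {(x, y). x \<in> V \<and> y \<in> V \<and> x \<noteq> y \<and> dist x y \<le> \<rho> \<and> x \<in> W \<and> y \<in> W}"
  define O' where "O' = (\<lambda>n z. occ k m (cube (real (n * s)) (site i1 i2 s z)))"
  define B where "B = (\<lambda>n z. big k (5 * real s / 9) (O' n z))"
  have nearby: "x \<in> V \<Longrightarrow> y \<in> V \<Longrightarrow> x \<in> W \<Longrightarrow> y \<in> W \<Longrightarrow> dist x y \<le> \<rho> \<Longrightarrow> (x, y) \<in> E\<^sup>*" for x y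
    by (cases "x = y") (auto simp: E_def)
  have "\<forall>z\<in>Z. \<forall>u\<in>O' 8 z. \<exists>x. x \<in> V \<and> x \<in> gcell k u \<and> x \<in> cube (real (8 * s)) (site i1 i2 s z)"
    using V unfolding O'_def by blast
  then obtain p where p: "\<And>z u. z \<in> Z \<Longrightarrow> u \<in> O' 8 z \<Longrightarrow>
    p z u \<in> V \<and> p z u \<in> gcell k u \<and> p z u \<in> cube (real (8 * s)) (site i1 i2 s z)" by metis
  have pW: "p z u \<in> W" if "z \<in> Z" "u \<in> O' 8 z" for z u using p[OF that] that by (auto simp: W_def)
  have edge: "(p z u, p z' v) \<in> E\<^sup>*"
    if "z \<in> Z" "u \<in> O' 8 z" "z' \<in> Z" "v \<in> O' 8 z'" "\<And>i. \<bar>u $ i - v $ i\<bar> \<le> r" for z u z' v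
  proof (rule nearby)
    have "dist (p z u) (p z' v) \<le> real CARD('d) * ((of_int r + 1) / real k)"
      by (rule gcell_dist[OF _ _ that(5) k]) (use p that in auto)
    then show "dist (p z u) (p z' v) \<le> \<rho>" using \<rho> by linarith
  qed (use p pW that in auto)
  have path: "(p z u, p z v) \<in> E\<^sup>*" if z: "z \<in> Z" and u: "u \<in> O' 8 z" and uv: "(u, v) \<in> (cchain r (O' 8 z))\<^sup>*" for z u v
    using uv
  proof (induction rule: rtrancl_induct)
    case (step v w)
    then have "v \<in> O' 8 z" "w \<in> O' 8 z" "\<And>i. \<bar>v $ i - w $ i\<bar> \<le> r" by (auto simp: cchain_def)
    then have "(p z v, p z w) \<in> E\<^sup>*" using z by (intro edge)
    with step.IH show ?case by (rule rtrancl_trans)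
  qed simp
  have sub: "O' a y \<subseteq> O' b z" if "\<And>i. \<bar>site i1 i2 s y $ i - site i1 i2 s z $ i\<bar> \<le> real e * real s" "a + 2 * e \<le> b" for a b e y z
    unfolding O'_def
  proof (rule occ_mono[OF m _ cube_borel], rule subsetI)
    fix x assume x: "x \<in> cube (real (a * s)) (site i1 i2 s y)"
    show "x \<in> cube (real (b * s)) (site i1 i2 s z)"
      unfolding mem_cube
    proof
      fix i
      have "\<bar>x $ i - site i1 i2 s y $ i\<bar> \<le> real (a * s) / 2" using x by (simp add: mem_cube)
      moreover have "real (a * s) + 2 * (real e * real s) \<le> real (b * s)"
      proof -
        have "(a + 2 * e) * s \<le> b * s" using that(2) by (rule mult_le_mono1)
        then have "real ((a + 2 * e) * s) \<le> real (b * s)" by (simp only: of_nat_le_iff)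
        then show ?thesis by (simp add: algebra_simps)
      qed
      ultimately show "\<bar>x $ i - site i1 i2 s z $ i\<bar> \<le> real (b * s) / 2" using that(1)[of i] by linarith
    qed
  qed
  have sub0: "O' a z \<subseteq> O' b z" if "a \<le> b" for a b z
    by (rule sub[where e = 0]) (use that in auto)
  have BO: "B a z \<subseteq> O' a z" for a z by (auto simp: B_def big_def)
  have "\<forall>z\<in>Z. \<exists>u. u \<in> B 2 z" using good unfolding good_link_def B_def O'_def by blast
  then obtain h where h: "\<And>z. z \<in> Z \<Longrightarrow> h z \<in> B 2 z" by metis
  have h8: "h z \<in> O' 8 z" if "z \<in> Z" for z using h[OF that] BO[of 2 z] sub0[of 2 8 z] by auto
  have reach: "(p (0, 0) (h (0, 0)), p z (h z)) \<in> E\<^sup>*" if "((0, 0), z) \<in> (nbr_rel Z)\<^sup>*" for z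
    using that
  proof (induction rule: rtrancl_induct)
    case (step y z)
    then have yz: "nbr y z" "y \<in> Z" "z \<in> Z" by (auto simp: nbr_rel_def)
    have "O' 2 z \<subseteq> O' 4 y"
      by (rule sub[where e = 1]) (use site_nbr[OF yz(1)[unfolded nbr_sym[of y z]]] in auto)
    then have "B 2 z \<subseteq> B 4 y" unfolding B_def by (rule big_mono)
    then have hz: "h z \<in> B 4 y" using h yz by blast
    have "B 2 y \<subseteq> B 4 y" unfolding B_def by (rule big_mono[OF sub0]) simp
    then have hy: "h y \<in> B 4 y" using h[OF yz(2)] by blast
    have "(h y, h z) \<in> (cchain r (O' 8 y))\<^sup>*"
      using good[OF yz(2)] hy hz unfolding good_link_def B_def O'_def by blast
    then have "(p y (h y), p y (h z)) \<in> E\<^sup>*" by (rule path[OF yz(2) h8[OF yz(2)]])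
    moreover have "h z \<in> O' 8 y" using hz BO[of 4 y] sub0[of 4 8 y] by auto
    \<comment> \<open>The cell \<open>h z\<close> has two representatives, chosen for the sites
      \<open>y\<close> and \<open>z\<close>. Lying in the same cell, they are within range of each
      other.\<close>
    then have "(p y (h z), p z (h z)) \<in> E\<^sup>*"
      using yz h8 r by (intro edge) auto
    ultimately show ?case using step.IH by (meson rtrancl_trans)
  qed simp
  let ?C = "{z. ((0, 0), z) \<in> (nbr_rel Z)\<^sup>*}"
  have CZ: "?C \<subseteq> Z" using nbr_rel_rtrancl_mem[OF _ Z(1)] by auto
  have "\<not> bounded ((\<lambda>z. p z (h z)) ` ?C)"
    by (rule sites_unbounded[OF i12 s Z(2), of _ "real (8 * s)"]) (use CZ p h8 in blast)
  moreover have "(\<lambda>z. p z (h z)) ` ?C \<subseteq> E\<^sup>* `` {p (0, 0) (h (0, 0))}" using reach by auto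
  ultimately have "\<not> bounded (E\<^sup>* `` {p (0, 0) (h (0, 0))})" using bounded_subset by blast
  moreover have "p (0, 0) (h (0, 0)) \<in> V" using p[OF Z(1) h8[OF Z(1)]] by blast
  ultimately show ?thesis unfolding E_def W_def by blast
qed

section \<open>Measurability and translation of occupied cells\<close>

lemma sets_occ_eq:
  assumes Q: "Q \<in> sets borel" and U: "finite U" "A \<subseteq> U" "idx k ` Q \<subseteq> U"
  shows "{m\<in>space locally_finite_algebra. occ k m Q = A} \<in> sets locally_finite_algebra"
proof -
  let ?L = "locally_finite_algebra :: (real^'a) measure measure"
  have 1: "(\<lambda>m. emeasure m (gcell k u \<inter> Q)) \<in> borel_measurable ?L" for u
    using Q by (intro measurable_emeasure_locally_finite_algebra) auto
  have "{m\<in>space ?L. occ k m Q = A} = space ?L \<inter> (\<Inter>u\<in>U. {m\<in>space ?L. (emeasure m (gcell k u \<inter> Q) > 0) = (u \<in> A)})"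
  proof -
    have "occ k m Q = A \<longleftrightarrow> (\<forall>u\<in>U. (emeasure m (gcell k u \<inter> Q) > 0) = (u \<in> A))" for m :: "(real^'a) measure"
    proof
      assume "\<forall>u\<in>U. (emeasure m (gcell k u \<inter> Q) > 0) = (u \<in> A)"
      then have "\<forall>u\<in>U. u \<in> occ k m Q \<longleftrightarrow> u \<in> A" by (simp add: occ_def)
      then show "occ k m Q = A" using order_trans[OF occ_subset U(3), of m] U(2) by blast
    qed (simp add: occ_def set_eq_iff)
    then show ?thesis by auto
  qed
  also have "\<dots> \<in> sets ?L"
  proof (rule Int_INT_sets[OF U(1)])
    fix u show "{m\<in>space ?L. (emeasure m (gcell k u \<inter> Q) > 0) = (u \<in> A)} \<in> sets ?L"
      using 1[of u] by measurable
  qed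
  finally show ?thesis .
qed

text \<open>Only finitely many cells meet the three sets, so the event splits into finitely many
  cases with prescribed occupied cells, and no property of \<open>P\<close> enters.\<close>

lemma sets_occ_pred:
  assumes Q: "Q1 \<in> sets borel" "Q2 \<in> sets borel" "Q3 \<in> sets borel"
    and U: "finite U" "idx k ` Q1 \<subseteq> U" "idx k ` Q2 \<subseteq> U" "idx k ` Q3 \<subseteq> U"
  shows "{m\<in>space locally_finite_algebra. P (occ k m Q1) (occ k m Q2) (occ k m Q3)} \<in> sets locally_finite_algebra"
proof -
  let ?L = "locally_finite_algebra :: (real^'a) measure measure"
  define T where "T = {(A, B, C). A \<subseteq> U \<and> B \<subseteq> U \<and> C \<subseteq> U \<and> P A B C}"
  have "finite T" by (rule finite_subset[of _ "Pow U \<times> Pow U \<times> Pow U"]) (use U in \<open>auto simp: T_def\<close>)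
  moreover have "{m\<in>space ?L. occ k m Q1 = A} \<inter> {m\<in>space ?L. occ k m Q2 = B} \<inter> {m\<in>space ?L. occ k m Q3 = C} \<in> sets ?L"
    if "A \<subseteq> U" "B \<subseteq> U" "C \<subseteq> U" for A B C
    by (intro sets.Int sets_occ_eq[OF Q(1) U(1) that(1) U(2)] sets_occ_eq[OF Q(2) U(1) that(2) U(3)] sets_occ_eq[OF Q(3) U(1) that(3) U(4)])
  ultimately have "(\<Union>(A, B, C)\<in>T. {m\<in>space ?L. occ k m Q1 = A} \<inter> {m\<in>space ?L. occ k m Q2 = B} \<inter> {m\<in>space ?L. occ k m Q3 = C}) \<in> sets ?L"
    by (intro sets.finite_UN) (auto simp: T_def)
  also have "(\<Union>(A, B, C)\<in>T. {m\<in>space ?L. occ k m Q1 = A} \<inter> {m\<in>space ?L. occ k m Q2 = B} \<inter> {m\<in>space ?L. occ k m Q3 = C})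
    = {m\<in>space ?L. P (occ k m Q1) (occ k m Q2) (occ k m Q3)}"
  proof (intro set_eqI iffI)
    fix m assume m: "m \<in> {m\<in>space ?L. P (occ k m Q1) (occ k m Q2) (occ k m Q3)}"
    have "(occ k m Q1, occ k m Q2, occ k m Q3) \<in> T"
      using m order_trans[OF occ_subset U(2)] order_trans[OF occ_subset U(3)] order_trans[OF occ_subset U(4)] by (simp add: T_def)
    then show "m \<in> (\<Union>(A, B, C)\<in>T. {m\<in>space ?L. occ k m Q1 = A} \<inter> {m\<in>space ?L. occ k m Q2 = B} \<inter> {m\<in>space ?L. occ k m Q3 = C})"
      by (rule UN_I) (use m in simp)
  qed (auto simp: T_def)
  finally show ?thesis .
qed

definition site_shift :: "'d \<Rightarrow> 'd \<Rightarrow> nat \<Rightarrow> nat \<Rightarrow> int \<times> int \<Rightarrow> int^'d" where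
  "site_shift i1 i2 k s z = (\<chi> i. if i = i1 then int k * int s * fst z
    else if i = i2 then int k * int s * snd z else 0)"

text \<open>The mesh divides the scale: \<open>k\<close> times a site has integer coordinates.
  Translations by sites therefore permute the cells of the grid.\<close>

lemma idx_site: "idx k (site i1 i2 s z + x) = idx k x + site_shift i1 i2 k s z"
proof -
  have "\<lfloor>real k * (real s * of_int c + x $ i)\<rfloor> = \<lfloor>real k * x $ i\<rfloor> + int k * int s * c" for c :: int and i
  proof -
    have "real k * (real s * of_int c + x $ i) = real k * x $ i + of_int (int k * int s * c)"
      by (simp add: algebra_simps)
    then show ?thesis by (simp only: floor_add_int)
  qed
  note * = this
  have "\<lfloor>real k * (0 + x $ i)\<rfloor> = \<lfloor>real k * x $ i\<rfloor> + 0" for i by simp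
  then show ?thesis using *
    by (simp add: idx_def site_def site_shift_def vec_eq_iff)
qed

lemma translate_gcell:
  "(+) (site i1 i2 s z) ` (gcell k u \<inter> cube n 0) =
    gcell k (u + site_shift i1 i2 k s z) \<inter> cube n (site i1 i2 s z)"
proof (intro set_eqI iffI)
  fix x assume x: "x \<in> gcell k (u + site_shift i1 i2 k s z) \<inter> cube n (site i1 i2 s z)"
  have "idx k (x - site i1 i2 s z) = u"
    using x idx_site[of k i1 i2 s z "x - site i1 i2 s z"] by (simp add: gcell_def)
  then have "x - site i1 i2 s z \<in> gcell k u \<inter> cube n 0" using x by (simp add: gcell_def mem_cube)
  then show "x \<in> (+) (site i1 i2 s z) ` (gcell k u \<inter> cube n 0)"
    by (intro image_eqI[of _ _ "x - site i1 i2 s z"]) auto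
qed (auto simp: gcell_def idx_site mem_cube)

lemma occ_translate:
  assumes m: "sets m = sets borel"
  shows "u \<in> occ k (translate_measure (site i1 i2 s z) m) (cube n 0) \<longleftrightarrow>
    u + site_shift i1 i2 k s z \<in> occ k m (cube n (site i1 i2 s z))"
  unfolding occ_def using m by (simp add: emeasure_translate translate_gcell cube_borel)

lemma good_link_translate:
  assumes m: "sets m = sets borel" and good: "good_link k r (translate_measure (site i1 i2 s z) m) s 0"
  shows "good_link k r m s (site i1 i2 s z)"
proof -
  define a where "a = site_shift i1 i2 k s z"
  define A where "A = (\<lambda>n. occ k (translate_measure (site i1 i2 s z) m) (cube (real (n * s)) 0))"
  define B where "B = (\<lambda>n. occ k m (cube (real (n * s)) (site i1 i2 s z)))"
  have mem: "u \<in> A n \<longleftrightarrow> u + a \<in> B n" for u n unfolding A_def B_def a_def by (rule occ_translate[OF m])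
  have AB: "(\<lambda>u. u + a) ` A n = B n" for n
  proof (intro set_eqI iffI)
    fix u assume "u \<in> B n"
    then show "u \<in> (\<lambda>u. u + a) ` A n" using mem[of "u - a" n] by (intro image_eqI[of _ _ "u - a"]) auto
  qed (auto simp: mem)
  have BA: "(\<lambda>u. u + (- a)) ` B n = A n" for n
    unfolding AB[symmetric] image_image by simp
  have g: "big k (5 * real s / 9) (A 2) \<noteq> {}" "\<And>u v. u \<in> big k (5 * real s / 9) (A 4) \<Longrightarrow>
      v \<in> big k (5 * real s / 9) (A 4) \<Longrightarrow> (u, v) \<in> (cchain r (A 8))\<^sup>*"
    using good unfolding good_link_def A_def by blast+
  obtain u where "u \<in> big k (5 * real s / 9) (A 2)" using g(1) by blast
  from big_shift[OF this, of a] have 1: "big k (5 * real s / 9) (B 2) \<noteq> {}" by (auto simp: AB)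
  have "(u, v) \<in> (cchain r (B 8))\<^sup>*" if "u \<in> big k (5 * real s / 9) (B 4)" "v \<in> big k (5 * real s / 9) (B 4)" for u v
  proof -
    have "u + (- a) \<in> big k (5 * real s / 9) (A 4)" "v + (- a) \<in> big k (5 * real s / 9) (A 4)"
      using big_shift[OF that(1), of "- a"] big_shift[OF that(2), of "- a"] by (simp_all only: BA)
    then have "(u + (- a), v + (- a)) \<in> (cchain r (A 8))\<^sup>*" by (rule g(2))
    from cchain_shift[OF this, of a] show ?thesis by (simp add: AB)
  qed
  with 1 show ?thesis unfolding good_link_def B_def by blast
qed


lemma occ_restrict:
  assumes "sets m = sets borel" "Q \<subseteq> Q'" "Q \<in> sets borel" "Q' \<in> sets borel"
  shows "occ k (restrict_to Q' m) Q = occ k m Q"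
proof -
  have "Q' \<inter> (gcell k u \<inter> Q) = gcell k u \<inter> Q" for u using assms(2) by blast
  then show ?thesis unfolding occ_def using assms by (simp add: emeasure_restrict_to)
qed

lemma cube_nested: "n \<le> n' \<Longrightarrow> cube n x \<subseteq> cube n' x"
proof
  fix y assume "n \<le> n'" "y \<in> cube n x"
  then have "\<bar>y $ i - x $ i\<bar> \<le> n / 2 \<and> n / 2 \<le> n' / 2" for i by (simp add: mem_cube)
  then show "y \<in> cube n' x" unfolding mem_cube by (meson order_trans)
qed

lemma translate_0: "sets m = sets borel \<Longrightarrow> translate_measure 0 m = (m :: (real^'d) measure)"
  by (rule measure_eqI) (auto simp: emeasure_translate)

context stab begin

text \<open>The choices are nested: \<open>s\<close> large enough for small radii, then a mesh for
  which the discrete linking holds with high probability, then a mass level below all positive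
  masses of the finitely many cells with high probability. The last two enter the good event itself,
  so that on it every occupied cell is charged by a fixed amount.\<close>

lemma linked_connected:
  assumes i12: "(i1 :: 'd) \<noteq> i2" and q: "0 < q" "q \<le> 1" and \<rho>: "\<rho> > 0"
    and aec: "\<And>n \<omega>. n \<ge> 1 \<Longrightarrow> \<omega> \<in> space M \<Longrightarrow>
      cube_radius R (2 * real n) 0 \<omega> < ennreal (real n / 2) \<Longrightarrow>
      (let S = measure_support (restrict_to (cube (real n) 0) (\<Lambda> \<omega>));
           S' = measure_support (restrict_to (cube (2 * real n) 0) (\<Lambda> \<omega>))
       in (\<exists>C\<in>components S. diameter C \<ge> real n / 3) \<and>
          (\<forall>C1\<in>components S. \<forall>C2\<in>components S.
             diameter C1 \<ge> real n / 9 \<and> diameter C2 \<ge> real n / 9 \<longrightarrow>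
             (\<exists>D\<in>components S'. C1 \<subseteq> D \<and> C2 \<subseteq> D)))"
  shows "\<exists>s0. \<forall>s\<ge>s0. linked M \<Lambda> i1 i2 \<rho> q s"
proof -
  define D where "D = real CARD('d)"
  have D: "D \<ge> 1" by (simp add: D_def Suc_leI)
  \<comment> \<open>With this \<open>\<delta>\<close> a cell step of
    \<open>\<lceil>real k * \<delta>\<rceil> + 2\<close> spans at most
    \<open>\<rho> / 2 + 4 * D / real k\<close>, and the second term is at most
    \<open>\<rho> / 2\<close> once \<open>real k \<ge> 8 * D / \<rho>\<close>.\<close>
  define \<delta> where "\<delta> = \<rho> / (2 * D)"
  have \<delta>: "\<delta> > 0" using \<rho> D by (simp add: \<delta>_def)
  \<comment> \<open>Cubes of side \<open>8 * s\<close> have to be more than \<open>24 * s\<close>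
    apart, hence 25; the third accounts for the events of small radius, good mesh and mass
    level.\<close>
  define \<epsilon> where "\<epsilon> = q ^ (25 * 25) / 3"
  have \<epsilon>: "\<epsilon> > 0" using q by (simp add: \<epsilon>_def)
  obtain n0 where n0: "\<And>n. n \<ge> n0 \<Longrightarrow> measure M {\<omega>\<in>space M. cube_radius R (real (8 * n)) 0 \<omega> < of_nat n} > 1 - \<epsilon>"
    using cube_radius_scaled_small[OF \<epsilon>, of 8] by auto
  show ?thesis
  proof (intro exI[of _ "max 1 n0"] allI impI)
    fix s assume "s \<ge> max 1 n0"
    then have s: "s \<ge> 1" "s \<ge> n0" by auto
    define r where "r = (\<lambda>k::nat. \<lceil>real k * \<delta>\<rceil> + 2)"
    define Q where "Q = (\<lambda>n. cube (real (n * s)) (0::real^'d))"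
    have Qb: "Q n \<in> sets borel" for n by (simp add: Q_def cube_borel)
    have Qs: "cube (real (2 * s)) 0 = Q 2" "cube (real (4 * s)) 0 = Q 4" "cube (real (8 * s)) 0 = Q 8"
      by (simp_all add: Q_def)
    have Qmono: "Q a \<subseteq> Q b" if "a \<le> b" for a b
    proof -
      have "a * s \<le> b * s" using that by (rule mult_le_mono1)
      then show ?thesis unfolding Q_def by (intro cube_nested) (simp only: of_nat_le_iff)
    qed
    define U where "U = (\<lambda>k. idx k ` Q 8)"
    have finU: "finite (U k)" for k unfolding U_def Q_def by (rule finite_idx_cube)
    have QU: "idx k ` Q 2 \<subseteq> U k" "idx k ` Q 4 \<subseteq> U k" "idx k ` Q 8 \<subseteq> U k" for k
      using Qmono[of 2 8] Qmono[of 4 8] by (auto simp: U_def)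
    define B where "B = {\<omega>\<in>space M. cube_radius R (real (8 * s)) 0 \<omega> < of_nat s}"
    have B: "B \<in> sets M" unfolding B_def by measurable
    have pB: "measure M B > 1 - \<epsilon>" using n0[OF s(2)] by (simp add: B_def)
    define G where "G = (\<lambda>k. {\<omega>\<in>space M. good_link k (r k) (\<Lambda> \<omega>) s 0})"
    have gl: "{m :: (real^'d) measure\<in>space locally_finite_algebra. good_link k (r k) m s 0} \<in> sets locally_finite_algebra" for k
      unfolding good_link_def Qs
      by (rule sets_occ_pred[OF Qb Qb Qb finU QU, where P = "\<lambda>A B C. big k (5 * real s / 9) A \<noteq> {} \<and>
        (\<forall>u\<in>big k (5 * real s / 9) B. \<forall>v\<in>big k (5 * real s / 9) B. (u, v) \<in> (cchain (r k) C)\<^sup>*)"])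
    have G: "G k \<in> sets M" for k
    proof -
      have "G k = \<Lambda> -` {m\<in>space locally_finite_algebra. good_link k (r k) m s 0} \<inter> space M"
        using \<Lambda>_lfa by (auto simp: G_def)
      then show ?thesis using measurable_sets[OF measurable_\<Lambda> gl] by simp
    qed
    \<comment> \<open>The mesh that suffices depends on \<open>\<omega>\<close>. Requiring all finer
      meshes as well makes the events increasing, so that some deterministic mesh captures almost
      all of \<open>B\<close>.\<close>
    define A where "A = (\<lambda>K. space M \<inter> (\<Inter>k\<in>{K..}. G k))"
    have A: "A K \<in> sets M" for K
      unfolding A_def using G by (intro sets.Int sets.top sets.countable_INT') auto
    have "incseq A" unfolding A_def incseq_def by auto
    then have lim: "(\<lambda>K. measure M (A K)) \<longlonglongrightarrow> measure M (\<Union>K. A K)"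
      using A by (intro finite_Lim_measure_incseq) auto
    have "B \<subseteq> (\<Union>K. A K)"
    proof
      fix \<omega> assume w: "\<omega> \<in> B"
      then have wM: "\<omega> \<in> space M" by (simp add: B_def)
      note m = lfa_sets[OF \<Lambda>_lfa[OF wM]]
      \<comment> \<open>A radius below \<open>s\<close> on the side \<open>8 * s\<close> serves both
        uses of the connectedness condition, at \<open>n = 2 * s\<close> with bound \<open>s\<close>
        and at \<open>n = 4 * s\<close> with bound \<open>2 * s\<close>.\<close>
      have R8: "cube_radius R (real (8 * s)) 0 \<omega> < ennreal (real s)"
        using w by (simp add: B_def ennreal_of_nat_eq_real_of_nat)
      have "cube_radius R (real (4 * s)) 0 \<omega> \<le> cube_radius R (real (8 * s)) 0 \<omega>"
        unfolding cube_radius_def using Qmono[of 4 8] by (intro SUP_subset_mono) (auto simp: Q_def)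
      then have R4: "cube_radius R (2 * real (2 * s)) 0 \<omega> < ennreal (real (2 * s) / 2)" using R8 by simp
      have "ennreal (real s) \<le> ennreal (real (4 * s) / 2)" by (intro ennreal_leI) simp
      then have R8': "cube_radius R (2 * real (4 * s)) 0 \<omega> < ennreal (real (4 * s) / 2)"
        using R8 by (simp add: less_le_trans)
      have "\<exists>k0. \<forall>k\<ge>k0. good_link k (\<lceil>real k * \<delta>\<rceil> + 2) (\<Lambda> \<omega>) s 0"
      proof (rule good_link_eventually[OF m s(1) \<delta>])
        show "\<exists>C\<in>components (measure_support (restrict_to (cube (real (2 * s)) 0) (\<Lambda> \<omega>))). diameter C \<ge> real (2 * s) / 3"
          using aec[OF _ wM R4] s unfolding Let_def by auto
        fix C1 C2
        assume "C1 \<in> components (measure_support (restrict_to (cube (real (4 * s)) 0) (\<Lambda> \<omega>)))"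
          "C2 \<in> components (measure_support (restrict_to (cube (real (4 * s)) 0) (\<Lambda> \<omega>)))"
          "diameter C1 \<ge> real (4 * s) / 9" "diameter C2 \<ge> real (4 * s) / 9"
        then have "\<exists>D\<in>components (measure_support (restrict_to (cube (2 * real (4 * s)) 0) (\<Lambda> \<omega>))). C1 \<subseteq> D \<and> C2 \<subseteq> D"
          using aec[OF _ wM R8'] s unfolding Let_def by auto
        then show "\<exists>D\<in>components (measure_support (restrict_to (cube (real (8 * s)) 0) (\<Lambda> \<omega>))). C1 \<subseteq> D \<and> C2 \<subseteq> D"
          by simp
      qed
      then show "\<omega> \<in> (\<Union>K. A K)" using wM by (auto simp: A_def G_def r_def)
    qed
    then have "measure M B \<le> measure M (\<Union>K. A K)" using A by (intro finite_measure_mono) auto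
    then have "1 - \<epsilon> < measure M (\<Union>K. A K)" using pB by linarith
    from order_tendstoD(1)[OF lim this] obtain K1 where K1: "\<And>K. K \<ge> K1 \<Longrightarrow> measure M (A K) > 1 - \<epsilon>"
      by (auto simp: eventually_sequentially)
    define k where "k = max 1 (max K1 (nat \<lceil>8 * D / \<rho>\<rceil>))"
    have k: "k > 0" "k \<ge> K1" "real k \<ge> 8 * D / \<rho>" unfolding k_def by linarith+
    have "measure M (A k) \<le> measure M (G k)" using G by (intro finite_measure_mono) (auto simp: A_def)
    then have pG: "measure M (G k) > 1 - \<epsilon>" using K1[OF k(2)] by linarith
    have rk: "r k \<ge> 0"
    proof -
      have "real k * \<delta> \<ge> 0" using \<delta> by simp
      then show ?thesis unfolding r_def by linarith
    qed
    have \<rho>k: "real CARD('d) * ((of_int (r k) + 1) / real k) \<le> \<rho>"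
    proof -
      have "of_int (r k) + 1 \<le> real k * \<delta> + 4" unfolding r_def by linarith
      then have "D * ((of_int (r k) + 1) / real k) \<le> D * ((real k * \<delta> + 4) / real k)"
        using D by (intro mult_left_mono divide_right_mono) auto
      also have "\<dots> = \<rho> / 2 + 4 * D / real k" using k D by (simp add: \<delta>_def field_simps)
      also have "4 * D / real k \<le> \<rho> / 2" using k \<rho> by (simp add: field_simps)
      finally show ?thesis by (simp add: D_def)
    qed
    define em where "em = (\<lambda>u (m :: (real^'d) measure). emeasure m (gcell k u \<inter> Q 8))"
    have em: "em u \<in> borel_measurable locally_finite_algebra" for u
      unfolding em_def using Qb by (intro measurable_emeasure_locally_finite_algebra) auto
    \<comment> \<open>No positive mass below the level: a cell of the window is either uncharged or
      charged by at least \<open>1 / (j + 1)\<close>.\<close>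
    define T where "T = (\<lambda>j m. \<forall>u\<in>U k. em u m = 0 \<or> em u m \<ge> ennreal (1 / real (Suc j)))"
    have T: "{m\<in>space locally_finite_algebra. T j m} \<in> sets locally_finite_algebra" for j
    proof -
      have "{m\<in>space locally_finite_algebra. T j m} = space locally_finite_algebra \<inter>
        (\<Inter>u\<in>U k. {m\<in>space locally_finite_algebra. em u m = 0 \<or> em u m \<ge> ennreal (1 / real (Suc j))})"
        by (auto simp: T_def)
      also have "\<dots> \<in> sets locally_finite_algebra"
      proof (rule Int_INT_sets[OF finU])
        fix u show "{m\<in>space locally_finite_algebra. em u m = 0 \<or> em u m \<ge> ennreal (1 / real (Suc j))} \<in> sets locally_finite_algebra"
          using em[of u] by measurable
      qed
      finally show ?thesis .
    qed
    define E where "E = (\<lambda>j. {\<omega>\<in>space M. T j (\<Lambda> \<omega>)})"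
    have E: "E j \<in> sets M" for j
    proof -
      have "E j = \<Lambda> -` {m\<in>space locally_finite_algebra. T j m} \<inter> space M"
        using \<Lambda>_lfa by (auto simp: E_def)
      then show ?thesis using measurable_sets[OF measurable_\<Lambda> T] by simp
    qed
    have "incseq E"
    proof (rule incseq_SucI, rule subsetI)
      fix j \<omega> assume w: "\<omega> \<in> E j"
      have le: "ennreal (1 / real (Suc (Suc j))) \<le> ennreal (1 / real (Suc j))"
        by (intro ennreal_leI) (simp add: frac_le)
      have "T j (\<Lambda> \<omega>)" "\<omega> \<in> space M" using w by (simp_all add: E_def)
      then show "\<omega> \<in> E (Suc j)" unfolding E_def T_def mem_Collect_eq using le order_trans by blast
    qed
    then have limE: "(\<lambda>j. measure M (E j)) \<longlonglongrightarrow> measure M (\<Union>j. E j)"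
      using E by (intro finite_Lim_measure_incseq) auto
    have "(\<Union>j. E j) = space M"
    proof (intro set_eqI iffI)
      fix \<omega> assume w: "\<omega> \<in> space M"
      have "\<exists>j. em u (\<Lambda> \<omega>) = 0 \<or> em u (\<Lambda> \<omega>) \<ge> ennreal (1 / real (Suc j))" for u
      proof (cases "em u (\<Lambda> \<omega>) = 0")
        case False
        have fin: "em u (\<Lambda> \<omega>) < \<infinity>"
          unfolding em_def using w Qb by (intro lfa_finite[OF \<Lambda>_lfa]) (auto simp: Q_def bounded_cube intro: bounded_subset)
        define x where "x = enn2real (em u (\<Lambda> \<omega>))"
        have x: "em u (\<Lambda> \<omega>) = ennreal x" "x > 0"
          using fin False by (auto simp: x_def enn2real_positive_iff zero_less_iff_neq_zero)
        obtain j where "inverse (real (Suc j)) < x" using reals_Archimedean[OF x(2)] by blast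
        then show ?thesis by (intro exI[of _ j] disjI2) (auto simp: x(1) inverse_eq_divide intro!: ennreal_leI)
      qed simp
      then obtain j where j: "\<And>u. em u (\<Lambda> \<omega>) = 0 \<or> em u (\<Lambda> \<omega>) \<ge> ennreal (1 / real (Suc (j u)))" by metis
      define J where "J = Max (insert 0 (j ` U k))"
      have "T J (\<Lambda> \<omega>)"
        unfolding T_def
      proof
        fix u assume "u \<in> U k"
        then have "j u \<le> J" using finU unfolding J_def by (intro Max_ge) auto
        then have "ennreal (1 / real (Suc J)) \<le> ennreal (1 / real (Suc (j u)))"
          by (intro ennreal_leI) (simp add: frac_le)
        then show "em u (\<Lambda> \<omega>) = 0 \<or> em u (\<Lambda> \<omega>) \<ge> ennreal (1 / real (Suc J))" using j[of u] order_trans by blast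
      qed
      then show "\<omega> \<in> (\<Union>j. E j)" using w by (auto simp: E_def)
    qed (auto simp: E_def)
    then have "(\<lambda>j. measure M (E j)) \<longlonglongrightarrow> 1" using limE by (simp add: prob_space)
    from order_tendstoD(1)[OF this, of "1 - \<epsilon>"] \<epsilon> obtain j where pE: "measure M (E j) > 1 - \<epsilon>"
      by (auto simp: eventually_sequentially)
    define F where "F = (\<lambda>m. good_link k (r k) m s 0 \<and> T j m)"
    have F: "{m\<in>space locally_finite_algebra. F m} \<in> sets locally_finite_algebra"
    proof -
      have "{m\<in>space locally_finite_algebra. F m} = {m\<in>space locally_finite_algebra. good_link k (r k) m s 0} \<inter>
        {m\<in>space locally_finite_algebra. T j m}" by (auto simp: F_def)
      then show ?thesis using gl T by auto
    qed
    have "occ k (null_measure borel) Q' = {}" for Q' :: "(real^'d) set" by (simp add: occ_def)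
    then have F0: "\<not> F (null_measure borel)" by (simp add: F_def good_link_def big_def)
    \<comment> \<open>The property only inspects masses inside the cube of side
      \<open>8 * s\<close>, so the restriction in \<open>stab_event\<close> does not change
      it.\<close>
    have Fr: "F (restrict_to (cube (real (8 * s)) 0) m) \<longleftrightarrow> F m" if m: "sets m = sets borel" for m
    proof -
      have occQ: "occ k (restrict_to (cube (real (8 * s)) 0) m) (Q n) = occ k m (Q n)" if "n \<le> 8" for n
        using Qmono[OF that] unfolding Q_def by (intro occ_restrict[OF m]) (auto simp: cube_borel)
      have emQ: "em u (restrict_to (cube (real (8 * s)) 0) m) = em u m" for u
        unfolding em_def using m Qb by (simp add: emeasure_restrict_to Q_def Int_ac)
      have "occ k (restrict_to (Q 8) m) (Q 2) = occ k m (Q 2)" "occ k (restrict_to (Q 8) m) (Q 4) = occ k m (Q 4)"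
        "occ k (restrict_to (Q 8) m) (Q 8) = occ k m (Q 8)" using occQ[unfolded Qs] by simp_all
      then show ?thesis unfolding F_def good_link_def T_def Qs emQ[unfolded Qs] by simp
    qed
    define H where "H = (\<lambda>z. stab_event M \<Lambda> R (8 * s) F (site i1 i2 s z))"
    have rare: "rare M (\<lambda>z. space M - H z) q"
      unfolding H_def
    proof (rule stab_rare[OF F F0, where t = 25])
      have "measure M (B \<inter> G k \<inter> E j) > 1 - ((\<epsilon> + \<epsilon>) + \<epsilon>)"
        by (intro prob_Int_gt B G E sets.Int pB pG pE)
      moreover have "B \<inter> G k \<inter> E j \<subseteq> stab_event M \<Lambda> R (8 * s) F 0"
      proof
        fix \<omega> assume w: "\<omega> \<in> B \<inter> G k \<inter> E j"
        then have wM: "\<omega> \<in> space M" by (simp add: B_def)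
        note m = lfa_sets[OF \<Lambda>_lfa[OF wM]]
        have "(of_nat s :: ennreal) \<le> of_nat (8 * s)" by (intro of_nat_mono) simp
        then have "cube_radius R (real (8 * s)) 0 \<omega> < of_nat (8 * s)"
          using w by (auto simp only: B_def Int_iff mem_Collect_eq intro: less_le_trans)
        then show "\<omega> \<in> stab_event M \<Lambda> R (8 * s) F 0"
          unfolding stab_event_def mem_Collect_eq translate_0[OF m] Fr[OF m]
          using w wM by (simp add: F_def G_def E_def)
      qed
      then have "measure M (B \<inter> G k \<inter> E j) \<le> measure M (stab_event M \<Lambda> R (8 * s) F 0)"
        using stab_event_measurable[OF F] by (intro finite_measure_mono)
      ultimately show "1 - q ^ (25 * 25) \<le> measure M (stab_event M \<Lambda> R (8 * s) F 0)" by (simp add: \<epsilon>_def)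
    qed (use s i12 q in auto)
    define cell where "cell = (\<lambda>z u. (+) (site i1 i2 s z) ` (gcell k u \<inter> Q 8))"
    have cell_eq: "cell z u = gcell k (u + site_shift i1 i2 k s z) \<inter> cube (real (8 * s)) (site i1 i2 s z)" for z u
      unfolding cell_def Q_def by (rule translate_gcell)
    show "linked M \<Lambda> i1 i2 \<rho> q s"
      unfolding linked_def linking_scheme_def
    proof (rule exI[of _ "8 * s"], rule exI[of _ "card (U k)"], rule exI[of _ "1 / real (Suc j)"], rule exI[of _ H],
        rule exI[of _ "\<lambda>z. cell z ` U k"], intro conjI allI ballI impI)
      fix z show "finite (cell z ` U k)" "card (cell z ` U k) \<le> card (U k)" using finU by (auto intro: card_image_le)
      fix c assume "c \<in> cell z ` U k"
      then show "c \<in> sets borel" "c \<subseteq> cube (real (8 * s)) (site i1 i2 s z)" by (auto simp: cell_eq cube_borel)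
    next
      fix \<omega> Z V
      assume wM: "\<omega> \<in> space M" and *: "(0, 0) \<in> Z \<and> infinite {z. ((0, 0), z) \<in> (nbr_rel Z)\<^sup>*} \<and>
        (\<forall>z\<in>Z. \<omega> \<in> H z \<and> (\<forall>c\<in>cell z ` U k. emeasure (\<Lambda> \<omega>) c \<ge> ennreal (1 / real (Suc j)) \<longrightarrow> V \<inter> c \<noteq> {}))"
      note m = lfa_sets[OF \<Lambda>_lfa[OF wM]]
      have FH: "F (translate_measure (site i1 i2 s z) (\<Lambda> \<omega>))" if "z \<in> Z" for z
      proof -
        have "\<omega> \<in> H z" using * that by blast
        then have "F (restrict_to (cube (real (8 * s)) 0) (translate_measure (site i1 i2 s z) (\<Lambda> \<omega>)))"
          by (simp add: H_def stab_event_def)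
        then show ?thesis by (subst (asm) Fr) simp_all
      qed
      show "\<exists>x\<in>V. \<not> bounded ({(x, y). x \<in> V \<and> y \<in> V \<and> x \<noteq> y \<and> dist x y \<le> \<rho> \<and>
          x \<in> (\<Union>z\<in>Z. cube (real (8 * s)) (site i1 i2 s z)) \<and>
          y \<in> (\<Union>z\<in>Z. cube (real (8 * s)) (site i1 i2 s z))}\<^sup>* `` {x})"
      proof (rule good_link_percolates[OF i12 s(1) k(1) rk \<rho>k m])
        fix z assume z: "z \<in> Z"
        show "good_link k (r k) (\<Lambda> \<omega>) s (site i1 i2 s z)"
          using FH[OF z] by (intro good_link_translate[OF m]) (simp add: F_def)
        fix u assume u: "u \<in> occ k (\<Lambda> \<omega>) (cube (real (8 * s)) (site i1 i2 s z))"
        define v where "v = u - site_shift i1 i2 k s z"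
        have vu: "v + site_shift i1 i2 k s z = u" by (simp add: v_def)
        have vo: "v \<in> occ k (translate_measure (site i1 i2 s z) (\<Lambda> \<omega>)) (Q 8)"
          unfolding Q_def occ_translate[OF m] vu by (rule u)
        then have vU: "v \<in> U k" unfolding U_def by (rule subsetD[OF occ_subset])
        have e: "em v (translate_measure (site i1 i2 s z) (\<Lambda> \<omega>)) = emeasure (\<Lambda> \<omega>) (cell z v)"
          unfolding em_def cell_def using Qb by (intro emeasure_translate[OF m]) auto
        have "em v (translate_measure (site i1 i2 s z) (\<Lambda> \<omega>)) \<noteq> 0" using vo by (simp add: occ_def em_def)
        then have "emeasure (\<Lambda> \<omega>) (cell z v) \<ge> ennreal (1 / real (Suc j))"
          using FH[OF z] vU unfolding F_def T_def e[symmetric] by blast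
        then have "V \<inter> cell z v \<noteq> {}" using * z vU by blast
        then show "V \<inter> (gcell k u \<inter> cube (real (8 * s)) (site i1 i2 s z)) \<noteq> {}" by (simp add: cell_eq vu)
      qed (use * in auto)
    qed (use rare in auto)
  qed
qed

end

section \<open>Rare events of the Cox process\<close>

lemma cube_sites_disjoint:
  assumes i12: "i1 \<noteq> i2" and S: "separated t S" "p \<in> S" "q \<in> S" "p \<noteq> q" and n: "n < s * t"
  shows "cube (real n) (site i1 i2 s p) \<inter> cube (real n) (site i1 i2 s q) = {}"
proof -
  obtain i where "\<bar>site i1 i2 s p $ i - site i1 i2 s q $ i\<bar> \<ge> real (s * t)"
    using site_separated[OF i12 S] by blast
  moreover have "real n < real (s * t)" using n by (simp only: of_nat_less_iff)
  ultimately show ?thesis by (intro cube_disjoint[of _ _ i]) linarith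
qed

text \<open>On a finite set of sites one common index is enough, so the intersection of the unions
  is an increasing union of intersections and continuity from below applies.\<close>

lemma rare_INT_SUP:
  assumes M: "prob_space M" and t: "finite S" and E: "\<And>n z. E n z \<in> sets M"
    and inc: "\<And>z. incseq (\<lambda>n. E n z)"
    and b: "\<And>n. measure M (space M \<inter> (\<Inter>z\<in>S. E n z)) \<le> b"
  shows "measure M (space M \<inter> (\<Inter>z\<in>S. \<Union>n::nat. E n z)) \<le> b"
proof -
  interpret prob_space M by fact
  define G where "G = (\<lambda>n. space M \<inter> (\<Inter>z\<in>S. E n z))"
  have G: "G n \<in> sets M" for n unfolding G_def using t E by (intro Int_INT_sets)
  have "incseq G" unfolding incseq_def G_def using inc by (fastforce simp: incseq_def)
  then have lim: "(\<lambda>n. measure M (G n)) \<longlonglongrightarrow> measure M (\<Union>n. G n)"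
    using G by (intro finite_Lim_measure_incseq) auto
  have "space M \<inter> (\<Inter>z\<in>S. \<Union>n. E n z) = (\<Union>n. G n)"
  proof (intro set_eqI iffI)
    fix \<omega> assume w: "\<omega> \<in> space M \<inter> (\<Inter>z\<in>S. \<Union>n. E n z)"
    then have "\<forall>z\<in>S. \<exists>n. \<omega> \<in> E n z" by auto
    then obtain n where n: "\<And>z. z \<in> S \<Longrightarrow> \<omega> \<in> E (n z) z" by metis
    define m where "m = Max (insert 0 (n ` S))"
    have "\<omega> \<in> E m z" if "z \<in> S" for z
    proof -
      have "n z \<le> m" using t that by (auto simp: m_def)
      then show ?thesis using n[OF that] inc[of z] unfolding incseq_def by blast
    qed
    then show "\<omega> \<in> (\<Union>n. G n)" using w by (auto simp: G_def)
  qed (auto simp: G_def)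
  then show ?thesis using LIMSEQ_le_const2[OF lim] b by (auto simp: G_def)
qed

lemma prod_mono_ennreal:
  fixes f g :: "'a \<Rightarrow> ennreal"
  assumes "\<And>j. j \<in> S \<Longrightarrow> f j \<le> g j"
  shows "prod f S \<le> prod g S"
  using assms by (induction S rule: infinite_finite_induct) (auto intro: mult_mono)

context cox begin

text \<open>Markov's inequality for a product of functions of the counts.\<close>

lemma count_bound:
  assumes S: "finite S"
    and A: "\<And>j. j \<in> S \<Longrightarrow> A j \<in> sets borel" "\<And>j. j \<in> S \<Longrightarrow> bounded (A j)"
    and C: "C \<in> sets borel" "bounded C"
    and disj: "\<And>i j. i \<in> S \<Longrightarrow> j \<in> S \<Longrightarrow> i \<noteq> j \<Longrightarrow> A i \<inter> A j = {}"
    and G: "G \<in> sets locally_finite_algebra" and E: "E \<in> sets M" and b: "b \<ge> 0"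
    and EG: "AE \<omega> in M. \<omega> \<in> E \<longrightarrow> \<Lambda> \<omega> \<in> G \<and> (\<forall>j\<in>S. 1 \<le> count_fun \<phi> (A j \<times> C) \<omega>)"
    and bound: "\<And>\<omega> j. \<omega> \<in> space M \<Longrightarrow> \<Lambda> \<omega> \<in> G \<Longrightarrow> j \<in> S \<Longrightarrow>
      (\<Sum>n. \<phi> n * ennreal (poisson_prob (rate (A j) C \<omega>) n)) \<le> ennreal b"
  shows "measure M E \<le> b ^ card S"
proof -
  have "emeasure M E = (\<integral>\<^sup>+\<omega>. indicator E \<omega> \<partial>M)" using E by simp
  also have "\<dots> \<le> (\<integral>\<^sup>+\<omega>. indicator G (\<Lambda> \<omega>) * (\<Prod>j\<in>S. count_fun \<phi> (A j \<times> C) \<omega>) \<partial>M)"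
  proof (rule nn_integral_mono_AE, rule AE_mp[OF EG], intro AE_I2 impI)
    fix \<omega> assume *: "\<omega> \<in> E \<longrightarrow> \<Lambda> \<omega> \<in> G \<and> (\<forall>j\<in>S. 1 \<le> count_fun \<phi> (A j \<times> C) \<omega>)"
    show "indicator E \<omega> \<le> indicator G (\<Lambda> \<omega>) * (\<Prod>j\<in>S. count_fun \<phi> (A j \<times> C) \<omega>)"
    proof (cases "\<omega> \<in> E")
      case True
      have "(\<Prod>j\<in>S. 1) \<le> (\<Prod>j\<in>S. count_fun \<phi> (A j \<times> C) \<omega>)"
        using * True by (intro prod_mono_ennreal) auto
      then show ?thesis using * True by simp
    qed simp
  qed
  also have "\<dots> = (\<integral>\<^sup>+\<omega>. indicator G (\<Lambda> \<omega>) * (\<Prod>j\<in>S. \<Sum>n. \<phi> n * ennreal (poisson_prob (rate (A j) C \<omega>) n)) \<partial>M)"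
  proof (rule count_formula[where C = "\<lambda>_. C" and \<phi> = "\<lambda>_. \<phi>"])
    show "disjoint_family_on (\<lambda>j. A j \<times> C) S"
      unfolding disjoint_family_on_def using disj by blast
  qed (use S A C G in auto)
  also have "\<dots> \<le> (\<integral>\<^sup>+\<omega>. ennreal (b ^ card S) \<partial>M)"
  proof (rule nn_integral_mono)
    fix \<omega> assume w: "\<omega> \<in> space M"
    show "indicator G (\<Lambda> \<omega>) * (\<Prod>j\<in>S. \<Sum>n. \<phi> n * ennreal (poisson_prob (rate (A j) C \<omega>) n)) \<le> ennreal (b ^ card S)"
    proof (cases "\<Lambda> \<omega> \<in> G")
      case True
      have "(\<Prod>j\<in>S. \<Sum>n. \<phi> n * ennreal (poisson_prob (rate (A j) C \<omega>) n)) \<le> (\<Prod>j\<in>S. ennreal b)"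
        using bound[OF w True] by (intro prod_mono_ennreal) auto
      also have "\<dots> = ennreal (b ^ card S)" using b by (simp add: ennreal_power)
      finally show ?thesis using True by simp
    qed simp
  qed
  also have "\<dots> = ennreal (b ^ card S)" by (simp add: emeasure_space_1)
  finally show ?thesis using b by (simp add: emeasure_eq_measure)
qed

lemma empty_event:
  assumes "B \<in> sets borel"
  shows "{\<omega>\<in>space M. points_in (X \<omega>) B = {}} \<in> sets M"
proof -
  have "{\<omega>\<in>space M. points_in (X \<omega>) B = {}} = {\<omega>\<in>space M. \<forall>i. \<not> i \<in> points_in (X \<omega>) B}" by auto
  also have "\<dots> \<in> sets M" using point_event[OF assms] by measurable
  finally show ?thesis .
qed

lemma mass_event:
  assumes "B \<in> sets borel"
  shows "{\<omega>\<in>space M. a \<le> emeasure (\<Lambda> \<omega>) B} \<in> sets M" "{\<omega>\<in>space M. emeasure (\<Lambda> \<omega>) B \<le> a} \<in> sets M"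
proof -
  have "(\<lambda>\<omega>. emeasure (\<Lambda> \<omega>) B) \<in> borel_measurable M"
    by (rule measurable_compose[OF measurable_\<Lambda> measurable_emeasure_locally_finite_algebra[OF assms]])
  then show "{\<omega>\<in>space M. a \<le> emeasure (\<Lambda> \<omega>) B} \<in> sets M" "{\<omega>\<in>space M. emeasure (\<Lambda> \<omega>) B \<le> a} \<in> sets M"
    by measurable
qed

lemma void_sum: "(\<Sum>n. (if n = 0 then 1 else 0) * ennreal (poisson_prob r n)) = ennreal (exp (- r))"
proof -
  have "(\<Sum>n. (if n = 0 then 1 else 0) * ennreal (poisson_prob r n)) = (\<Sum>n\<in>{0}. (if n = 0 then 1 else 0) * ennreal (poisson_prob r n))"
    by (rule suminf_finite) auto
  then show ?thesis by (simp add: poisson_prob_def)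
qed

text \<open>Given \<open>\<Lambda>\<close>, a cell of mass at least \<open>\<delta>\<close> is void
  with probability at most \<open>exp (- lam * \<delta> * measure \<mu> C)\<close>, whatever
  \<open>\<Lambda>\<close> is otherwise; cells at separated sites are disjoint, so these bounds
  multiply. Choosing one void cell at each site of \<open>S\<close> costs a factor
  \<open>K ^ card S\<close>.\<close>

lemma charged_void_rare:
  assumes i12: "i1 \<noteq> i2" and N: "N \<le> 8 * s" and s: "s \<ge> 1"
    and cells: "\<And>z. finite (cells z) \<and> card (cells z) \<le> K \<and>
        (\<forall>c\<in>cells z. c \<in> sets borel \<and> c \<subseteq> cube (real N) (site i1 i2 s z))"
    and \<delta>: "\<delta> > 0" and C: "C \<in> sets borel" "bounded C" and q: "0 \<le> q" "q \<le> 1"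
    and small: "real K * exp (- (lam * (\<delta> * measure \<mu> C))) \<le> q ^ (9 * 9)"
  shows "rare M (\<lambda>z. {\<omega>\<in>space M. \<exists>c\<in>cells z. ennreal \<delta> \<le> emeasure (\<Lambda> \<omega>) c \<and> points_in (X \<omega>) (c \<times> C) = {}}) q"
proof -
  define V where "V = (\<lambda>c. {\<omega>\<in>space M. ennreal \<delta> \<le> emeasure (\<Lambda> \<omega>) c \<and> points_in (X \<omega>) (c \<times> C) = {}})"
  have V: "V c \<in> sets M" if "c \<in> sets borel" for c
  proof -
    have "c \<times> C \<in> sets borel" using that C by (intro borel_Times)
    then have "{\<omega>\<in>space M. ennreal \<delta> \<le> emeasure (\<Lambda> \<omega>) c} \<inter> {\<omega>\<in>space M. points_in (X \<omega>) (c \<times> C) = {}} \<in> sets M"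
      using mass_event[OF that] empty_event by (intro sets.Int) auto
    then show ?thesis by (rule back_subst[of "\<lambda>S. S \<in> sets M"]) (auto simp: V_def)
  qed
  have eq: "{\<omega>\<in>space M. \<exists>c\<in>cells z. ennreal \<delta> \<le> emeasure (\<Lambda> \<omega>) c \<and> points_in (X \<omega>) (c \<times> C) = {}} = (\<Union>c\<in>cells z. V c)" for z
    by (auto simp: V_def)
  have UV: "(\<Union>c\<in>cells z. V c) \<in> sets M" for z using cells[of z] V by (intro sets.finite_UN) auto
  \<comment> \<open>The cells lie in cubes of side \<open>N \<le> 8 * s < 9 * s\<close>, hence are
    disjoint for sites of a set that is 9-separated.\<close>
  show ?thesis
    unfolding eq
  proof (rule rare_of_separated[where t = 9, OF prob_space_axioms UV _ q])
    fix S :: "(int \<times> int) set" assume S: "finite S" "separated 9 S"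
    define P where "P = PiE S cells"
    have finP: "finite P" unfolding P_def using S cells by (intro finite_PiE) auto
    define b where "b = exp (- (lam * (\<delta> * measure \<mu> C)))"
    have Ig: "space M \<inter> (\<Inter>z\<in>S. V (g z)) \<in> sets M" if "g \<in> P" for g
      using that cells by (intro Int_INT_sets S V) (auto simp: P_def PiE_iff)
    have bound: "measure M (space M \<inter> (\<Inter>z\<in>S. V (g z))) \<le> b ^ card S" if g: "g \<in> P" for g
    proof -
      have gc: "g z \<in> sets borel" "g z \<subseteq> cube (real N) (site i1 i2 s z)" if "z \<in> S" for z
        using g that cells[of z] by (auto simp: P_def PiE_iff)
      have bd: "bounded (g z)" if "z \<in> S" for z using gc[OF that] bounded_cube bounded_subset by blast
      define G where "G = space locally_finite_algebra \<inter> (\<Inter>z\<in>S. {m\<in>space locally_finite_algebra. ennreal \<delta> \<le> emeasure m (g z)})"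
      show ?thesis
      proof (rule count_bound[where A = g and C = C and G = G and \<phi> = "\<lambda>n. if n = 0 then 1 else 0"])
        fix p q assume pq: "p \<in> S" "q \<in> S" "p \<noteq> q"
        have "N < s * 9" using N s by linarith
        from cube_sites_disjoint[OF i12 S(2) pq this] show "g p \<inter> g q = {}" using gc pq by blast
      next
        show "G \<in> sets locally_finite_algebra" unfolding G_def
        proof (rule Int_INT_sets[OF S(1)])
          fix z assume "z \<in> S"
          then show "{m\<in>space locally_finite_algebra. ennreal \<delta> \<le> emeasure m (g z)} \<in> sets locally_finite_algebra"
            using measurable_emeasure_locally_finite_algebra[OF gc(1)] by measurable
        qed
        show "AE \<omega> in M. \<omega> \<in> space M \<inter> (\<Inter>z\<in>S. V (g z)) \<longrightarrow> \<Lambda> \<omega> \<in> G \<and>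
          (\<forall>j\<in>S. 1 \<le> count_fun (\<lambda>n. if n = 0 then 1 else 0) (g j \<times> C) \<omega>)"
          by (rule AE_I2) (auto simp: V_def G_def \<Lambda>_lfa count_fun_def)
        fix \<omega> z assume w: "\<omega> \<in> space M" "\<Lambda> \<omega> \<in> G" and z: "z \<in> S"
        have "emeasure (\<Lambda> \<omega>) (g z) < \<infinity>" using lfa_finite[OF \<Lambda>_lfa[OF w(1)] gc(1)[OF z] bd[OF z]] .
        moreover have "ennreal \<delta> \<le> emeasure (\<Lambda> \<omega>) (g z)" using w z by (auto simp: G_def)
        ultimately have "enn2real (ennreal \<delta>) \<le> measure (\<Lambda> \<omega>) (g z)"
          unfolding measure_def by (intro enn2real_mono) (simp_all add: infinity_ennreal_def)
        then have "\<delta> \<le> measure (\<Lambda> \<omega>) (g z)" using \<delta> by simp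
        then have "lam * (\<delta> * measure \<mu> C) \<le> rate (g z) C \<omega>"
          using lam by (intro mult_left_mono mult_right_mono) auto
        then show "(\<Sum>n. (if n = 0 then 1 else 0) * ennreal (poisson_prob (rate (g z) C \<omega>) n)) \<le> ennreal b"
          unfolding void_sum b_def by (intro ennreal_leI) simp
      qed (use S C gc bd Ig[OF g] in \<open>auto simp: b_def\<close>)
    qed
    have "space M \<inter> (\<Inter>z\<in>S. \<Union>c\<in>cells z. V c) \<subseteq> (\<Union>g\<in>P. space M \<inter> (\<Inter>z\<in>S. V (g z)))"
    proof
      fix \<omega> assume w: "\<omega> \<in> space M \<inter> (\<Inter>z\<in>S. \<Union>c\<in>cells z. V c)"
      then have "\<forall>z\<in>S. \<exists>c. c \<in> cells z \<and> \<omega> \<in> V c" by auto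
      then obtain g where g: "\<And>z. z \<in> S \<Longrightarrow> g z \<in> cells z \<and> \<omega> \<in> V (g z)" by metis
      have "restrict g S \<in> P" using g by (auto simp: P_def)
      moreover have "\<omega> \<in> space M \<inter> (\<Inter>z\<in>S. V (restrict g S z))" using g w by auto
      ultimately show "\<omega> \<in> (\<Union>g\<in>P. space M \<inter> (\<Inter>z\<in>S. V (g z)))" by (rule UN_I[of "restrict g S"])
    qed
    then have "measure M (space M \<inter> (\<Inter>z\<in>S. \<Union>c\<in>cells z. V c)) \<le> measure M (\<Union>g\<in>P. space M \<inter> (\<Inter>z\<in>S. V (g z)))"
      by (rule finite_measure_mono[OF _ sets.finite_UN[OF finP Ig]])
    also have "\<dots> \<le> (\<Sum>g\<in>P. measure M (space M \<inter> (\<Inter>z\<in>S. V (g z))))"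
      by (rule finite_measure_subadditive_finite[OF finP image_subsetI[OF Ig]])
    also have "\<dots> \<le> (\<Sum>g\<in>P. b ^ card S)" by (rule sum_mono[OF bound])
    also have "\<dots> = real (card P) * b ^ card S" by simp
    also have "\<dots> \<le> real K ^ card S * b ^ card S"
    proof (rule mult_right_mono)
      have "card P = (\<Prod>z\<in>S. card (cells z))" unfolding P_def using S(1) by (rule card_PiE)
      also have "\<dots> \<le> (\<Prod>z\<in>S. K)" using cells by (intro prod_mono) auto
      also have "\<dots> = K ^ card S" by simp
      finally have "card P \<le> K ^ card S" .
      then show "real (card P) \<le> real K ^ card S" by (metis of_nat_le_iff of_nat_power)
    qed (simp add: b_def)
    also have "\<dots> = (real K * b) ^ card S" by (simp add: power_mult_distrib)
    also have "\<dots> \<le> (q ^ (9 * 9)) ^ card S" using small by (intro power_mono) (auto simp: b_def)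
    finally show "measure M (space M \<inter> (\<Inter>z\<in>S. \<Union>c\<in>cells z. V c)) \<le> (q ^ (9 * 9)) ^ card S" .
  qed simp
qed

lemma measure_\<mu>_le_1: "measure \<mu> B \<le> 1"
  using prob_space.prob_le_1[OF \<mu>_prob] .

lemma rate_le:
  assumes "emeasure (\<Lambda> \<omega>) A \<le> ennreal a" "a \<ge> 0"
  shows "rate A C \<omega> \<le> lam * (a * measure \<mu> C)"
proof -
  have "measure (\<Lambda> \<omega>) A \<le> a" unfolding measure_def using assms by (rule enn2real_leI[rotated])
  then show ?thesis using lam by (intro mult_left_mono mult_right_mono) auto
qed

text \<open>Exponential Markov inequality with exponent 1. The bound on the mass belongs to the
  event, so the rates are bounded whatever the dependence within \<open>\<Lambda>\<close>, and only
  the disjointness of the cubes is used.\<close>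

lemma many_points_rare:
  assumes i12: "i1 \<noteq> i2" and s: "s \<ge> 1" and a: "a \<ge> 0" and C: "C \<in> sets borel" "bounded C"
    and q: "0 < q" "q \<le> 1"
  shows "\<exists>K. rare M (\<lambda>z. {\<omega>\<in>space M. emeasure (\<Lambda> \<omega>) (cube (real (\<kappa> * s)) (site i1 i2 s z)) \<le> ennreal a \<and>
    \<not> (finite (points_in (X \<omega>) (cube (real (\<kappa> * s)) (site i1 i2 s z) \<times> C)) \<and>
      card (points_in (X \<omega>) (cube (real (\<kappa> * s)) (site i1 i2 s z) \<times> C)) \<le> K)}) q"
proof -
  define t where "t = \<kappa> + 1"
  let ?Q = "\<lambda>z. cube (real (\<kappa> * s)) (site i1 i2 s z)"
  \<comment> \<open>Solves \<open>exp (- real K) * exp (lam * a * (exp 1 - 1)) \<le> q ^ (t *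
    t)\<close>.\<close>
  obtain K :: nat where K: "real K \<ge> lam * a * (exp 1 - 1) - ln (q ^ (t * t))" using real_arch_simple by blast
  define E where "E = (\<lambda>z. {\<omega>\<in>space M. emeasure (\<Lambda> \<omega>) (?Q z) \<le> ennreal a \<and>
    \<not> (finite (points_in (X \<omega>) (?Q z \<times> C)) \<and> card (points_in (X \<omega>) (?Q z \<times> C)) \<le> K)})"
  have rect: "?Q z \<times> C \<in> sets borel" for z using C by (intro borel_Times) (auto simp: cube_borel)
  have E: "E z \<in> sets M" for z
  proof -
    have "E z = {\<omega>\<in>space M. emeasure (\<Lambda> \<omega>) (?Q z) \<le> ennreal a} -
      (\<Union>k\<in>{..K}. {\<omega>\<in>space M. finite (points_in (X \<omega>) (?Q z \<times> C)) \<and> card (points_in (X \<omega>) (?Q z \<times> C)) = k})"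
      by (auto simp: E_def)
    also have "\<dots> \<in> sets M" using mass_event[OF cube_borel] count_event[OF rect] by (intro sets.Diff sets.finite_UN) auto
    finally show ?thesis .
  qed
  have "rare M E q"
  proof (rule rare_of_separated[where t = t, OF prob_space_axioms E _ less_imp_le[OF q(1)] q(2)])
    fix S :: "(int \<times> int) set" assume S: "finite S" "separated t S"
    define G where "G = space locally_finite_algebra \<inter> (\<Inter>z\<in>S. {m\<in>space locally_finite_algebra. emeasure m (?Q z) \<le> ennreal a})"
    show "measure M (space M \<inter> (\<Inter>z\<in>S. E z)) \<le> (q ^ (t * t)) ^ card S"
    proof (rule count_bound[where A = ?Q and C = C and G = G and \<phi> = "\<lambda>n. ennreal (exp (- real K)) * ennreal (exp (1 * real n))"])
      fix p q assume pq: "p \<in> S" "q \<in> S" "p \<noteq> q"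
      have "\<kappa> * s < s * t" using s by (simp add: t_def)
      from cube_sites_disjoint[OF i12 S(2) pq this] show "?Q p \<inter> ?Q q = {}" .
    next
      show "G \<in> sets locally_finite_algebra" unfolding G_def
      proof (rule Int_INT_sets[OF S(1)])
        fix z show "{m\<in>space locally_finite_algebra. emeasure m (?Q z) \<le> ennreal a} \<in> sets locally_finite_algebra"
          using measurable_emeasure_locally_finite_algebra[OF cube_borel] by measurable
      qed
      have "AE \<omega> in M. \<forall>z\<in>S. finite (points_in (X \<omega>) (?Q z \<times> C))"
        using S(1) C by (intro AE_finite_allI AE_finite_points) (auto simp: cube_borel bounded_cube)
      then show "AE \<omega> in M. \<omega> \<in> space M \<inter> (\<Inter>z\<in>S. E z) \<longrightarrow> \<Lambda> \<omega> \<in> G \<and>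
        (\<forall>j\<in>S. 1 \<le> count_fun (\<lambda>n. ennreal (exp (- real K)) * ennreal (exp (1 * real n))) (?Q j \<times> C) \<omega>)"
      proof (rule AE_mp, intro AE_I2 impI conjI ballI)
        fix \<omega> z assume fin: "\<forall>z\<in>S. finite (points_in (X \<omega>) (?Q z \<times> C))"
          and w: "\<omega> \<in> space M \<inter> (\<Inter>z\<in>S. E z)"
        show "\<Lambda> \<omega> \<in> G" using w \<Lambda>_lfa by (auto simp: G_def E_def)
        assume z: "z \<in> S"
        then have "card (points_in (X \<omega>) (?Q z \<times> C)) > K" using w fin by (force simp: E_def)
        then have "1 \<le> exp (- real K) * exp (1 * real (card (points_in (X \<omega>) (?Q z \<times> C))))"
          by (simp add: exp_add[symmetric])
        then show "1 \<le> count_fun (\<lambda>n. ennreal (exp (- real K)) * ennreal (exp (1 * real n))) (?Q z \<times> C) \<omega>"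
          using fin z by (simp add: count_fun_def ennreal_mult'[symmetric] flip: ennreal_1)
      qed
      fix \<omega> z assume w: "\<omega> \<in> space M" "\<Lambda> \<omega> \<in> G" and z: "z \<in> S"
      have "rate (?Q z) C \<omega> \<le> lam * (a * measure \<mu> C)" using w z a by (intro rate_le) (auto simp: G_def)
      also have "\<dots> \<le> lam * a" using lam a measure_\<mu>_le_1 by (simp add: mult_left_le)
      finally have r: "rate (?Q z) C \<omega> \<le> lam * a" .
      have "(\<Sum>n. ennreal (exp (- real K)) * ennreal (exp (1 * real n)) * ennreal (poisson_prob (rate (?Q z) C \<omega>) n))
        = ennreal (exp (- real K)) * (\<Sum>n. ennreal (exp (1 * real n)) * ennreal (poisson_prob (rate (?Q z) C \<omega>) n))"
        by (simp only: mult.assoc ennreal_suminf_cmult)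
      also have "\<dots> = ennreal (exp (- real K) * exp (rate (?Q z) C \<omega> * (exp 1 - 1)))"
        by (simp only: poisson_exp_sum[OF rate_nonneg] ennreal_mult'[OF exp_ge_zero])
      also have "\<dots> \<le> ennreal (q ^ (t * t))"
      proof (rule ennreal_leI)
        have "rate (?Q z) C \<omega> * (exp 1 - 1) \<le> lam * a * (exp 1 - 1)" using r by (intro mult_right_mono) auto
        then have "exp (- real K + rate (?Q z) C \<omega> * (exp 1 - 1)) \<le> exp (ln (q ^ (t * t)))" using K by simp
        then show "exp (- real K) * exp (rate (?Q z) C \<omega> * (exp 1 - 1)) \<le> q ^ (t * t)"
          using q unfolding exp_add[symmetric] by simp
      qed
      finally show "(\<Sum>n. ennreal (exp (- real K)) * ennreal (exp (1 * real n)) * ennreal (poisson_prob (rate (?Q z) C \<omega>) n)) \<le> ennreal (q ^ (t * t))" .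
    next
      show "space M \<inter> (\<Inter>z\<in>S. E z) \<in> sets M" by (rule Int_INT_sets[OF S(1) E])
    qed (use S C q in \<open>auto simp: cube_borel bounded_cube\<close>)
  qed (simp add: t_def)
  then show ?thesis unfolding E_def by blast
qed

lemma \<mu>_tail_small:
  assumes "\<epsilon> > 0"
  shows "\<exists>k::nat. measure \<mu> {real k<..} < \<epsilon>"
proof -
  interpret \<mu>: prob_space \<mu> by (rule \<mu>_prob)
  have "(\<lambda>k::nat. measure \<mu> {real k<..}) \<longlonglongrightarrow> measure \<mu> (\<Inter>k::nat. {real k<..})"
  proof (rule \<mu>.finite_Lim_measure_decseq)
    show "range (\<lambda>k::nat. {real k<..}) \<subseteq> sets \<mu>" unfolding sets_\<mu> by auto
    show "decseq (\<lambda>k::nat. {real k<..})" by (rule decseq_SucI) auto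
  qed
  moreover have "(\<Inter>k::nat. {real k<..}) = {}"
  proof -
    have "x \<notin> (\<Inter>k::nat. {real k<..})" for x using real_arch_simple[of x] by (auto simp: not_less)
    then show ?thesis by blast
  qed
  ultimately have "(\<lambda>k::nat. measure \<mu> {real k<..}) \<longlonglongrightarrow> 0" by simp
  from order_tendstoD(2)[OF this assms] show ?thesis by (auto simp: eventually_sequentially)
qed

text \<open>A single point beyond the level \<open>k\<close> already has to be unlikely. The
  exponent \<open>e\<close> is taken so large that one point costs enough, and then \<open>k\<close>
  so large that the rate of such points keeps the exponential moment bounded. Marks are cut off at
  \<open>k + m\<close> first, because counts are controlled on bounded sets only.\<close>

lemma high_mark_rare:
  assumes i12: "i1 \<noteq> i2" and s: "s \<ge> 1" and a: "a \<ge> 0" and q: "0 < q" "q \<le> 1"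
  shows "\<exists>k::nat. rare M (\<lambda>z. {\<omega>\<in>space M. emeasure (\<Lambda> \<omega>) (cube (real (\<kappa> * s)) (site i1 i2 s z)) \<le> ennreal a \<and>
    points_in (X \<omega>) (cube (real (\<kappa> * s)) (site i1 i2 s z) \<times> {real k<..}) \<noteq> {}}) q"
proof -
  define t where "t = \<kappa> + 1"
  let ?Q = "\<lambda>z. cube (real (\<kappa> * s)) (site i1 i2 s z)"
  \<comment> \<open>Chosen so that \<open>exp (1 - e) = q ^ (t * t)\<close>; the 1 is the bound on
    \<open>rate * (exp e - 1)\<close> which the choice of \<open>c\<close> guarantees.\<close>
  define e where "e = 1 - ln (q ^ (t * t))"
  define c where "c = lam * a * exp e + 1"
  have c: "c > 0" using lam a by (auto simp: c_def intro!: add_nonneg_pos mult_nonneg_nonneg)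
  obtain k :: nat where k: "measure \<mu> {real k<..} < 1 / c" using \<mu>_tail_small[of "1 / c"] c by auto
  define C where "C = (\<lambda>m::nat. {real k<..real k + real m})"
  have C: "C m \<in> sets borel" "bounded (C m)" for m by (auto simp: C_def)
  define E where "E = (\<lambda>m z. {\<omega>\<in>space M. emeasure (\<Lambda> \<omega>) (?Q z) \<le> ennreal a \<and> points_in (X \<omega>) (?Q z \<times> C m) \<noteq> {}})"
  have rect: "?Q z \<times> C m \<in> sets borel" for z m using C by (intro borel_Times) (auto simp: cube_borel)
  have E: "E m z \<in> sets M" for m z
  proof -
    have "E m z = {\<omega>\<in>space M. emeasure (\<Lambda> \<omega>) (?Q z) \<le> ennreal a} - {\<omega>\<in>space M. points_in (X \<omega>) (?Q z \<times> C m) = {}}"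
      by (auto simp: E_def)
    also have "\<dots> \<in> sets M" using mass_event[OF cube_borel] empty_event[OF rect] by (intro sets.Diff)
    finally show ?thesis .
  qed
  have inc: "incseq (\<lambda>m. E m z)" for z
  proof (rule incseq_SucI, rule subsetI)
    fix m \<omega> assume w: "\<omega> \<in> E m z"
    have "points_in (X \<omega>) (?Q z \<times> C m) \<subseteq> points_in (X \<omega>) (?Q z \<times> C (Suc m))"
      by (auto simp: points_in_def C_def)
    then show "\<omega> \<in> E (Suc m) z" using w by (auto simp: E_def)
  qed
  have UE: "(\<Union>m. E m z) = {\<omega>\<in>space M. emeasure (\<Lambda> \<omega>) (?Q z) \<le> ennreal a \<and>
    points_in (X \<omega>) (?Q z \<times> {real k<..}) \<noteq> {}}" for z
  proof (intro set_eqI iffI)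
    fix \<omega> assume w: "\<omega> \<in> {\<omega>\<in>space M. emeasure (\<Lambda> \<omega>) (?Q z) \<le> ennreal a \<and> points_in (X \<omega>) (?Q z \<times> {real k<..}) \<noteq> {}}"
    then obtain i where i: "i \<in> points_in (X \<omega>) (?Q z \<times> {real k<..})" by blast
    obtain m :: nat where "mark (X \<omega>) i \<le> real m" using real_arch_simple by blast
    then have "i \<in> points_in (X \<omega>) (?Q z \<times> C m)" using i by (auto simp: points_in_def C_def)
    then show "\<omega> \<in> (\<Union>m. E m z)" using w by (auto simp: E_def)
  qed (auto simp: E_def C_def points_in_def)
  have "rare M (\<lambda>z. \<Union>m. E m z) q"
  proof (rule rare_of_separated[where t = t, OF prob_space_axioms _ _ less_imp_le[OF q(1)] q(2)])
    show "(\<Union>m. E m z) \<in> sets M" for z using E by auto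
    fix S :: "(int \<times> int) set" assume S: "finite S" "separated t S"
    define G where "G = space locally_finite_algebra \<inter> (\<Inter>z\<in>S. {m\<in>space locally_finite_algebra. emeasure m (?Q z) \<le> ennreal a})"
    show "measure M (space M \<inter> (\<Inter>z\<in>S. \<Union>m. E m z)) \<le> (q ^ (t * t)) ^ card S"
    proof (rule rare_INT_SUP[OF prob_space_axioms S(1) E inc])
      fix m
      show "measure M (space M \<inter> (\<Inter>z\<in>S. E m z)) \<le> (q ^ (t * t)) ^ card S"
      proof (rule count_bound[where A = ?Q and C = "C m" and G = G and \<phi> = "\<lambda>n. ennreal (exp (- e)) * ennreal (exp (e * real n))"])
        fix p q assume pq: "p \<in> S" "q \<in> S" "p \<noteq> q"
        have "\<kappa> * s < s * t" using s by (simp add: t_def)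
        from cube_sites_disjoint[OF i12 S(2) pq this] show "?Q p \<inter> ?Q q = {}" .
      next
        show "G \<in> sets locally_finite_algebra" unfolding G_def
        proof (rule Int_INT_sets[OF S(1)])
          fix z show "{m\<in>space locally_finite_algebra. emeasure m (?Q z) \<le> ennreal a} \<in> sets locally_finite_algebra"
            using measurable_emeasure_locally_finite_algebra[OF cube_borel] by measurable
        qed
        have "ln (q ^ (t * t)) \<le> 0" using q by (simp add: power_le_one)
        then have e1: "e \<ge> 0" by (simp add: e_def)
        have "AE \<omega> in M. \<forall>z\<in>S. finite (points_in (X \<omega>) (?Q z \<times> C m))"
          using S(1) C by (intro AE_finite_allI AE_finite_points) (auto simp: cube_borel bounded_cube)
        then show "AE \<omega> in M. \<omega> \<in> space M \<inter> (\<Inter>z\<in>S. E m z) \<longrightarrow> \<Lambda> \<omega> \<in> G \<and>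
          (\<forall>j\<in>S. 1 \<le> count_fun (\<lambda>n. ennreal (exp (- e)) * ennreal (exp (e * real n))) (?Q j \<times> C m) \<omega>)"
        proof (rule AE_mp, intro AE_I2 impI conjI ballI)
          fix \<omega> z assume fin: "\<forall>z\<in>S. finite (points_in (X \<omega>) (?Q z \<times> C m))"
            and w: "\<omega> \<in> space M \<inter> (\<Inter>z\<in>S. E m z)"
          show "\<Lambda> \<omega> \<in> G" using w \<Lambda>_lfa by (auto simp: G_def E_def)
          assume z: "z \<in> S"
          then have "points_in (X \<omega>) (?Q z \<times> C m) \<noteq> {}" using w by (auto simp: E_def)
          then have "card (points_in (X \<omega>) (?Q z \<times> C m)) \<ge> 1" using fin z by (simp add: Suc_le_eq card_gt_0_iff)
          then have "e * 1 \<le> e * real (card (points_in (X \<omega>) (?Q z \<times> C m)))" using e1 by (intro mult_left_mono) auto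
          then have "1 \<le> exp (- e) * exp (e * real (card (points_in (X \<omega>) (?Q z \<times> C m))))"
            by (simp add: exp_add[symmetric])
          then show "1 \<le> count_fun (\<lambda>n. ennreal (exp (- e)) * ennreal (exp (e * real n))) (?Q z \<times> C m) \<omega>"
            using fin z by (simp add: count_fun_def ennreal_mult'[symmetric] flip: ennreal_1)
        qed
        fix \<omega> z assume w: "\<omega> \<in> space M" "\<Lambda> \<omega> \<in> G" and z: "z \<in> S"
        interpret \<mu>: prob_space \<mu> by (rule \<mu>_prob)
        have "measure \<mu> (C m) \<le> measure \<mu> {real k<..}"
          by (rule \<mu>.finite_measure_mono) (auto simp: C_def sets_\<mu>)
        then have m: "measure \<mu> (C m) \<le> 1 / c" using k by linarith
        have rm: "rate (?Q z) (C m) \<omega> \<le> lam * (a * measure \<mu> (C m))" using w z a by (intro rate_le) (auto simp: G_def)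
        have "rate (?Q z) (C m) \<omega> * (exp e - 1) \<le> lam * (a * measure \<mu> (C m)) * exp e"
          using e1 lam a by (intro mult_mono[OF rm]) auto
        also have "\<dots> = lam * a * exp e * measure \<mu> (C m)" by (simp add: mult_ac)
        also have "\<dots> \<le> lam * a * exp e * (1 / c)" using m lam a by (intro mult_left_mono) auto
        also have "\<dots> \<le> 1" using c by (simp add: c_def field_simps)
        finally have r: "rate (?Q z) (C m) \<omega> * (exp e - 1) \<le> 1" .
        have "(\<Sum>n. ennreal (exp (- e)) * ennreal (exp (e * real n)) * ennreal (poisson_prob (rate (?Q z) (C m) \<omega>) n))
          = ennreal (exp (- e)) * (\<Sum>n. ennreal (exp (e * real n)) * ennreal (poisson_prob (rate (?Q z) (C m) \<omega>) n))"
          by (simp only: mult.assoc ennreal_suminf_cmult)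
        also have "\<dots> = ennreal (exp (- e) * exp (rate (?Q z) (C m) \<omega> * (exp e - 1)))"
          by (simp only: poisson_exp_sum[OF rate_nonneg] ennreal_mult'[OF exp_ge_zero])
        also have "\<dots> \<le> ennreal (q ^ (t * t))"
        proof (rule ennreal_leI)
          have "exp (- e + rate (?Q z) (C m) \<omega> * (exp e - 1)) \<le> exp (ln (q ^ (t * t)))" using r by (simp add: e_def)
          then show "exp (- e) * exp (rate (?Q z) (C m) \<omega> * (exp e - 1)) \<le> q ^ (t * t)"
          using q unfolding exp_add[symmetric] by simp
        qed
        finally show "(\<Sum>n. ennreal (exp (- e)) * ennreal (exp (e * real n)) * ennreal (poisson_prob (rate (?Q z) (C m) \<omega>) n)) \<le> ennreal (q ^ (t * t))" .
      next
        show "space M \<inter> (\<Inter>z\<in>S. E m z) \<in> sets M" by (rule Int_INT_sets[OF S(1) E])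
      qed (use S C q in \<open>auto simp: cube_borel bounded_cube\<close>)
    qed
  qed (simp add: t_def)
  then show ?thesis unfolding UE by blast
qed

end

section \<open>Percolation of the signal-to-interference graph\<close>

lemma interference_finite_bound:
  assumes "\<And>T. finite T \<Longrightarrow> T \<subseteq> dom c - {i, j} \<Longrightarrow>
    (\<Sum>k\<in>T. ennreal (mark c k * l (dist (pos c k) (pos c j)))) \<le> b"
  shows "interference l c i j \<le> b"
  unfolding interference_def by (rule infsum_le_finite_sums[OF nonneg_summable_on_complete assms]) simp_all

context cox begin

text \<open>Everything that interferes at a point of the cube of side \<open>8 * s\<close> lies
  within \<open>L\<close> of it, hence in the cube of side \<open>\<kappa> * s\<close>. If no mark
  there exceeds \<open>k1\<close> and at most \<open>k2\<close> points are there, the sum has at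
  most \<open>k2\<close> relevant terms, each at most \<open>k1 * l0\<close>.\<close>

lemma bounded_interference_rare:
  assumes i12: "i1 \<noteq> i2" and s: "s \<ge> 1" and a: "a \<ge> 0" and q: "0 < q" "q \<le> 1"
    and l: "\<And>r. r \<ge> 0 \<Longrightarrow> 0 \<le> l r \<and> l r \<le> l0" "\<And>r. r \<ge> L \<Longrightarrow> l r = 0"
    and \<kappa>: "8 * real s + 2 * L \<le> real (\<kappa> * s)"
    and H: "rare M (\<lambda>z. space M - H z) ((q / 2)\<^sup>2)"
    and Hmass: "\<And>z \<omega>. \<omega> \<in> H z \<Longrightarrow> emeasure (\<Lambda> \<omega>) (cube (real (\<kappa> * s)) (site i1 i2 s z)) \<le> ennreal a"
  shows "\<exists>K\<ge>0. \<exists>B. rare M B q \<and> (\<forall>z. \<forall>\<omega>\<in>space M - B z. \<forall>i j.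
    pos (X \<omega>) j \<in> cube (real (8 * s)) (site i1 i2 s z) \<longrightarrow> interference l (X \<omega>) i j \<le> ennreal K)"
proof -
  let ?Q = "\<lambda>z. cube (real (\<kappa> * s)) (site i1 i2 s z)"
  \<comment> \<open>Two applications of \<open>rare_Un\<close> read backwards:
    \<open>p\<^sup>2\<close> for each of the point events gives
    \<open>2 * p = (q / 2)\<^sup>2\<close>, and this together with \<open>H\<close> gives
    \<open>q\<close>.\<close>
  define p where "p = (q / 2)\<^sup>2 / 2"
  have "(q / 2)\<^sup>2 \<le> 1" using q by (intro power_le_one) auto
  then have p: "0 < p" "p \<le> 1" using q by (auto simp: p_def)
  have p2: "0 < p\<^sup>2" "p\<^sup>2 \<le> 1" using p by (auto simp: power2_eq_square mult_le_one)
  obtain k1 :: nat where k1: "rare M (\<lambda>z. {\<omega>\<in>space M. emeasure (\<Lambda> \<omega>) (?Q z) \<le> ennreal a \<and>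
    points_in (X \<omega>) (?Q z \<times> {real k1<..}) \<noteq> {}}) (p\<^sup>2)" (is "rare M ?B1 _")
    using high_mark_rare[OF i12 s a p2] by blast
  have C: "{0..real k1} \<in> sets borel" "bounded {0..real k1}" by auto
  obtain k2 where k2: "rare M (\<lambda>z. {\<omega>\<in>space M. emeasure (\<Lambda> \<omega>) (?Q z) \<le> ennreal a \<and>
    \<not> (finite (points_in (X \<omega>) (?Q z \<times> {0..real k1})) \<and> card (points_in (X \<omega>) (?Q z \<times> {0..real k1})) \<le> k2)}) (p\<^sup>2)" (is "rare M ?B2 _")
    using many_points_rare[OF i12 s a C p2] by blast
  have l0: "l0 \<ge> 0" using l(1)[of 0] by linarith
  have "rare M (\<lambda>z. ?B1 z \<union> ?B2 z) (2 * p)"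
    using p by (intro rare_Un[OF prob_space_axioms k1 k2]) auto
  then have 12: "rare M (\<lambda>z. ?B1 z \<union> ?B2 z) ((q / 2)\<^sup>2)" by (simp add: p_def)
  have "rare M (\<lambda>z. (space M - H z) \<union> (?B1 z \<union> ?B2 z)) (2 * (q / 2))"
    using q by (intro rare_Un[OF prob_space_axioms H 12]) auto
  then have rare: "rare M (\<lambda>z. (space M - H z) \<union> (?B1 z \<union> ?B2 z)) q" by simp
  define K where "K = real k2 * (real k1 * l0)"
  have K: "K \<ge> 0" using l0 by (simp add: K_def)
  show ?thesis
  proof (intro exI[of _ K] conjI K exI[of _ "\<lambda>z. (space M - H z) \<union> (?B1 z \<union> ?B2 z)"] rare allI ballI impI)
    fix z \<omega> i j assume w: "\<omega> \<in> space M - ((space M - H z) \<union> (?B1 z \<union> ?B2 z))"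
      and j: "pos (X \<omega>) j \<in> cube (real (8 * s)) (site i1 i2 s z)"
    define P where "P = points_in (X \<omega>) (?Q z \<times> {0..real k1})"
    have "\<omega> \<in> H z" "\<omega> \<in> space M" using w by auto
    then have 1: "points_in (X \<omega>) (?Q z \<times> {real k1<..}) = {}" and 2: "finite P" "card P \<le> k2"
      using w Hmass by (auto simp: P_def)
    show "interference l (X \<omega>) i j \<le> ennreal K"
    proof (rule interference_finite_bound)
      fix T assume T: "finite T" "T \<subseteq> dom (X \<omega>) - {i, j}"
      let ?f = "\<lambda>k. ennreal (mark (X \<omega>) k * l (dist (pos (X \<omega>) k) (pos (X \<omega>) j)))"
      \<comment> \<open>A point outside \<open>P\<close> is out of reach, or has a negative mark, or
        would have a mark above \<open>k1\<close> within reach. The first two give a product that is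
        truncated to 0, the third is excluded.\<close>
      have zero: "?f k = 0" if k: "k \<in> T - P" for k
      proof (cases "dist (pos (X \<omega>) k) (pos (X \<omega>) j) \<ge> L \<or> mark (X \<omega>) k < 0")
        case True
        then have "mark (X \<omega>) k * l (dist (pos (X \<omega>) k) (pos (X \<omega>) j)) \<le> 0"
          using l(2) l(1)[of "dist (pos (X \<omega>) k) (pos (X \<omega>) j)"]
          by (elim disjE) (auto intro: mult_nonpos_nonneg)
        then show ?thesis by (rule ennreal_neg)
      next
        case False
        have "pos (X \<omega>) k \<in> ?Q z"
          unfolding mem_cube
        proof
          fix h
          have "\<bar>pos (X \<omega>) j $ h - site i1 i2 s z $ h\<bar> \<le> real (8 * s) / 2" using j by (simp add: mem_cube)
          moreover have "\<bar>pos (X \<omega>) k $ h - pos (X \<omega>) j $ h\<bar> \<le> dist (pos (X \<omega>) k) (pos (X \<omega>) j)"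
            using component_le_norm_cart[of "pos (X \<omega>) k - pos (X \<omega>) j" h] by (simp add: dist_norm)
          moreover have "real (8 * s) / 2 + L \<le> real (\<kappa> * s) / 2" using \<kappa> by simp
          ultimately show "\<bar>pos (X \<omega>) k $ h - site i1 i2 s z $ h\<bar> \<le> real (\<kappa> * s) / 2"
            using False by linarith
        qed
        moreover have "k \<in> dom (X \<omega>)" using k T by auto
        ultimately have "k \<in> points_in (X \<omega>) (?Q z \<times> {real k1<..}) \<or> k \<in> P"
          using False by (auto simp: points_in_def P_def)
        then show ?thesis using 1 k by auto
      qed
      have "(\<Sum>k\<in>T. ?f k) = (\<Sum>k\<in>T \<inter> P. ?f k)"
        using T zero by (intro sum.mono_neutral_right) auto
      also have "\<dots> \<le> (\<Sum>k\<in>T \<inter> P. ennreal (real k1 * l0))"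
      proof (intro sum_mono ennreal_leI mult_mono)
        fix k assume "k \<in> T \<inter> P"
        then show "mark (X \<omega>) k \<le> real k1" by (auto simp: P_def points_in_def)
      qed (use l in auto)
      also have "\<dots> = of_nat (card (T \<inter> P)) * ennreal (real k1 * l0)" by simp
      also have "\<dots> \<le> of_nat k2 * ennreal (real k1 * l0)"
      proof (rule mult_right_mono)
        have "card (T \<inter> P) \<le> card P" using 2 by (intro card_mono) auto
        then show "(of_nat (card (T \<inter> P)) :: ennreal) \<le> of_nat k2" using 2 by (intro of_nat_mono) linarith
      qed simp
      also have "\<dots> = ennreal K" by (simp add: K_def ennreal_of_nat_eq_real_of_nat ennreal_mult'[OF of_nat_0_le_iff])
      finally show "(\<Sum>k\<in>T. ?f k) \<le> ennreal K" .
    qed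
  qed
qed

section \<open>Measurability of the percolation event\<close>

lemma dom_event [measurable]: "{\<omega>\<in>space M. i \<in> dom (X \<omega>)} \<in> sets M"
proof -
  have "{\<omega>\<in>space M. i \<in> dom (X \<omega>)} = {\<omega>\<in>space M. i \<in> points_in (X \<omega>) UNIV}" by (auto simp: points_in_def)
  then show ?thesis using point_event[of UNIV] by simp
qed

lemma measurable_pos [measurable]: "(\<lambda>\<omega>. pos (X \<omega>) i) \<in> borel_measurable M"
proof (rule measurableI)
  fix A :: "(real^'d) set" assume A: "A \<in> sets borel"
  \<comment> \<open>For an index that is not in use the position is the fixed default
    \<open>fst (the None)\<close>, so its preimage is everything or nothing.\<close>
  have "(\<lambda>\<omega>. pos (X \<omega>) i) -` A \<inter> space M = {\<omega>\<in>space M. i \<in> points_in (X \<omega>) (A \<times> UNIV)} \<union>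
    (space M - {\<omega>\<in>space M. i \<in> dom (X \<omega>)}) \<inter> (if fst (the None :: (real^'d) \<times> real) \<in> A then space M else {})"
  proof (intro set_eqI)
    fix \<omega>
    show "\<omega> \<in> (\<lambda>\<omega>. pos (X \<omega>) i) -` A \<inter> space M \<longleftrightarrow> \<omega> \<in> {\<omega>\<in>space M. i \<in> points_in (X \<omega>) (A \<times> UNIV)} \<union>
      (space M - {\<omega>\<in>space M. i \<in> dom (X \<omega>)}) \<inter> (if fst (the None :: (real^'d) \<times> real) \<in> A then space M else {})"
      by (cases "X \<omega> i") (auto simp: points_in_def pos_def mark_def domIff)
  qed
  also have "\<dots> \<in> sets M" using A by (intro sets.Un sets.Int sets.Diff point_event borel_Times dom_event) auto
  finally show "(\<lambda>\<omega>. pos (X \<omega>) i) -` A \<inter> space M \<in> sets M" .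
qed simp

lemma measurable_mark [measurable]: "(\<lambda>\<omega>. mark (X \<omega>) i) \<in> borel_measurable M"
proof (rule measurableI)
  fix A :: "real set" assume A: "A \<in> sets borel"
  have "(\<lambda>\<omega>. mark (X \<omega>) i) -` A \<inter> space M = {\<omega>\<in>space M. i \<in> points_in (X \<omega>) (UNIV \<times> A)} \<union>
    (space M - {\<omega>\<in>space M. i \<in> dom (X \<omega>)}) \<inter> (if snd (the None :: (real^'d) \<times> real) \<in> A then space M else {})"
  proof (intro set_eqI)
    fix \<omega>
    show "\<omega> \<in> (\<lambda>\<omega>. mark (X \<omega>) i) -` A \<inter> space M \<longleftrightarrow> \<omega> \<in> {\<omega>\<in>space M. i \<in> points_in (X \<omega>) (UNIV \<times> A)} \<union>
      (space M - {\<omega>\<in>space M. i \<in> dom (X \<omega>)}) \<inter> (if snd (the None :: (real^'d) \<times> real) \<in> A then space M else {})"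
      by (cases "X \<omega> i") (auto simp: points_in_def pos_def mark_def domIff)
  qed
  also have "\<dots> \<in> sets M" using A by (intro sets.Un sets.Int sets.Diff point_event borel_Times dom_event) auto
  finally show "(\<lambda>\<omega>. mark (X \<omega>) i) -` A \<inter> space M \<in> sets M" .
qed simp

lemma interference_suminf:
  "interference l c i j = (\<Sum>k. if k \<in> dom c \<and> k \<noteq> i \<and> k \<noteq> j
    then ennreal (mark c k * l (dist (pos c k) (pos c j))) else 0)" (is "_ = suminf ?f")
proof -
  have "interference l c i j = infsum ?f UNIV"
    unfolding interference_def by (rule infsum_cong_neutral) auto
  moreover have "?f sums infsum ?f UNIV" by (intro has_sum_imp_sums has_sum_infsum nonneg_summable_on_complete) simp
  ultimately show ?thesis by (simp add: sums_iff)
qed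

text \<open>Continuity is given on \<open>{0..}\<close> only; precomposing with \<open>max 0\<close>
  extends \<open>l\<close> continuously without changing its values at distances.\<close>

lemma measurable_path_loss:
  assumes l: "continuous_on {0..} l"
  shows "(\<lambda>\<omega>. l (dist (pos (X \<omega>) i) (pos (X \<omega>) j))) \<in> borel_measurable M"
proof -
  have "continuous_on UNIV (\<lambda>x::real. l (max 0 x))"
    by (rule continuous_on_compose2[OF l]) (auto intro!: continuous_intros)
  then have "(\<lambda>x. l (max 0 x)) \<in> borel_measurable borel" by (rule borel_measurable_continuous_onI)
  moreover have "(\<lambda>\<omega>. dist (pos (X \<omega>) i) (pos (X \<omega>) j)) \<in> borel_measurable M" by measurable
  ultimately have "(\<lambda>\<omega>. l (max 0 (dist (pos (X \<omega>) i) (pos (X \<omega>) j)))) \<in> borel_measurable M"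
    by (rule measurable_compose[rotated])
  then show ?thesis by simp
qed

lemma measurable_interference:
  assumes l: "continuous_on {0..} l"
  shows "(\<lambda>\<omega>. interference l (X \<omega>) i j) \<in> borel_measurable M"
  unfolding interference_suminf
proof (rule borel_measurable_suminf_order)
  fix k
  note measurable_path_loss[OF l, measurable]
  show "(\<lambda>\<omega>. if k \<in> dom (X \<omega>) \<and> k \<noteq> i \<and> k \<noteq> j
    then ennreal (mark (X \<omega>) k * l (dist (pos (X \<omega>) k) (pos (X \<omega>) j))) else 0) \<in> borel_measurable M"
    by measurable
qed

lemma sinr_ok_event:
  assumes l: "continuous_on {0..} l"
  shows "{\<omega>\<in>space M. sinr_ok \<tau> No l \<gamma> (X \<omega>) i j} \<in> sets M"
proof -
  note measurable_path_loss[OF l, measurable] measurable_interference[OF l, measurable]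
  show ?thesis unfolding sinr_ok_def by measurable
qed

text \<open>Edges join positions, and several indices may share a position, so the conditions may be
  met by other indices than \<open>i\<close> and \<open>j\<close>.\<close>

lemma edge_event:
  assumes l: "continuous_on {0..} l"
  shows "{\<omega>\<in>space M. (pos (X \<omega>) i, pos (X \<omega>) j) \<in> sinr_edges \<tau> No l \<gamma> (X \<omega>)} \<in> sets M"
proof -
  note sinr_ok_event[OF l, measurable]
  have eq: "(pos c i, pos c j) \<in> sinr_edges \<tau> No l \<gamma> c \<longleftrightarrow> (\<exists>i' j'. i' \<in> dom c \<and> j' \<in> dom c \<and>
    pos c i' = pos c i \<and> pos c j' = pos c j \<and> pos c i' \<noteq> pos c j' \<and> sinr_ok \<tau> No l \<gamma> c i' j' \<and> sinr_ok \<tau> No l \<gamma> c j' i')"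
    for c :: "'d config"
    unfolding sinr_edges_def mem_Collect_eq prod.inject by (intro iffI; elim exE conjE; intro exI conjI; assumption?; simp)
  show ?thesis unfolding eq by measurable
qed

lemma path_event:
  assumes l: "continuous_on {0..} l"
  shows "{\<omega>\<in>space M. (pos (X \<omega>) i, pos (X \<omega>) j) \<in> sinr_edges \<tau> No l \<gamma> (X \<omega>) ^^ n} \<in> sets M"
proof (induction n arbitrary: j)
  case 0
  show ?case by simp measurable
next
  case (Suc n)
  note Suc.IH[measurable] edge_event[OF l, measurable]
  have eq: "(pos c i, pos c j) \<in> sinr_edges \<tau> No l \<gamma> c ^^ Suc n \<longleftrightarrow> (\<exists>k.
    (pos c i, pos c k) \<in> sinr_edges \<tau> No l \<gamma> c ^^ n \<and> (pos c k, pos c j) \<in> sinr_edges \<tau> No l \<gamma> c)"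
    for c :: "'d config" by (auto simp: sinr_edges_def)
  show ?case unfolding eq by measurable
qed

text \<open>Reachability and unboundedness are replaced by quantifiers over indices, path lengths
  and natural radii, all of them countable.\<close>

lemma percolates_iff:
  fixes c :: "'d config"
  shows "sinr_percolates \<tau> No l \<gamma> c \<longleftrightarrow> (\<exists>i. i \<in> dom c \<and> (\<forall>b::nat. \<exists>j n.
    (pos c i, pos c j) \<in> sinr_edges \<tau> No l \<gamma> c ^^ n \<and> norm (pos c j) > real b))"
proof -
  let ?E = "sinr_edges \<tau> No l \<gamma> c"
  have "\<not> bounded (?E\<^sup>* `` {pos c i}) \<longleftrightarrow> (\<forall>b::nat. \<exists>j n. (pos c i, pos c j) \<in> ?E ^^ n \<and> norm (pos c j) > real b)" for i
  proof
    assume unb: "\<not> bounded (?E\<^sup>* `` {pos c i})"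
    show "\<forall>b::nat. \<exists>j n. (pos c i, pos c j) \<in> ?E ^^ n \<and> norm (pos c j) > real b"
    proof
      fix b :: nat
      obtain y where y: "(pos c i, y) \<in> ?E\<^sup>*" "norm y > real b"
        using unb unfolding bounded_iff by (force simp: not_le)
      then have "\<exists>j. y = pos c j" by (cases rule: rtranclE) (auto simp: sinr_edges_def)
      then obtain j where "y = pos c j" ..
      moreover obtain n where "(pos c i, y) \<in> ?E ^^ n" using y(1) by (auto simp: rtrancl_power)
      ultimately show "\<exists>j n. (pos c i, pos c j) \<in> ?E ^^ n \<and> norm (pos c j) > real b" using y by blast
    qed
  next
    assume *: "\<forall>b::nat. \<exists>j n. (pos c i, pos c j) \<in> ?E ^^ n \<and> norm (pos c j) > real b"
    show "\<not> bounded (?E\<^sup>* `` {pos c i})"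
    proof
      assume "bounded (?E\<^sup>* `` {pos c i})"
      then obtain B where B: "\<And>y. (pos c i, y) \<in> ?E\<^sup>* \<Longrightarrow> norm y \<le> B" by (auto simp: bounded_iff)
      obtain b :: nat where "B \<le> real b" using real_arch_simple by blast
      moreover obtain j n where "(pos c i, pos c j) \<in> ?E ^^ n" "norm (pos c j) > real b" using * by blast
      ultimately show False using B[of "pos c j"] by (force simp: rtrancl_power)
    qed
  qed
  then show ?thesis by (auto simp: sinr_percolates_def graph_percolates_def)
qed

lemma percolation_event:
  assumes l: "continuous_on {0..} l"
  shows "{\<omega>\<in>space M. sinr_percolates \<tau> No l \<gamma> (X \<omega>)} \<in> sets M"
proof -
  note path_event[OF l, measurable]
  show ?thesis unfolding percolates_iff by measurable
qed

text \<open>Over a link of length at most \<open>\<rho>\<close> the received power exceeds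
  \<open>p0 * l\<rho>\<close> in both directions, while the interference at both ends is at most
  \<open>K\<close>. Hence every link of the geometric graph is an edge.\<close>

lemma sinr_percolates_linked:
  assumes \<tau>: "\<tau> > 0" and No: "No > 0" and \<gamma>: "\<gamma> > 0" "\<tau> * (No + \<gamma> * K) < p0 * l\<rho>" and K: "K \<ge> 0"
    and p0: "p0 > 0" and l: "\<And>r. 0 \<le> r \<Longrightarrow> r \<le> \<rho> \<Longrightarrow> l r \<ge> l\<rho>" and l\<rho>: "l\<rho> > 0"
    and I: "\<And>i j. pos c j \<in> W \<Longrightarrow> interference l c i j \<le> ennreal K"
    and V: "V = pos c ` {i\<in>dom c. mark c i \<in> {p0<..p1}}"
    and x: "x \<in> V" "\<not> bounded ({(x, y). x \<in> V \<and> y \<in> V \<and> x \<noteq> y \<and> dist x y \<le> \<rho> \<and> x \<in> W \<and> y \<in> W}\<^sup>* `` {x})"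
  shows "sinr_percolates \<tau> No l \<gamma> c"
proof -
  define E where "E = {(x, y). x \<in> V \<and> y \<in> V \<and> x \<noteq> y \<and> dist x y \<le> \<rho> \<and> x \<in> W \<and> y \<in> W}"
  have ok: "sinr_ok \<tau> No l \<gamma> c i j" if "mark c i > p0" "pos c j \<in> W" "dist (pos c i) (pos c j) \<le> \<rho>" for i j
  proof -
    have "ennreal \<tau> * (ennreal No + ennreal \<gamma> * interference l c i j) \<le> ennreal \<tau> * (ennreal No + ennreal \<gamma> * ennreal K)"
      using I[OF that(2)] by (intro mult_left_mono add_left_mono) auto
    also have "\<dots> = ennreal (\<tau> * (No + \<gamma> * K))"
      using \<tau> No \<gamma> K by (simp add: ennreal_mult' ennreal_plus mult_nonneg_nonneg)
    also have "\<dots> < ennreal (p0 * l\<rho>)" using \<gamma> \<tau> No K by (subst ennreal_less_iff) (auto intro!: mult_nonneg_nonneg add_nonneg_nonneg)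
    also have "\<dots> \<le> ennreal (mark c i * l (dist (pos c i) (pos c j)))"
      using that p0 l\<rho> l[OF zero_le_dist that(3)] by (intro ennreal_leI mult_mono) auto
    finally show ?thesis by (simp add: sinr_ok_def)
  qed
  have "E \<subseteq> sinr_edges \<tau> No l \<gamma> c"
  proof (rule subrelI)
    fix x y assume xy: "(x, y) \<in> E"
    then obtain i j where i: "i \<in> dom c" "x = pos c i" "mark c i > p0" and j: "j \<in> dom c" "y = pos c j" "mark c j > p0"
      unfolding E_def V by auto
    have "sinr_ok \<tau> No l \<gamma> c i j" "sinr_ok \<tau> No l \<gamma> c j i" "pos c i \<noteq> pos c j"
      using xy i j by (auto simp: E_def dist_commute intro!: ok)
    then show "(x, y) \<in> sinr_edges \<tau> No l \<gamma> c" using i j unfolding sinr_edges_def by blast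
  qed
  then have "E\<^sup>* `` {x} \<subseteq> (sinr_edges \<tau> No l \<gamma> c)\<^sup>* `` {x}" using rtrancl_mono by blast
  then have "\<not> bounded ((sinr_edges \<tau> No l \<gamma> c)\<^sup>* `` {x})" using x(2) bounded_subset unfolding E_def by blast
  moreover have "x \<in> pos c ` dom c" using x(1) V by auto
  ultimately show ?thesis unfolding sinr_percolates_def graph_percolates_def by blast
qed

end

text \<open>Without such \<open>p1\<close> the half-line above \<open>p0\<close> would be a null
  set. The upper end \<open>p1\<close> keeps the window of marks bounded, as the count formula
  requires.\<close>

lemma esssup_infinite_mass:
  assumes \<mu>: "mark_distribution \<mu>" and sup: "esssup \<mu> ereal = \<infinity>"
  shows "\<exists>p1>p0. measure \<mu> {p0<..p1} > 0"
proof (rule ccontr)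
  interpret prob_space \<mu> using \<mu> by (simp add: mark_distribution_def)
  have s: "sets \<mu> = sets borel" using \<mu> by (simp add: mark_distribution_def)
  assume "\<not> ?thesis"
  then have z: "\<And>p1. p1 > p0 \<Longrightarrow> measure \<mu> {p0<..p1} = 0" using measure_nonneg by (metis less_eq_real_def)
  have "(\<Union>k::nat. {p0<..p0 + (real k + 1)}) \<in> null_sets \<mu>"
    using z by (intro null_sets_UN) (auto simp: null_sets_def s emeasure_eq_measure)
  moreover have "(\<Union>k::nat. {p0<..p0 + (real k + 1)}) = {p0<..}"
  proof (intro set_eqI iffI)
    fix x assume x: "x \<in> {p0<..}"
    obtain k :: nat where "x - p0 \<le> real k" using real_arch_simple by blast
    then show "x \<in> (\<Union>k::nat. {p0<..p0 + (real k + 1)})" using x by (intro UN_I[of k]) auto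
  qed auto
  ultimately have "{p0<..} \<in> null_sets \<mu>" by simp
  then have "AE x in \<mu>. ereal x \<le> ereal p0" by (rule AE_I') auto
  moreover have "ereal \<in> borel_measurable \<mu>"
    unfolding measurable_cong_sets[OF s refl] by simp
  ultimately have "esssup \<mu> ereal \<le> ereal p0" by (intro esssup_I)
  then show False using sup by simp
qed

lemma critical_intensity_finite:
  fixes M :: "'w measure" and \<Lambda> :: "'w \<Rightarrow> (real^'d) measure" and X :: "real \<Rightarrow> 'w \<Rightarrow> 'd config"
  assumes M: "prob_space M" and \<Lambda>: "random_measure M \<Lambda>" and \<mu>: "mark_distribution \<mu>"
    and sup: "esssup \<mu> ereal = \<infinity>" and \<tau>: "\<tau> > 0" and No: "No > 0"
    and X: "\<And>lam. lam > 0 \<Longrightarrow> marked_cox_process M \<Lambda> \<mu> lam (X lam)"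
    and cont: "continuous_on {0..} l" and l: "\<And>r. 0 \<le> r \<Longrightarrow> r \<le> \<rho> \<Longrightarrow> l r \<ge> l\<rho>" and l\<rho>: "l\<rho> > 0"
    and i12: "i1 \<noteq> i2" and s: "s \<ge> 1" and linked: "linked M \<Lambda> i1 i2 \<rho> ((1/3200)\<^sup>2) s"
    and interf: "\<And>lam. lam > 0 \<Longrightarrow> \<exists>K\<ge>0. \<exists>B. rare M B ((1/40)\<^sup>2) \<and> (\<forall>z. \<forall>\<omega>\<in>space M - B z. \<forall>i j.
      pos (X lam \<omega>) j \<in> cube (real (8 * s)) (site i1 i2 s z) \<longrightarrow> interference l (X lam \<omega>) i j \<le> ennreal K)"
  shows "critical_intensity M \<tau> No l X < \<infinity>"
proof -
  interpret M: prob_space M by fact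
  \<comment> \<open>Twice the power needed against noise alone; the surplus
    \<open>\<tau> * No\<close> is left for the interference.\<close>
  define p0 where "p0 = 2 * \<tau> * No / l\<rho>"
  have p0: "p0 > 0" "p0 * l\<rho> = 2 * \<tau> * No" using \<tau> No l\<rho> by (auto simp: p0_def)
  obtain p1 where p1: "p1 > p0" "measure \<mu> {p0<..p1} > 0" using esssup_infinite_mass[OF \<mu> sup] by blast
  let ?C = "{p0<..p1}"
  from linked obtain N Kc \<delta> H cells where scheme: "linking_scheme M \<Lambda> i1 i2 \<rho> ((1/3200)\<^sup>2) s N Kc \<delta> H cells"
    unfolding linked_def by blast
  note sch = scheme[unfolded linking_scheme_def]
  have N: "N \<le> 8 * s" and \<delta>: "\<delta> > 0" and H: "rare M (\<lambda>z. space M - H z) ((1/3200)\<^sup>2)"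
    using sch by simp_all
  have cells: "finite (cells z) \<and> card (cells z) \<le> Kc \<and>
        (\<forall>c\<in>cells z. c \<in> sets borel \<and> c \<subseteq> cube (real N) (site i1 i2 s z))" for z
    using sch by blast
  note link = sch[THEN conjunct2, THEN conjunct2, THEN conjunct2, THEN conjunct2, rule_format]
  define q :: real where "q = ((1/3200)\<^sup>2) ^ (9 * 9)"
  have q: "q > 0" by (simp add: q_def)
  define m where "m = \<delta> * measure \<mu> ?C"
  have m: "m > 0" using \<delta> p1 by (simp add: m_def)
  \<comment> \<open>Solves \<open>(Kc + 1) * exp (- lam0 * m) = q\<close>. The added 1 keeps the
    logarithm defined and makes the inequality for \<open>Kc\<close> strict.\<close>
  define lam0 where "lam0 = ln ((real Kc + 1) / q) / m"
  have lam0: "real Kc * exp (- (x * m)) < q" if "x \<ge> lam0" for x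
  proof -
    have "ln ((real Kc + 1) / q) \<le> x * m" using that m by (simp add: lam0_def field_simps)
    then have "exp (- (x * m)) \<le> exp (- ln ((real Kc + 1) / q))" by simp
    also have "\<dots> = q / (real Kc + 1)" using q by (simp add: exp_minus)
    finally have "real Kc * exp (- (x * m)) \<le> real Kc * (q / (real Kc + 1))" by (rule mult_left_mono) simp
    also have "\<dots> < q" using q by (simp add: field_simps)
    finally show ?thesis .
  qed
  define lam1 where "lam1 = max 1 lam0"
  have pos: "critical_interference M \<tau> No l (X lam) > 0" if lam: "lam > lam1" for lam
  proof -
    have lp: "lam > 0" "lam \<ge> lam0" using lam by (simp_all add: lam1_def)
    interpret cox M \<Lambda> \<mu> lam "X lam"
      by unfold_locales (use \<Lambda> \<mu> lp X[OF lp(1)] in auto)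
    obtain K B where K: "K \<ge> 0" and B: "rare M B ((1/40)\<^sup>2)"
      and I: "\<And>z \<omega> i j. \<omega> \<in> space M - B z \<Longrightarrow> pos (X lam \<omega>) j \<in> cube (real (8 * s)) (site i1 i2 s z) \<Longrightarrow>
        interference l (X lam \<omega>) i j \<le> ennreal K" using interf[OF lp(1)] by blast
    define Vd where "Vd = (\<lambda>z. {\<omega>\<in>space M. \<exists>c\<in>cells z. ennreal \<delta> \<le> emeasure (\<Lambda> \<omega>) c \<and> points_in (X lam \<omega>) (c \<times> ?C) = {}})"
    have Vd: "rare M Vd ((1/3200)\<^sup>2)"
      unfolding Vd_def
    proof (rule charged_void_rare[OF i12 N s cells \<delta>])
      have "real Kc * exp (- (lam * m)) < q" by (rule lam0[OF lp(2)])
      then show "real Kc * exp (- (lam * (\<delta> * measure \<mu> ?C))) \<le> ((1/3200)\<^sup>2) ^ (9 * 9)"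
        by (simp add: m_def q_def)
    qed (auto simp: power2_eq_square)
    \<comment> \<open>The parameters telescope: \<open>2 * (1/3200) = (1/40)\<^sup>2\<close> here,
      and \<open>2 * (1/40) = 1/20\<close> when the interference is added.\<close>
    have "rare M (\<lambda>z. (space M - H z) \<union> Vd z) (2 * (1/3200))"
      by (rule rare_Un[OF M H Vd]) auto
    then have 1: "rare M (\<lambda>z. (space M - H z) \<union> Vd z) ((1/40)\<^sup>2)" by (simp add: power2_eq_square)
    have "rare M (\<lambda>z. ((space M - H z) \<union> Vd z) \<union> B z) (2 * (1/40))"
      by (rule rare_Un[OF M 1 B]) auto
    then have "rare M (\<lambda>z. ((space M - H z) \<union> Vd z) \<union> B z) (1/20)" by simp
    from rare_infinite_cluster[OF M this] obtain Nl where Nl: "Nl \<in> sets M" "measure M Nl < 1"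
      and cl: "\<And>\<omega>. \<omega> \<in> space M - Nl \<Longrightarrow> \<omega> \<notin> ((space M - H (0, 0)) \<union> Vd (0, 0)) \<union> B (0, 0) \<and>
        infinite {z. ((0, 0), z) \<in> (nbr_rel {z. \<omega> \<notin> ((space M - H z) \<union> Vd z) \<union> B z})\<^sup>*}" by blast
    \<comment> \<open>At this point the intensity is fixed and with it \<open>K\<close>. The choice
      gives \<open>\<gamma> * K < No\<close>, so the interference uses less than the surplus left by
      \<open>p0\<close>.\<close>
    define \<gamma> where "\<gamma> = No / (2 * (K + 1))"
    have \<gamma>: "\<gamma> > 0" using No K by (simp add: \<gamma>_def)
    have "K + 1 \<noteq> 0" using K by linarith
    then have "\<gamma> * (K + 1) = No / 2"
      by (metis \<gamma>_def divide_divide_eq_left nonzero_divide_eq_eq mult.commute)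
    then have "\<gamma> * K < No" using No \<gamma> by (simp add: distrib_left)
    then have \<gamma>K: "\<tau> * (No + \<gamma> * K) < p0 * l\<rho>" unfolding p0(2) using \<tau> by (simp add: algebra_simps)
    have perc: "sinr_percolates \<tau> No l \<gamma> (X lam \<omega>)" if w: "\<omega> \<in> space M - Nl" for \<omega>
    proof -
      define Z where "Z = {z. \<omega> \<notin> ((space M - H z) \<union> Vd z) \<union> B z}"
      define V where "V = pos (X lam \<omega>) ` {i\<in>dom (X lam \<omega>). mark (X lam \<omega>) i \<in> ?C}"
      have wM: "\<omega> \<in> space M" using w by simp
      have "\<exists>x\<in>V. \<not> bounded ({(x, y). x \<in> V \<and> y \<in> V \<and> x \<noteq> y \<and> dist x y \<le> \<rho> \<and>
          x \<in> (\<Union>z\<in>Z. cube (real N) (site i1 i2 s z)) \<and>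
          y \<in> (\<Union>z\<in>Z. cube (real N) (site i1 i2 s z))}\<^sup>* `` {x})"
      proof (rule link[OF wM], intro conjI)
        show "(0, 0) \<in> Z" "infinite {z. ((0, 0), z) \<in> (nbr_rel Z)\<^sup>*}" using cl[OF w] by (auto simp: Z_def)
        show "\<forall>z\<in>Z. \<omega> \<in> H z \<and> (\<forall>c\<in>cells z. emeasure (\<Lambda> \<omega>) c \<ge> ennreal \<delta> \<longrightarrow> V \<inter> c \<noteq> {})"
        proof (intro ballI conjI impI)
        fix z assume z: "z \<in> Z"
        show "\<omega> \<in> H z" using z wM by (auto simp: Z_def)
        fix c assume c: "c \<in> cells z" "ennreal \<delta> \<le> emeasure (\<Lambda> \<omega>) c"
        have "\<omega> \<notin> Vd z" using z by (auto simp: Z_def)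
        then have "points_in (X lam \<omega>) (c \<times> ?C) \<noteq> {}" using c wM unfolding Vd_def by blast
        then show "V \<inter> c \<noteq> {}" by (auto simp: V_def points_in_def)
        qed
      qed
      then obtain x where x: "x \<in> V" "\<not> bounded ({(x, y). x \<in> V \<and> y \<in> V \<and> x \<noteq> y \<and> dist x y \<le> \<rho> \<and>
          x \<in> (\<Union>z\<in>Z. cube (real N) (site i1 i2 s z)) \<and>
          y \<in> (\<Union>z\<in>Z. cube (real N) (site i1 i2 s z))}\<^sup>* `` {x})" by blast
      show ?thesis
      proof (rule sinr_percolates_linked[OF \<tau> No \<gamma> \<gamma>K K p0(1) l l\<rho> _ V_def x])
        fix i j assume "pos (X lam \<omega>) j \<in> (\<Union>z\<in>Z. cube (real N) (site i1 i2 s z))"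
        then obtain z where z: "z \<in> Z" "pos (X lam \<omega>) j \<in> cube (real N) (site i1 i2 s z)" by blast
        have "real N \<le> real (8 * s)" using N by (simp only: of_nat_le_iff)
        then have "pos (X lam \<omega>) j \<in> cube (real (8 * s)) (site i1 i2 s z)" using z(2) cube_nested by blast
        then show "interference l (X lam \<omega>) i j \<le> ennreal K" using z(1) wM by (intro I[of _ z]) (auto simp: Z_def)
      qed
    qed
    have "measure M (space M - Nl) \<le> measure M {\<omega>\<in>space M. sinr_percolates \<tau> No l \<gamma> (X lam \<omega>)}"
      using perc by (intro M.finite_measure_mono percolation_event[OF cont]) auto
    then have "measure M {\<omega>\<in>space M. sinr_percolates \<tau> No l \<gamma> (X lam \<omega>)} > 0"
      using Nl M.prob_compl[OF Nl(1)] by linarith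
    then have "ennreal \<gamma> \<le> critical_interference M \<tau> No l (X lam)"
      unfolding critical_interference_def using \<gamma> by (intro SUP_upper) auto
    moreover have "0 < ennreal \<gamma>" using \<gamma> by simp
    ultimately show ?thesis by (rule less_le_trans[rotated])
  qed
  have "critical_intensity M \<tau> No l X \<le> ennreal lam1"
    unfolding critical_intensity_def using pos by (intro INF_lower) (auto simp: lam1_def)
  then show ?thesis by (simp add: le_less_trans[OF _ ennreal_less_top])
qed

section \<open>Summability of the path loss over the lattice\<close>

definition vnorm :: "int^'d \<Rightarrow> int" where
  "vnorm v = Max (range (\<lambda>i. \<bar>v $ i\<bar>))"

lemma vnorm_ge: "\<bar>v $ i\<bar> \<le> vnorm v"
  unfolding vnorm_def by (rule Max_ge) auto

lemma vnorm_attained: "\<exists>i. vnorm v = \<bar>v $ i\<bar>"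
proof -
  have "vnorm v \<in> range (\<lambda>i. \<bar>v $ i\<bar>)" unfolding vnorm_def by (rule Max_in) auto
  then show ?thesis by auto
qed

lemma vnorm_nonneg: "0 \<le> vnorm v"
  using vnorm_attained[of v] by auto

lemma finite_vnorm_le: "finite {v :: int^'d. vnorm v \<le> n}"
proof (rule finite_subset[OF _ finite_int_box[of 0 n]])
  show "{v :: int^'d. vnorm v \<le> n} \<subseteq> {u. \<forall>i. \<bar>u $ i - 0 $ i\<bar> \<le> n}"
    using vnorm_ge order_trans by fastforce
qed

text \<open>Some coordinate equals \<open>k\<close> or \<open>- k\<close>, and each of the others
  has at most \<open>2 * k + 1\<close> values.\<close>

lemma card_sphere:
  "card {v :: int^'d. vnorm v = int k} \<le> 2 * CARD('d) * (2 * k + 1) ^ (CARD('d) - 1)"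
proof -
  define P where "P = (\<lambda>(i::'d) e. vec_lambda ` PiE (UNIV :: 'd set) (\<lambda>h. if h = i then {e} else {- int k..int k}))"
  have "{v :: int^'d. vnorm v = int k} \<subseteq> (\<Union>(i, e)\<in>UNIV \<times> {int k, - int k}. P i e)"
  proof
    fix v :: "int^'d" assume "v \<in> {v. vnorm v = int k}"
    then have v: "vnorm v = int k" by simp
    obtain i where i: "\<bar>v $ i\<bar> = int k" using vnorm_attained[of v] v by auto
    have "\<bar>v $ h\<bar> \<le> int k" for h using vnorm_ge[of v h] v by simp
    then have "- int k \<le> v $ h \<and> v $ h \<le> int k" for h by (simp add: abs_le_iff minus_le_iff)
    then have "(\<lambda>h. v $ h) \<in> PiE UNIV (\<lambda>h. if h = i then {v $ i} else {- int k..int k})" by auto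
    then have "vec_lambda (\<lambda>h. v $ h) \<in> P i (v $ i)" unfolding P_def by (rule imageI)
    then have "v \<in> P i (v $ i)" by simp
    moreover have "v $ i \<in> {int k, - int k}" using i by (auto simp: abs_if split: if_splits)
    ultimately show "v \<in> (\<Union>(i, e)\<in>UNIV \<times> {int k, - int k}. P i e)" by blast
  qed
  moreover have finP: "finite (P i e)" for i e unfolding P_def by (intro finite_imageI finite_PiE) auto
  ultimately have "card {v :: int^'d. vnorm v = int k} \<le> card (\<Union>(i, e)\<in>UNIV \<times> {int k, - int k}. P i e)"
    by (intro card_mono finite_UN_I) auto
  also have "\<dots> \<le> (\<Sum>(i, e)\<in>UNIV \<times> {int k, - int k}. card (P i e))"
    using card_UN_le[of "UNIV \<times> {int k, - int k}" "\<lambda>(i, e). P i e"] by (simp add: case_prod_beta)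
  also have "\<dots> \<le> (\<Sum>(i, e)\<in>(UNIV :: 'd set) \<times> {int k, - int k}. (2 * k + 1) ^ (CARD('d) - 1))"
  proof (intro sum_mono, clarify)
    fix i :: 'd and e :: int
    have "card (P i e) \<le> card (PiE (UNIV :: 'd set) (\<lambda>h. if h = i then {e} else {- int k..int k}))"
      unfolding P_def by (intro card_image_le finite_PiE) auto
    also have "\<dots> = (\<Prod>h\<in>(UNIV :: 'd set). card (if h = i then {e} else {- int k..int k}))" by (rule card_PiE) simp
    also have "\<dots> = (\<Prod>h\<in>(UNIV :: 'd set) - {i}. 2 * k + 1)"
    proof -
      have c: "card {- int k..int k} = 2 * k + 1" by simp
      have "(\<Prod>h\<in>UNIV - {i}. card (if h = i then {e} else {- int k..int k})) = (\<Prod>h\<in>UNIV - {i}. 2 * k + 1)"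
        by (rule prod.cong) (auto simp only: c if_False Diff_iff singleton_iff)
      then show ?thesis by (subst prod.remove[of _ i]) simp_all
    qed
    also have "\<dots> = (2 * k + 1) ^ (CARD('d) - 1)" by (simp add: card_Diff_singleton)
    finally show "card (P i e) \<le> (2 * k + 1) ^ (CARD('d) - 1)" .
  qed
  also have "\<dots> = card ((UNIV :: 'd set) \<times> {int k, - int k}) * (2 * k + 1) ^ (CARD('d) - 1)" by simp
  also have "\<dots> \<le> (2 * CARD('d)) * (2 * k + 1) ^ (CARD('d) - 1)"
  proof (rule mult_right_mono)
    have "card {int k, - int k} \<le> 2" by (simp add: card_insert_if)
    then have "CARD('d) * card {int k, - int k} \<le> CARD('d) * 2" by (rule mult_le_mono2)
    then show "card ((UNIV :: 'd set) \<times> {int k, - int k}) \<le> 2 * CARD('d)" by (simp add: card_cartesian_product mult.commute)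
  qed simp
  finally show ?thesis .
qed

text \<open>Integral test: on \<open>[m, m + 1)\<close> the integrand is at least
  \<open>m ^ p * l (m + 1)\<close> by monotonicity. The shift by \<open>a\<close> and the factor 2
  are absorbed by starting the series later.\<close>

lemma path_loss_summable:
  fixes l :: "real \<Rightarrow> real"
  assumes nn: "\<And>r. r \<ge> 0 \<Longrightarrow> l r \<ge> 0" and anti: "\<And>r r'. 0 \<le> r \<Longrightarrow> r \<le> r' \<Longrightarrow> l r' \<le> l r"
    and int: "(\<integral>\<^sup>+ r\<in>{0..}. ennreal (r ^ p * l r) \<partial>lborel) < \<infinity>" and a: "a \<ge> 0"
  shows "summable (\<lambda>k. (2 * real k + 1) ^ p * l (max 0 (real k - a)))"
proof -
  define t where "t = (\<lambda>m::nat. real m ^ p * l (real m + 1))"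
  have t0: "t m \<ge> 0" for m using nn by (simp add: t_def)
  define I where "I = enn2real (\<integral>\<^sup>+ r\<in>{0..}. ennreal (r ^ p * l r) \<partial>lborel)"
  have I: "(\<integral>\<^sup>+ r\<in>{0..}. ennreal (r ^ p * l r) \<partial>lborel) = ennreal I" using int by (simp add: I_def)
  have I0: "I \<ge> 0" by (simp add: I_def)
  have part: "(\<Sum>m<n. t m) \<le> I" for n
  proof -
    let ?J = "\<lambda>m::nat. {real m..<real m + 1}"
    have disj: "disjoint_family_on ?J {..<n}"
      unfolding disjoint_family_on_def
    proof (intro ballI impI)
      fix i j :: nat assume "i \<noteq> j"
      then have "i + 1 \<le> j \<or> j + 1 \<le> i" by linarith
      then have "real i + 1 \<le> real j \<or> real j + 1 \<le> real i" by linarith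
      then show "?J i \<inter> ?J j = {}" by auto
    qed
    have "ennreal (\<Sum>m<n. t m) = (\<Sum>m<n. ennreal (t m))" using t0 by (simp add: sum_ennreal)
    also have "\<dots> = (\<Sum>m<n. \<integral>\<^sup>+r. ennreal (t m) * indicator (?J m) r \<partial>lborel)"
      by (intro sum.cong refl) (simp add: nn_integral_cmult_indicator)
    also have "\<dots> = (\<integral>\<^sup>+r. (\<Sum>m<n. ennreal (t m) * indicator (?J m) r) \<partial>lborel)"
      by (rule nn_integral_sum[symmetric]) simp
    also have "\<dots> \<le> (\<integral>\<^sup>+ r\<in>{0..}. ennreal (r ^ p * l r) \<partial>lborel)"
    proof (rule nn_integral_mono)
      fix r :: real
      have "(\<Sum>m<n. ennreal (t m) * indicator (?J m) r) \<le> (\<Sum>m<n. ennreal (r ^ p * l r) * indicator (?J m) r)"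
      proof (rule sum_mono)
        fix m
        show "ennreal (t m) * indicator (?J m) r \<le> ennreal (r ^ p * l r) * indicator (?J m) r"
        proof (cases "r \<in> ?J m")
          case True
          then have "t m \<le> r ^ p * l r" unfolding t_def
            using nn anti by (intro mult_mono power_mono) auto
          then show ?thesis using True by (simp add: ennreal_leI)
        qed simp
      qed
      also have "\<dots> = ennreal (r ^ p * l r) * indicator (\<Union>m<n. ?J m) r"
        unfolding indicator_UN_disjoint[OF finite_lessThan disj] by (simp add: sum_distrib_left)
      also have "\<dots> \<le> ennreal (r ^ p * l r) * indicator {0..} r"
        by (intro mult_left_mono) (auto simp: indicator_def)
      finally show "(\<Sum>m<n. ennreal (t m) * indicator (?J m) r) \<le> ennreal (r ^ p * l r) * indicator {0..} r" .
    qed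
    finally show ?thesis unfolding I using I0 by simp
  qed
  have sum_t: "summable t"
  proof (rule bounded_imp_summable)
    show "0 \<le> t n" for n by (rule t0)
    show "(\<Sum>k\<le>n. t k) \<le> I" for n using part[of "Suc n"] by (simp add: lessThan_Suc_atMost)
  qed
  \<comment> \<open>After shifting the index by \<open>A + 1\<close> the argument of
    \<open>l\<close> is at least \<open>m + 1\<close>, and for \<open>m \<ge> 1\<close> the
    polynomial factor is at most \<open>((2 * A + 5) * m) ^ p\<close>.\<close>
  define A where "A = nat \<lceil>a\<rceil> + 1"
  have A: "a \<le> real A" using a by (simp add: A_def) linarith
  have "summable (\<lambda>m. (2 * real (m + (A + 1)) + 1) ^ p * l (max 0 (real (m + (A + 1)) - a)))"
  proof (rule summable_comparison_test'[where N = 1])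
    show "summable (\<lambda>m. (2 * real A + 5) ^ p * t m)" by (intro summable_mult sum_t)
    fix m :: nat assume m: "m \<ge> 1"
    have "2 * real (m + (A + 1)) + 1 \<le> (2 * real A + 5) * real m"
    proof -
      have "2 * real A + 3 \<le> (2 * real A + 3) * real m" using m by simp
      then show ?thesis by (simp add: algebra_simps)
    qed
    then have 1: "(2 * real (m + (A + 1)) + 1) ^ p \<le> ((2 * real A + 5) * real m) ^ p" by (intro power_mono) auto
    have 2: "l (max 0 (real (m + (A + 1)) - a)) \<le> l (real m + 1)" using A by (intro anti) auto
    have "(2 * real (m + (A + 1)) + 1) ^ p * l (max 0 (real (m + (A + 1)) - a)) \<le> ((2 * real A + 5) * real m) ^ p * l (real m + 1)"
      using 1 2 nn by (intro mult_mono) auto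
    then show "norm ((2 * real (m + (A + 1)) + 1) ^ p * l (max 0 (real (m + (A + 1)) - a))) \<le> (2 * real A + 5) ^ p * t m"
      using nn by (simp add: t_def power_mult_distrib mult.assoc)
  qed
  then show ?thesis
    by (rule summable_iff_shift[where f = "\<lambda>k. (2 * real k + 1) ^ p * l (max 0 (real k - a))", THEN iffD1])
qed

text \<open>Summation over spheres of the maximum norm, whose size is of order
  \<open>k ^ (CARD('d) - 1)\<close>, reduces the lattice sum to the integrability of
  \<open>l\<close> in polar form.\<close>

lemma lattice_path_loss_bounded:
  fixes l :: "real \<Rightarrow> real"
  assumes nn: "\<And>r. r \<ge> 0 \<Longrightarrow> l r \<ge> 0" and anti: "\<And>r r'. 0 \<le> r \<Longrightarrow> r \<le> r' \<Longrightarrow> l r' \<le> l r"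
    and int: "(\<integral>\<^sup>+ r\<in>{0..}. ennreal (r ^ (CARD('d) - 1) * l r) \<partial>lborel) < \<infinity>" and a: "a \<ge> 0"
  shows "\<exists>W>0. \<forall>A :: (int^'d) set. finite A \<longrightarrow> (\<Sum>v\<in>A. l (max 0 (of_int (vnorm v) - a))) \<le> W"
proof -
  define w where "w = (\<lambda>v :: int^'d. l (max 0 (of_int (vnorm v) - a)))"
  have w0: "w v \<ge> 0" for v using nn by (simp add: w_def)
  define h where "h = (\<lambda>k::nat. (2 * real k + 1) ^ (CARD('d) - 1) * l (max 0 (real k - a)))"
  have h: "summable h" unfolding h_def by (rule path_loss_summable[OF nn anti int a])
  have h0: "h k \<ge> 0" for k using nn by (simp add: h_def)
  \<comment> \<open>The added 1 makes \<open>W\<close> positive, so that it can be divided by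
    later.\<close>
  define W where "W = 2 * real CARD('d) * suminf h + 1"
  have W: "W > 0" using suminf_nonneg[OF h h0] by (simp add: W_def add_nonneg_pos)
  have "(\<Sum>v\<in>A. w v) \<le> W" if A: "finite A" for A
  proof -
    define n where "n = Max (insert 0 ((\<lambda>v. nat (vnorm v)) ` A))"
    let ?f = "\<lambda>v. nat (vnorm v)"
    have fA: "?f ` A \<subseteq> {..n}" using A by (auto simp: n_def)
    have "(\<Sum>v\<in>A. w v) = (\<Sum>k\<le>n. \<Sum>v\<in>{v\<in>A. ?f v = k}. w v)"
      using sum.group[OF A _ fA, of w] by simp
    also have "\<dots> \<le> (\<Sum>k\<le>n. 2 * real CARD('d) * h k)"
    proof (rule sum_mono)
      fix k
      have eq: "vnorm v = int k" if "nat (vnorm v) = k" for v :: "int^'d" using that vnorm_nonneg[of v] by simp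
      have "(\<Sum>v\<in>{v\<in>A. ?f v = k}. w v) = (\<Sum>v\<in>{v\<in>A. ?f v = k}. l (max 0 (real k - a)))"
        by (intro sum.cong refl) (auto simp: w_def vnorm_nonneg)
      also have "\<dots> = real (card {v\<in>A. ?f v = k}) * l (max 0 (real k - a))" by simp
      also have "\<dots> \<le> real (2 * CARD('d) * (2 * k + 1) ^ (CARD('d) - 1)) * l (max 0 (real k - a))"
      proof (rule mult_right_mono)
        have fin: "finite {v :: int^'d. vnorm v = int k}" by (rule finite_subset[OF _ finite_vnorm_le[of "int k"]]) auto
        have "card {v\<in>A. ?f v = k} \<le> card {v :: int^'d. vnorm v = int k}"
          using eq by (intro card_mono[OF fin]) auto
        then show "real (card {v\<in>A. ?f v = k}) \<le> real (2 * CARD('d) * (2 * k + 1) ^ (CARD('d) - 1))"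
          using card_sphere[where k = k and 'd = 'd] by (simp only: of_nat_le_iff)
      qed (simp add: nn)
      also have "\<dots> = 2 * real CARD('d) * h k" by (simp add: h_def add.commute)
      finally show "(\<Sum>v\<in>{v\<in>A. ?f v = k}. w v) \<le> 2 * real CARD('d) * h k" .
    qed
    also have "\<dots> = 2 * real CARD('d) * (\<Sum>k\<le>n. h k)" by (simp add: sum_distrib_left)
    also have "\<dots> \<le> 2 * real CARD('d) * suminf h"
      using sum_le_suminf[OF h, of "{..n}"] h0 by (intro mult_left_mono) auto
    finally show ?thesis by (simp add: W_def)
  qed
  then show ?thesis using W unfolding w_def by blast
qed

section \<open>Exponential moments\<close>

text \<open>Convexity of \<open>exp\<close> on the segment from 0 to \<open>\<alpha> * y\<close>. It
  turns one exponential moment into a bound that is linear in a smaller exponent.\<close>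

lemma exp_chord:
  fixes x y \<alpha> :: real
  assumes "0 \<le> x" "x \<le> \<alpha>" "\<alpha> > 0"
  shows "exp (x * y) - 1 \<le> x / \<alpha> * (exp (\<alpha> * y) - 1)"
proof -
  have "convex_on UNIV (exp :: real \<Rightarrow> real)" by (rule exp_convex)
  then have "exp ((1 - x / \<alpha>) *\<^sub>R 0 + (x / \<alpha>) *\<^sub>R (\<alpha> * y)) \<le> (1 - x / \<alpha>) * exp 0 + x / \<alpha> * exp (\<alpha> * y)"
    using assms by (intro convex_onD) auto
  moreover have "(x / \<alpha>) * (\<alpha> * y) = x * y" using assms by simp
  ultimately show ?thesis by (simp add: algebra_simps)
qed

text \<open>The sum is at most \<open>card R\<close> times its largest term. This plays the role of
  Hoelder's inequality when dependent groups of cells are separated.\<close>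

lemma exp_sum_le_sum_exp:
  fixes a :: "'a \<Rightarrow> real"
  assumes "finite R" "R \<noteq> {}"
  shows "exp (\<Sum>r\<in>R. a r) \<le> (\<Sum>r\<in>R. exp (real (card R) * a r))"
proof -
  obtain m where m: "m \<in> R" "\<And>r. r \<in> R \<Longrightarrow> a r \<le> a m"
  proof -
    have "Max (a ` R) \<in> a ` R" using assms by (intro Max_in) auto
    then obtain m where "m \<in> R" "a m = Max (a ` R)" by auto
    then show ?thesis using that[of m] assms by auto
  qed
  have "(\<Sum>r\<in>R. a r) \<le> (\<Sum>r\<in>R. a m)" using m by (intro sum_mono)
  then have "exp (\<Sum>r\<in>R. a r) \<le> exp (real (card R) * a m)" by simp
  also have "\<dots> \<le> (\<Sum>r\<in>R. exp (real (card R) * a r))"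
    using m(1) assms(1) by (intro member_le_sum) auto
  finally show ?thesis .
qed

lemma (in prob_space) indep_var_nn_integral_mult:
  fixes X Y :: "'a \<Rightarrow> ennreal"
  assumes "indep_var borel X borel Y"
  shows "(\<integral>\<^sup>+\<omega>. X \<omega> * Y \<omega> \<partial>M) = (\<integral>\<^sup>+\<omega>. X \<omega> \<partial>M) * (\<integral>\<^sup>+\<omega>. Y \<omega> \<partial>M)"
proof -
  have "case_bool borel borel = (\<lambda>_. borel :: ennreal measure)" by (rule ext) (simp split: bool.split)
  then have "indep_vars (\<lambda>_. borel) (case_bool X Y) UNIV" using assms by (simp add: indep_var_def)
  from indep_vars_nn_integral[OF _ this] show ?thesis by (simp add: UNIV_bool mult.commute)
qed

lemma gcell_subset_cube: "gcell 1 u \<subseteq> cube 1 (\<chi> i. of_int (u $ i) + 1 / 2)"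
proof
  fix x assume x: "x \<in> gcell 1 u"
  show "x \<in> cube 1 (\<chi> i. of_int (u $ i) + 1 / 2)"
    unfolding mem_cube
  proof
    fix i
    have "\<lfloor>x $ i\<rfloor> = u $ i" using x by (auto simp: gcell_def idx_def)
    then have "of_int (u $ i) \<le> x $ i" "x $ i < of_int (u $ i) + 1" by linarith+
    then show "\<bar>x $ i - (\<chi> i. of_int (u $ i) + 1 / 2) $ i\<bar> \<le> 1 / 2"       unfolding vec_lambda_beta by linarith
  qed
qed

lemma bounded_gcell: "bounded (gcell 1 u)"
  using gcell_subset_cube bounded_cube bounded_subset by blast

lemma gcell_nonempty: "gcell 1 u \<noteq> {}"
proof -
  have "(\<chi> i. of_int (u $ i)) \<in> gcell 1 u" by (simp add: gcell_def idx_def vec_eq_iff)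
  then show ?thesis by blast
qed

lemma gcell_coord: "x \<in> gcell 1 u \<Longrightarrow> of_int (u $ i) \<le> x $ i \<and> x $ i < of_int (u $ i) + 1"
proof -
  assume "x \<in> gcell 1 u"
  then have "\<lfloor>x $ i\<rfloor> = u $ i" by (auto simp: gcell_def idx_def)
  then show ?thesis by linarith
qed

context cox begin

lemma stationary_nn_integral:
  assumes stat: "stationary_random_measure M \<Lambda>" and f: "f \<in> borel_measurable locally_finite_algebra"
  shows "(\<integral>\<^sup>+\<omega>. f (translate_measure y (\<Lambda> \<omega>)) \<partial>M) = (\<integral>\<^sup>+\<omega>. f (\<Lambda> \<omega>) \<partial>M)"
proof -
  have m: "(\<lambda>\<omega>. translate_measure y (\<Lambda> \<omega>)) \<in> measurable M locally_finite_algebra"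
    by (rule measurable_compose[OF measurable_\<Lambda> measurable_translate])
  have "(\<integral>\<^sup>+\<omega>. f (translate_measure y (\<Lambda> \<omega>)) \<partial>M) = (\<integral>\<^sup>+x. f x \<partial>distr M locally_finite_algebra (\<lambda>\<omega>. translate_measure y (\<Lambda> \<omega>)))"
    by (rule nn_integral_distr[OF m, symmetric]) (simp add: f)
  also have "distr M locally_finite_algebra (\<lambda>\<omega>. translate_measure y (\<Lambda> \<omega>)) = distr M locally_finite_algebra \<Lambda>"
    using stat by (simp add: stationary_random_measure_def)
  also have "(\<integral>\<^sup>+x. f x \<partial>distr M locally_finite_algebra \<Lambda>) = (\<integral>\<^sup>+\<omega>. f (\<Lambda> \<omega>) \<partial>M)"
    by (rule nn_integral_distr[OF measurable_\<Lambda>]) (simp add: f)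
  finally show ?thesis .
qed

lemma mass_measurable: "B \<in> sets borel \<Longrightarrow> (\<lambda>\<omega>. measure (\<Lambda> \<omega>) B) \<in> borel_measurable M"
  by (rule measurable_compose[OF measurable_\<Lambda> measurable_measure_locally_finite_algebra])

text \<open>A cell fits into a translate of the unit cube, and stationarity moves it to the origin.
  By the chord bound the result is exponential in a multiple of \<open>c\<close>, so products over
  many cells depend only on the sum of their coefficients.\<close>

lemma cell_exp_moment:
  assumes stat: "stationary_random_measure M \<Lambda>" and \<alpha>: "\<alpha> > 0"
    and m: "(\<integral>\<^sup>+\<omega>. ennreal (exp (\<alpha> * measure (\<Lambda> \<omega>) (cube 1 0))) \<partial>M) \<le> ennreal m" "m \<ge> 0"
    and c: "0 \<le> c" "c \<le> \<alpha>"
  shows "(\<integral>\<^sup>+\<omega>. ennreal (exp (c * measure (\<Lambda> \<omega>) (gcell 1 u))) \<partial>M) \<le> ennreal (exp (c * m / \<alpha>))"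
proof -
  define y where "y = (\<chi> i. of_int (u $ i) + (1 / 2 :: real))"
  have meas: "(\<lambda>\<omega>. ennreal (exp (\<alpha> * measure (\<Lambda> \<omega>) B))) \<in> borel_measurable M" if "B \<in> sets borel" for B
    using mass_measurable[OF that] by measurable
  have "(\<integral>\<^sup>+\<omega>. ennreal (exp (\<alpha> * measure (\<Lambda> \<omega>) (gcell 1 u))) \<partial>M)
    \<le> (\<integral>\<^sup>+\<omega>. ennreal (exp (\<alpha> * measure (translate_measure y (\<Lambda> \<omega>)) (cube 1 0))) \<partial>M)"
  proof (intro nn_integral_mono ennreal_leI)
    fix \<omega> assume w: "\<omega> \<in> space M"
    note s = lfa_sets[OF \<Lambda>_lfa[OF w]]
    have "emeasure (translate_measure y (\<Lambda> \<omega>)) (cube 1 0) = emeasure (\<Lambda> \<omega>) (cube 1 y)"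
      using emeasure_translate[OF s cube_borel, of y 1 0] translate_cube[of y 1 0] by simp
    then have e: "measure (translate_measure y (\<Lambda> \<omega>)) (cube 1 0) = measure (\<Lambda> \<omega>) (cube 1 y)"
      by (simp add: measure_def)
    have "measure (\<Lambda> \<omega>) (gcell 1 u) \<le> measure (\<Lambda> \<omega>) (cube 1 y)"
      unfolding measure_def
    proof (rule enn2real_mono)
      show "emeasure (\<Lambda> \<omega>) (gcell 1 u) \<le> emeasure (\<Lambda> \<omega>) (cube 1 y)"
        using gcell_subset_cube s unfolding y_def by (intro emeasure_mono) (auto simp: cube_borel)
      show "emeasure (\<Lambda> \<omega>) (cube 1 y) < top"
        using lfa_finite[OF \<Lambda>_lfa[OF w] cube_borel bounded_cube] by simp
    qed
    then show "exp (\<alpha> * measure (\<Lambda> \<omega>) (gcell 1 u)) \<le> exp (\<alpha> * measure (translate_measure y (\<Lambda> \<omega>)) (cube 1 0))"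
      using \<alpha> unfolding e by simp
  qed
  also have "\<dots> = (\<integral>\<^sup>+\<omega>. ennreal (exp (\<alpha> * measure (\<Lambda> \<omega>) (cube 1 0))) \<partial>M)"
  proof (rule stationary_nn_integral[OF stat, of "\<lambda>m. ennreal (exp (\<alpha> * measure m (cube 1 0)))"])
    have "(\<lambda>m. measure m (cube 1 0)) \<in> borel_measurable locally_finite_algebra"
      by (rule measurable_measure_locally_finite_algebra[OF cube_borel])
    then show "(\<lambda>m. ennreal (exp (\<alpha> * measure m (cube 1 0)))) \<in> borel_measurable locally_finite_algebra"
      by measurable
  qed
  finally have bound: "(\<integral>\<^sup>+\<omega>. ennreal (exp (\<alpha> * measure (\<Lambda> \<omega>) (gcell 1 u))) \<partial>M) \<le> ennreal m" using m(1) by (rule order_trans)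
  have "(\<integral>\<^sup>+\<omega>. ennreal (exp (c * measure (\<Lambda> \<omega>) (gcell 1 u))) \<partial>M)
    \<le> (\<integral>\<^sup>+\<omega>. 1 + ennreal (c / \<alpha>) * ennreal (exp (\<alpha> * measure (\<Lambda> \<omega>) (gcell 1 u))) \<partial>M)"
  proof (rule nn_integral_mono)
    fix \<omega>
    let ?x = "measure (\<Lambda> \<omega>) (gcell 1 u)"
    have "exp (c * ?x) \<le> 1 + c / \<alpha> * (exp (\<alpha> * ?x) - 1)" using exp_chord[OF c \<alpha>, of ?x] by simp
    also have "\<dots> \<le> 1 + c / \<alpha> * exp (\<alpha> * ?x)" using c \<alpha> by (simp add: algebra_simps)
    finally have "ennreal (exp (c * ?x)) \<le> ennreal (1 + c / \<alpha> * exp (\<alpha> * ?x))" by (rule ennreal_leI)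
    also have "\<dots> = 1 + ennreal (c / \<alpha>) * ennreal (exp (\<alpha> * ?x))"
      using c \<alpha> by (subst ennreal_plus) (auto simp del: times_divide_eq_left intro: ennreal_mult)
    finally show "ennreal (exp (c * ?x)) \<le> 1 + ennreal (c / \<alpha>) * ennreal (exp (\<alpha> * ?x))" .
  qed
  also have "\<dots> = 1 + ennreal (c / \<alpha>) * (\<integral>\<^sup>+\<omega>. ennreal (exp (\<alpha> * measure (\<Lambda> \<omega>) (gcell 1 u))) \<partial>M)"
    using meas[OF gcell_borel] by (simp add: nn_integral_add nn_integral_cmult emeasure_space_1)
  also have "\<dots> \<le> 1 + ennreal (c / \<alpha>) * ennreal m" using bound by (intro add_left_mono mult_left_mono) auto
  also have "\<dots> = ennreal (1 + c * m / \<alpha>)"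
    using c \<alpha> m(2) by (simp add: ennreal_mult[symmetric] ennreal_plus[symmetric] flip: ennreal_1 del: ennreal_plus)
  also have "\<dots> \<le> ennreal (exp (c * m / \<alpha>))" by (intro ennreal_leI exp_ge_add_one_self)
  finally show ?thesis .
qed

text \<open>Cells have side 1, so indices that differ by \<open>b + 2\<close> leave a distance of at
  least \<open>b + 1 > b\<close>. One cell at a time is split off from the union of the
  others.\<close>

lemma separated_cells_product:
  assumes dep: "b_dependent M \<Lambda> b" and A: "finite A"
    and sep: "\<And>u v. u \<in> A \<Longrightarrow> v \<in> A \<Longrightarrow> u \<noteq> v \<Longrightarrow> \<exists>i. of_int \<bar>u $ i - v $ i\<bar> \<ge> b + 2"
  shows "(\<integral>\<^sup>+\<omega>. (\<Prod>u\<in>A. ennreal (exp (c u * measure (\<Lambda> \<omega>) (gcell 1 u)))) \<partial>M) =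
    (\<Prod>u\<in>A. \<integral>\<^sup>+\<omega>. ennreal (exp (c u * measure (\<Lambda> \<omega>) (gcell 1 u))) \<partial>M)"
  using A sep
proof (induction A rule: finite_induct)
  case empty
  show ?case by (simp add: emeasure_space_1)
next
  case (insert u A)
  show ?case
  \<comment> \<open>For empty \<open>A\<close> the union \<open>B\<close> is empty, where
    \<open>setdist\<close> is 0 and dependence on range \<open>b\<close> says nothing.\<close>
  proof (cases "A = {}")
    case False
    let ?L = "locally_finite_algebra :: (real^'d) measure measure"
    define B where "B = (\<Union>v\<in>A. gcell 1 v)"
    have B: "B \<in> sets borel" unfolding B_def using insert.hyps(1) by (intro sets.finite_UN) (auto simp: gcell_borel)
    have "b + 1 \<le> setdist (gcell 1 u) B"
    proof (rule le_setdistI[OF gcell_nonempty])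
      show "B \<noteq> {}" using False gcell_nonempty by (auto simp: B_def)
      fix x y assume x: "x \<in> gcell 1 u" and "y \<in> B"
      then obtain v where v: "v \<in> A" "y \<in> gcell 1 v" by (auto simp: B_def)
      have "u \<noteq> v" using v insert.hyps(2) by auto
      then obtain i where "of_int \<bar>u $ i - v $ i\<bar> \<ge> b + 2" using insert.prems[of u v] v by auto
      then have "\<bar>x $ i - y $ i\<bar> \<ge> b + 1" using gcell_coord[OF x, of i] gcell_coord[OF v(2), of i] by linarith
      also have "\<bar>x $ i - y $ i\<bar> \<le> dist x y" using component_le_norm_cart[of "x - y" i] by (simp add: dist_norm)
      finally show "b + 1 \<le> dist x y" .
    qed
    then have "setdist (gcell 1 u) B > b" by linarith
    then have ind: "indep_var ?L (\<lambda>\<omega>. restrict_to (gcell 1 u) (\<Lambda> \<omega>)) ?L (\<lambda>\<omega>. restrict_to B (\<Lambda> \<omega>))"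
      using dep B unfolding b_dependent_def by (auto simp: gcell_borel)
    have f: "(\<lambda>m. ennreal (exp (c v * measure m (gcell 1 v)))) \<in> borel_measurable ?L" for v
      using measurable_measure_locally_finite_algebra[OF gcell_borel, of 1 v] by measurable
    have g: "(\<lambda>m. \<Prod>v\<in>A. ennreal (exp (c v * measure m (gcell 1 v)))) \<in> borel_measurable ?L"
      by (intro borel_measurable_prod_ennreal f)
    have iv: "indep_var borel (\<lambda>\<omega>. ennreal (exp (c u * measure (restrict_to (gcell 1 u) (\<Lambda> \<omega>)) (gcell 1 u))))
      borel (\<lambda>\<omega>. \<Prod>v\<in>A. ennreal (exp (c v * measure (restrict_to B (\<Lambda> \<omega>)) (gcell 1 v))))"
      using indep_var_compose[OF ind f g] by (simp add: comp_def)
    have r: "measure (restrict_to (gcell 1 u) (\<Lambda> \<omega>)) (gcell 1 u) = measure (\<Lambda> \<omega>) (gcell 1 u)"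
      "\<And>v. v \<in> A \<Longrightarrow> measure (restrict_to B (\<Lambda> \<omega>)) (gcell 1 v) = measure (\<Lambda> \<omega>) (gcell 1 v)" if w: "\<omega> \<in> space M" for \<omega>
    proof -
      note s = lfa_sets[OF \<Lambda>_lfa[OF w]]
      show "measure (restrict_to (gcell 1 u) (\<Lambda> \<omega>)) (gcell 1 u) = measure (\<Lambda> \<omega>) (gcell 1 u)"
        by (simp add: measure_def emeasure_restrict_to[OF s gcell_borel gcell_borel])
      fix v assume "v \<in> A"
      then have "B \<inter> gcell 1 v = gcell 1 v" by (auto simp: B_def)
      then show "measure (restrict_to B (\<Lambda> \<omega>)) (gcell 1 v) = measure (\<Lambda> \<omega>) (gcell 1 v)"
        by (simp add: measure_def emeasure_restrict_to[OF s B gcell_borel])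
    qed
    have "(\<integral>\<^sup>+\<omega>. (\<Prod>v\<in>insert u A. ennreal (exp (c v * measure (\<Lambda> \<omega>) (gcell 1 v)))) \<partial>M) =
      (\<integral>\<^sup>+\<omega>. ennreal (exp (c u * measure (restrict_to (gcell 1 u) (\<Lambda> \<omega>)) (gcell 1 u))) *
        (\<Prod>v\<in>A. ennreal (exp (c v * measure (restrict_to B (\<Lambda> \<omega>)) (gcell 1 v)))) \<partial>M)"
    proof (rule nn_integral_cong)
      fix \<omega> assume w: "\<omega> \<in> space M"
      have "(\<Prod>v\<in>A. ennreal (exp (c v * measure (restrict_to B (\<Lambda> \<omega>)) (gcell 1 v)))) =
          (\<Prod>v\<in>A. ennreal (exp (c v * measure (\<Lambda> \<omega>) (gcell 1 v))))"
        by (intro prod.cong refl) (simp only: r(2)[OF w])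
      then show "(\<Prod>v\<in>insert u A. ennreal (exp (c v * measure (\<Lambda> \<omega>) (gcell 1 v)))) =
          ennreal (exp (c u * measure (restrict_to (gcell 1 u) (\<Lambda> \<omega>)) (gcell 1 u))) *
          (\<Prod>v\<in>A. ennreal (exp (c v * measure (restrict_to B (\<Lambda> \<omega>)) (gcell 1 v))))"
        by (simp only: prod.insert[OF insert.hyps] r(1)[OF w])
    qed
    also have "\<dots> = (\<integral>\<^sup>+\<omega>. ennreal (exp (c u * measure (restrict_to (gcell 1 u) (\<Lambda> \<omega>)) (gcell 1 u))) \<partial>M) *
        (\<integral>\<^sup>+\<omega>. (\<Prod>v\<in>A. ennreal (exp (c v * measure (restrict_to B (\<Lambda> \<omega>)) (gcell 1 v)))) \<partial>M)"
      by (rule indep_var_nn_integral_mult[OF iv])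
    also have "\<dots> = (\<integral>\<^sup>+\<omega>. ennreal (exp (c u * measure (\<Lambda> \<omega>) (gcell 1 u))) \<partial>M) *
        (\<integral>\<^sup>+\<omega>. (\<Prod>v\<in>A. ennreal (exp (c v * measure (\<Lambda> \<omega>) (gcell 1 v)))) \<partial>M)"
      by (intro arg_cong2[where f = "(*)"] nn_integral_cong prod.cong refl) (simp_all only: r)
    also have "\<dots> = (\<Prod>v\<in>insert u A. \<integral>\<^sup>+\<omega>. ennreal (exp (c v * measure (\<Lambda> \<omega>) (gcell 1 v))) \<partial>M)"
      using insert by simp
    finally show ?thesis .
  qed simp
qed

text \<open>The cells are split into residue classes within which they are far apart; the sum over the
  classes is then bounded by its largest term.\<close>

lemma mass_exp_moment:
  assumes stat: "stationary_random_measure M \<Lambda>" and dep: "b_dependent M \<Lambda> b" and b: "b > 0" and \<alpha>: "\<alpha> > 0"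
    and fin: "(\<integral>\<^sup>+\<omega>. ennreal (exp (\<alpha> * measure (\<Lambda> \<omega>) (cube 1 0))) \<partial>M) < \<infinity>"
  shows "\<exists>\<kappa> C. \<kappa> \<ge> 1 \<and> C \<ge> 0 \<and> (\<forall>F \<beta>. finite F \<and> (\<forall>u\<in>F. 0 \<le> \<beta> u \<and> \<kappa> * \<beta> u \<le> \<alpha>) \<longrightarrow>
    (\<integral>\<^sup>+\<omega>. ennreal (exp (\<Sum>u\<in>F. \<beta> u * measure (\<Lambda> \<omega>) (gcell 1 u))) \<partial>M) \<le> ennreal (\<kappa> * exp (C * (\<Sum>u\<in>F. \<beta> u))))"
proof -
  define m where "m = enn2real (\<integral>\<^sup>+\<omega>. ennreal (exp (\<alpha> * measure (\<Lambda> \<omega>) (cube 1 0))) \<partial>M)"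
  have m: "(\<integral>\<^sup>+\<omega>. ennreal (exp (\<alpha> * measure (\<Lambda> \<omega>) (cube 1 0))) \<partial>M) \<le> ennreal m" "m \<ge> 0"
    using fin by (auto simp: m_def)
  \<comment> \<open>Different indices in the same residue class modulo \<open>T\<close> differ by at
    least \<open>b + 2\<close> in some coordinate.\<close>
  define T where "T = \<lceil>b\<rceil> + 2"
  have T: "T > 0" "of_int T \<ge> b + 2" using b unfolding T_def by linarith+
  define cl where "cl = (\<lambda>u :: int^'d. \<chi> i. u $ i mod T)"
  \<comment> \<open>A box containing all residue vectors. Surplus elements have empty classes and
    only enlarge the constant \<open>\<kappa>\<close>.\<close>
  define Rs where "Rs = {r :: int^'d. \<forall>i. \<bar>r $ i - 0 $ i\<bar> \<le> T}"
  have "0 \<in> Rs" using T by (simp add: Rs_def)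
  then have Rs: "finite Rs" "Rs \<noteq> {}" by (auto simp only: Rs_def finite_int_box)
  have clR: "cl u \<in> Rs" for u
  proof -
    have "\<bar>u $ i mod T\<bar> \<le> T" for i
      using pos_mod_bound[OF T(1), of "u $ i"] pos_mod_sign[OF T(1), of "u $ i"] by linarith
    then show ?thesis unfolding Rs_def cl_def by simp
  qed
  define \<kappa> where "\<kappa> = real (card Rs)"
  have "card Rs \<ge> 1" using Rs by (simp add: Suc_le_eq card_gt_0_iff)
  then have \<kappa>: "\<kappa> \<ge> 1" by (simp add: \<kappa>_def)
  have sep: "\<exists>i. of_int \<bar>u $ i - v $ i\<bar> \<ge> b + 2" if uv: "cl u = cl v" "u \<noteq> v" for u v
  proof -
    obtain i where i: "u $ i \<noteq> v $ i" using uv(2) by (auto simp: vec_eq_iff)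
    have "u $ i mod T = v $ i mod T" using uv(1) by (simp add: cl_def vec_eq_iff)
    then have "T dvd (u $ i - v $ i)" by (simp add: mod_eq_dvd_iff)
    then have "T \<le> \<bar>u $ i - v $ i\<bar>" using i dvd_imp_le_int[of "u $ i - v $ i" T] T by simp
    then have "real_of_int T \<le> of_int \<bar>u $ i - v $ i\<bar>" by (simp only: of_int_le_iff)
    then show ?thesis using T(2) by (intro exI[of _ i]) linarith
  qed
  show ?thesis
  proof (rule exI[of _ \<kappa>], rule exI[of _ "\<kappa> * m / \<alpha>"], intro conjI \<kappa> allI impI)
    show "0 \<le> \<kappa> * m / \<alpha>" using \<kappa> m \<alpha> by simp
    fix F and \<beta> :: "int^'d \<Rightarrow> real" assume F: "finite F \<and> (\<forall>u\<in>F. 0 \<le> \<beta> u \<and> \<kappa> * \<beta> u \<le> \<alpha>)"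
    define Fr where "Fr = (\<lambda>r. {u\<in>F. cl u = r})"
    have finFr: "finite (Fr r)" for r using F by (simp add: Fr_def)
    let ?x = "\<lambda>\<omega> u. measure (\<Lambda> \<omega>) (gcell 1 u)"
    have xm: "(\<lambda>\<omega>. ennreal (exp (c * ?x \<omega> u))) \<in> borel_measurable M" for c u
      using mass_measurable[OF gcell_borel] by measurable
    have "(\<integral>\<^sup>+\<omega>. ennreal (exp (\<Sum>u\<in>F. \<beta> u * ?x \<omega> u)) \<partial>M)
      \<le> (\<integral>\<^sup>+\<omega>. (\<Sum>r\<in>Rs. \<Prod>u\<in>Fr r. ennreal (exp (\<kappa> * \<beta> u * ?x \<omega> u))) \<partial>M)"
    proof (rule nn_integral_mono)
      fix \<omega>
      have "(\<Sum>u\<in>F. \<beta> u * ?x \<omega> u) = (\<Sum>r\<in>Rs. \<Sum>u\<in>Fr r. \<beta> u * ?x \<omega> u)"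
        unfolding Fr_def using F Rs clR by (intro sum.group[symmetric]) auto
      then have "exp (\<Sum>u\<in>F. \<beta> u * ?x \<omega> u) \<le> (\<Sum>r\<in>Rs. exp (real (card Rs) * (\<Sum>u\<in>Fr r. \<beta> u * ?x \<omega> u)))"
        using exp_sum_le_sum_exp[OF Rs] by simp
      also have "\<dots> = (\<Sum>r\<in>Rs. \<Prod>u\<in>Fr r. exp (\<kappa> * \<beta> u * ?x \<omega> u))"
        by (intro sum.cong refl) (simp add: \<kappa>_def sum_distrib_left mult.assoc exp_sum[OF finFr])
      finally have "ennreal (exp (\<Sum>u\<in>F. \<beta> u * ?x \<omega> u)) \<le> ennreal (\<Sum>r\<in>Rs. \<Prod>u\<in>Fr r. exp (\<kappa> * \<beta> u * ?x \<omega> u))"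
        by (rule ennreal_leI)
      also have "\<dots> = (\<Sum>r\<in>Rs. \<Prod>u\<in>Fr r. ennreal (exp (\<kappa> * \<beta> u * ?x \<omega> u)))"
        by (simp add: sum_ennreal[symmetric] prod_ennreal[symmetric] prod_nonneg)
      finally show "ennreal (exp (\<Sum>u\<in>F. \<beta> u * ?x \<omega> u)) \<le> (\<Sum>r\<in>Rs. \<Prod>u\<in>Fr r. ennreal (exp (\<kappa> * \<beta> u * ?x \<omega> u)))" .
    qed
    also have "\<dots> = (\<Sum>r\<in>Rs. \<integral>\<^sup>+\<omega>. (\<Prod>u\<in>Fr r. ennreal (exp (\<kappa> * \<beta> u * ?x \<omega> u))) \<partial>M)"
      by (intro nn_integral_sum borel_measurable_prod_ennreal xm)
    also have "\<dots> = (\<Sum>r\<in>Rs. \<Prod>u\<in>Fr r. \<integral>\<^sup>+\<omega>. ennreal (exp (\<kappa> * \<beta> u * ?x \<omega> u)) \<partial>M)"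
      by (intro sum.cong refl separated_cells_product[OF dep finFr] sep) (auto simp: Fr_def)
    also have "\<dots> \<le> (\<Sum>r\<in>Rs. \<Prod>u\<in>Fr r. ennreal (exp (\<kappa> * \<beta> u * m / \<alpha>)))"
      using F \<kappa> by (intro sum_mono prod_mono_ennreal cell_exp_moment[OF stat \<alpha> m]) (auto simp: Fr_def)
    also have "\<dots> = ennreal (\<Sum>r\<in>Rs. exp (\<Sum>u\<in>Fr r. \<kappa> * \<beta> u * m / \<alpha>))"
      by (simp add: sum_ennreal prod_ennreal prod_nonneg exp_sum[OF finFr])
    also have "\<dots> \<le> ennreal (\<Sum>r\<in>Rs. exp (\<kappa> * m / \<alpha> * (\<Sum>u\<in>F. \<beta> u)))"
    proof (intro ennreal_leI sum_mono)
      fix r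
      have "(\<Sum>u\<in>Fr r. \<kappa> * \<beta> u * m / \<alpha>) = \<kappa> * m / \<alpha> * (\<Sum>u\<in>Fr r. \<beta> u)"
        unfolding sum_distrib_left by (intro sum.cong refl) simp
      also have "\<dots> \<le> \<kappa> * m / \<alpha> * (\<Sum>u\<in>F. \<beta> u)"
        using F \<kappa> m \<alpha> by (intro mult_left_mono sum_mono2) (auto simp: Fr_def)
      finally show "exp (\<Sum>u\<in>Fr r. \<kappa> * \<beta> u * m / \<alpha>) \<le> exp (\<kappa> * m / \<alpha> * (\<Sum>u\<in>F. \<beta> u))" by simp
    qed
    also have "\<dots> = ennreal (\<kappa> * exp (\<kappa> * m / \<alpha> * (\<Sum>u\<in>F. \<beta> u)))" by (simp add: \<kappa>_def)
    finally show "(\<integral>\<^sup>+\<omega>. ennreal (exp (\<Sum>u\<in>F. \<beta> u * ?x \<omega> u)) \<partial>M) \<le> ennreal (\<kappa> * exp (\<kappa> * m / \<alpha> * (\<Sum>u\<in>F. \<beta> u)))" .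
  qed
qed

end

section \<open>Interference with unbounded range\<close>

text \<open>Open on the left: points with mark 0 belong to no cell, and they contribute nothing to
  the interference.\<close>

abbreviation mark_cell :: "nat \<Rightarrow> real set" where
  "mark_cell j \<equiv> {real j<..real j + 1}"

lemma mark_cells_disjoint: "i \<noteq> j \<Longrightarrow> mark_cell i \<inter> mark_cell j = {}"
proof -
  assume "i \<noteq> j"
  then have "i + 1 \<le> j \<or> j + 1 \<le> i" by linarith
  then have "real i + 1 \<le> real j \<or> real j + 1 \<le> real i" by linarith
  then show ?thesis by auto
qed

text \<open>On \<open>mark_cell j\<close> the exponent \<open>\<alpha> * (real j + 1)\<close>
  exceeds \<open>\<alpha> * p\<close> by at most \<open>\<alpha>\<close>. The bound is uniform in
  \<open>J\<close>, so marks may be truncated at first.\<close>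

lemma mark_exp_sum:
  assumes \<mu>: "mark_distribution \<mu>" and \<alpha>: "\<alpha> > 0"
    and fin: "(\<integral>\<^sup>+p. ennreal (exp (\<alpha> * p)) \<partial>\<mu>) < \<infinity>"
  shows "\<exists>D\<ge>0. \<forall>J. (\<Sum>j<J. measure \<mu> (mark_cell j) * (exp (\<alpha> * (real j + 1)) - 1)) \<le> D"
proof -
  interpret prob_space \<mu> using \<mu> by (simp add: mark_distribution_def)
  have s: "sets \<mu> = sets borel" using \<mu> by (simp add: mark_distribution_def)
  define I where "I = enn2real (\<integral>\<^sup>+p. ennreal (exp (\<alpha> * p)) \<partial>\<mu>)"
  have I: "(\<integral>\<^sup>+p. ennreal (exp (\<alpha> * p)) \<partial>\<mu>) = ennreal I" "I \<ge> 0" using fin by (auto simp: I_def)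
  have "(\<Sum>j<J. measure \<mu> (mark_cell j) * (exp (\<alpha> * (real j + 1)) - 1)) \<le> exp \<alpha> * I" for J
  proof -
    have disj: "disjoint_family_on mark_cell {..<J}"
      unfolding disjoint_family_on_def using mark_cells_disjoint by blast
    have le: "(\<Sum>j<J. measure \<mu> (mark_cell j) * (exp (\<alpha> * (real j + 1)) - 1)) \<le> (\<Sum>j<J. measure \<mu> (mark_cell j) * exp (\<alpha> * (real j + 1)))"
      by (intro sum_mono mult_left_mono) auto
    have "ennreal (\<Sum>j<J. measure \<mu> (mark_cell j) * exp (\<alpha> * (real j + 1))) = (\<Sum>j<J. ennreal (exp (\<alpha> * (real j + 1))) * emeasure \<mu> (mark_cell j))"
      by (simp add: sum_ennreal[symmetric] ennreal_mult emeasure_eq_measure mult.commute)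
    also have "\<dots> = (\<Sum>j<J. \<integral>\<^sup>+p. ennreal (exp (\<alpha> * (real j + 1))) * indicator (mark_cell j) p \<partial>\<mu>)"
      by (intro sum.cong refl nn_integral_cmult_indicator[symmetric]) (simp add: s)
    also have "\<dots> = (\<integral>\<^sup>+p. (\<Sum>j<J. ennreal (exp (\<alpha> * (real j + 1))) * indicator (mark_cell j) p) \<partial>\<mu>)"
      by (intro nn_integral_sum[symmetric] borel_measurable_times_ennreal borel_measurable_const borel_measurable_indicator) (simp add: s)
    also have "\<dots> \<le> (\<integral>\<^sup>+p. ennreal (exp \<alpha>) * ennreal (exp (\<alpha> * p)) \<partial>\<mu>)"
    proof (rule nn_integral_mono)
      fix p :: real
      have "(\<Sum>j<J. ennreal (exp (\<alpha> * (real j + 1))) * indicator (mark_cell j) p)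
        \<le> (\<Sum>j<J. ennreal (exp (\<alpha> * (p + 1))) * indicator (mark_cell j) p)"
        using \<alpha> by (intro sum_mono) (auto simp: indicator_def intro!: ennreal_leI)
      also have "\<dots> = ennreal (exp (\<alpha> * (p + 1))) * indicator (\<Union>j<J. mark_cell j) p"
        unfolding indicator_UN_disjoint[OF finite_lessThan disj] by (simp add: sum_distrib_left)
      also have "\<dots> \<le> ennreal (exp (\<alpha> * (p + 1))) * 1" by (intro mult_left_mono) (auto simp: indicator_def)
      also have "\<dots> = ennreal (exp \<alpha>) * ennreal (exp (\<alpha> * p))"
        by (simp add: ennreal_mult[symmetric] exp_add[symmetric] algebra_simps)
      finally show "(\<Sum>j<J. ennreal (exp (\<alpha> * (real j + 1))) * indicator (mark_cell j) p) \<le> ennreal (exp \<alpha>) * ennreal (exp (\<alpha> * p))" .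
    qed
    also have "\<dots> = ennreal (exp \<alpha>) * (\<integral>\<^sup>+p. ennreal (exp (\<alpha> * p)) \<partial>\<mu>)"
    proof (rule nn_integral_cmult)
      show "(\<lambda>p. ennreal (exp (\<alpha> * p))) \<in> borel_measurable \<mu>"
        unfolding measurable_cong_sets[OF s refl] by measurable
    qed
    also have "\<dots> = ennreal (exp \<alpha> * I)" unfolding I(1) by (simp add: ennreal_mult I(2))
    finally have "(\<Sum>j<J. measure \<mu> (mark_cell j) * exp (\<alpha> * (real j + 1))) \<le> exp \<alpha> * I"
      using I(2) by (subst (asm) ennreal_le_iff) auto
    with le show ?thesis by linarith
  qed
  then show ?thesis using I(2) by (intro exI[of _ "exp \<alpha> * I"]) auto
qed

section \<open>Shot-noise estimates for the interference\<close>

context cox begin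

abbreviation cell_count :: "int^'d \<Rightarrow> nat \<Rightarrow> 'w \<Rightarrow> nat" where
  "cell_count u j \<omega> \<equiv> card (points_in (X \<omega>) (gcell 1 u \<times> mark_cell j))"

lemma cell_rect: "gcell 1 u \<times> mark_cell j \<in> sets borel"
  by (intro borel_Times) (auto simp: gcell_borel)

lemma measurable_cell_count: "(\<lambda>\<omega>. real (cell_count u j \<omega>)) \<in> borel_measurable M"
proof -
  have "(\<lambda>\<omega>. real (cell_count u j \<omega>)) = (\<lambda>\<omega>. enn2real (count_fun (\<lambda>n. ennreal (real n)) (gcell 1 u \<times> mark_cell j) \<omega>))"
    by (auto simp: count_fun_def)
  then show ?thesis using measurable_count_fun[OF cell_rect] by (simp add: borel_measurable_enn2real)
qed

text \<open>Exponential moment of a shot noise with weights \<open>g\<close> and marks rounded up.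
  Given \<open>\<Lambda>\<close>, the Poisson moment generating function yields an exponential of
  the masses. The chord bound extracts the factor \<open>\<theta> * g u / \<alpha>\<close>, the
  remaining sum over marks is at most \<open>D\<close>, and the moment of the masses is supplied by
  the hypothesis \<open>mass\<close>.\<close>

lemma points_exp_moment:
  fixes g :: "int^'d \<Rightarrow> real"
  assumes mass: "\<And>F \<beta>. finite F \<Longrightarrow> (\<And>u. u \<in> F \<Longrightarrow> 0 \<le> \<beta> u \<and> \<kappa> * \<beta> u \<le> \<alpha>) \<Longrightarrow>
      (\<integral>\<^sup>+\<omega>. ennreal (exp (\<Sum>u\<in>F. \<beta> u * measure (\<Lambda> \<omega>) (gcell 1 u))) \<partial>M) \<le> ennreal (\<kappa> * exp (C * (\<Sum>u\<in>F. \<beta> u)))"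
    and D: "D \<ge> 0" "\<And>J. (\<Sum>j<J. measure \<mu> (mark_cell j) * (exp (\<alpha> * (real j + 1)) - 1)) \<le> D"
    and \<alpha>: "\<alpha> > 0" and \<kappa>: "\<kappa> \<ge> 1" and \<theta>: "\<theta> \<ge> 0" "\<theta> * W \<le> \<alpha>" "\<kappa> * (lam * (\<theta> * W / \<alpha> * D)) \<le> \<alpha>"
    and F: "finite F" and g: "\<And>u. u \<in> F \<Longrightarrow> 0 \<le> g u \<and> g u \<le> W"
  shows "(\<integral>\<^sup>+\<omega>. (\<Prod>p\<in>F \<times> {..<J}. count_fun (\<lambda>n. ennreal (exp (\<theta> * g (fst p) * (real (snd p) + 1) * real n)))
      (gcell 1 (fst p) \<times> mark_cell (snd p)) \<omega>) \<partial>M) \<le> ennreal (\<kappa> * exp (C * (\<Sum>u\<in>F. lam * (\<theta> * g u / \<alpha> * D))))"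
proof -
  define sp where "sp = (\<lambda>p. \<theta> * g (fst p) * (real (snd p) + 1))"
  have "(\<integral>\<^sup>+\<omega>. (\<Prod>p\<in>F \<times> {..<J}. count_fun (\<lambda>n. ennreal (exp (sp p * real n))) (gcell 1 (fst p) \<times> mark_cell (snd p)) \<omega>) \<partial>M)
    = (\<integral>\<^sup>+\<omega>. indicator (space locally_finite_algebra) (\<Lambda> \<omega>) *
        (\<Prod>p\<in>F \<times> {..<J}. count_fun (\<lambda>n. ennreal (exp (sp p * real n))) (gcell 1 (fst p) \<times> mark_cell (snd p)) \<omega>) \<partial>M)"
    by (intro nn_integral_cong) (simp add: \<Lambda>_lfa)
  also have "\<dots> = (\<integral>\<^sup>+\<omega>. indicator (space locally_finite_algebra) (\<Lambda> \<omega>) * (\<Prod>p\<in>F \<times> {..<J}. \<Sum>n. ennreal (exp (sp p * real n)) *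
      ennreal (poisson_prob (rate (gcell 1 (fst p)) (mark_cell (snd p)) \<omega>) n)) \<partial>M)"
  proof (rule count_formula)
    show "disjoint_family_on (\<lambda>p. gcell 1 (fst p) \<times> mark_cell (snd p)) (F \<times> {..<J})"
      unfolding disjoint_family_on_def
    proof (intro ballI impI)
      fix p q :: "(int^'d) \<times> nat" assume "p \<noteq> q"
      then have "fst p \<noteq> fst q \<or> snd p \<noteq> snd q" by (auto simp: prod_eq_iff)
      then show "gcell 1 (fst p) \<times> mark_cell (snd p) \<inter> gcell 1 (fst q) \<times> mark_cell (snd q) = {}"
      proof
        assume "fst p \<noteq> fst q"
        then have "gcell 1 (fst p) \<inter> gcell 1 (fst q) = {}" by (auto simp: gcell_def)
        then show ?thesis by blast
      next
        assume "snd p \<noteq> snd q"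
        from mark_cells_disjoint[OF this] show ?thesis by blast
      qed
    qed
  qed (use F in \<open>auto simp: gcell_borel bounded_gcell simp del: One_nat_def\<close>)
  also have "\<dots> = (\<integral>\<^sup>+\<omega>. ennreal (exp (\<Sum>p\<in>F \<times> {..<J}. rate (gcell 1 (fst p)) (mark_cell (snd p)) \<omega> * (exp (sp p) - 1))) \<partial>M)"
  proof (rule nn_integral_cong)
    fix \<omega> assume "\<omega> \<in> space M"
    then show "indicator (space locally_finite_algebra) (\<Lambda> \<omega>) * (\<Prod>p\<in>F \<times> {..<J}. \<Sum>n. ennreal (exp (sp p * real n)) *
        ennreal (poisson_prob (rate (gcell 1 (fst p)) (mark_cell (snd p)) \<omega>) n))
      = ennreal (exp (\<Sum>p\<in>F \<times> {..<J}. rate (gcell 1 (fst p)) (mark_cell (snd p)) \<omega> * (exp (sp p) - 1)))"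
      unfolding poisson_exp_sum[OF rate_nonneg] using F by (simp add: \<Lambda>_lfa prod_ennreal exp_sum)
  qed
  also have "\<dots> \<le> (\<integral>\<^sup>+\<omega>. ennreal (exp (\<Sum>u\<in>F. lam * (\<theta> * g u / \<alpha> * D) * measure (\<Lambda> \<omega>) (gcell 1 u))) \<partial>M)"
  proof (intro nn_integral_mono ennreal_leI)
    fix \<omega>
    have "(\<Sum>p\<in>F \<times> {..<J}. rate (gcell 1 (fst p)) (mark_cell (snd p)) \<omega> * (exp (sp p) - 1))
      = (\<Sum>u\<in>F. \<Sum>j<J. rate (gcell 1 u) (mark_cell j) \<omega> * (exp (sp (u, j)) - 1))"
      by (simp add: sum.cartesian_product case_prod_beta)
    also have "\<dots> \<le> (\<Sum>u\<in>F. lam * (\<theta> * g u / \<alpha> * D) * measure (\<Lambda> \<omega>) (gcell 1 u))"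
    proof (rule sum_mono)
      fix u assume u: "u \<in> F"
      have gu: "0 \<le> \<theta> * g u" "\<theta> * g u \<le> \<alpha>" using g[OF u] \<theta> mult_left_mono[of "g u" W \<theta>] by auto
      have "(\<Sum>j<J. rate (gcell 1 u) (mark_cell j) \<omega> * (exp (sp (u, j)) - 1))
        \<le> (\<Sum>j<J. rate (gcell 1 u) (mark_cell j) \<omega> * (\<theta> * g u / \<alpha> * (exp (\<alpha> * (real j + 1)) - 1)))"
        unfolding sp_def fst_conv snd_conv by (intro sum_mono mult_left_mono exp_chord gu \<alpha> rate_nonneg)
      also have "\<dots> = lam * measure (\<Lambda> \<omega>) (gcell 1 u) * (\<theta> * g u / \<alpha>) * (\<Sum>j<J. measure \<mu> (mark_cell j) * (exp (\<alpha> * (real j + 1)) - 1))"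
        unfolding sum_distrib_left by (intro sum.cong refl) (simp add: mult_ac)
      also have "\<dots> \<le> lam * measure (\<Lambda> \<omega>) (gcell 1 u) * (\<theta> * g u / \<alpha>) * D"
        using lam gu \<alpha> by (intro mult_left_mono D) auto
      finally show "(\<Sum>j<J. rate (gcell 1 u) (mark_cell j) \<omega> * (exp (sp (u, j)) - 1)) \<le> lam * (\<theta> * g u / \<alpha> * D) * measure (\<Lambda> \<omega>) (gcell 1 u)"
        by (simp add: mult_ac)
    qed
    finally show "exp (\<Sum>p\<in>F \<times> {..<J}. rate (gcell 1 (fst p)) (mark_cell (snd p)) \<omega> * (exp (sp p) - 1))
      \<le> exp (\<Sum>u\<in>F. lam * (\<theta> * g u / \<alpha> * D) * measure (\<Lambda> \<omega>) (gcell 1 u))" by simp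
  qed
  also have "\<dots> \<le> ennreal (\<kappa> * exp (C * (\<Sum>u\<in>F. lam * (\<theta> * g u / \<alpha> * D))))"
  proof (rule mass[OF F], intro conjI)
    fix u assume u: "u \<in> F"
    show "0 \<le> lam * (\<theta> * g u / \<alpha> * D)" using lam \<theta> g[OF u] \<alpha> D by simp
    have "\<theta> * g u / \<alpha> * D \<le> \<theta> * W / \<alpha> * D"
      using \<theta> g[OF u] \<alpha> D by (intro mult_right_mono divide_right_mono mult_left_mono) auto
    then have "\<kappa> * (lam * (\<theta> * g u / \<alpha> * D)) \<le> \<kappa> * (lam * (\<theta> * W / \<alpha> * D))"
      using \<kappa> lam by (intro mult_left_mono) auto
    then show "\<kappa> * (lam * (\<theta> * g u / \<alpha> * D)) \<le> \<alpha>" using \<theta>(3) by linarith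
  qed
  finally show ?thesis unfolding sp_def .
qed

text \<open>Interference of infinite range cannot be decoupled by separating sites, so all sites of
  \<open>S\<close> are treated at once. If every one is bad, the sum of their interferences exceeds
  \<open>K * card S\<close>. This sum is again a shot noise; summability of the path loss bounds its
  weights by \<open>W\<close> for every \<open>S\<close> and their total by
  \<open>W * card S\<close>. Its exponential moment thus grows exponentially in
  \<open>card S\<close> at a rate that a large \<open>K\<close> beats.\<close>

lemma unbounded_interference_rare:
  fixes l :: "real \<Rightarrow> real"
  assumes i12: "i1 \<noteq> i2" and s: "s \<ge> 1" and q: "0 < q" "q \<le> 1"
    and stat: "stationary_random_measure M \<Lambda>" and dep: "b_dependent M \<Lambda> b" and b: "b > 0" and \<alpha>: "\<alpha> > 0"
    and fin\<Lambda>: "(\<integral>\<^sup>+\<omega>. ennreal (exp (\<alpha> * measure (\<Lambda> \<omega>) (cube 1 0))) \<partial>M) < \<infinity>"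
    and fin\<mu>: "(\<integral>\<^sup>+p. ennreal (exp (\<alpha> * p)) \<partial>\<mu>) < \<infinity>"
    and nn: "\<And>r. r \<ge> 0 \<Longrightarrow> l r \<ge> 0" and anti: "\<And>r r'. 0 \<le> r \<Longrightarrow> r \<le> r' \<Longrightarrow> l r' \<le> l r"
    and int: "(\<integral>\<^sup>+ r\<in>{0..}. ennreal (r ^ (CARD('d) - 1) * l r) \<partial>lborel) < \<infinity>"
  shows "\<exists>K\<ge>0. \<exists>B. rare M B q \<and> (\<forall>z. \<forall>\<omega>\<in>space M - B z. \<forall>i j.
    pos (X \<omega>) j \<in> cube (real (8 * s)) (site i1 i2 s z) \<longrightarrow> interference l (X \<omega>) i j \<le> ennreal K)"
proof -
  from mass_exp_moment[OF stat dep b \<alpha> fin\<Lambda>] obtain \<kappa> C where \<kappa>C: "\<kappa> \<ge> 1 \<and> C \<ge> 0 \<and> (\<forall>F \<beta>. finite F \<and>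
      (\<forall>u\<in>F. 0 \<le> \<beta> u \<and> \<kappa> * \<beta> u \<le> \<alpha>) \<longrightarrow>
      (\<integral>\<^sup>+\<omega>. ennreal (exp (\<Sum>u\<in>F. \<beta> u * measure (\<Lambda> \<omega>) (gcell 1 u))) \<partial>M) \<le> ennreal (\<kappa> * exp (C * (\<Sum>u\<in>F. \<beta> u))))"
    by (elim exE)
  then have \<kappa>: "\<kappa> \<ge> 1" and C: "C \<ge> 0" by auto
  have mass: "(\<integral>\<^sup>+\<omega>. ennreal (exp (\<Sum>u\<in>F. \<beta> u * measure (\<Lambda> \<omega>) (gcell 1 u))) \<partial>M) \<le> ennreal (\<kappa> * exp (C * (\<Sum>u\<in>F. \<beta> u)))"
    if "finite F" "\<And>u. u \<in> F \<Longrightarrow> 0 \<le> \<beta> u \<and> \<kappa> * \<beta> u \<le> \<alpha>" for F \<beta>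
    using \<kappa>C[THEN conjunct2, THEN conjunct2, rule_format, of F \<beta>] that by blast
  obtain D where D: "D \<ge> 0" "\<And>J. (\<Sum>j<J. measure \<mu> (mark_cell j) * (exp (\<alpha> * (real j + 1)) - 1)) \<le> D"
    using mark_exp_sum[OF \<mu> \<alpha> fin\<mu>] by blast
  \<comment> \<open>Half the side \<open>8 * s\<close> of the cube around the site, and 1 for the
    position of a point within its cell.\<close>
  define a where "a = 4 * real s + 1"
  have a: "a \<ge> 0" by (simp add: a_def)
  define w where "w = (\<lambda>v :: int^'d. l (max 0 (of_int (vnorm v) - a)))"
  have w0: "w v \<ge> 0" for v using nn by (simp add: w_def)
  obtain W where W: "W > 0" and sumW: "\<And>A. finite A \<Longrightarrow> (\<Sum>v\<in>A. w v) \<le> W"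
    using lattice_path_loss_bounded[OF nn anti int a] unfolding w_def by blast
  \<comment> \<open>The two terms are the smallness conditions of \<open>points_exp_moment\<close>;
    \<open>D + 1\<close> keeps the denominator positive if \<open>D = 0\<close>.\<close>
  define \<theta> where "\<theta> = min (\<alpha> / W) (\<alpha> * \<alpha> / (\<kappa> * lam * W * (D + 1)))"
  have den: "\<kappa> * lam * W * (D + 1) > 0" using \<kappa> lam W D by (intro mult_pos_pos) auto
  have \<theta>: "\<theta> > 0" using \<alpha> W den by (simp add: \<theta>_def)
  have \<theta>W: "\<theta> * W \<le> \<alpha>"
  proof -
    have "\<theta> \<le> \<alpha> / W" by (simp add: \<theta>_def)
    then show ?thesis using W by (simp add: pos_le_divide_eq)
  qed
  have \<theta>D: "\<kappa> * (lam * (\<theta> * W / \<alpha> * D)) \<le> \<alpha>"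
  proof -
    have "\<theta> \<le> \<alpha> * \<alpha> / (\<kappa> * lam * W * (D + 1))" by (simp add: \<theta>_def)
    then have "\<theta> * (\<kappa> * lam * W * (D + 1)) \<le> \<alpha> * \<alpha>" using den by (simp add: pos_le_divide_eq)
    moreover have "\<theta> * (\<kappa> * lam * W * D) \<le> \<theta> * (\<kappa> * lam * W * (D + 1))"
      using \<theta> \<kappa> lam W by (intro mult_left_mono) auto
    ultimately have "\<theta> * (\<kappa> * lam * W * D) \<le> \<alpha> * \<alpha>" by linarith
    then have "\<theta> * (\<kappa> * lam * W * D) / \<alpha> \<le> \<alpha>" using \<alpha> by (simp add: pos_divide_le_eq)
    then show ?thesis by (simp add: mult_ac)
  qed
  define C' where "C' = C * (lam * (\<theta> * W / \<alpha> * D))"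
  \<comment> \<open>Makes the exponential estimate at most \<open>q ^ card S\<close>. The single
    factor \<open>\<kappa>\<close> is charged to every site, which is harmless because
    \<open>S\<close> is nonempty there.\<close>
  define K where "K = max 0 ((C' + ln \<kappa> - ln q) / \<theta>)"
  have K: "K \<ge> 0" "\<theta> * K \<ge> C' + ln \<kappa> - ln q"
  proof -
    have "(C' + ln \<kappa> - ln q) / \<theta> \<le> K" by (simp add: K_def)
    then show "\<theta> * K \<ge> C' + ln \<kappa> - ln q" using \<theta> by (simp add: pos_divide_le_eq mult.commute)
  qed (simp add: K_def)
  define sh where "sh = site_shift i1 i2 1 s"
  have sh_inj: "sh z = sh z' \<Longrightarrow> z = z'" for z z'
  proof -
    assume "sh z = sh z'"
    then have "sh z $ i1 = sh z' $ i1" "sh z $ i2 = sh z' $ i2" by auto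
    then show "z = z'" using s i12 by (auto simp: sh_def site_shift_def prod_eq_iff)
  qed
  define Fn where "Fn = (\<lambda>n::nat. {u :: int^'d. vnorm u \<le> int n})"
  have finFn: "finite (Fn n)" for n unfolding Fn_def by (rule finite_vnorm_le)
  define I where "I = (\<lambda>n z \<omega>. \<Sum>u\<in>Fn n. \<Sum>j<n. (real j + 1) * w (u - sh z) * real (cell_count u j \<omega>))"
  have Im: "I n z \<in> borel_measurable M" for n z
    unfolding I_def by (intro borel_measurable_sum borel_measurable_times borel_measurable_const measurable_cell_count)
  have Imono: "I n z \<omega> \<le> I (Suc n) z \<omega>" for n z \<omega>
  proof -
    have "I n z \<omega> \<le> (\<Sum>u\<in>Fn n. \<Sum>j<Suc n. (real j + 1) * w (u - sh z) * real (cell_count u j \<omega>))"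
      unfolding I_def using w0 by (intro sum_mono sum_mono2) auto
    also have "\<dots> \<le> I (Suc n) z \<omega>"
      unfolding I_def using w0 by (intro sum_mono2 finFn) (auto simp: Fn_def intro!: sum_nonneg mult_nonneg_nonneg add_nonneg_nonneg)
    finally show ?thesis .
  qed
  define E where "E = (\<lambda>n z. {\<omega>\<in>space M. I n z \<omega> > K})"
  have E: "E n z \<in> sets M" for n z unfolding E_def using Im[of n z] by measurable
  have Einc: "incseq (\<lambda>n. E n z)" for z
  proof (rule incseq_SucI, rule subsetI)
    fix n \<omega> assume "\<omega> \<in> E n z"
    then have "K < I n z \<omega>" "\<omega> \<in> space M" by (simp_all add: E_def)
    with Imono[of n z \<omega>] show "\<omega> \<in> E (Suc n) z" by (simp add: E_def)
  qed
  define Inf' where "Inf' = (\<lambda>u j. {\<omega>\<in>space M. \<not> finite (points_in (X \<omega>) (gcell 1 u \<times> mark_cell j))})"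
  have Inf0: "Inf' u j \<in> null_sets M" for u j
  proof -
    have "Inf' u j = space M - (\<Union>k. {\<omega>\<in>space M. finite (points_in (X \<omega>) (gcell 1 u \<times> mark_cell j)) \<and> cell_count u j \<omega> = k})"
      by (auto simp: Inf'_def)
    also have "\<dots> \<in> sets M" using count_event[OF cell_rect] by (intro sets.Diff sets.countable_UN) auto
    finally have "Inf' u j \<in> sets M" .
    moreover have "AE \<omega> in M. \<omega> \<notin> Inf' u j"
      using AE_finite_points[of "gcell 1 u" "mark_cell j"] by (auto simp: gcell_borel bounded_gcell Inf'_def simp del: One_nat_def elim!: AE_mp)
    ultimately show ?thesis using AE_iff_null_sets by blast
  qed
  define Null where "Null = (\<Union>n. \<Union>u\<in>Fn n. \<Union>j. Inf' u j)"
  have Null: "Null \<in> null_sets M"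
    unfolding Null_def using finFn Inf0 by (intro null_sets_UN null_sets_UN' countable_finite)
  \<comment> \<open>Outcomes with infinitely many points in some cell are included in
    \<open>B\<close>: there \<open>card\<close> is 0, and \<open>I\<close> would miss these
    points.\<close>
  define B where "B = (\<lambda>z. (\<Union>n. E n z) \<union> Null)"
  have UE: "(\<Union>n. E n z) \<in> sets M" for z by (intro sets.countable_UN image_subsetI E)
  have B: "B z \<in> sets M" for z unfolding B_def by (intro sets.Un UE null_setsD2[OF Null])
  have finite_off: "finite (points_in (X \<omega>) (gcell 1 u \<times> mark_cell j))" if "\<omega> \<in> space M - Null" for \<omega> u j
  proof -
    have "u \<in> Fn (nat (vnorm u))" using vnorm_nonneg[of u] by (simp add: Fn_def)
    then show ?thesis using that by (auto simp: Null_def Inf'_def)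
  qed
  have "rare M B q"
    unfolding rare_def
  proof (intro conjI allI impI B)
    fix S :: "(int \<times> int) set" assume S: "finite S"
    show "measure M (space M \<inter> (\<Inter>z\<in>S. B z)) \<le> q ^ card S"
    proof (cases "S = {}")
      case True
      then show ?thesis by (simp add: prob_space)
    next
      case False
      then have cS: "card S \<ge> 1" using S by (simp add: Suc_le_eq card_gt_0_iff)
      have main: "measure M (space M \<inter> (\<Inter>z\<in>S. \<Union>n. E n z)) \<le> q ^ card S"
      proof (rule rare_INT_SUP[OF prob_space_axioms S E Einc])
        fix n
        define G where "G = space M \<inter> (\<Inter>z\<in>S. E n z)"
        have G: "G \<in> sets M" unfolding G_def by (rule Int_INT_sets[OF S E])
        \<comment> \<open>The total weight of a point in the cell \<open>u\<close> over all sites of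
          \<open>S\<close>. Distinct sites give distinct shifts, so \<open>g u\<close> is a partial
          sum of the lattice sum.\<close>
        define g where "g = (\<lambda>u. \<Sum>z\<in>S. w (u - sh z))"
        have g: "0 \<le> g u \<and> g u \<le> W" for u
        proof
          show "0 \<le> g u" unfolding g_def by (intro sum_nonneg w0)
          have "inj_on (\<lambda>z. u - sh z) S" using sh_inj by (intro inj_onI) simp
          then have "g u = (\<Sum>v\<in>(\<lambda>z. u - sh z) ` S. w v)" by (simp add: g_def sum.reindex)
          also have "\<dots> \<le> W" using S by (intro sumW) simp
          finally show "g u \<le> W" .
        qed
        have sumg: "(\<Sum>u\<in>Fn n. g u) \<le> real (card S) * W"
        proof -
          have "(\<Sum>u\<in>Fn n. g u) = (\<Sum>z\<in>S. \<Sum>u\<in>Fn n. w (u - sh z))" unfolding g_def by (rule sum.swap)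
          also have "\<dots> \<le> (\<Sum>z\<in>S. W)"
          proof (rule sum_mono)
            fix z
            have "(\<Sum>u\<in>Fn n. w (u - sh z)) = (\<Sum>v\<in>(\<lambda>u. u - sh z) ` Fn n. w v)" by (subst sum.reindex) (auto intro: inj_onI)
            also have "\<dots> \<le> W" using finFn by (intro sumW) simp
            finally show "(\<Sum>u\<in>Fn n. w (u - sh z)) \<le> W" .
          qed
          finally show ?thesis by simp
        qed
        let ?P = "\<lambda>\<omega>. \<Prod>p\<in>Fn n \<times> {..<n}. count_fun (\<lambda>k. ennreal (exp (\<theta> * g (fst p) * (real (snd p) + 1) * real k)))
            (gcell 1 (fst p) \<times> mark_cell (snd p)) \<omega>"
        have Pm: "?P \<in> borel_measurable M"
          by (intro borel_measurable_prod_ennreal measurable_count_fun cell_rect)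
        have "emeasure M G = (\<integral>\<^sup>+\<omega>. indicator G \<omega> \<partial>M)" using G by simp
        also have "\<dots> \<le> (\<integral>\<^sup>+\<omega>. ennreal (exp (- (\<theta> * K * real (card S)))) * ?P \<omega> \<partial>M)"
        proof (rule nn_integral_mono_AE, rule AE_mp[OF AE_not_in[OF Null]], intro AE_I2 impI)
          fix \<omega> assume w: "\<omega> \<in> space M" "\<omega> \<notin> Null"
          show "indicator G \<omega> \<le> ennreal (exp (- (\<theta> * K * real (card S)))) * ?P \<omega>"
          proof (cases "\<omega> \<in> G")
            case True
            have "real (card S) * K = (\<Sum>z\<in>S. K)" by simp
            also have "\<dots> \<le> (\<Sum>z\<in>S. I n z \<omega>)" using True by (intro sum_mono) (auto simp: G_def E_def)
            also have "\<dots> = (\<Sum>u\<in>Fn n. \<Sum>j<n. \<Sum>z\<in>S. (real j + 1) * w (u - sh z) * real (cell_count u j \<omega>))"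
              unfolding I_def by (subst sum.swap, intro sum.cong refl, rule sum.swap)
            also have "\<dots> = (\<Sum>u\<in>Fn n. \<Sum>j<n. g u * (real j + 1) * real (cell_count u j \<omega>))"
              by (intro sum.cong refl) (simp add: g_def sum_distrib_left sum_distrib_right mult_ac)
            also have "\<dots> = (\<Sum>p\<in>Fn n \<times> {..<n}. g (fst p) * (real (snd p) + 1) * real (cell_count (fst p) (snd p) \<omega>))"
              by (simp add: sum.cartesian_product case_prod_beta)
            finally have "real (card S) * K \<le> (\<Sum>p\<in>Fn n \<times> {..<n}. g (fst p) * (real (snd p) + 1) * real (cell_count (fst p) (snd p) \<omega>))" .
            from mult_left_mono[OF this less_imp_le[OF \<theta>]]
            have le: "\<theta> * (real (card S) * K) \<le> (\<Sum>p\<in>Fn n \<times> {..<n}. \<theta> * g (fst p) * (real (snd p) + 1) * real (cell_count (fst p) (snd p) \<omega>))"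
              by (simp add: sum_distrib_left mult.assoc)
            have P: "?P \<omega> = ennreal (exp (\<Sum>p\<in>Fn n \<times> {..<n}. \<theta> * g (fst p) * (real (snd p) + 1) * real (cell_count (fst p) (snd p) \<omega>)))"
              using finite_off[of \<omega>] w finFn by (simp add: count_fun_def prod_ennreal exp_sum)
            have "1 \<le> exp (- (\<theta> * K * real (card S))) * exp (\<Sum>p\<in>Fn n \<times> {..<n}. \<theta> * g (fst p) * (real (snd p) + 1) * real (cell_count (fst p) (snd p) \<omega>))"
              using le unfolding exp_add[symmetric] by (simp add: mult_ac)
            then have "1 \<le> ennreal (exp (- (\<theta> * K * real (card S)))) * ?P \<omega>"
              unfolding P by (simp add: ennreal_mult[symmetric] flip: ennreal_1)
            then show ?thesis using True by simp
          qed simp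
        qed
        also have "\<dots> = ennreal (exp (- (\<theta> * K * real (card S)))) * (\<integral>\<^sup>+\<omega>. ?P \<omega> \<partial>M)"
          by (rule nn_integral_cmult[OF Pm])
        also have "\<dots> \<le> ennreal (exp (- (\<theta> * K * real (card S)))) * ennreal (\<kappa> * exp (C * (\<Sum>u\<in>Fn n. lam * (\<theta> * g u / \<alpha> * D))))"
          using g by (intro mult_left_mono points_exp_moment[OF mass D \<alpha> \<kappa> less_imp_le[OF \<theta>] \<theta>W \<theta>D finFn]) auto
        also have "\<dots> = ennreal (exp (- (\<theta> * K * real (card S))) * (\<kappa> * exp (C * (\<Sum>u\<in>Fn n. lam * (\<theta> * g u / \<alpha> * D)))))"
          using \<kappa> by (simp add: ennreal_mult)
        also have "\<dots> \<le> ennreal (q ^ card S)"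
        proof (rule ennreal_leI)
          have "(\<Sum>u\<in>Fn n. lam * (\<theta> * g u / \<alpha> * D)) = lam * \<theta> / \<alpha> * D * (\<Sum>u\<in>Fn n. g u)"
            unfolding sum_distrib_left by (intro sum.cong refl) simp
          also have "\<dots> \<le> lam * \<theta> / \<alpha> * D * (real (card S) * W)"
            using lam \<theta> \<alpha> D by (intro mult_left_mono sumg) auto
          finally have "C * (\<Sum>u\<in>Fn n. lam * (\<theta> * g u / \<alpha> * D)) \<le> C * (lam * \<theta> / \<alpha> * D * (real (card S) * W))"
            using C by (rule mult_left_mono)
          also have "\<dots> = C' * real (card S)" by (simp add: C'_def mult_ac)
          finally have 1: "exp (C * (\<Sum>u\<in>Fn n. lam * (\<theta> * g u / \<alpha> * D))) \<le> exp (C' * real (card S))" by simp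
          have "\<kappa> = exp (ln \<kappa>)" using \<kappa> by simp
          also have "\<dots> \<le> exp (ln \<kappa> * real (card S))"
          proof -
            have "ln \<kappa> * 1 \<le> ln \<kappa> * real (card S)" using \<kappa> cS by (intro mult_left_mono) auto
            then show ?thesis by simp
          qed
          finally have 2: "\<kappa> \<le> exp (ln \<kappa> * real (card S))" .
          have "exp (- (\<theta> * K * real (card S))) * (\<kappa> * exp (C * (\<Sum>u\<in>Fn n. lam * (\<theta> * g u / \<alpha> * D))))
            \<le> exp (- (\<theta> * K * real (card S))) * (exp (ln \<kappa> * real (card S)) * exp (C' * real (card S)))"
            using 1 2 \<kappa> by (intro mult_left_mono mult_mono) auto
          also have "\<dots> = exp ((C' + ln \<kappa> - \<theta> * K) * real (card S))"
            unfolding exp_add[symmetric] by (simp add: algebra_simps)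
          also have "\<dots> \<le> exp (ln q * real (card S))" using K by (simp add: mult_right_mono)
          also have "\<dots> = q ^ card S" using q by (simp add: exp_of_nat2_mult)
          finally show "exp (- (\<theta> * K * real (card S))) * (\<kappa> * exp (C * (\<Sum>u\<in>Fn n. lam * (\<theta> * g u / \<alpha> * D)))) \<le> q ^ card S" .
        qed
        finally show "measure M (space M \<inter> (\<Inter>z\<in>S. E n z)) \<le> q ^ card S"
          unfolding G_def[symmetric] using q by (simp add: emeasure_eq_measure)
      qed
      have J: "space M \<inter> (\<Inter>z\<in>S. \<Union>n. E n z) \<in> sets M" by (rule Int_INT_sets[OF S UE])
      have "measure M (space M \<inter> (\<Inter>z\<in>S. B z)) \<le> measure M ((space M \<inter> (\<Inter>z\<in>S. \<Union>n. E n z)) \<union> Null)"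
        using Null J by (intro finite_measure_mono) (auto simp: B_def)
      also have "\<dots> \<le> measure M (space M \<inter> (\<Inter>z\<in>S. \<Union>n. E n z)) + measure M Null"
        using Null J by (intro measure_Un_le) auto
      also have "measure M Null = 0" using Null by (simp add: measure_eq_0_null_sets)
      finally show ?thesis using main by simp
    qed
  qed
  moreover have "interference l (X \<omega>) i j \<le> ennreal K"
    if wB: "\<omega> \<in> space M - B z" and pj: "pos (X \<omega>) j \<in> cube (real (8 * s)) (site i1 i2 s z)" for z \<omega> i j
  proof (rule interference_finite_bound)
    fix T assume T: "finite T" "T \<subseteq> dom (X \<omega>) - {i, j}"
    define c where "c = X \<omega>"
    let ?f = "\<lambda>k. ennreal (mark c k * l (dist (pos c k) (pos c j)))"
    define T' where "T' = {k\<in>T. mark c k > 0}"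
    have T': "finite T'" using T by (simp add: T'_def)
    \<comment> \<open>A positive mark lies in \<open>mark_cell j\<close> for \<open>j\<close> one
      less than its ceiling.\<close>
    define uj where "uj = (\<lambda>k. (idx 1 (pos c k), nat (\<lceil>mark c k\<rceil> - 1)))"
    define n where "n = Max (insert 0 ((\<lambda>k. max (nat (vnorm (fst (uj k)))) (Suc (snd (uj k)))) ` T'))"
    have ujn: "uj k \<in> Fn n \<times> {..<n}" if k: "k \<in> T'" for k
    proof -
      have "max (nat (vnorm (fst (uj k)))) (Suc (snd (uj k))) \<le> n" unfolding n_def using T' k by (intro Max_ge) auto
      then show ?thesis using vnorm_nonneg[of "fst (uj k)"] by (cases "uj k") (auto simp: Fn_def nat_le_iff)
    qed
    have mk: "mark c k \<in> mark_cell (snd (uj k))" if k: "k \<in> T'" for k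
    proof -
      have "\<lceil>mark c k\<rceil> \<ge> 1" using k by (simp add: T'_def)
      then have "real (nat (\<lceil>mark c k\<rceil> - 1)) = of_int \<lceil>mark c k\<rceil> - 1" by simp
      then show ?thesis unfolding uj_def snd_conv using ceiling_correct[of "mark c k"] by auto
    qed
    have lw: "l (dist (pos c k) (pos c j)) \<le> w (fst (uj k) - sh z)" for k
      unfolding w_def
    proof (rule anti)
      obtain h where h: "vnorm (fst (uj k) - sh z) = \<bar>(fst (uj k) - sh z) $ h\<bar>" using vnorm_attained by blast
      have "pos c k \<in> gcell 1 (fst (uj k))" by (simp add: gcell_def uj_def)
      from gcell_coord[OF this, of h] have x: "of_int (fst (uj k) $ h) \<le> pos c k $ h" "pos c k $ h < of_int (fst (uj k) $ h) + 1" by auto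
      have site_h: "site i1 i2 s z $ h = of_int (sh z $ h)" by (simp add: site_def sh_def site_shift_def)
      then have y: "\<bar>pos c j $ h - of_int (sh z $ h)\<bar> \<le> 4 * real s"
      proof -
        have "\<bar>pos c j $ h - site i1 i2 s z $ h\<bar> \<le> real (8 * s) / 2"
          using pj unfolding c_def mem_cube by blast
        then show ?thesis by (simp add: site_h)
      qed
      have "of_int (vnorm (fst (uj k) - sh z)) = \<bar>real_of_int (fst (uj k) $ h) - of_int (sh z $ h)\<bar>" unfolding h by simp
      also have "\<dots> \<le> \<bar>pos c k $ h - pos c j $ h\<bar> + a" using x y unfolding a_def by linarith
      also have "\<bar>pos c k $ h - pos c j $ h\<bar> \<le> dist (pos c k) (pos c j)"
        using component_le_norm_cart[of "pos c k - pos c j" h] by (simp add: dist_norm)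
      finally show "max 0 (of_int (vnorm (fst (uj k) - sh z)) - a) \<le> dist (pos c k) (pos c j)" by simp
    qed simp
    have "(\<Sum>k\<in>T. ?f k) = (\<Sum>k\<in>T'. ?f k)"
    proof (rule sum.mono_neutral_right[OF T(1)])
      show "\<forall>k\<in>T - T'. ?f k = 0"
      proof
        fix k assume "k \<in> T - T'"
        then have "mark c k \<le> 0" by (simp add: T'_def not_less)
        then have "mark c k * l (dist (pos c k) (pos c j)) \<le> 0"
          using nn by (intro mult_nonpos_nonneg) auto
        then show "?f k = 0" by (rule ennreal_neg)
      qed
    qed (auto simp: T'_def)
    also have "\<dots> \<le> (\<Sum>k\<in>T'. ennreal ((real (snd (uj k)) + 1) * w (fst (uj k) - sh z)))"
    proof (intro sum_mono ennreal_leI mult_mono lw)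
      fix k assume "k \<in> T'"
      from mk[OF this] show "mark c k \<le> real (snd (uj k)) + 1" by simp
    qed (use nn in auto)
    also have "\<dots> = ennreal (\<Sum>k\<in>T'. (real (snd (uj k)) + 1) * w (fst (uj k) - sh z))"
      using w0 by (intro sum_ennreal) simp
    also have "\<dots> \<le> ennreal (I n z \<omega>)"
    proof (rule ennreal_leI)
      have "(\<Sum>k\<in>T'. (real (snd (uj k)) + 1) * w (fst (uj k) - sh z))
        = (\<Sum>p\<in>Fn n \<times> {..<n}. \<Sum>k\<in>{k\<in>T'. uj k = p}. (real (snd (uj k)) + 1) * w (fst (uj k) - sh z))"
      proof (rule sum.group[symmetric, OF T'])
        show "finite (Fn n \<times> {..<n})" using finFn by simp
        show "uj ` T' \<subseteq> Fn n \<times> {..<n}" by (rule image_subsetI) (rule ujn)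
      qed
      also have "\<dots> \<le> (\<Sum>p\<in>Fn n \<times> {..<n}. (real (snd p) + 1) * w (fst p - sh z) * real (cell_count (fst p) (snd p) \<omega>))"
      proof (rule sum_mono)
        fix p :: "(int^'d) \<times> nat"
        have "(\<Sum>k\<in>{k\<in>T'. uj k = p}. (real (snd (uj k)) + 1) * w (fst (uj k) - sh z))
          = (\<Sum>k\<in>{k\<in>T'. uj k = p}. (real (snd p) + 1) * w (fst p - sh z))" by (intro sum.cong refl) auto
        also have "\<dots> = (real (snd p) + 1) * w (fst p - sh z) * real (card {k\<in>T'. uj k = p})" by simp
        also have "\<dots> \<le> (real (snd p) + 1) * w (fst p - sh z) * real (cell_count (fst p) (snd p) \<omega>)"
        proof (rule mult_left_mono)
          have "{k\<in>T'. uj k = p} \<subseteq> points_in c (gcell 1 (fst p) \<times> mark_cell (snd p))"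
          proof
            fix k assume k: "k \<in> {k\<in>T'. uj k = p}"
            then have "pos c k \<in> gcell 1 (fst p)" by (auto simp: gcell_def uj_def)
            moreover have "mark c k \<in> mark_cell (snd p)" using mk k by auto
            moreover have "k \<in> dom c" using k T by (auto simp: T'_def c_def)
            ultimately show "k \<in> points_in c (gcell 1 (fst p) \<times> mark_cell (snd p))" by (simp add: points_in_def)
          qed
          moreover have "finite (points_in c (gcell 1 (fst p) \<times> mark_cell (snd p)))"
            unfolding c_def using wB by (intro finite_off) (auto simp: B_def)
          ultimately show "real (card {k\<in>T'. uj k = p}) \<le> real (cell_count (fst p) (snd p) \<omega>)"
            unfolding c_def[symmetric] by (simp add: card_mono)
        qed (simp add: w0)
        finally show "(\<Sum>k\<in>{k\<in>T'. uj k = p}. (real (snd (uj k)) + 1) * w (fst (uj k) - sh z))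
          \<le> (real (snd p) + 1) * w (fst p - sh z) * real (cell_count (fst p) (snd p) \<omega>)" .
      qed
      also have "\<dots> = I n z \<omega>" by (simp add: I_def sum.cartesian_product case_prod_beta)
      finally show "(\<Sum>k\<in>T'. (real (snd (uj k)) + 1) * w (fst (uj k) - sh z)) \<le> I n z \<omega>" .
    qed
    also have "\<dots> \<le> ennreal K"
    proof (rule ennreal_leI)
      have "\<omega> \<notin> E n z" using wB by (auto simp: B_def)
      then show "I n z \<omega> \<le> K" using wB by (simp add: E_def not_less)
    qed
    finally show "(\<Sum>k\<in>T. ennreal (mark (X \<omega>) k * l (dist (pos (X \<omega>) k) (pos (X \<omega>) j)))) \<le> ennreal K"
      unfolding c_def .
  qed
  ultimately show ?thesis using K(1) by blast
qed

end

section \<open>Well-behaved path-loss functions\<close>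

lemma path_loss_supportI: "r \<ge> 0 \<Longrightarrow> l r \<noteq> 0 \<Longrightarrow> r \<in> path_loss_support l"
  unfolding path_loss_support_def by (rule subsetD[OF closure_subset]) simp

text \<open>An increase would force a strictly intermediate, hence positive, value at a point of the
  support to the left of a point of the support with a larger value.\<close>

lemma well_behaved_antimono:
  assumes nn: "path_loss l" and wb: "well_behaved d l" and r: "0 \<le> r" "r \<le> r'"
  shows "l r' \<le> l r"
proof (rule ccontr)
  assume "\<not> l r' \<le> l r"
  then have lt: "l r < l r'" by simp
  from wb obtain d0 where cont: "continuous_on {0..} l" and d0: "d0 \<ge> 0" and const: "l constant_on {0..d0}"
    and strict: "strict_antimono_on ({d0..} \<inter> path_loss_support l) l"
    by (auto simp: well_behaved_def)
  have eq: "l x = l y" if "x \<in> {0..d0}" "y \<in> {0..d0}" for x y using const that by (auto simp: constant_on_def)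
  have r'd: "r' > d0"
  proof (rule ccontr)
    assume "\<not> r' > d0"
    then have "l r = l r'" using r by (intro eq) auto
    then show False using lt by simp
  qed
  \<comment> \<open>If \<open>r\<close> lies on the plateau of \<open>l\<close>, it is moved to its
    right end, where the value is the same and strict monotonicity begins.\<close>
  define r1 where "r1 = max r d0"
  have lr1: "l r1 = l r" using r d0 unfolding r1_def max_def by (auto intro: eq)
  have r1: "0 \<le> r1" "d0 \<le> r1" "r1 \<le> r'" using r r'd by (auto simp: r1_def)
  have "l r \<ge> 0" using nn r by (simp add: path_loss_def)
  have "continuous_on {r1..r'} l" using cont by (rule continuous_on_subset) (use r1 in auto)
  then obtain x where x: "r1 \<le> x" "x \<le> r'" "l x = (l r + l r') / 2"
    using IVT'[of l r1 "(l r + l r') / 2" r'] lt lr1 r1 by auto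
  have "l r' > 0" using lt \<open>l r \<ge> 0\<close> by simp
  moreover have "l x > 0" using x(3) lt \<open>l r \<ge> 0\<close> by simp
  ultimately have "l x \<noteq> 0" "l r' \<noteq> 0" by simp_all
  then have "x \<in> {d0..} \<inter> path_loss_support l" "r' \<in> {d0..} \<inter> path_loss_support l"
    using x r1 r r'd by (auto intro!: path_loss_supportI)
  moreover have "x < r'" using x lt by (cases "x = r'") auto
  ultimately have "l r' < l x" using monotone_onD[OF strict, of x r'] by simp
  then show False using x(3) lt by (simp add: field_simps)
qed

text \<open>An open half-line that meets a closure also meets the set itself.\<close>

lemma path_loss_support_gt:
  assumes "r \<in> path_loss_support l" "c < r"
  shows "\<exists>x\<ge>0. x > c \<and> l x \<noteq> 0"
proof -
  have "{c<..} \<inter> {r. r \<ge> 0 \<and> l r \<noteq> 0} \<noteq> {}"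
  proof (rule ccontr)
    assume "\<not> ?thesis"
    then have "{c<..} \<inter> closure {r. r \<ge> 0 \<and> l r \<noteq> 0} = {}"
      using open_Int_closure_eq_empty[of "{c<..}"] by auto
    then show False using assms by (auto simp: path_loss_support_def)
  qed
  then show ?thesis by auto
qed

text \<open>By monotonicity \<open>l 0\<close> is positive as soon as \<open>l\<close> does not
  vanish identically on \<open>{0..}\<close>, and continuity leads to a positive distance.\<close>

lemma positive_near_origin:
  assumes nn: "path_loss l" and wb: "well_behaved d l" and ne: "path_loss_support l \<noteq> {}"
  shows "\<exists>\<rho>>0. l \<rho> > 0"
proof -
  obtain r where "r \<in> path_loss_support l" using ne by blast
  then obtain x where x: "x \<ge> 0" "l x \<noteq> 0" using path_loss_support_gt[of r l "r - 1"] by auto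
  have "l x \<le> l 0" by (rule well_behaved_antimono[OF nn wb]) (use x in auto)
  moreover have "l x \<ge> 0" using nn x by (simp add: path_loss_def)
  ultimately have l0: "l 0 > 0" using x by linarith
  have "continuous_on {0..} l" using wb by (simp add: well_behaved_def)
  then have "continuous_on {0..} l" "(0::real) \<in> {0..}" by auto
  then obtain e where e: "e > 0" "\<And>x. x \<in> {0..} \<Longrightarrow> dist x 0 < e \<Longrightarrow> dist (l x) (l 0) < l 0"
    using l0 unfolding continuous_on_iff by metis
  have "dist (l (e / 2)) (l 0) < l 0" using e by (intro e(2)) auto
  then have "l (e / 2) > 0" by (simp add: dist_real_def abs_less_iff)
  then show ?thesis using e by (intro exI[of _ "e / 2"]) auto
qed

lemma bounded_range_percolation:
  fixes M :: "'w measure" and \<Lambda> :: "'w \<Rightarrow> (real^'d) measure" and X :: "real \<Rightarrow> 'w \<Rightarrow> 'd config"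
  assumes M: "prob_space M" and \<Lambda>: "random_measure M \<Lambda>" and \<mu>: "mark_distribution \<mu>"
    and sup: "esssup \<mu> ereal = \<infinity>" and \<tau>: "\<tau> > 0" and No: "No > 0"
    and X: "\<And>lam. lam > 0 \<Longrightarrow> marked_cox_process M \<Lambda> \<mu> lam (X lam)"
    and nn: "path_loss l" and wb: "well_behaved CARD('d) l" and \<rho>: "\<rho> \<ge> 0" "l \<rho> > 0"
    and L: "\<And>r. r \<ge> L \<Longrightarrow> l r = 0" "8 * real s + 2 * L \<le> real (\<kappa> * s)"
    and i12: "i1 \<noteq> i2" and s: "s \<ge> 1" and linked: "linked M \<Lambda> i1 i2 \<rho> ((1/3200)\<^sup>2) s"
    and a: "a \<ge> 0" and H: "rare M (\<lambda>z. space M - H z) (((1/40)\<^sup>2 / 2)\<^sup>2)"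
    and Hmass: "\<And>z \<omega>. \<omega> \<in> H z \<Longrightarrow> emeasure (\<Lambda> \<omega>) (cube (real (\<kappa> * s)) (site i1 i2 s z)) \<le> ennreal a"
  shows "critical_intensity M \<tau> No l X < \<infinity>"
proof (rule critical_intensity_finite[OF M \<Lambda> \<mu> sup \<tau> No X _ _ \<rho>(2) i12 s linked])
  show "continuous_on {0..} l" using wb by (simp add: well_behaved_def)
  show "l \<rho> \<le> l r" if "0 \<le> r" "r \<le> \<rho>" for r by (rule well_behaved_antimono[OF nn wb that])
  fix lam :: real assume lam: "lam > 0"
  interpret M: prob_space M by fact
  interpret cox M \<Lambda> \<mu> lam "X lam" by unfold_locales (use \<Lambda> \<mu> lam X[OF lam] in auto)
  show "\<exists>K\<ge>0. \<exists>B. rare M B ((1/40)\<^sup>2) \<and> (\<forall>z. \<forall>\<omega>\<in>space M - B z. \<forall>i j.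
      pos (X lam \<omega>) j \<in> cube (real (8 * s)) (site i1 i2 s z) \<longrightarrow> interference l (X lam \<omega>) i j \<le> ennreal K)"
  proof (rule bounded_interference_rare[OF i12 s a _ _ _ L H Hmass])
    fix r :: real assume "r \<ge> 0"
    then show "0 \<le> l r \<and> l r \<le> l 0"
      using nn well_behaved_antimono[OF nn wb, of 0 r] by (auto simp: path_loss_def)
  qed (auto simp: power2_eq_square)
qed

text \<open>The three cases use one criterion and differ in which of range and scale comes first.
  For unbounded support the range \<open>c\<close> at the scale \<open>n0\<close> is available since
  \<open>l\<close> is positive everywhere. Under asymptotic essential connectedness a short range is
  given and the scale is free. In the remaining case the range is taken from the support and
  determines the scale.\<close>

theorem theorem2p1:
  fixes M :: "'w measure"
    and \<Lambda> :: "'w \<Rightarrow> (real^'d) measure"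
    and \<tau> No :: real
  assumes "CARD('d) \<ge> 2"
    and "prob_space M"
    and "stationary_random_measure M \<Lambda>"
    and "(\<integral>\<^sup>+\<omega>. emeasure (\<Lambda> \<omega>) (cube 1 0) \<partial>M) = 1"
    and "stabilizing M \<Lambda>"
    and "\<tau> > 0"
    and "No > 0"
  shows "\<exists>c\<ge>0::real. \<forall>(\<mu> :: real measure) (l :: real \<Rightarrow> real) (X :: real \<Rightarrow> 'w \<Rightarrow> 'd config).
    mark_distribution \<mu> \<and>
    esssup \<mu> ereal = \<infinity> \<and>
    path_loss l \<and>
    well_behaved CARD('d) l \<and>
    (\<forall>lam>0. marked_cox_process M \<Lambda> \<mu> lam (X lam)) \<and>
    ((\<not> bounded (path_loss_support l) \<and>
      (\<exists>b>0. b_dependent M \<Lambda> b) \<and>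
      (\<exists>\<alpha>>0. (\<integral>\<^sup>+\<omega>. ennreal (exp (\<alpha> * measure (\<Lambda> \<omega>) (cube 1 0))) \<partial>M) < \<infinity> \<and>
              (\<integral>\<^sup>+p. ennreal (exp (\<alpha> * p)) \<partial>\<mu>) < \<infinity>))
     \<or>
     (bounded (path_loss_support l) \<and> path_loss_support l \<noteq> {} \<and>
      (\<integral>\<^sup>+p. ennreal p \<partial>\<mu>) < \<infinity> \<and>
      asymptotically_essentially_connected M \<Lambda>)
     \<or>
     (bounded (path_loss_support l) \<and>
      (\<integral>\<^sup>+p. ennreal p \<partial>\<mu>) < \<infinity> \<and>
      (SUP r\<in>path_loss_support l. ereal r) > ereal c))
    \<longrightarrow> critical_intensity M \<tau> No l X < \<infinity>"
proof -
  note M = assms(2) and stat = assms(3) and mean = assms(4) and \<tau> = assms(6) and No = assms(7)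
  interpret prob_space M by fact
  define D where "D = CARD('d)"
  have D: "D \<ge> 2" using assms(1) by (simp add: D_def)
  have "\<not> (\<forall>i1 i2 :: 'd. i1 = i2)"
    using assms(1) card_le_Suc0_iff_eq[of "UNIV :: 'd set"] by auto
  then obtain i1 i2 :: 'd where i12: "i1 \<noteq> i2" by blast
  have \<Lambda>: "random_measure M \<Lambda>" using stat by (simp add: stationary_random_measure_def)
  obtain R where R: "stabilization_radii M \<Lambda> R" using assms(5) by (auto simp: stabilizing_def)
  interpret S: stab M \<Lambda> R by unfold_locales (rule \<Lambda> R)+
  \<comment> \<open>Fits \<open>8 * s + 2 * L \<le> \<kappa> * s\<close> for every reach
    \<open>L \<le> 8 * D * s\<close>.\<close>
  define \<kappa> where "\<kappa> = 8 + 16 * D"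
  define q1 :: real where "q1 = (1/3200)\<^sup>2"
  define q2 :: real where "q2 = ((1/40)\<^sup>2 / 2)\<^sup>2"
  have q: "0 < q1" "q1 \<le> 1" "0 < q2" "q2 \<le> 1" by (auto simp: q1_def q2_def power2_eq_square)
  obtain n1 where n1: "\<And>s \<rho>. s \<ge> n1 \<Longrightarrow> \<rho> \<ge> 2 * real CARD('d) * real s \<Longrightarrow> linked M \<Lambda> i1 i2 \<rho> q1 s"
    using S.linked_large_range[OF i12 mean q(1,2)] by blast
  have "\<kappa> \<ge> 1" by (simp add: \<kappa>_def)
  then obtain n2 where n2: "\<And>s. s \<ge> n2 \<Longrightarrow> \<exists>C\<ge>0. \<exists>H. rare M (\<lambda>z. space M - H z) q2 \<and>
    (\<forall>z. \<forall>\<omega>\<in>H z. emeasure (\<Lambda> \<omega>) (cube (real (\<kappa> * s)) (site i1 i2 s z)) \<le> ennreal C)"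
    using S.mass_bound_rare[OF i12 _ mean q(3,4)] by blast
  define n0 where "n0 = max 1 (max n1 n2)"
  have n0: "n0 \<ge> 1" "n0 \<ge> n1" "n0 \<ge> n2" by (auto simp: n0_def)
  \<comment> \<open>The range at which one charged cube per site links on the scale
    \<open>n0\<close>. It is fixed here, before \<open>\<mu>\<close>, \<open>l\<close> and
    \<open>X\<close>.\<close>
  define c where "c = 2 * real D * real n0"
  have c0: "c \<ge> 0" by (simp add: c_def)
  have bounded_case: "critical_intensity M \<tau> No l X < \<infinity>"
    if H: "mark_distribution \<mu>" "esssup \<mu> ereal = \<infinity>" "path_loss l" "well_behaved CARD('d) l"
      "\<forall>lam>0. marked_cox_process M \<Lambda> \<mu> lam (X lam)"
      and \<rho>: "\<rho> \<ge> 0" "l \<rho> > 0" and L: "\<And>r. r \<ge> L \<Longrightarrow> l r = 0" "L \<le> 8 * real D * real s"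
      and s: "s \<ge> 1" "s \<ge> n2" and linked: "linked M \<Lambda> i1 i2 \<rho> q1 s"
    for \<mu> l and X :: "real \<Rightarrow> 'w \<Rightarrow> 'd config" and \<rho> L s
  proof -
    obtain C G where C: "C \<ge> 0" and G: "rare M (\<lambda>z. space M - G z) q2"
      and Gm: "\<And>z \<omega>. \<omega> \<in> G z \<Longrightarrow> emeasure (\<Lambda> \<omega>) (cube (real (\<kappa> * s)) (site i1 i2 s z)) \<le> ennreal C"
      using n2[OF s(2)] by blast
    have "8 * real s + 2 * L \<le> real (\<kappa> * s)" using L(2) by (simp add: \<kappa>_def algebra_simps)
    then show ?thesis
      using H(5) by (intro bounded_range_percolation[OF M \<Lambda> H(1,2) \<tau> No _ H(3,4) \<rho> L(1) _ i12 s(1)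
          linked[unfolded q1_def] C G[unfolded q2_def] Gm]) auto
  qed
  show ?thesis
  proof (intro exI[of _ c] conjI c0 allI impI, elim conjE disjE)
    fix \<mu> :: "real measure" and l :: "real \<Rightarrow> real" and X :: "real \<Rightarrow> 'w \<Rightarrow> 'd config"
    assume H: "mark_distribution \<mu>" "esssup \<mu> ereal = \<infinity>" "path_loss l" "well_behaved CARD('d) l"
      "\<forall>lam>0. marked_cox_process M \<Lambda> \<mu> lam (X lam)"
      and unb: "\<not> bounded (path_loss_support l)"
      and "\<exists>b>0. b_dependent M \<Lambda> b"
      and "\<exists>\<alpha>>0. (\<integral>\<^sup>+\<omega>. ennreal (exp (\<alpha> * measure (\<Lambda> \<omega>) (cube 1 0))) \<partial>M) < \<infinity> \<and>
              (\<integral>\<^sup>+p. ennreal (exp (\<alpha> * p)) \<partial>\<mu>) < \<infinity>"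
    then obtain b \<alpha> where b: "b > 0" "b_dependent M \<Lambda> b" and \<alpha>: "\<alpha> > 0"
      "(\<integral>\<^sup>+\<omega>. ennreal (exp (\<alpha> * measure (\<Lambda> \<omega>) (cube 1 0))) \<partial>M) < \<infinity>"
      "(\<integral>\<^sup>+p. ennreal (exp (\<alpha> * p)) \<partial>\<mu>) < \<infinity>" by blast
    have X: "marked_cox_process M \<Lambda> \<mu> lam (X lam)" if "lam > 0" for lam using H(5) that by blast
    have linked: "linked M \<Lambda> i1 i2 c ((1/3200)\<^sup>2) n0"
      using n1[OF n0(2), of c] unfolding q1_def by (simp add: c_def D_def)
    have lpos: "l c > 0"
    proof -
      have "\<exists>r\<in>path_loss_support l. r > c"
      proof (rule ccontr)
        assume "\<not> ?thesis"
        then have *: "\<And>r. r \<in> path_loss_support l \<Longrightarrow> r \<le> c" by force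
        have "path_loss_support l \<subseteq> {0..}" unfolding path_loss_support_def by (rule closure_minimal) auto
        then have "path_loss_support l \<subseteq> {0..c}" using * by auto
        then show False using unb bounded_subset[OF bounded_closed_interval] by blast
      qed
      then obtain x where x: "x \<ge> 0" "x > c" "l x \<noteq> 0" using path_loss_support_gt by blast
      have "l x \<le> l c" by (rule well_behaved_antimono[OF H(3,4) c0]) (use x in simp)
      moreover have "l x \<ge> 0" using H(3) x by (simp add: path_loss_def)
      ultimately show ?thesis using x by linarith
    qed
    show "critical_intensity M \<tau> No l X < \<infinity>"
    proof (rule critical_intensity_finite[OF M \<Lambda> H(1,2) \<tau> No X _ _ lpos i12 n0(1) linked])
      show "continuous_on {0..} l" using H(4) by (simp add: well_behaved_def)
      show "l c \<le> l r" if "0 \<le> r" "r \<le> c" for r by (rule well_behaved_antimono[OF H(3,4) that])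
      fix lam :: real assume lam: "lam > 0"
      interpret C: cox M \<Lambda> \<mu> lam "X lam" by unfold_locales (use \<Lambda> H(1) lam X[OF lam] in auto)
      show "\<exists>K\<ge>0. \<exists>B. rare M B ((1/40)\<^sup>2) \<and> (\<forall>z. \<forall>\<omega>\<in>space M - B z. \<forall>i j.
        pos (X lam \<omega>) j \<in> cube (real (8 * n0)) (site i1 i2 n0 z) \<longrightarrow> interference l (X lam \<omega>) i j \<le> ennreal K)"
      proof (rule C.unbounded_interference_rare[OF i12 n0(1) _ _ stat b(2,1) \<alpha>])
        show "l r \<ge> 0" if "r \<ge> 0" for r using H(3) that by (simp add: path_loss_def)
        show "l r' \<le> l r" if "0 \<le> r" "r \<le> r'" for r r' by (rule well_behaved_antimono[OF H(3,4) that])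
        show "(\<integral>\<^sup>+ r\<in>{0..}. ennreal (r ^ (CARD('d) - 1) * l r) \<partial>lborel) < \<infinity>"
          using H(4) by (simp add: well_behaved_def)
      qed (auto simp: power2_eq_square)
    qed
  next
    fix \<mu> :: "real measure" and l :: "real \<Rightarrow> real" and X :: "real \<Rightarrow> 'w \<Rightarrow> 'd config"
    assume H: "mark_distribution \<mu>" "esssup \<mu> ereal = \<infinity>" "path_loss l" "well_behaved CARD('d) l"
      "\<forall>lam>0. marked_cox_process M \<Lambda> \<mu> lam (X lam)"
      and bd: "bounded (path_loss_support l)" and ne: "path_loss_support l \<noteq> {}"
      and aec: "asymptotically_essentially_connected M \<Lambda>"
    obtain \<rho> where \<rho>: "\<rho> > 0" "l \<rho> > 0" using positive_near_origin[OF H(3,4) ne] by blast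
    obtain B where B: "\<And>r. r \<in> path_loss_support l \<Longrightarrow> \<bar>r\<bar> \<le> B" using bd by (auto simp: bounded_iff)
    obtain R' where R': "stabilization_radii M \<Lambda> R'" and conn: "\<forall>n::nat. n \<ge> 1 \<longrightarrow> (\<forall>\<omega>\<in>space M.
          cube_radius R' (2 * real n) 0 \<omega> < ennreal (real n / 2) \<longrightarrow>
          (let S = measure_support (restrict_to (cube (real n) 0) (\<Lambda> \<omega>));
               S' = measure_support (restrict_to (cube (2 * real n) 0) (\<Lambda> \<omega>))
           in (\<exists>C\<in>components S. diameter C \<ge> real n / 3) \<and>
              (\<forall>C1\<in>components S. \<forall>C2\<in>components S.
                 diameter C1 \<ge> real n / 9 \<and> diameter C2 \<ge> real n / 9 \<longrightarrow>
                 (\<exists>D\<in>components S'. C1 \<subseteq> D \<and> C2 \<subseteq> D))))"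
      using aec unfolding asymptotically_essentially_connected_def by blast
    interpret S': stab M \<Lambda> R' by unfold_locales (rule \<Lambda> R')+
    have "\<exists>s0. \<forall>s\<ge>s0. linked M \<Lambda> i1 i2 \<rho> q1 s"
      by (rule S'.linked_connected[OF i12 q(1,2) \<rho>(1)]) (rule conn[rule_format])
    then obtain n3 where n3: "\<And>s. s \<ge> n3 \<Longrightarrow> linked M \<Lambda> i1 i2 \<rho> q1 s" by blast
    \<comment> \<open>The scale is free in this case and is taken beyond the reach of
      \<open>l\<close>.\<close>
    define s where "s = max n0 (max n3 (nat \<lceil>\<bar>B\<bar> + 1\<rceil>))"
    have s: "s \<ge> 1" "s \<ge> n2" "s \<ge> n3" using n0 by (auto simp: s_def)
    have sB: "\<bar>B\<bar> + 1 \<le> real s" unfolding s_def by linarith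
    show "critical_intensity M \<tau> No l X < \<infinity>"
    proof (rule bounded_case[OF H less_imp_le[OF \<rho>(1)] \<rho>(2) _ _ s(1,2) n3[OF s(3)]])
      show "l r = 0" if r: "r \<ge> \<bar>B\<bar> + 1" for r
      proof (rule ccontr)
        assume "l r \<noteq> 0"
        then have "\<bar>r\<bar> \<le> B" using r by (intro B path_loss_supportI) auto
        then show False using r by linarith
      qed
      have "1 * real s \<le> 8 * real D * real s" using D by (intro mult_right_mono) auto
      then show "\<bar>B\<bar> + 1 \<le> 8 * real D * real s" using sB by linarith
    qed
  next
    fix \<mu> :: "real measure" and l :: "real \<Rightarrow> real" and X :: "real \<Rightarrow> 'w \<Rightarrow> 'd config"
    assume H: "mark_distribution \<mu>" "esssup \<mu> ereal = \<infinity>" "path_loss l" "well_behaved CARD('d) l"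
      "\<forall>lam>0. marked_cox_process M \<Lambda> \<mu> lam (X lam)"
      and bd: "bounded (path_loss_support l)" and gt: "(SUP r\<in>path_loss_support l. ereal r) > ereal c"
    define A where "A = {r. r \<ge> 0 \<and> l r \<noteq> 0}"
    obtain r0 where "r0 \<in> path_loss_support l" "r0 > c" using gt by (auto simp: less_SUP_iff)
    then have "\<exists>x\<ge>0. c < x \<and> l x \<noteq> 0" by (rule path_loss_support_gt)
    then obtain x where x: "x \<in> A" "x > c" by (auto simp: A_def)
    have "bounded A" using bd by (simp add: path_loss_support_def A_def bounded_closure_image bounded_subset[OF _ closure_subset])
    then have bdd: "bdd_above A" by (rule bounded_imp_bdd_above)
    have xs: "x \<le> Sup A" using bdd x(1) by (rule cSup_upper[rotated])
    \<comment> \<open>A range above \<open>c\<close> permits links on a scale of at least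
      \<open>n0\<close>. Being more than half the end of the support, it also ensures that
      \<open>l\<close> vanishes from \<open>2 * \<rho>\<close> on.\<close>
    then have "max c (Sup A / 2) < Sup A" using x(2) c0 by auto
    then obtain \<rho> where \<rho>A: "\<rho> \<in> A" and \<rho>: "\<rho> > c" "\<rho> > Sup A / 2"
      using less_cSup_iff[OF _ bdd, of "max c (Sup A / 2)"] x(1) by auto
    have "l \<rho> \<ge> 0" using H(3) \<rho>A by (simp add: path_loss_def A_def)
    then have l\<rho>: "l \<rho> > 0" using \<rho>A by (simp add: A_def)
    \<comment> \<open>The largest scale with \<open>2 * D * s \<le> \<rho>\<close>. Maximality gives
      \<open>\<rho> \<le> 2 * D * (s + 1) \<le> 4 * D * s\<close>, so the reach
      \<open>2 * \<rho>\<close> stays below the bound \<open>8 * D * s\<close> required for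
      \<open>\<kappa>\<close>.\<close>
    define s where "s = nat \<lfloor>\<rho> / (2 * real D)\<rfloor>"
    have Dp: "2 * real D > 0" using D by simp
    have "real n0 \<le> \<rho> / (2 * real D)" using \<rho>(1) Dp by (simp add: c_def pos_le_divide_eq mult.commute)
    then have sn: "s \<ge> n0" unfolding s_def by linarith
    have s1: "real s \<le> \<rho> / (2 * real D)" "\<rho> / (2 * real D) \<le> real s + 1"
      using \<open>real n0 \<le> _\<close> unfolding s_def by linarith+
    have \<rho>s: "2 * real D * real s \<le> \<rho>" using s1(1) Dp by (simp add: pos_le_divide_eq mult.commute)
    have "\<rho> \<le> (real s + 1) * (2 * real D)" using s1(2) Dp by (simp add: pos_divide_le_eq)
    also have "\<dots> \<le> (2 * real s) * (2 * real D)" using sn n0(1) by (intro mult_right_mono) auto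
    finally have \<rho>4: "\<rho> \<le> 4 * real D * real s" by (simp add: mult_ac)
    have sn': "s \<ge> 1" "s \<ge> n1" "s \<ge> n2" using sn n0 by auto
    show "critical_intensity M \<tau> No l X < \<infinity>"
    proof (rule bounded_case[OF H _ l\<rho> _ _ sn'(1,3) n1[OF sn'(2)]])
      show "0 \<le> \<rho>" using \<rho> c0 by linarith
      show "2 * real CARD('d) * real s \<le> \<rho>" using \<rho>s by (simp add: D_def)
      show "2 * \<rho> \<le> 8 * real D * real s" using \<rho>4 by simp
      show "l r = 0" if r: "r \<ge> 2 * \<rho>" for r
      proof (rule ccontr)
        assume "l r \<noteq> 0"
        then have "r \<in> A" using r \<rho> c0 by (simp add: A_def)
        then have "r \<le> Sup A" using bdd by (intro cSup_upper)
        then show False using r \<rho> by linarith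
      qed
    qed
  qed
qed

end
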